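(* Let $S$ be a compact Hausdorff space, let $X$ be a lattice normed space over a Dedekind complete vector lattice $E$ with norm completion $\tilde X$, and let $W$ be a nonempty subset of $C_{uo}(S,X)$ such that the set $\mu(W)$ of all multipliers of $W$ separates the points of $\Sigma$. Then for each $f\in C_{uo}(S,X)$ there exists $\sigma\in\Sigma$ such that $$\inf\{\|f-g\|: g\in W\}=\inf\{\|f(\sigma)-x\|_{\tilde X}: x\in W(\sigma)\},$$ where $W(\sigma):=\{g(\sigma)\in\tilde X: g\in W\}$ and both infima are taken in $E$.
   Context: **Lattices.** Vector lattices are real and Archimedean. $E$ is a Dedekind complete vector lattice, $\mathbb B=\mathbb P(E)$ is the complete Boolean algebra of its band projections, $\Lambda=\mathrm{Orth}(E)$ is the Dedekind complete $f$-algebra (under composition) of orthomorphisms of $E$, with unit $I=I_E$. Elements of $\mathbb B$ act on $\Lambda$ by multiplication. A partition of unity in $\mathbb B$ is a family of pairwise disjoint elements with supremum $I$. **Lattice normed spaces.** A lattice normed space (LNS) over $E$ is a real or complex vector space $X$ with a map $\|\cdot\|:X\to E_+$ (an $E$-valued norm) such that $\|x\|=0$ implies $x=0$, $\|\lambda x\|=|\lambda|\|x\|$ for scalars $\lambda$, and $\|x+y\|\le\|x\|+\|y\|$. It is always assumed that $\{\|x\|:x\in X\}^{\perp\perp}=E$. A net $(x_\alpha)$ norm $o$-converges to $x$ if $\|x-x_\alpha\|$ order converges to $0$ in $E$; $X$ is norm $o$-complete if every net $(x_\alpha)$ for which $(x_\alpha-x_\beta)_{(\alpha,\beta)}$ norm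 $o$-converges to $0$ is norm $o$-convergent in $X$. $X$ is decomposable if $\|x\|=e_1+e_2$ with $e_1,e_2\in E_+$ implies $x=x_1+x_2$ with $\|x_k\|=e_k$ for some $x_1,x_2\in X$. A Banach–Kantorovich space over $E$ is a decomposable norm $o$-complete LNS. The norm completion $\tilde X$ of an LNS $X$ over $E$ is a Banach–Kantorovich space over $E$ containing $X$ isometrically and such that every decomposable norm complete subspace of $\tilde X$ including $X$ equals $\tilde X$; it is unique up to linear isometry. Each $\pi\in\mathbb B$ acts on $\tilde X$ as a linear projection with $\|\pi x+\pi^\perp y\|=\pi\|x\|+\pi^\perp\|y\|$, and this action extends to a faithful $\Lambda$-module structure on $\tilde X$ with $\|\lambda x\|=|\lambda|\,\|x\|$. **The space $C_{uo}$.** $S$ carries its unique compatible uniformity $\mathcal U$. For an LNS $X$, $C_{uo}(S,X)$ is the vector space of uniformly order continuous $f:S\to X$, i.e. norm bounded $f$ (there is $e\in E$ with $\|f(s)\|\le e$ for all $s$) with $\inf_{U\in\mathcal U}\sup\{\|f(s)-f(t)\|:(s,t)\in U\}=0$. It has the $E$-valued norm $\|f\|=\sup_{s\in S}\|f(s)\|$. $C_{uo}(S,\Lambda)$ is defined in the same way, with $\Lambda$ viewed as an LNS over itself with norm $|\cdot|$; it has pointwise multiplication and order. For $\varphi\in C_{uo}(S,\Lambda)$ and $f\in C_{uo}(S,X)$, $(\varphi f)(s)=\varphi(s)f(s)$ (computed in $\tilde X$). **The set $\Sigma$.** Let $\varepsilon^c:C_{uo}(S,\Lambda)\to\Lambda$,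 $\varepsilon^c(\varphi)=\sup_{s\in S}\varphi(s)$, and let $\partial\varepsilon^c$ be the convex set of linear operators $T:C_{uo}(S,\Lambda)\to\Lambda$ with $T\varphi\le\varepsilon^c(\varphi)$ for all $\varphi$. $\Sigma$ is the set of extreme points of $\partial\varepsilon^c$; equivalently, the set of all lattice homomorphisms $\sigma:C_{uo}(S,\Lambda)\to\Lambda$ with $\sigma(\bar\lambda)=\lambda$ for every $\lambda\in\Lambda$, where $\bar\lambda$ is the constant function $s\mapsto\lambda$. A pure state is an operator $\sum_{s\in S}\pi_s\delta_s:\varphi\mapsto o\text{-}\sum_s\pi_s\varphi(s)$ with $(\pi_s)_{s\in S}$ a partition of unity in $\mathbb B$. Every $\sigma\in\Sigma$ is a pointwise $r$-limit (relatively uniform limit) of a net of pure states. **Values $f(\sigma)$.** Each $f\in C_{uo}(S,X)$ extends canonically to a map $\Sigma\to\tilde X$, $\sigma\mapsto f(\sigma)$: for a pure state $\sigma=\sum_s\pi_s\delta_s$, $f(\sigma)=\sum_s\pi_sf(s)$, i.e. the unique element of $\tilde X$ with $\pi_sf(\sigma)=\pi_sf(s)$ for all $s$; for general $\sigma$, $f(\sigma)=\lim_\alpha f(\sigma_\alpha)$ (norm $o$-limit in $\tilde X$) for any net $(\sigma_\alpha)$ of pure states that $r$-converges pointwise to $\sigma$. **Multipliers and separation.** A multiplier of $W\subset C_{uo}(S,X)$ is a $\varphi\in C_{uo}(S,\Lambda)$ with $0\le\varphi(s)\le I$ for all $s\in S$ and $\varphi f+(I-\varphi)g\in W$ for all $f,g\in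 W$; $\mu(W)$ is the set of all multipliers. A set $\mathcal F\subset C_{uo}(S,\Lambda)$ separates the points of $\Sigma$ if for all $\sigma,\tau\in\Sigma$ and $b\in\mathbb B$: whenever $b\sigma(\varphi)=b\tau(\varphi)$ for all $\varphi\in\mathcal F$, then $b\sigma=b\tau$. *)

theory Defs
  imports "HOL-Library.Lattice_Algebras" "HOL-Library.FuncSet"
begin

section \<open>Dedekind complete vector lattices and orthomorphisms\<close>

class dedekind_complete_vector_lattice =
  ordered_real_vector + conditionally_complete_lattice + lattice_ab_group_add_abs

instance real :: dedekind_complete_vector_lattice
  by standard (simp add: sup_real_def)

declare neg_inf_eq_sup [simp del] neg_sup_eq_inf [simp del]
  diff_inf_eq_sup [simp del] diff_sup_eq_inf [simp del]

definition disjoint_complement :: "'e::dedekind_complete_vector_lattice set \<Rightarrow> 'e set" where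
  "disjoint_complement A = {x. \<forall>a\<in>A. inf \<bar>x\<bar> \<bar>a\<bar> = 0}"

text \<open>A band is an order closed order ideal.\<close>

definition band :: "'e::dedekind_complete_vector_lattice set \<Rightarrow> bool" where
  "band B \<longleftrightarrow> subspace B \<and> (\<forall>x\<in>B. \<forall>y. \<bar>y\<bar> \<le> \<bar>x\<bar> \<longrightarrow> y \<in> B) \<and>
     (\<forall>A. A \<noteq> {} \<and> A \<subseteq> B \<and> bdd_above A \<longrightarrow> Sup A \<in> B)"

definition orthomorphism :: "('e::dedekind_complete_vector_lattice \<Rightarrow> 'e) \<Rightarrow> bool" where
  "orthomorphism T \<longleftrightarrow> linear T \<and> (\<forall>a b. \<exists>c d. T ` {a..b} \<subseteq> {c..d}) \<and>
     (\<forall>B. band B \<longrightarrow> T ` B \<subseteq> B)"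

lemma archimedean:
  fixes q c :: "'e::dedekind_complete_vector_lattice"
  assumes "\<And>n::nat. n > 0 \<Longrightarrow> q \<le> (1 / real n) *\<^sub>R c"
  shows "q \<le> 0"
proof -
  have b: "real n *\<^sub>R q \<le> c" if "n > 0" for n :: nat
  proof -
    have "real n *\<^sub>R q \<le> real n *\<^sub>R ((1 / real n) *\<^sub>R c)"
      by (rule scaleR_left_mono[OF assms[OF that]]) simp
    then show ?thesis using that by simp
  qed
  define S where "S = (\<lambda>n::nat. real n *\<^sub>R q) ` {0<..}"
  have bd: "bdd_above S" unfolding S_def bdd_above_def using b by auto
  have "Sup S \<le> Sup S - q"
  proof (rule cSup_least)
    show "S \<noteq> {}" unfolding S_def by auto
    fix x assume "x \<in> S"
    then obtain n :: nat where n: "n > 0" "x = real n *\<^sub>R q" unfolding S_def by auto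
    have "real (Suc n) *\<^sub>R q \<le> Sup S"
      by (rule cSup_upper[OF _ bd]) (unfold S_def, rule imageI, simp)
    then have "x + q \<le> Sup S" using n by (simp add: algebra_simps)
    then show "x \<le> Sup S - q" by (simp add: le_diff_eq)
  qed
  then show ?thesis by simp
qed

lemma inf_add_le:
  fixes a b c :: "'e::lattice_ab_group_add"
  assumes "0 \<le> a" "0 \<le> b" "0 \<le> c"
  shows "inf a (b + c) \<le> inf a b + inf a c"
proof -
  have "inf a (b + c) \<le> inf (inf a b + a) (inf a b + c)"
  proof (rule inf_greatest)
    show "inf a (b + c) \<le> inf a b + a"
      using assms by (meson add_increasing inf_greatest inf_le1 order_trans)
    have "inf a (b + c) - c \<le> inf a b"
    proof (rule inf_greatest)
      have "inf a (b + c) \<le> a + c" using assms by (meson add_increasing2 inf_le1 order_trans order_refl)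
      then show "inf a (b + c) - c \<le> a" by (simp add: diff_le_eq)
      show "inf a (b + c) - c \<le> b" by (simp add: diff_le_eq)
    qed
    then show "inf a (b + c) \<le> inf a b + c" by (rule diff_le_eq[THEN iffD1])
  qed
  also have "\<dots> = inf a b + inf a c" by (simp add: add_inf_distrib_left)
  finally show ?thesis .
qed

lemma disjoint_mono:
  fixes a b :: "'e::lattice_ab_group_add"
  assumes "inf a b = 0" "0 \<le> a'" "a' \<le> a" "0 \<le> b'" "b' \<le> b"
  shows "inf a' b' = 0"
proof (rule order.antisym)
  show "inf a' b' \<le> 0" using inf_mono[OF assms(3,5)] assms(1) by simp
  show "0 \<le> inf a' b'" using assms by simp
qed

lemma pprt_eq_abs: fixes x :: "'e::lattice_ab_group_add_abs"
  shows "pprt x \<le> \<bar>x\<bar>" "- nprt x \<le> \<bar>x\<bar>"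
  by (simp_all add: abs_prts)

lemma pprt_disjoint_nprt:
  fixes x :: "'e::lattice_ab_group_add"
  shows "inf (pprt x) (- nprt x) = 0"
proof -
  have "inf (pprt x) (- nprt x) - (- nprt x) = inf (pprt x + nprt x) 0"
    using add_inf_distrib_right[of "pprt x" "- nprt x" "nprt x"] by simp
  also have "\<dots> = nprt x" by (subst prts[symmetric]) (simp add: nprt_def)
  finally show ?thesis by simp
qed

lemma le_imp_pprt_le:
  fixes x y :: "'e::lattice_ab_group_add"
  shows "x \<le> y \<Longrightarrow> 0 \<le> y \<Longrightarrow> pprt x \<le> y"
  by (simp add: pprt_def)

lemma self_le_pprt: fixes x :: "'e::lattice_ab_group_add" shows "x \<le> pprt x"
  by (simp add: pprt_def)

lemma band_disjoint_complement:
  fixes y :: "'e::dedekind_complete_vector_lattice"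
  shows "band {x. inf \<bar>x\<bar> \<bar>y\<bar> = 0}"
  unfolding band_def
proof (intro conjI ballI allI impI)
  have add: "inf \<bar>a + b\<bar> \<bar>y\<bar> = 0" if "inf \<bar>a\<bar> \<bar>y\<bar> = 0" "inf \<bar>b\<bar> \<bar>y\<bar> = 0" for a b
  proof -
    have "inf \<bar>y\<bar> (\<bar>a\<bar> + \<bar>b\<bar>) \<le> inf \<bar>y\<bar> \<bar>a\<bar> + inf \<bar>y\<bar> \<bar>b\<bar>" by (rule inf_add_le) auto
    then have "inf \<bar>y\<bar> (\<bar>a\<bar> + \<bar>b\<bar>) = 0" using that by (intro order.antisym) (auto simp: inf_commute)
    from disjoint_mono[OF this, of "\<bar>y\<bar>" "\<bar>a+b\<bar>"] show ?thesis
      by (simp add: inf_commute abs_triangle_ineq)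
  qed
  have nat: "inf \<bar>real n *\<^sub>R a\<bar> \<bar>y\<bar> = 0" if "inf \<bar>a\<bar> \<bar>y\<bar> = 0" for n a
  proof (induction n)
    case 0 show ?case by (simp add: inf_absorb1)
  next
    case (Suc n)
    have "inf \<bar>a + real n *\<^sub>R a\<bar> \<bar>y\<bar> = 0" by (rule add[OF that Suc])
    then show ?case by (simp add: algebra_simps)
  qed
  have sc0: "\<bar>c *\<^sub>R a\<bar> \<le> c *\<^sub>R \<bar>a\<bar>" if "c \<ge> 0" for c :: real and a :: 'e
  proof (rule abs_leI)
    show "c *\<^sub>R a \<le> c *\<^sub>R \<bar>a\<bar>" using that by (intro scaleR_left_mono abs_ge_self)
    have "c *\<^sub>R (- a) \<le> c *\<^sub>R \<bar>a\<bar>" using that by (intro scaleR_left_mono abs_ge_minus_self)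
    then show "- (c *\<^sub>R a) \<le> c *\<^sub>R \<bar>a\<bar>" by simp
  qed
  have sc: "inf \<bar>c *\<^sub>R a\<bar> \<bar>y\<bar> = 0" if a: "inf \<bar>a\<bar> \<bar>y\<bar> = 0" for c a
  proof -
    obtain n :: nat where n: "\<bar>c\<bar> \<le> real n" using real_arch_simple by blast
    have "\<bar>c *\<^sub>R a\<bar> = \<bar>\<bar>c\<bar> *\<^sub>R a\<bar>" by (cases "c \<ge> 0") auto
    also have "\<dots> \<le> \<bar>c\<bar> *\<^sub>R \<bar>a\<bar>" by (rule sc0) simp
    also have "\<dots> \<le> real n *\<^sub>R \<bar>a\<bar>" by (rule scaleR_right_mono[OF n]) simp
    also have "\<dots> \<le> \<bar>real n *\<^sub>R \<bar>a\<bar>\<bar>" by (rule abs_ge_self)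
    finally have le: "\<bar>c *\<^sub>R a\<bar> \<le> \<bar>real n *\<^sub>R \<bar>a\<bar>\<bar>" .
    have "inf \<bar>real n *\<^sub>R \<bar>a\<bar>\<bar> \<bar>y\<bar> = 0" by (rule nat) (simp add: a)
    from disjoint_mono[OF this _ le] show ?thesis by simp
  qed
  show "subspace {x. inf \<bar>x\<bar> \<bar>y\<bar> = 0}"
    unfolding subspace_def by (auto simp: add sc inf_absorb1)
next
  fix x z assume "x \<in> {x. inf \<bar>x\<bar> \<bar>y\<bar> = 0}" "\<bar>z\<bar> \<le> \<bar>x\<bar>"
  then show "z \<in> {x. inf \<bar>x\<bar> \<bar>y\<bar> = 0}" using disjoint_mono[of "\<bar>x\<bar>" "\<bar>y\<bar>" "\<bar>z\<bar>" "\<bar>y\<bar>"] by simp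
next
  fix A assume A: "A \<noteq> {} \<and> A \<subseteq> {x. inf \<bar>x\<bar> \<bar>y\<bar> = 0} \<and> bdd_above A"
  define s where "s = Sup A"
  have up: "a \<le> s" if "a \<in> A" for a unfolding s_def using A that by (intro cSup_upper) auto
  define t where "t = inf (pprt s) \<bar>y\<bar>"
  have t0: "0 \<le> t" by (simp add: t_def)
  have "s \<le> pprt s - t" unfolding s_def
  proof (rule cSup_least)
    show "A \<noteq> {}" using A by simp
    fix a assume a: "a \<in> A"
    then have "inf \<bar>a\<bar> \<bar>y\<bar> = 0" using A by auto
    then have d: "inf (pprt a) t = 0"
      by (rule disjoint_mono) (auto simp: t_def pprt_eq_abs)
    have "pprt a + t = sup (pprt a) t" using add_eq_inf_sup[of "pprt a" t] d by simp
    also have "\<dots> \<le> pprt s" using up[OF a] by (auto simp: t_def)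
    finally have "pprt a \<le> pprt s - t" by (simp add: le_diff_eq)
    then show "a \<le> pprt (Sup A) - t" unfolding s_def using self_le_pprt order_trans by blast
  qed
  moreover have "0 \<le> pprt s - t" by (simp add: t_def)
  ultimately have "pprt s \<le> pprt s - t" by (rule le_imp_pprt_le)
  then have p: "inf (pprt s) \<bar>y\<bar> = 0" using t0 by (simp add: t_def order.antisym)
  obtain a where a: "a \<in> A" using A by auto
  then have "inf \<bar>a\<bar> \<bar>y\<bar> = 0" using A by auto
  moreover have "- nprt s \<le> \<bar>a\<bar>" 
    using pprt_eq_abs(2)[of a] nprt_mono[OF up[OF a]] by (meson neg_le_iff_le order_trans)
  ultimately have n: "inf (- nprt s) \<bar>y\<bar> = 0"
    using disjoint_mono[of "\<bar>a\<bar>" "\<bar>y\<bar>" "- nprt s" "\<bar>y\<bar>"] by simp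
  have "inf \<bar>y\<bar> (pprt s + - nprt s) \<le> inf \<bar>y\<bar> (pprt s) + inf \<bar>y\<bar> (- nprt s)"
    by (rule inf_add_le) auto
  then have "inf \<bar>y\<bar> \<bar>s\<bar> \<le> 0" using p n by (simp add: inf_commute abs_prts)
  then show "Sup A \<in> {x. inf \<bar>x\<bar> \<bar>y\<bar> = 0}"
    unfolding s_def[symmetric] by (simp add: inf_commute order.antisym)
qed

lemma orthomorphism_linear: "orthomorphism T \<Longrightarrow> linear T"
  by (simp add: orthomorphism_def)

lemma orthomorphism_band: "orthomorphism T \<Longrightarrow> band B \<Longrightarrow> x \<in> B \<Longrightarrow> T x \<in> B"
  unfolding orthomorphism_def by blast

lemma orthomorphism_interval:
  assumes "orthomorphism T"
  obtains c d where "\<And>x. a \<le> x \<Longrightarrow> x \<le> b \<Longrightarrow> c \<le> T x \<and> T x \<le> d"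
  using assms unfolding orthomorphism_def image_subset_iff by (metis atLeastAtMost_iff)

lemma band_subspace: "band B \<Longrightarrow> subspace B"
  by (simp add: band_def)

lemma band_Sup: "band B \<Longrightarrow> A \<noteq> {} \<Longrightarrow> A \<subseteq> B \<Longrightarrow> bdd_above A \<Longrightarrow> Sup A \<in> B"
  by (simp add: band_def)

lemma band_solid: "band B \<Longrightarrow> x \<in> B \<Longrightarrow> \<bar>y\<bar> \<le> \<bar>x\<bar> \<Longrightarrow> y \<in> B"
  by (auto simp: band_def)

lemma orthomorphismI:
  assumes "linear T" "\<And>a b. \<exists>c d. \<forall>x. a \<le> x \<and> x \<le> b \<longrightarrow> c \<le> T x \<and> T x \<le> d"
    "\<And>B x. band B \<Longrightarrow> x \<in> B \<Longrightarrow> T x \<in> B"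
  shows "orthomorphism T"
  unfolding orthomorphism_def image_subset_iff Ball_def atLeastAtMost_iff using assms by simp

lemma orthomorphism_disjoint:
  assumes "orthomorphism T" "inf \<bar>x\<bar> \<bar>y\<bar> = 0" shows "inf \<bar>T x\<bar> \<bar>y\<bar> = 0"
  using assms band_disjoint_complement[of y] unfolding orthomorphism_def by blast

lemma orthomorphism_bounded:
  assumes "orthomorphism T"
  obtains c where "0 \<le> c" "\<And>x. a \<le> x \<Longrightarrow> x \<le> b \<Longrightarrow> \<bar>T x\<bar> \<le> c"
proof -
  obtain l u where lu: "\<And>x. a \<le> x \<Longrightarrow> x \<le> b \<Longrightarrow> l \<le> T x \<and> T x \<le> u"
    using orthomorphism_interval[OF assms] by metis
  show ?thesis
  proof (rule that[of "\<bar>l\<bar> + \<bar>u\<bar>"])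
    show "0 \<le> \<bar>l\<bar> + \<bar>u\<bar>" by simp
    fix x assume "a \<le> x" "x \<le> b"
    then have b: "l \<le> T x" "T x \<le> u" using lu by auto
    show "\<bar>T x\<bar> \<le> \<bar>l\<bar> + \<bar>u\<bar>"
    proof (rule abs_leI)
      show "T x \<le> \<bar>l\<bar> + \<bar>u\<bar>" by (rule order_trans[OF order_trans[OF b(2) abs_ge_self]]) simp
      have "- T x \<le> - l" using b(1) by simp
      then show "- T x \<le> \<bar>l\<bar> + \<bar>u\<bar>"
        by (rule order_trans[OF order_trans[OF _ abs_ge_minus_self]]) simp
    qed
  qed
qed

lemma orthomorphism_minus:
  assumes T: "orthomorphism T" shows "orthomorphism (\<lambda>x. - T x)"
proof (rule orthomorphismI)
  show "linear (\<lambda>x. - T x)" by (rule linear_compose_neg[OF orthomorphism_linear[OF T]])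
  fix a b
  obtain c d where cd: "\<And>x. a \<le> x \<Longrightarrow> x \<le> b \<Longrightarrow> c \<le> T x \<and> T x \<le> d"
    using orthomorphism_interval[OF T] by metis
  show "\<exists>c d. \<forall>x. a \<le> x \<and> x \<le> b \<longrightarrow> c \<le> - T x \<and> - T x \<le> d"
    by (rule exI[of _ "- d"], rule exI[of _ "- c"]) (simp add: cd)
qed (simp add: subspace_neg band_subspace orthomorphism_band[OF T])

lemma orthomorphism_add:
  assumes S: "orthomorphism S" and T: "orthomorphism T"
  shows "orthomorphism (\<lambda>x. S x + T x)"
proof (rule orthomorphismI)
  show "linear (\<lambda>x. S x + T x)"
    by (rule linear_compose_add[OF S[THEN orthomorphism_linear] T[THEN orthomorphism_linear]])
  fix a b
  obtain c d where cd: "\<And>x. a \<le> x \<Longrightarrow> x \<le> b \<Longrightarrow> c \<le> T x \<and> T x \<le> d"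
    using orthomorphism_interval[OF T] by metis
  obtain c' d' where cd': "\<And>x. a \<le> x \<Longrightarrow> x \<le> b \<Longrightarrow> c' \<le> S x \<and> S x \<le> d'"
    using orthomorphism_interval[OF S] by metis
  show "\<exists>c d. \<forall>x. a \<le> x \<and> x \<le> b \<longrightarrow> c \<le> S x + T x \<and> S x + T x \<le> d"
    by (rule exI[of _ "c' + c"], rule exI[of _ "d' + d"]) (simp add: cd cd' add_mono)
qed (simp add: subspace_add band_subspace orthomorphism_band[OF S] orthomorphism_band[OF T])

lemma orthomorphism_pprt_disjoint_aux:
  assumes R: "orthomorphism R" and x: "0 \<le> x" "x \<le> z"
    and d: "0 \<le> d" "inf d (pprt (R z)) = 0"
  shows "inf d (pprt (R x)) = 0"
proof -
  interpret R: linear R by (rule orthomorphism_linear[OF R])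
  have z0: "0 \<le> z" using x by simp
  obtain c where c: "0 \<le> c" "\<And>v. 0 \<le> v \<Longrightarrow> v \<le> z \<Longrightarrow> \<bar>R v\<bar> \<le> c"
    using orthomorphism_bounded[OF R, of 0 z] by metis
  have "inf d (pprt (R x)) \<le> (1 / real n) *\<^sub>R c" if n: "n > 0" for n :: nat
  proof -
    define e where "e = (1 / real n) *\<^sub>R z"
    define k where "k = (1 / real n) *\<^sub>R c"
    define y where "y j = inf x (real j *\<^sub>R e)" for j :: nat
    have e0: "0 \<le> e" unfolding e_def using z0 by (simp add: scaleR_nonneg_nonneg)
    have k0: "0 \<le> k" unfolding k_def using c by (simp add: scaleR_nonneg_nonneg)
    have ne: "real n *\<^sub>R e = z" using n by (simp add: e_def)
    have bound: "\<bar>R v\<bar> \<le> k" if v: "0 \<le> v" "v \<le> e" for v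
    proof -
      have "real n *\<^sub>R v \<le> real n *\<^sub>R e" by (rule scaleR_left_mono[OF v(2)]) simp
      then have b: "\<bar>R (real n *\<^sub>R v)\<bar> \<le> c" using v by (intro c) (auto simp: ne scaleR_nonneg_nonneg)
      have 1: "R v = (1 / real n) *\<^sub>R R (real n *\<^sub>R v)" using n by (simp add: R.scale)
      have "R (real n *\<^sub>R v) \<le> c" "- R (real n *\<^sub>R v) \<le> c" using b by (simp_all add: abs_le_iff)
      then have "(1 / real n) *\<^sub>R R (real n *\<^sub>R v) \<le> k" "(1 / real n) *\<^sub>R (- R (real n *\<^sub>R v)) \<le> k"
        unfolding k_def by (auto intro!: scaleR_left_mono simp del: scaleR_minus_right)
      then show ?thesis by (intro abs_leI) (subst 1, simp)+
    qed
    have *: "inf d (pprt (R (y j))) \<le> k" for j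
    proof (induction j)
      case 0
      have "y 0 = 0" unfolding y_def using x by (simp add: inf_absorb2)
      then show ?case using d k0 by (simp add: R.zero inf_absorb2)
    next
      case (Suc j)
      define w where "w = real j *\<^sub>R e - y j"
      define v where "v = y (Suc j) - y j"
      have w0: "0 \<le> w" unfolding w_def y_def by simp
      have je: "real j *\<^sub>R e \<le> real (Suc j) *\<^sub>R e" by (rule scaleR_right_mono[OF _ e0]) simp
      have v0: "0 \<le> v" unfolding v_def y_def using je by (simp add: le_infI2)
      have "y (Suc j) \<le> y j + e"
      proof -
        have "y j + e = inf (x + e) (real (Suc j) *\<^sub>R e)"
          unfolding y_def by (subst add_inf_distrib_right) (simp add: scaleR_add_left add.commute)
        moreover have "y (Suc j) \<le> x + e" unfolding y_def using e0 by (simp add: le_infI1 add_increasing2)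
        ultimately show ?thesis unfolding y_def by simp
      qed
      then have ve: "v \<le> e" unfolding v_def by (simp add: diff_le_eq add.commute)
      have "inf v w = 0"
      proof (rule disjoint_mono[OF pprt_disjoint_nprt[of "x - real j *\<^sub>R e"]])
        have "x - y j = pprt (x - real j *\<^sub>R e)"
          unfolding y_def pprt_def diff_inf_eq_sup by (simp add: add_sup_distrib_left sup_commute)
        moreover have "v \<le> x - y j" unfolding v_def y_def by simp
        ultimately show "v \<le> pprt (x - real j *\<^sub>R e)" by simp
        have "nprt (x - real j *\<^sub>R e) = y j - real j *\<^sub>R e"
          unfolding y_def nprt_def using add_inf_distrib_right[of x "real j *\<^sub>R e" "- (real j *\<^sub>R e)"] by simp
        then show "w \<le> - nprt (x - real j *\<^sub>R e)" unfolding w_def by simp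
      qed (use v0 w0 in auto)
      then have "inf \<bar>v\<bar> \<bar>w\<bar> = 0" using v0 w0 by simp
      from orthomorphism_disjoint[OF R this] have "inf \<bar>w\<bar> \<bar>R v\<bar> = 0" by (simp add: inf_commute)
      from orthomorphism_disjoint[OF R this] have dis: "inf \<bar>R v\<bar> \<bar>R w\<bar> = 0" by (simp add: inf_commute)
      define q where "q = inf d (pprt (R (y (Suc j))))"
      have q0: "0 \<le> q" unfolding q_def using d by simp
      have ys: "R (y (Suc j)) = R (y j) + R v" unfolding v_def by (simp add: R.diff)
      have A: "q \<le> k + \<bar>R v\<bar>"
      proof -
        have "R (y j) + R v \<le> pprt (R (y j)) + \<bar>R v\<bar>" by (intro add_mono self_le_pprt abs_ge_self)
        then have "pprt (R (y (Suc j))) \<le> pprt (R (y j)) + \<bar>R v\<bar>"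
          unfolding ys by (rule le_imp_pprt_le) (simp add: add_nonneg_nonneg)
        then have "q \<le> inf d (pprt (R (y j)) + \<bar>R v\<bar>)" unfolding q_def by (simp add: le_infI2)
        also have "\<dots> \<le> inf d (pprt (R (y j))) + inf d \<bar>R v\<bar>" by (rule inf_add_le) (use d in auto)
        also have "\<dots> \<le> k + \<bar>R v\<bar>" using Suc by (intro add_mono) auto
        finally show ?thesis .
      qed
      have B: "q \<le> k + \<bar>R w\<bar>"
      proof -
        have jp: "inf d (real m *\<^sub>R pprt (R e)) = 0" for m
        proof -
          have Re: "pprt (R e) \<le> pprt (R z)"
          proof -
            have "R e \<le> pprt (R z)"
            proof -
              have "R e = (1 / real n) *\<^sub>R R z" unfolding e_def by (simp add: R.scale)
              also have "\<dots> \<le> (1 / real n) *\<^sub>R pprt (R z)" by (rule scaleR_left_mono[OF self_le_pprt]) simp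
              also have "\<dots> \<le> 1 *\<^sub>R pprt (R z)" by (rule scaleR_right_mono) (use n in auto)
              finally show ?thesis by simp
            qed
            then show ?thesis by (rule le_imp_pprt_le) simp
          qed
          have base: "inf d (pprt (R e)) = 0"
            by (rule disjoint_mono[OF d(2)]) (use d Re in auto)
          show ?thesis
          proof (induction m)
            case 0 then show ?case using d by (simp add: inf_absorb2)
          next
            case (Suc m)
            have "inf d (pprt (R e) + real m *\<^sub>R pprt (R e)) \<le> inf d (pprt (R e)) + inf d (real m *\<^sub>R pprt (R e))"
              by (rule inf_add_le) (use d in \<open>auto simp: scaleR_nonneg_nonneg\<close>)
            then have "inf d (real (Suc m) *\<^sub>R pprt (R e)) \<le> 0"
              using Suc base by (simp add: algebra_simps)
            moreover have "0 \<le> inf d (real (Suc m) *\<^sub>R pprt (R e))"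
              using d by (intro inf_greatest scaleR_nonneg_nonneg) auto
            ultimately show ?case by (rule order.antisym)
          qed
        qed
        have "R (y j) = real j *\<^sub>R R e - R w" unfolding w_def by (simp add: R.diff R.scale)
        then have "R (y (Suc j)) = real j *\<^sub>R R e + (- R w + R v)" unfolding ys by simp
        also have "\<dots> \<le> real j *\<^sub>R pprt (R e) + (\<bar>R w\<bar> + k)"
          by (intro add_mono scaleR_left_mono self_le_pprt abs_ge_minus_self
              order_trans[OF abs_ge_self bound] v0 ve) simp
        finally have "pprt (R (y (Suc j))) \<le> real j *\<^sub>R pprt (R e) + (\<bar>R w\<bar> + k)"
          by (rule le_imp_pprt_le) (use k0 in \<open>simp add: add_nonneg_nonneg scaleR_nonneg_nonneg\<close>)
        then have "q \<le> inf d (real j *\<^sub>R pprt (R e) + (\<bar>R w\<bar> + k))" unfolding q_def by (simp add: le_infI2)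
        also have "\<dots> \<le> inf d (real j *\<^sub>R pprt (R e)) + inf d (\<bar>R w\<bar> + k)"
          by (rule inf_add_le) (use d k0 in \<open>auto simp: add_nonneg_nonneg scaleR_nonneg_nonneg\<close>)
        also have "\<dots> \<le> k + \<bar>R w\<bar>" by (simp add: jp add.commute)
        finally show ?thesis .
      qed
      have "q - k \<le> inf \<bar>R v\<bar> \<bar>R w\<bar>" using A B by (simp add: diff_le_eq add.commute)
      then show ?case using dis unfolding q_def by simp
    qed
    have "y n = x" unfolding y_def ne using x by (simp add: inf_absorb1)
    then show ?thesis using *[of n] by (simp add: k_def)
  qed
  then have "inf d (pprt (R x)) \<le> 0" by (rule archimedean)
  then show ?thesis using d by (intro order.antisym) auto
qed

lemma orthomorphism_pprt_disjoint:
  assumes R: "orthomorphism R" and xy: "0 \<le> x" "0 \<le> y"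
  shows "inf (pprt (R x)) (- nprt (R y)) = 0"
proof -
  interpret R: linear R by (rule orthomorphism_linear[OF R])
  let ?z = "x + y" and ?p = "inf (pprt (R x)) (- nprt (R y))"
  have p0: "0 \<le> ?p" by simp
  have mz: "pprt (- R v) = - nprt (R v)" for v by (simp add: pprt_neg)
  have "inf (- nprt (R y)) (pprt (R ?z)) = 0"
  proof -
    have "inf (pprt (R ?z)) (pprt (- R y)) = 0"
      by (rule orthomorphism_pprt_disjoint_aux[OF orthomorphism_minus[OF R], of y ?z])
        (use xy in \<open>auto simp: mz pprt_disjoint_nprt\<close>)
    then show ?thesis by (simp add: mz inf_commute)
  qed
  then have "inf ?p (pprt (R ?z)) = 0" by (rule disjoint_mono) auto
  then have "inf ?p (pprt (R x)) = 0"
    by (intro orthomorphism_pprt_disjoint_aux[OF R, of x ?z]) (use xy in auto)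
  moreover have "inf ?p (pprt (R x)) = ?p" by (simp add: inf_absorb1)
  ultimately show ?thesis by simp
qed

lemma orthomorphism_cross_bound:
  assumes S: "orthomorphism S" and T: "orthomorphism T" and xy: "0 \<le> x" "0 \<le> y"
  shows "T x + S y \<le> sup (T (x + y)) (S (x + y))"
proof -
  interpret S: linear S by (rule orthomorphism_linear[OF S])
  interpret T: linear T by (rule orthomorphism_linear[OF T])
  define R where "R = (\<lambda>x. T x - S x)"
  have R: "orthomorphism R"
    using orthomorphism_add[OF T orthomorphism_minus[OF S]] by (simp add: R_def)
  define p where "p = pprt (R x)"
  define a where "a = - nprt (R x)"
  define b where "b = - nprt (R y)"
  have pos: "0 \<le> p" "0 \<le> a" "0 \<le> b" by (auto simp: p_def a_def b_def)
  have "inf p a = 0" "inf p b = 0"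
    unfolding p_def a_def b_def using pprt_disjoint_nprt orthomorphism_pprt_disjoint[OF R xy] by auto
  then have z: "inf p (a + b) = 0"
    using inf_add_le[OF pos] pos by (intro order.antisym) auto
  have "p \<le> pprt (p - (a + b))"
  proof -
    have "p - inf p (a + b) = sup 0 (p - (a + b))" unfolding diff_inf_eq_sup
      by (simp add: add_sup_distrib_left del: minus_add_distrib)
    then show ?thesis using z by (simp add: pprt_def sup_commute)
  qed
  also have "\<dots> \<le> pprt (R x + R y)"
  proof (rule pprt_mono)
    have "p - (a + b) = R x + nprt (R y)" unfolding p_def a_def b_def by (subst (3) prts) simp
    also have "\<dots> \<le> R x + R y" by (simp add: nprt_def)
    finally show "p - (a + b) \<le> R x + R y" .
  qed
  finally have "R x \<le> pprt (R x + R y)" using self_le_pprt[of "R x"] unfolding p_def by (rule order_trans[rotated])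
  then have "T x - S x + S (x + y) \<le> sup (T x - S x + (T y - S y)) 0 + S (x + y)"
    unfolding pprt_def R_def by (rule add_right_mono)
  also have "\<dots> = sup (T (x + y)) (S (x + y))"
    by (subst add_sup_distrib_right) (simp add: T.add S.add algebra_simps)
  finally show ?thesis by (simp add: S.add)
qed

lemma orthomorphism_zero: "orthomorphism (\<lambda>x. 0)"
  by (rule orthomorphismI) (auto simp: linear_zero subspace_0 band_subspace)

lemma orthomorphism_id: "orthomorphism (\<lambda>x. x)"
  by (rule orthomorphismI) (auto simp: linear_ident)

lemma orthomorphism_comp:
  assumes S: "orthomorphism S" and T: "orthomorphism T"
  shows "orthomorphism (\<lambda>x. S (T x))"
proof (rule orthomorphismI)
  show "linear (\<lambda>x. S (T x))"
    using linear_compose[OF T[THEN orthomorphism_linear] S[THEN orthomorphism_linear]]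
    by (simp add: o_def)
  fix a b
  obtain c d where cd: "\<And>x. a \<le> x \<Longrightarrow> x \<le> b \<Longrightarrow> c \<le> T x \<and> T x \<le> d"
    using orthomorphism_interval[OF T] by metis
  obtain c' d' where cd': "\<And>x. c \<le> x \<Longrightarrow> x \<le> d \<Longrightarrow> c' \<le> S x \<and> S x \<le> d'"
    using orthomorphism_interval[OF S] by metis
  show "\<exists>c d. \<forall>x. a \<le> x \<and> x \<le> b \<longrightarrow> c \<le> S (T x) \<and> S (T x) \<le> d"
    by (rule exI[of _ c'], rule exI[of _ d']) (simp add: cd cd')
qed (simp add: orthomorphism_band[OF S] orthomorphism_band[OF T])

lemma orthomorphism_scaleR:
  assumes T: "orthomorphism T"
  shows "orthomorphism (\<lambda>x. r *\<^sub>R T x)"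
proof (rule orthomorphismI)
  show "linear (\<lambda>x. r *\<^sub>R T x)"
    by (rule linear_compose_scale_right[OF T[THEN orthomorphism_linear]])
  fix a b
  obtain c d where cd: "\<And>x. a \<le> x \<Longrightarrow> x \<le> b \<Longrightarrow> c \<le> T x \<and> T x \<le> d"
    using orthomorphism_interval[OF T] by metis
  show "\<exists>c d. \<forall>x. a \<le> x \<and> x \<le> b \<longrightarrow> c \<le> r *\<^sub>R T x \<and> r *\<^sub>R T x \<le> d"
  proof (cases "r \<ge> 0")
    case True
    then show ?thesis
      by (intro exI[of _ "r *\<^sub>R c"] exI[of _ "r *\<^sub>R d"]) (simp add: cd scaleR_left_mono)
  next
    case False
    then show ?thesis
      by (intro exI[of _ "r *\<^sub>R d"] exI[of _ "r *\<^sub>R c"]) (simp add: cd scaleR_left_mono_neg)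
  qed
qed (simp add: subspace_scale band_subspace orthomorphism_band[OF T])

lemma pprt_diff: fixes x :: "'e::lattice_ab_group_add" shows "pprt x - pprt (- x) = x"
  by (simp add: pprt_neg flip: prts)

definition orth_sup_fun ::
  "('e::dedekind_complete_vector_lattice \<Rightarrow> 'e) set \<Rightarrow> 'e \<Rightarrow> 'e" where
  "orth_sup_fun A x = (SUP T\<in>A. T (pprt x)) - (SUP T\<in>A. T (pprt (- x)))"

lemma orth_sup_fun:
  fixes A :: "('e::dedekind_complete_vector_lattice \<Rightarrow> 'e) set"
  assumes ne: "A \<noteq> {}" and A: "\<And>T. T \<in> A \<Longrightarrow> orthomorphism T"
    and bd: "\<And>x. 0 \<le> x \<Longrightarrow> bdd_above ((\<lambda>T. T x) ` A)"
  shows "orthomorphism (orth_sup_fun A)"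
    and "0 \<le> x \<Longrightarrow> orth_sup_fun A x = (SUP T\<in>A. T x)"
proof -
  define g where "g x = (SUP T\<in>A. T x)" for x
  have up: "T x \<le> g x" if "T \<in> A" "0 \<le> x" for T x
    unfolding g_def by (rule cSUP_upper[OF that(1) bd[OF that(2)]])
  have least: "g x \<le> u" if "\<And>T. T \<in> A \<Longrightarrow> T x \<le> u" for x u
    unfolding g_def by (rule cSUP_least[OF ne that])
  note lin = orthomorphism_linear[OF A]
  have gadd: "g (x + y) = g x + g y" if xy: "0 \<le> x" "0 \<le> y" for x y
  proof (rule order.antisym)
    have xy': "0 \<le> x + y" using xy by simp
    show "g (x + y) \<le> g x + g y"
    proof (rule least)
      fix T assume T: "T \<in> A"
      have "T (x + y) = T x + T y" by (rule linear_add[OF lin[OF T]])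
      also have "\<dots> \<le> g x + g y" by (intro add_mono up T xy)
      finally show "T (x + y) \<le> g x + g y" .
    qed
    have "g x \<le> g (x + y) - g y"
    proof (rule least)
      fix T assume T: "T \<in> A"
      have "g y \<le> g (x + y) - T x"
      proof (rule least)
        fix S assume S: "S \<in> A"
        have "T x + S y \<le> sup (T (x + y)) (S (x + y))"
          by (rule orthomorphism_cross_bound[OF A[OF S] A[OF T] xy])
        also have "\<dots> \<le> g (x + y)" by (intro sup_least up T S xy')
        finally show "S y \<le> g (x + y) - T x" by (simp add: le_diff_eq add.commute)
      qed
      then show "T x \<le> g (x + y) - g y" by (simp add: le_diff_eq add.commute)
    qed
    then show "g x + g y \<le> g (x + y)" by (simp add: le_diff_eq)
  qed
  have g0: "g 0 = 0"
  proof -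
    have "g 0 + 0 = g 0 + g 0" using gadd[of 0 0] by simp
    then show ?thesis by (simp only: add_left_cancel)
  qed
  have gsc_le: "g (c *\<^sub>R x) \<le> c *\<^sub>R g x" if "0 \<le> c" "0 \<le> x" for c x
  proof (rule least)
    fix T assume T: "T \<in> A"
    have "T (c *\<^sub>R x) = c *\<^sub>R T x" by (rule linear_scale[OF lin[OF T]])
    also have "\<dots> \<le> c *\<^sub>R g x" by (intro scaleR_left_mono up T that)
    finally show "T (c *\<^sub>R x) \<le> c *\<^sub>R g x" .
  qed
  have gsc: "g (c *\<^sub>R x) = c *\<^sub>R g x" if c: "0 \<le> c" and x: "0 \<le> x" for c x
  proof (cases "c = 0")
    case True then show ?thesis by (simp add: g0)
  next
    case False
    have "g ((1 / c) *\<^sub>R (c *\<^sub>R x)) \<le> (1 / c) *\<^sub>R g (c *\<^sub>R x)"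
      using c x by (intro gsc_le scaleR_nonneg_nonneg) auto
    then have "g x \<le> (1 / c) *\<^sub>R g (c *\<^sub>R x)" using False by simp
    then have "c *\<^sub>R g x \<le> c *\<^sub>R ((1 / c) *\<^sub>R g (c *\<^sub>R x))" using c by (rule scaleR_left_mono)
    then have "c *\<^sub>R g x \<le> g (c *\<^sub>R x)" using False by simp
    with gsc_le[OF c x] show ?thesis by (rule order.antisym)
  qed
  have F: "orth_sup_fun A x = g (pprt x) - g (pprt (- x))" for x
    by (simp add: orth_sup_fun_def g_def)
  have Fd: "orth_sup_fun A x = g a - g b" if "0 \<le> a" "0 \<le> b" "x = a - b" for x a b
  proof -
    have "pprt x - pprt (- x) = a - b" using that(3) by (simp only: pprt_diff)
    then have eq: "pprt x + b = a + pprt (- x)" by (simp only: diff_eq_eq diff_add_eq)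
    have "g (pprt x) + g b = g (pprt x + b)" by (rule gadd[symmetric]) (use that in simp_all)
    also have "\<dots> = g a + g (pprt (- x))" unfolding eq by (rule gadd) (use that in simp_all)
    finally have "g (pprt x) + g b = g a + g (pprt (- x))" .
    then show ?thesis unfolding F by (simp add: algebra_simps)
  qed
  show Fpos: "orth_sup_fun A x = (SUP T\<in>A. T x)" if "0 \<le> x" for x
    using Fd[of x 0 x] that by (simp add: g0 g_def[symmetric])
  show "orthomorphism (orth_sup_fun A)"
  proof (rule orthomorphismI)
    have add: "orth_sup_fun A (x + y) = orth_sup_fun A x + orth_sup_fun A y" for x y
    proof -
      have "x + y = (pprt x - pprt (- x)) + (pprt y - pprt (- y))" by (simp only: pprt_diff)
      also have "\<dots> = (pprt x + pprt y) - (pprt (- x) + pprt (- y))" by simp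
      finally have eq: "x + y = (pprt x + pprt y) - (pprt (- x) + pprt (- y))" .
      have "orth_sup_fun A (x + y) = g (pprt x + pprt y) - g (pprt (- x) + pprt (- y))"
        by (rule Fd[OF _ _ eq]) (simp_all only: add_nonneg_nonneg zero_le_pprt)
      then show ?thesis unfolding F by (simp add: gadd)
    qed
    have sc: "orth_sup_fun A (c *\<^sub>R x) = c *\<^sub>R orth_sup_fun A x" for c x
    proof (cases "0 \<le> c")
      case True
      have "c *\<^sub>R x = c *\<^sub>R (pprt x - pprt (- x))" by (simp only: pprt_diff)
      also have "\<dots> = c *\<^sub>R pprt x - c *\<^sub>R pprt (- x)" by (simp only: scaleR_right_diff_distrib)
      finally have eq: "c *\<^sub>R x = c *\<^sub>R pprt x - c *\<^sub>R pprt (- x)" .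
      have "orth_sup_fun A (c *\<^sub>R x) = g (c *\<^sub>R pprt x) - g (c *\<^sub>R pprt (- x))"
        by (rule Fd[OF _ _ eq]) (simp_all only: scaleR_nonneg_nonneg True zero_le_pprt)
      then show ?thesis unfolding F using True by (simp add: gsc scaleR_right_diff_distrib)
    next
      case False
      then have c: "0 \<le> - c" by simp
      have "c *\<^sub>R x = c *\<^sub>R (pprt x - pprt (- x))" by (simp only: pprt_diff)
      also have "\<dots> = (- c) *\<^sub>R pprt (- x) - (- c) *\<^sub>R pprt x"
        by (simp only: scaleR_right_diff_distrib scaleR_minus_left) simp
      finally have eq: "c *\<^sub>R x = (- c) *\<^sub>R pprt (- x) - (- c) *\<^sub>R pprt x" .
      have "orth_sup_fun A (c *\<^sub>R x) = g ((- c) *\<^sub>R pprt (- x)) - g ((- c) *\<^sub>R pprt x)"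
        by (rule Fd[OF _ _ eq]) (simp_all only: scaleR_nonneg_nonneg c zero_le_pprt)
      also have "\<dots> = (- c) *\<^sub>R g (pprt (- x)) - (- c) *\<^sub>R g (pprt x)"
        by (simp only: gsc[OF c] zero_le_pprt)
      also have "\<dots> = c *\<^sub>R (g (pprt x) - g (pprt (- x)))" by (simp add: scaleR_right_diff_distrib)
      finally show ?thesis unfolding F .
    qed
    show lin': "linear (orth_sup_fun A)" by (rule linearI) (simp_all add: add sc)
    fix a b
    obtain T0 where T0: "T0 \<in> A" using ne by blast
    obtain c where c: "\<And>x. 0 \<le> x \<Longrightarrow> x \<le> b - a \<Longrightarrow> \<bar>T0 x\<bar> \<le> c"
      using orthomorphism_bounded[OF A[OF T0], of 0 "b - a"] by metis
    have "orth_sup_fun A a - c \<le> orth_sup_fun A x \<and> orth_sup_fun A x \<le> orth_sup_fun A b + c"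
      if x: "a \<le> x" "x \<le> b" for x
    proof
      have "- c \<le> T0 (x - a)" using c[of "x - a"] x by (simp add: abs_le_iff minus_le_iff)
      also have "\<dots> \<le> orth_sup_fun A (x - a)" using up[OF T0, of "x - a"] x Fpos[of "x - a"] by (simp add: g_def)
      finally show "orth_sup_fun A a - c \<le> orth_sup_fun A x" by (simp add: linear_diff[OF lin'] algebra_simps)
      have "- c \<le> T0 (b - x)" using c[of "b - x"] x by (simp add: abs_le_iff minus_le_iff)
      also have "\<dots> \<le> orth_sup_fun A (b - x)" using up[OF T0, of "b - x"] x Fpos[of "b - x"] by (simp add: g_def)
      finally show "orth_sup_fun A x \<le> orth_sup_fun A b + c" by (simp add: linear_diff[OF lin'] algebra_simps)
    qed
    then show "\<exists>c d. \<forall>x. a \<le> x \<and> x \<le> b \<longrightarrow> c \<le> orth_sup_fun A x \<and> orth_sup_fun A x \<le> d" by blast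
  next
    fix B :: "'e set" and x assume B: "band B" and x: "x \<in> B"
    have gB: "g v \<in> B" if v: "v \<in> B" "0 \<le> v" for v
    proof -
      have "(\<lambda>T. T v) ` A \<subseteq> B" using orthomorphism_band[OF A B v(1)] by blast
      then show ?thesis unfolding g_def using bd[OF v(2)] ne by (intro band_Sup[OF B]) simp_all
    qed
    note ideal = band_solid[OF B]
    have "pprt x \<in> B" by (rule ideal[OF x]) (simp add: pprt_eq_abs)
    moreover have "pprt (- x) \<in> B" by (rule ideal[OF x]) (simp add: pprt_eq_abs pprt_neg)
    ultimately show "orth_sup_fun A x \<in> B" unfolding F
      by (intro subspace_diff[OF band_subspace[OF B]] gB zero_le_pprt)
  qed
qed

typedef (overloaded) 'e orth =
  "{T :: 'e::dedekind_complete_vector_lattice \<Rightarrow> 'e. orthomorphism T}"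
  morphisms orth_apply Orth
  using orthomorphism_zero by blast

setup_lifting type_definition_orth

lemma orthomorphism_orth_apply: "orthomorphism (orth_apply T)"
  using orth_apply by blast

instantiation orth :: (dedekind_complete_vector_lattice) "{real_vector, ring, monoid_mult}"
begin

lift_definition zero_orth :: "'a orth" is "\<lambda>x. 0" by (rule orthomorphism_zero)
lift_definition one_orth :: "'a orth" is "\<lambda>x. x" by (rule orthomorphism_id)
lift_definition plus_orth :: "'a orth \<Rightarrow> 'a orth \<Rightarrow> 'a orth" is "\<lambda>S T x. S x + T x"
  by (rule orthomorphism_add)
lift_definition uminus_orth :: "'a orth \<Rightarrow> 'a orth" is "\<lambda>T x. - T x"
  by (rule orthomorphism_minus)
lift_definition minus_orth :: "'a orth \<Rightarrow> 'a orth \<Rightarrow> 'a orth" is "\<lambda>S T x. S x - T x"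
  using orthomorphism_add[OF _ orthomorphism_minus] by fastforce
lift_definition times_orth :: "'a orth \<Rightarrow> 'a orth \<Rightarrow> 'a orth" is "\<lambda>S T x. S (T x)"
  by (rule orthomorphism_comp)
lift_definition scaleR_orth :: "real \<Rightarrow> 'a orth \<Rightarrow> 'a orth" is "\<lambda>r T x. r *\<^sub>R T x"
  by (rule orthomorphism_scaleR)

instance
  by standard
    (transfer; simp add: fun_eq_iff algebra_simps linear_add orthomorphism_linear)+

end

instantiation orth :: (dedekind_complete_vector_lattice) order
begin

lift_definition less_eq_orth :: "'a orth \<Rightarrow> 'a orth \<Rightarrow> bool" is "\<lambda>S T. \<forall>x\<ge>0. S x \<le> T x" .

definition less_orth :: "'a orth \<Rightarrow> 'a orth \<Rightarrow> bool" where
  "less_orth S T \<longleftrightarrow> S \<le> T \<and> \<not> T \<le> S"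

instance
proof
  fix S T U :: "'a orth"
  show "S < T \<longleftrightarrow> S \<le> T \<and> \<not> T \<le> S" by (rule less_orth_def)
  show "S \<le> S" by transfer simp
  show "S \<le> T \<Longrightarrow> T \<le> U \<Longrightarrow> S \<le> U" by transfer (blast intro: order_trans)
  show "S \<le> T \<Longrightarrow> T \<le> S \<Longrightarrow> S = T"
  proof transfer
    fix S T :: "'a \<Rightarrow> 'a"
    assume S: "orthomorphism S" and T: "orthomorphism T"
      and le: "\<forall>x\<ge>0. S x \<le> T x" "\<forall>x\<ge>0. T x \<le> S x"
    have eq: "S x = T x" if "0 \<le> x" for x using le that by (simp add: order.antisym)
    show "S = T"
    proof
      fix x
      have "S (pprt x - pprt (- x)) = T (pprt x - pprt (- x))"
        using S T by (simp add: linear_diff orthomorphism_linear eq)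
      then show "S x = T x" by (simp only: pprt_diff)
    qed
  qed
qed

end

instantiation orth :: (dedekind_complete_vector_lattice) dedekind_complete_vector_lattice
begin

definition Sup_orth :: "'a orth set \<Rightarrow> 'a orth" where
  "Sup_orth A = Orth (orth_sup_fun (orth_apply ` A))"

definition Inf_orth :: "'a orth set \<Rightarrow> 'a orth" where
  "Inf_orth A = - Sup (uminus ` A)"

definition sup_orth :: "'a orth \<Rightarrow> 'a orth \<Rightarrow> 'a orth" where
  "sup_orth S T = Sup {S, T}"

definition inf_orth :: "'a orth \<Rightarrow> 'a orth \<Rightarrow> 'a orth" where
  "inf_orth S T = Inf {S, T}"

definition abs_orth :: "'a orth \<Rightarrow> 'a orth" where
  "abs_orth T = sup T (- T)"

lemma orth_apply_Sup:
  fixes A :: "'a orth set"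
  assumes "A \<noteq> {}" "\<And>x. 0 \<le> x \<Longrightarrow> bdd_above ((\<lambda>T. orth_apply T x) ` A)" "0 \<le> x"
  shows "orth_apply (Sup A) x = (SUP T\<in>A. orth_apply T x)"
proof -
  have *: "\<And>x. 0 \<le> x \<Longrightarrow> bdd_above ((\<lambda>T. T x) ` (orth_apply ` A))"
    using assms(2) by (simp add: image_image)
  have "orthomorphism (orth_sup_fun (orth_apply ` A))"
    by (rule orth_sup_fun) (use assms(1) * orthomorphism_orth_apply in auto)
  moreover have "orth_sup_fun (orth_apply ` A) x = (SUP T\<in>orth_apply ` A. T x)"
    by (rule orth_sup_fun) (use assms(1,3) * orthomorphism_orth_apply in auto)
  ultimately show ?thesis by (simp add: Sup_orth_def Orth_inverse image_image)
qed

lemma Sup_orth_props: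
  fixes A :: "'a orth set"
  assumes ne: "A \<noteq> {}" and bd: "\<And>x. 0 \<le> x \<Longrightarrow> bdd_above ((\<lambda>T. orth_apply T x) ` A)"
  shows "T \<in> A \<Longrightarrow> T \<le> Sup A" "(\<And>T. T \<in> A \<Longrightarrow> T \<le> U) \<Longrightarrow> Sup A \<le> U"
  using ne bd orth_apply_Sup[OF ne bd]
  by (auto simp: less_eq_orth.rep_eq intro: cSUP_upper cSUP_least)

instance
proof
  fix S T U :: "'a orth" and r s :: real and A :: "'a orth set"
  show "S \<le> T \<Longrightarrow> U + S \<le> U + T" by transfer simp
  show "S \<le> T \<Longrightarrow> 0 \<le> r \<Longrightarrow> r *\<^sub>R S \<le> r *\<^sub>R T" by transfer (simp add: scaleR_left_mono)
  show "r \<le> s \<Longrightarrow> 0 \<le> T \<Longrightarrow> r *\<^sub>R T \<le> s *\<^sub>R T" by transfer (simp add: scaleR_right_mono)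
  show "\<bar>T\<bar> = sup T (- T)" by (rule abs_orth_def)
  have neg: "- S \<le> T \<longleftrightarrow> - T \<le> S" for S T :: "'a orth"
    by transfer (simp add: minus_le_iff)
  have neg2: "- S \<le> - T \<longleftrightarrow> T \<le> S" for S T :: "'a orth"
    by transfer simp
  have le_neg: "S \<le> - T \<longleftrightarrow> T \<le> - S" for S T :: "'a orth"
    by transfer (simp add: le_minus_iff)
  have fin: "bdd_above ((\<lambda>T. orth_apply T x) ` {S, T})" for x and S T :: "'a orth" by simp
  have bd: "bdd_above ((\<lambda>T. orth_apply T x) ` A)" if bA: "bdd_above A" and x0: "0 \<le> x" for x and A :: "'a orth set"
  proof -
    obtain U where "\<And>T. T \<in> A \<Longrightarrow> T \<le> U" using bA unfolding bdd_above_def by blast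
    then show ?thesis using x0 unfolding bdd_above_def less_eq_orth.rep_eq by blast
  qed
  show "S \<le> sup S T" unfolding sup_orth_def by (rule Sup_orth_props) (use fin in auto)
  show "T \<le> sup S T" unfolding sup_orth_def by (rule Sup_orth_props) (use fin in auto)
  show "S \<le> U \<Longrightarrow> T \<le> U \<Longrightarrow> sup S T \<le> U"
    unfolding sup_orth_def by (rule Sup_orth_props) (use fin in auto)
  have inf: "inf S T = - sup (- S) (- T)" for S T :: "'a orth"
    unfolding inf_orth_def Inf_orth_def sup_orth_def by simp
  have ub: "- S \<le> sup (- S) (- T)" "- T \<le> sup (- S) (- T)" for S T :: "'a orth"
    unfolding sup_orth_def by (rule Sup_orth_props; use fin in auto)+
  show "inf S T \<le> S" unfolding inf by (rule neg[THEN iffD2, OF ub(1)])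
  show "inf S T \<le> T" unfolding inf by (rule neg[THEN iffD2, OF ub(2)])
  show "S \<le> inf T U" if "S \<le> T" "S \<le> U"
  proof -
    have "sup (- T) (- U) \<le> - S"
      unfolding sup_orth_def
    proof (rule Sup_orth_props)
      fix V assume "V \<in> {- T, - U}"
      then show "V \<le> - S" using that neg2 by blast
    qed (simp_all add: fin)
    then show ?thesis unfolding inf by (rule le_neg[THEN iffD1])
  qed
  show "T \<le> Sup A" if "T \<in> A" "bdd_above A"
    by (rule Sup_orth_props) (use that bd in auto)
  show "Sup A \<le> U" if "A \<noteq> {}" "\<And>T. T \<in> A \<Longrightarrow> T \<le> U"
  proof (rule Sup_orth_props)
    have "bdd_above A" using that(2) by (rule bdd_aboveI)
    then show "\<And>x. 0 \<le> x \<Longrightarrow> bdd_above ((\<lambda>T. orth_apply T x) ` A)" by (rule bd)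
  qed (use that in auto)
  show "Inf A \<le> T" if "T \<in> A" "bdd_below A"
  proof -
    obtain L where "\<And>V. V \<in> A \<Longrightarrow> L \<le> V" using \<open>bdd_below A\<close> unfolding bdd_below_def by blast
    then have bA: "bdd_above (uminus ` A)" by (intro bdd_aboveI[of _ "- L"]) (auto simp: neg2)
    have "- T \<le> Sup (uminus ` A)"
      using \<open>T \<in> A\<close> by (intro Sup_orth_props(1) bd[OF bA]) blast+
    then show ?thesis unfolding Inf_orth_def by (rule neg[THEN iffD1])
  qed
  show "U \<le> Inf A" if "A \<noteq> {}" "\<And>T. T \<in> A \<Longrightarrow> U \<le> T"
  proof -
    have up: "V \<le> - U" if "V \<in> uminus ` A" for V using that \<open>\<And>T. T \<in> A \<Longrightarrow> U \<le> T\<close> neg2 by blast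
    then have bA: "bdd_above (uminus ` A)" by (rule bdd_aboveI)
    have "Sup (uminus ` A) \<le> - U"
      using \<open>A \<noteq> {}\<close> by (intro Sup_orth_props(2) bd[OF bA] up) blast+
    then show ?thesis unfolding Inf_orth_def by (rule le_neg[THEN iffD1])
  qed
qed

end

definition band_projections :: "'e::dedekind_complete_vector_lattice orth set" where
  "band_projections = {\<pi>. \<exists>B. band B \<and>
     (\<forall>x. orth_apply \<pi> x \<in> B \<and> x - orth_apply \<pi> x \<in> disjoint_complement B)}"

text \<open>The supremum is the one of the Boolean algebra of band projections.\<close>

definition partition_of_unity :: "('i \<Rightarrow> 'e::dedekind_complete_vector_lattice orth) \<Rightarrow> bool" where
  "partition_of_unity \<pi> \<longleftrightarrow> range \<pi> \<subseteq> band_projections \<and>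
     (\<forall>s t. s \<noteq> t \<longrightarrow> inf (\<pi> s) (\<pi> t) = 0) \<and>
     (\<forall>\<rho>\<in>band_projections. (\<forall>s. \<pi> s \<le> \<rho>) \<longrightarrow> 1 \<le> \<rho>)"


section \<open>Order convergence and relatively uniform convergence\<close>

text \<open>Nets are rendered as filters: a net indexed by a directed set converges iff it converges
  along the filter of tails of the index set.\<close>

definition order_tendsto ::
  "('i \<Rightarrow> 'e::dedekind_complete_vector_lattice) \<Rightarrow> 'e \<Rightarrow> 'i filter \<Rightarrow> bool" where
  "order_tendsto x l F \<longleftrightarrow> (\<exists>D. D \<noteq> {} \<and> (\<forall>c\<in>D. \<forall>d\<in>D. \<exists>e\<in>D. e \<le> c \<and> e \<le> d) \<and>
     (\<forall>d\<in>D. 0 \<le> d) \<and> Inf D = 0 \<and> (\<forall>d\<in>D. \<forall>\<^sub>F i in F. \<bar>x i - l\<bar> \<le> d))"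

definition relatively_uniform_tendsto ::
  "('i \<Rightarrow> 'e::dedekind_complete_vector_lattice) \<Rightarrow> 'e \<Rightarrow> 'i filter \<Rightarrow> bool" where
  "relatively_uniform_tendsto x l F \<longleftrightarrow>
     (\<exists>u\<ge>0. \<forall>\<epsilon>>0. \<forall>\<^sub>F i in F. \<bar>x i - l\<bar> \<le> \<epsilon> *\<^sub>R u)"

definition order_sums :: "('i \<Rightarrow> 'e::dedekind_complete_vector_lattice) \<Rightarrow> 'e \<Rightarrow> bool" where
  "order_sums x l \<longleftrightarrow> order_tendsto (sum x) l (finite_subsets_at_top UNIV)"


section \<open>Lattice normed spaces\<close>

text \<open>Vector spaces are subspaces of a type with scalar multiplication \<open>scale\<close>, so that a
  lattice normed space and its norm completion can share one ambient type and one norm.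
  The only instances of the class \<open>real_normed_field\<close> are, up to isometric isomorphism,
  the real and the complex numbers (Gelfand--Mazur).\<close>

definition lattice_normed_space ::
  "('k::real_normed_field \<Rightarrow> 'x::ab_group_add \<Rightarrow> 'x) \<Rightarrow>
   ('x \<Rightarrow> 'e::dedekind_complete_vector_lattice) \<Rightarrow> 'x set \<Rightarrow> bool" where
  "lattice_normed_space scale nrm X \<longleftrightarrow>
     vector_space scale \<and> module.subspace scale X \<and>
     (\<forall>x\<in>X. 0 \<le> nrm x) \<and>
     (\<forall>x\<in>X. nrm x = 0 \<longrightarrow> x = 0) \<and>
     (\<forall>c. \<forall>x\<in>X. nrm (scale c x) = norm c *\<^sub>R nrm x) \<and>
     (\<forall>x\<in>X. \<forall>y\<in>X. nrm (x + y) \<le> nrm x + nrm y) \<and>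
     disjoint_complement (disjoint_complement (nrm ` X)) = UNIV"

definition decomposable ::
  "('x::ab_group_add \<Rightarrow> 'e::dedekind_complete_vector_lattice) \<Rightarrow> 'x set \<Rightarrow> bool" where
  "decomposable nrm X \<longleftrightarrow> (\<forall>x\<in>X. \<forall>e1\<ge>0. \<forall>e2\<ge>0. nrm x = e1 + e2 \<longrightarrow>
     (\<exists>x1\<in>X. \<exists>x2\<in>X. x = x1 + x2 \<and> nrm x1 = e1 \<and> nrm x2 = e2))"

definition norm_order_complete ::
  "('x::ab_group_add \<Rightarrow> 'e::dedekind_complete_vector_lattice) \<Rightarrow> 'x set \<Rightarrow> bool" where
  "norm_order_complete nrm X \<longleftrightarrow>
     (\<forall>F. F \<noteq> bot \<and> (\<forall>\<^sub>F x in F. x \<in> X) \<and>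
        order_tendsto (\<lambda>(x, y). nrm (x - y)) 0 (F \<times>\<^sub>F F) \<longrightarrow>
      (\<exists>x\<in>X. order_tendsto (\<lambda>y. nrm (x - y)) 0 F))"

definition banach_kantorovich_space ::
  "('k::real_normed_field \<Rightarrow> 'x::ab_group_add \<Rightarrow> 'x) \<Rightarrow>
   ('x \<Rightarrow> 'e::dedekind_complete_vector_lattice) \<Rightarrow> 'x set \<Rightarrow> bool" where
  "banach_kantorovich_space scale nrm X \<longleftrightarrow>
     lattice_normed_space scale nrm X \<and> decomposable nrm X \<and> norm_order_complete nrm X"

definition norm_completion ::
  "('k::real_normed_field \<Rightarrow> 'x::ab_group_add \<Rightarrow> 'x) \<Rightarrow>
   ('x \<Rightarrow> 'e::dedekind_complete_vector_lattice) \<Rightarrow> 'x set \<Rightarrow> 'x set \<Rightarrow> bool" where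
  "norm_completion scale nrm X Xt \<longleftrightarrow>
     banach_kantorovich_space scale nrm Xt \<and> X \<subseteq> Xt \<and>
     (\<forall>Z. module.subspace scale Z \<and> X \<subseteq> Z \<and> Z \<subseteq> Xt \<and>
        decomposable nrm Z \<and> norm_order_complete nrm Z \<longrightarrow> Z = Xt)"

definition is_orth_action ::
  "('k::real_normed_field \<Rightarrow> 'x::ab_group_add \<Rightarrow> 'x) \<Rightarrow>
   ('x \<Rightarrow> 'e::dedekind_complete_vector_lattice) \<Rightarrow> 'x set \<Rightarrow> ('e orth \<Rightarrow> 'x \<Rightarrow> 'x) \<Rightarrow> bool" where
  "is_orth_action scale nrm Xt act \<longleftrightarrow>
     (\<forall>a. act a \<in> Xt \<rightarrow>\<^sub>E Xt) \<and>
     (\<forall>a. \<forall>x\<in>Xt. \<forall>y\<in>Xt. act a (x + y) = act a x + act a y) \<and>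
     (\<forall>a b. \<forall>x\<in>Xt. act (a + b) x = act a x + act b x) \<and>
     (\<forall>a b. \<forall>x\<in>Xt. act (a * b) x = act a (act b x)) \<and>
     (\<forall>x\<in>Xt. act 1 x = x) \<and>
     (\<forall>a c. \<forall>x\<in>Xt. act a (scale c x) = scale c (act a x)) \<and>
     (\<forall>a r. \<forall>x\<in>Xt. act (r *\<^sub>R a) x = scale (of_real r) (act a x)) \<and>
     (\<forall>a. (\<forall>x\<in>Xt. act a x = 0) \<longrightarrow> a = 0) \<and>
     (\<forall>\<pi>\<in>band_projections. \<forall>x\<in>Xt. \<forall>y\<in>Xt.
        nrm (act \<pi> x + act (1 - \<pi>) y) = orth_apply \<pi> (nrm x) + orth_apply (1 - \<pi>) (nrm y)) \<and>
     (\<forall>a. \<forall>x\<in>Xt. nrm (act a x) = orth_apply \<bar>a\<bar> (nrm x))"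

text \<open>On a Banach--Kantorovich space there is exactly one such action: a band projection \<open>\<pi>\<close> must
  send \<open>x\<close> to the unique \<open>y\<close> with \<open>nrm y = \<pi> (nrm x)\<close> and \<open>nrm (x - y) = (1 - \<pi>) (nrm x)\<close>, and
  the norm identity determines the action of all other orthomorphisms.\<close>

definition orth_action ::
  "('k::real_normed_field \<Rightarrow> 'x::ab_group_add \<Rightarrow> 'x) \<Rightarrow>
   ('x \<Rightarrow> 'e::dedekind_complete_vector_lattice) \<Rightarrow> 'x set \<Rightarrow> 'e orth \<Rightarrow> 'x \<Rightarrow> 'x" where
  "orth_action scale nrm Xt = (THE act. is_orth_action scale nrm Xt act)"


section \<open>Uniformly order continuous functions\<close>

definition Cuo ::
  "('x::ab_group_add \<Rightarrow> 'e::dedekind_complete_vector_lattice) \<Rightarrow> 'x set \<Rightarrow>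
   ('s::uniform_space \<Rightarrow> 'x) set" where
  "Cuo nrm X = {f. range f \<subseteq> X \<and> (\<exists>e. \<forall>s. nrm (f s) \<le> e) \<and>
     (INF U\<in>{U. \<forall>\<^sub>F p in uniformity. p \<in> U}. SUP (s, t)\<in>U. nrm (f s - f t)) = 0}"

definition Cuo_norm ::
  "('x \<Rightarrow> 'e::dedekind_complete_vector_lattice) \<Rightarrow> ('s \<Rightarrow> 'x) \<Rightarrow> 'e" where
  "Cuo_norm nrm f = (SUP s. nrm (f s))"

abbreviation Cuo_orth ::
  "('s::uniform_space \<Rightarrow> 'e::dedekind_complete_vector_lattice orth) set" where
  "Cuo_orth \<equiv> Cuo abs UNIV"

text \<open>Operators on \<open>Cuo_orth\<close> are extensional functions, so that they are equal
  iff they agree on \<open>Cuo_orth\<close>.\<close>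

definition subdiff_sup ::
  "(('s::uniform_space \<Rightarrow> 'e::dedekind_complete_vector_lattice orth) \<Rightarrow> 'e orth) set" where
  "subdiff_sup = {T \<in> extensional Cuo_orth.
     (\<forall>\<phi>\<in>Cuo_orth. \<forall>\<psi>\<in>Cuo_orth. T (\<lambda>s. \<phi> s + \<psi> s) = T \<phi> + T \<psi>) \<and>
     (\<forall>r. \<forall>\<phi>\<in>Cuo_orth. T (\<lambda>s. r *\<^sub>R \<phi> s) = r *\<^sub>R T \<phi>) \<and>
     (\<forall>\<phi>\<in>Cuo_orth. T \<phi> \<le> (SUP s. \<phi> s))}"

definition Sigma_extreme ::
  "(('s::uniform_space \<Rightarrow> 'e::dedekind_complete_vector_lattice orth) \<Rightarrow> 'e orth) set" where
  "Sigma_extreme = {\<sigma> \<in> subdiff_sup. \<forall>T1\<in>subdiff_sup. \<forall>T2\<in>subdiff_sup. \<forall>u::real.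
     0 < u \<and> u < 1 \<and> (\<forall>\<phi>\<in>Cuo_orth. \<sigma> \<phi> = (1 - u) *\<^sub>R T1 \<phi> + u *\<^sub>R T2 \<phi>) \<longrightarrow> T1 = T2}"

definition pure_state ::
  "('s::uniform_space \<Rightarrow> 'e::dedekind_complete_vector_lattice orth) \<Rightarrow>
   ('s \<Rightarrow> 'e orth) \<Rightarrow> 'e orth" where
  "pure_state \<pi> = (\<lambda>\<phi>\<in>Cuo_orth. THE l. order_sums (\<lambda>s. \<pi> s * \<phi> s) l)"

definition pure_value ::
  "('k::real_normed_field \<Rightarrow> 'x::ab_group_add \<Rightarrow> 'x) \<Rightarrow>
   ('x \<Rightarrow> 'e::dedekind_complete_vector_lattice) \<Rightarrow> 'x set \<Rightarrow>
   ('s::uniform_space \<Rightarrow> 'x) \<Rightarrow> ('s \<Rightarrow> 'e orth) \<Rightarrow> 'x" where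
  "pure_value scale nrm Xt f \<pi> = (THE y. y \<in> Xt \<and>
     (\<forall>s. orth_action scale nrm Xt (\<pi> s) y = orth_action scale nrm Xt (\<pi> s) (f s)))"

text \<open>The value \<open>f(\<sigma>)\<close>. A net of pure states is given by a filter on partitions of unity; if
  \<open>\<sigma>\<close> itself is the pure state of \<open>\<pi>\<close>, the constant net \<open>\<pi>\<close> gives
  \<open>f(\<sigma>) = pure_value scale nrm Xt f \<pi>\<close>.\<close>

definition value_at ::
  "('k::real_normed_field \<Rightarrow> 'x::ab_group_add \<Rightarrow> 'x) \<Rightarrow>
   ('x \<Rightarrow> 'e::dedekind_complete_vector_lattice) \<Rightarrow> 'x set \<Rightarrow>
   ('s::uniform_space \<Rightarrow> 'x) \<Rightarrow> (('s \<Rightarrow> 'e orth) \<Rightarrow> 'e orth) \<Rightarrow> 'x" where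
  "value_at scale nrm Xt f \<sigma> = (THE y. y \<in> Xt \<and>
     (\<forall>F. F \<noteq> bot \<and> (\<forall>\<^sub>F \<pi> in F. partition_of_unity \<pi>) \<and>
        (\<forall>\<phi>\<in>Cuo_orth. relatively_uniform_tendsto (\<lambda>\<pi>. pure_state \<pi> \<phi>) (\<sigma> \<phi>) F) \<longrightarrow>
      order_tendsto (\<lambda>\<pi>. nrm (y - pure_value scale nrm Xt f \<pi>)) 0 F))"


section \<open>Multipliers and separation\<close>

definition multipliers ::
  "('k::real_normed_field \<Rightarrow> 'x::ab_group_add \<Rightarrow> 'x) \<Rightarrow>
   ('x \<Rightarrow> 'e::dedekind_complete_vector_lattice) \<Rightarrow> 'x set \<Rightarrow>
   ('s::uniform_space \<Rightarrow> 'x) set \<Rightarrow> ('s \<Rightarrow> 'e orth) set" where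
  "multipliers scale nrm Xt W = {\<phi> \<in> Cuo_orth. (\<forall>s. 0 \<le> \<phi> s \<and> \<phi> s \<le> 1) \<and>
     (\<forall>f\<in>W. \<forall>g\<in>W.
        (\<lambda>s. orth_action scale nrm Xt (\<phi> s) (f s) + orth_action scale nrm Xt (1 - \<phi> s) (g s)) \<in> W)}"

definition separates_Sigma ::
  "('s::uniform_space \<Rightarrow> 'e::dedekind_complete_vector_lattice orth) set \<Rightarrow> bool" where
  "separates_Sigma M \<longleftrightarrow> (\<forall>\<sigma>\<in>Sigma_extreme. \<forall>\<tau>\<in>Sigma_extreme. \<forall>b\<in>band_projections.
     (\<forall>\<phi>\<in>M. b * \<sigma> \<phi> = b * \<tau> \<phi>) \<longrightarrow> (\<forall>\<phi>\<in>Cuo_orth. b * \<sigma> \<phi> = b * \<tau> \<phi>))"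

end

(* A closed subset of Sigma is encoded by the functional p on C_uo(S, Lambda) sending phi to the supremum
   of phi over that subset. Let d = inf ||f - g||. By Zorn's lemma there is a minimal such p with
   p(min(||f - g|| / d, 1)) >= 1 for all g in W. If some multiplier phi were not constant on the set
   described by p, then cutting at two levels r < t would give g1 and g2 in W closer to f than d, on a
   nonzero band, where phi <= t and where phi >= r, respectively. Since psi = (1 - phi^n)^m is again a
   multiplier, psi g1 + (1 - psi) g2 lies in W and, for suitable n and m, violates the constraint. So all
   lattice homomorphisms below p agree on the multipliers; by separation they coincide, so p is itself
   a point sigma of Sigma, and ||f(sigma) - g(sigma)|| >= d for all g in W.

   The action of orthomorphisms on a Banach--Kantorovich space is obtained by approximating an
   orthomorphism by real numbers on nonzero bands and gluing along partitions of unity. *)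

theory Submission
  imports Defs
begin

section \<open>Order convergence\<close>

text \<open>The order of \<open>'e orth\<close> is not total, and an orthomorphism need not be
  bounded by a multiple of \<open>1\<close>. Both defects disappear below a suitable nonzero band
  projection, so case distinctions and choices of real constants are made there;
  \<open>local_le\<close> or a partition of unity carries the result back. Norms lie in E while sup
  functionals act on \<Lambda>-valued functions; this is why distances are divided by d. Truncation
  at 1 keeps the quotient bounded, and the value 1 where d vanishes makes the constraint hold there
  automatically. Points of \<Sigma> have to be produced, not found: infima of chains of sup
  functionals are again sup functionals, which yields minimal ones without a topology on \<Sigma>. W
  need not be convex; only multipliers combine its elements. Two levels r < t are used because
  \<psi> is uncontrolled between them, and there both competitors are good. Outside, the wrong
  competitor is locally at distance at most k d, so a weight of \<delta> / (4 k) is harmless.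
  Compactness of S enters through finite nets, which make the values at pure states Cauchy.\<close>

lemma archimedean_eps:
  fixes q c :: "'e::dedekind_complete_vector_lattice"
  assumes "\<And>\<epsilon>::real. \<epsilon> > 0 \<Longrightarrow> q \<le> \<epsilon> *\<^sub>R c"
  shows "q \<le> 0"
  by (rule archimedean[of q c]) (use assms in simp)

text \<open>Order convergence to 0 without a chosen dominating family: the set of all nonnegative
  eventual upper bounds is nonempty, and each of its lower bounds is \<le> 0. Only upper estimates
  of \<open>r\<close> occur, so smaller nets inherit the property at once.\<close>

definition order_null ::
  "('i \<Rightarrow> 'e::dedekind_complete_vector_lattice) \<Rightarrow> 'i filter \<Rightarrow> bool" where
  "order_null r F \<longleftrightarrow> (\<exists>d\<ge>0. \<forall>\<^sub>F i in F. r i \<le> d) \<and>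
     (\<forall>L. (\<forall>d\<ge>0. (\<forall>\<^sub>F i in F. r i \<le> d) \<longrightarrow> L \<le> d) \<longrightarrow> L \<le> 0)"

lemma order_nullI:
  assumes "0 \<le> d" "\<forall>\<^sub>F i in F. r i \<le> d"
    and "\<And>L. (\<And>d. 0 \<le> d \<Longrightarrow> \<forall>\<^sub>F i in F. r i \<le> d \<Longrightarrow> L \<le> d) \<Longrightarrow> L \<le> 0"
  shows "order_null r F"
  using assms unfolding order_null_def by blast

lemma order_null_bound:
  assumes "order_null r F" obtains d where "0 \<le> d" "\<forall>\<^sub>F i in F. r i \<le> d"
  using assms unfolding order_null_def by blast

lemma order_nullD:
  assumes "order_null r F" "\<And>d. 0 \<le> d \<Longrightarrow> \<forall>\<^sub>F i in F. r i \<le> d \<Longrightarrow> L \<le> d"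
  shows "L \<le> 0"
  using assms unfolding order_null_def by blast

text \<open>The set of all nonnegative eventual bounds is the largest dominating family; it is
  directed downwards because \<open>inf c d\<close> is again an eventual bound.\<close>

lemma order_tendsto_iff: "order_tendsto x l F \<longleftrightarrow> order_null (\<lambda>i. \<bar>x i - l\<bar>) F"
proof
  assume "order_tendsto x l F"
  then obtain D where D: "D \<noteq> {}" "\<forall>d\<in>D. 0 \<le> d" "Inf D = 0" "\<forall>d\<in>D. \<forall>\<^sub>F i in F. \<bar>x i - l\<bar> \<le> d"
    unfolding order_tendsto_def by blast
  then obtain d where d: "d \<in> D" by blast
  show "order_null (\<lambda>i. \<bar>x i - l\<bar>) F"
  proof (rule order_nullI[of d])
    fix L assume L: "\<And>d. 0 \<le> d \<Longrightarrow> \<forall>\<^sub>F i in F. \<bar>x i - l\<bar> \<le> d \<Longrightarrow> L \<le> d"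
    have "L \<le> Inf D" by (rule cInf_greatest[OF D(1)]) (use L D in blast)
    then show "L \<le> 0" using D by simp
  qed (use D d in auto)
next
  assume n: "order_null (\<lambda>i. \<bar>x i - l\<bar>) F"
  define D where "D = {d. 0 \<le> d \<and> (\<forall>\<^sub>F i in F. \<bar>x i - l\<bar> \<le> d)}"
  have ne: "D \<noteq> {}" using order_null_bound[OF n] unfolding D_def by blast
  have bd: "bdd_below D" unfolding D_def by (rule bdd_belowI[of _ 0]) auto
  have "Inf D \<le> 0"
    by (rule order_nullD[OF n], rule cInf_lower[OF _ bd]) (auto simp: D_def)
  moreover have "0 \<le> Inf D" by (rule cInf_greatest[OF ne]) (auto simp: D_def)
  moreover have "\<exists>e\<in>D. e \<le> c \<and> e \<le> d" if "c \<in> D" "d \<in> D" for c d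
    using that by (intro bexI[of _ "inf c d"]) (auto simp: D_def eventually_conj_iff)
  ultimately show "order_tendsto x l F"
    unfolding order_tendsto_def using ne by (intro exI[of _ D]) (auto simp: D_def)
qed

lemma order_null_mono:
  assumes "order_null r F" "\<forall>\<^sub>F i in F. r' i \<le> r i"
  shows "order_null r' F"
proof -
  have *: "\<forall>\<^sub>F i in F. r' i \<le> d" if "\<forall>\<^sub>F i in F. r i \<le> d" for d
    using that assms(2) by eventually_elim (rule order_trans)
  obtain d where "0 \<le> d" "\<forall>\<^sub>F i in F. r i \<le> d" using order_null_bound[OF assms(1)] .
  then show ?thesis
    by (intro order_nullI[of d]) (auto intro: * order_nullD[OF assms(1)])
qed

text \<open>If \<open>L\<close> lies below all bounds of the sum, then for each bound
  \<open>d\<close> of \<open>r\<close> the element \<open>L - d\<close> lies below all bounds of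
  \<open>r'\<close> and is \<le> 0. Hence \<open>L\<close> lies below all bounds of
  \<open>r\<close>.\<close>

lemma order_null_add:
  assumes 1: "order_null r F" and 2: "order_null r' F"
  shows "order_null (\<lambda>i. r i + r' i) F"
proof -
  have *: "\<forall>\<^sub>F i in F. r i + r' i \<le> d + d'"
    if "\<forall>\<^sub>F i in F. r i \<le> d" "\<forall>\<^sub>F i in F. r' i \<le> d'" for d d'
    using that by eventually_elim (rule add_mono)
  obtain d d' where dd: "0 \<le> d" "\<forall>\<^sub>F i in F. r i \<le> d" "0 \<le> d'" "\<forall>\<^sub>F i in F. r' i \<le> d'"
    using order_null_bound[OF 1] order_null_bound[OF 2] by metis
  show ?thesis
  proof (rule order_nullI[of "d + d'"])
    fix L assume L: "\<And>d. 0 \<le> d \<Longrightarrow> \<forall>\<^sub>F i in F. r i + r' i \<le> d \<Longrightarrow> L \<le> d"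
    show "L \<le> 0"
    proof (rule order_nullD[OF 1])
      fix d assume d: "0 \<le> d" "\<forall>\<^sub>F i in F. r i \<le> d"
      have "L - d \<le> 0"
      proof (rule order_nullD[OF 2])
        fix d' assume d': "0 \<le> d'" "\<forall>\<^sub>F i in F. r' i \<le> d'"
        have "L \<le> d + d'" by (rule L) (use d d' * in auto)
        then show "L - d \<le> d'" by (simp add: diff_le_eq add.commute)
      qed
      then show "L \<le> d" by simp
    qed
  qed (use dd * in auto)
qed

lemma order_null_scaleR:
  assumes r: "order_null r F" and c: "(c::real) > 0"
  shows "order_null (\<lambda>i. c *\<^sub>R r i) F"
proof -
  have *: "\<forall>\<^sub>F i in F. c *\<^sub>R r i \<le> c *\<^sub>R d" if "\<forall>\<^sub>F i in F. r i \<le> d" for d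
    using that by eventually_elim (use c in \<open>simp add: scaleR_left_mono\<close>)
  obtain d where d: "0 \<le> d" "\<forall>\<^sub>F i in F. r i \<le> d" using order_null_bound[OF r] .
  show ?thesis
  proof (rule order_nullI[of "c *\<^sub>R d"])
    fix L assume L: "\<And>d. 0 \<le> d \<Longrightarrow> \<forall>\<^sub>F i in F. c *\<^sub>R r i \<le> d \<Longrightarrow> L \<le> d"
    have "(1 / c) *\<^sub>R L \<le> 0"
    proof (rule order_nullD[OF r])
      fix d assume "0 \<le> d" "\<forall>\<^sub>F i in F. r i \<le> d"
      then have "L \<le> c *\<^sub>R d" using c by (intro L *) (auto simp: scaleR_nonneg_nonneg)
      then have "(1 / c) *\<^sub>R L \<le> (1 / c) *\<^sub>R (c *\<^sub>R d)" using c by (intro scaleR_left_mono) auto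
      then show "(1 / c) *\<^sub>R L \<le> d" using c by simp
    qed
    then have "c *\<^sub>R ((1 / c) *\<^sub>R L) \<le> c *\<^sub>R 0" using c by (intro scaleR_left_mono) auto
    then show "L \<le> 0" using c by simp
  qed (use d c * in \<open>auto simp: scaleR_nonneg_nonneg\<close>)
qed

lemma order_null_const_le:
  assumes "order_null (\<lambda>i. c) F" "F \<noteq> bot" shows "c \<le> 0"
  by (rule order_nullD[OF assms(1)]) (use assms(2) in simp)

lemma order_null_zero: "order_null (\<lambda>i. 0) F"
  by (rule order_nullI[of 0]) auto

text \<open>Relatively uniform convergence with regulator \<open>u\<close> implies order convergence
  because the lattice is Archimedean.\<close>

lemma order_null_uniform:
  assumes "\<And>\<epsilon>::real. \<epsilon> > 0 \<Longrightarrow> \<forall>\<^sub>F i in F. r i \<le> \<epsilon> *\<^sub>R u" "0 \<le> u"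
  shows "order_null r F"
proof (rule order_nullI[of "1 *\<^sub>R u"])
  fix L assume L: "\<And>d. 0 \<le> d \<Longrightarrow> \<forall>\<^sub>F i in F. r i \<le> d \<Longrightarrow> L \<le> d"
  show "L \<le> 0"
    by (rule archimedean_eps[of L u]) (use assms L in \<open>auto simp: scaleR_nonneg_nonneg\<close>)
qed (use assms(1)[of 1] assms(2) in auto)

lemma order_null_filtermap: "order_null r (filtermap g F) \<longleftrightarrow> order_null (\<lambda>i. r (g i)) F"
  unfolding order_null_def by (simp add: eventually_filtermap)

lemma order_null_compose:
  assumes "order_null r G" "filterlim g G F" shows "order_null (\<lambda>i. r (g i)) F"
proof -
  have *: "\<forall>\<^sub>F i in F. r (g i) \<le> d" if "\<forall>\<^sub>F i in G. r i \<le> d" for d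
    using eventually_compose_filterlim[OF that assms(2)] .
  obtain d where "0 \<le> d" "\<forall>\<^sub>F i in G. r i \<le> d" using order_null_bound[OF assms(1)] .
  then show ?thesis
    by (intro order_nullI[of d]) (auto intro: * order_nullD[OF assms(1)])
qed

text \<open>Each entourage yields an eventual bound, namely the supremum of \<open>r\<close> over
  it; conversely, for an eventual bound \<open>d\<close> the set where \<open>r\<close> is \<le>
  \<open>d\<close> is an entourage with supremum at most \<open>d\<close>. The bound
  \<open>e\<close> makes these suprema exist.\<close>

lemma order_null_uniformity_iff:
  fixes r :: "'s::uniform_space \<times> 's \<Rightarrow> 'e::dedekind_complete_vector_lattice"
  assumes r0: "\<And>p. 0 \<le> r p" and re: "\<And>p. r p \<le> e"
  shows "(INF U\<in>{U. \<forall>\<^sub>F p in uniformity. p \<in> U}. SUP p\<in>U. r p) = 0 \<longleftrightarrow> order_null r uniformity"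
proof -
  let ?\<U> = "{U. \<forall>\<^sub>F p in uniformity. p \<in> (U :: ('s \<times> 's) set)}"
  have ne: "U \<noteq> {}" if "U \<in> ?\<U>" for U using that uniformity_refl[of "\<lambda>p. p \<in> U" undefined] by auto
  have bd: "bdd_above (r ` U)" for U by (rule bdd_aboveI[of _ e]) (use re in auto)
  have S0: "0 \<le> (SUP p\<in>U. r p)" if U: "U \<in> ?\<U>" for U
  proof -
    obtain p where "p \<in> U" using ne[OF U] by blast
    then show ?thesis using cSUP_upper[OF _ bd] r0 order_trans by blast
  qed
  have bb: "bdd_below ((\<lambda>U. SUP p\<in>U. r p) ` ?\<U>)" by (rule bdd_belowI[of _ 0]) (use S0 in auto)
  have U1: "UNIV \<in> ?\<U>" by simp
  show ?thesis
  proof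
    assume inf0: "(INF U\<in>?\<U>. SUP p\<in>U. r p) = 0"
    show "order_null r uniformity"
    proof (rule order_nullI[of e])
      show "0 \<le> e" using r0 re order_trans by blast
      fix L assume L: "\<And>d. 0 \<le> d \<Longrightarrow> \<forall>\<^sub>F i in uniformity. r i \<le> d \<Longrightarrow> L \<le> d"
      have "L \<le> (INF U\<in>?\<U>. SUP p\<in>U. r p)"
      proof (rule cINF_greatest)
        fix U assume U: "U \<in> ?\<U>"
        show "L \<le> (SUP p\<in>U. r p)"
        proof (rule L[OF S0[OF U]])
          show "\<forall>\<^sub>F i in uniformity. r i \<le> (SUP p\<in>U. r p)"
            using U by (auto elim: eventually_mono intro: cSUP_upper[OF _ bd])
        qed
      qed (use U1 in blast)
      then show "L \<le> 0" using inf0 by simp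
    qed (use re in simp)
  next
    assume n: "order_null r uniformity"
    have "(INF U\<in>?\<U>. SUP p\<in>U. r p) \<le> 0"
    proof (rule order_nullD[OF n])
      fix d assume d: "0 \<le> d" "\<forall>\<^sub>F i in uniformity. r i \<le> d"
      have m: "{p. r p \<le> d} \<in> ?\<U>" using d by simp
      have "(INF U\<in>?\<U>. SUP p\<in>U. r p) \<le> (SUP p\<in>{p. r p \<le> d}. r p)" by (rule cINF_lower[OF bb m])
      also have "\<dots> \<le> d" by (rule cSUP_least) (use ne[OF m] in auto)
      finally show "(INF U\<in>?\<U>. SUP p\<in>U. r p) \<le> d" .
    qed
    moreover have "0 \<le> (INF U\<in>?\<U>. SUP p\<in>U. r p)"
      by (rule cINF_greatest[OF _ S0]) (use U1 in blast)
    ultimately show "(INF U\<in>?\<U>. SUP p\<in>U. r p) = 0" by (rule order.antisym)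
  qed
qed

section \<open>The ring of orthomorphisms\<close>

notation orth_apply (infixr "\<bullet>" 75)

lemma orth_linear: "linear (orth_apply T)"
  by (rule orthomorphism_linear[OF orthomorphism_orth_apply])

lemma orth_apply_simps [simp]:
  "T \<bullet> 0 = 0" "T \<bullet> (x + y) = T \<bullet> x + T \<bullet> y" "T \<bullet> (x - y) = T \<bullet> x - T \<bullet> y" "T \<bullet> (- x) = - (T \<bullet> x)"
  "T \<bullet> (r *\<^sub>R x) = r *\<^sub>R (T \<bullet> x)"
  "0 \<bullet> x = 0" "1 \<bullet> x = x" "(S + T) \<bullet> x = S \<bullet> x + T \<bullet> x" "(S - T) \<bullet> x = S \<bullet> x - T \<bullet> x"
  "(- T) \<bullet> x = - (T \<bullet> x)" "(S * T) \<bullet> x = S \<bullet> T \<bullet> x" "(r *\<^sub>R T) \<bullet> x = r *\<^sub>R (T \<bullet> x)"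
  using orth_linear[of T]
  by (simp_all add: linear_0 linear_add linear_diff linear_neg linear_scale zero_orth.rep_eq one_orth.rep_eq
      plus_orth.rep_eq minus_orth.rep_eq uminus_orth.rep_eq times_orth.rep_eq scaleR_orth.rep_eq)

lemma orth_leI: "(\<And>x. 0 \<le> x \<Longrightarrow> S \<bullet> x \<le> T \<bullet> x) \<Longrightarrow> S \<le> T"
  by (simp add: less_eq_orth.rep_eq)

lemma orth_leD: "S \<le> T \<Longrightarrow> 0 \<le> x \<Longrightarrow> S \<bullet> x \<le> T \<bullet> x"
  by (simp add: less_eq_orth.rep_eq)

lemma orth_eqI:
  assumes "\<And>x. 0 \<le> x \<Longrightarrow> S \<bullet> x = T \<bullet> x" shows "S = T"
  by (rule order.antisym; rule orth_leI) (simp_all add: assms)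

lemma orth_pos: "0 \<le> T \<Longrightarrow> 0 \<le> x \<Longrightarrow> 0 \<le> T \<bullet> x"
  using orth_leD[of 0 T x] by simp

lemma orth_mono: "0 \<le> T \<Longrightarrow> x \<le> y \<Longrightarrow> T \<bullet> x \<le> T \<bullet> y"
  using orth_pos[of T "y - x"] by simp

lemma orth_sup_apply: "0 \<le> x \<Longrightarrow> sup S T \<bullet> x = sup (S \<bullet> x) (T \<bullet> x)"
  unfolding sup_orth_def by (subst orth_apply_Sup) (auto simp: cSup_insert)

lemma orth_abs_apply: "0 \<le> x \<Longrightarrow> \<bar>T\<bar> \<bullet> x = \<bar>T \<bullet> x\<bar>"
  by (simp add: abs_lattice orth_sup_apply)

lemma orth_pprt_apply: "0 \<le> x \<Longrightarrow> pprt T \<bullet> x = pprt (T \<bullet> x)"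
  by (simp add: pprt_def orth_sup_apply)

lemma orth_inf_apply: "0 \<le> x \<Longrightarrow> inf S T \<bullet> x = inf (S \<bullet> x) (T \<bullet> x)"
  by (simp add: inf_eq_neg_sup orth_sup_apply)

lemma orth_abs_apply_le: "\<bar>T \<bullet> x\<bar> \<le> \<bar>T\<bar> \<bullet> \<bar>x\<bar>"
proof (rule abs_leI)
  have "T \<bullet> x = T \<bullet> pprt x + - T \<bullet> - nprt x" by (subst (1) prts) simp
  also have "\<dots> \<le> \<bar>T\<bar> \<bullet> pprt x + \<bar>T\<bar> \<bullet> - nprt x"
    by (intro add_mono orth_leD) (auto simp: abs_lattice)
  also have "\<dots> = \<bar>T\<bar> \<bullet> \<bar>x\<bar>" by (simp add: abs_prts)
  finally show "T \<bullet> x \<le> \<bar>T\<bar> \<bullet> \<bar>x\<bar>" .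
  have "- (T \<bullet> x) = - T \<bullet> pprt x + T \<bullet> - nprt x" by (subst (1) prts) simp
  also have "\<dots> \<le> \<bar>T\<bar> \<bullet> pprt x + \<bar>T\<bar> \<bullet> - nprt x"
    by (intro add_mono orth_leD) (auto simp: abs_lattice)
  also have "\<dots> = \<bar>T\<bar> \<bullet> \<bar>x\<bar>" by (simp add: abs_prts)
  finally show "- (T \<bullet> x) \<le> \<bar>T\<bar> \<bullet> \<bar>x\<bar>" .
qed

instance orth :: (dedekind_complete_vector_lattice) lattice_ring
proof
  fix a b c :: "'a orth"
  assume ab: "a \<le> b" "0 \<le> c"
  show "c * a \<le> c * b" by (rule orth_leI) (use ab in \<open>simp add: orth_mono orth_leD\<close>)
  show "a * c \<le> b * c" by (rule orth_leI) (use ab in \<open>simp add: orth_pos orth_leD\<close>)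
qed

instance orth :: (dedekind_complete_vector_lattice) real_algebra
  by standard (auto intro: orth_eqI)

lemma orth_one_nonneg [simp]: "(0 :: 'e::dedekind_complete_vector_lattice orth) \<le> 1"
  by (rule orth_leI) simp

section \<open>Band projections\<close>

lemma subspace_disjoint_complement: "subspace (disjoint_complement A)"
proof -
  have "disjoint_complement A = (\<Inter>a\<in>A. {x. inf \<bar>x\<bar> \<bar>a\<bar> = 0})"
    by (auto simp: disjoint_complement_def)
  moreover have "subspace \<dots>"
    by (rule subspace_Inter) (use band_subspace[OF band_disjoint_complement] in blast)
  ultimately show ?thesis by simp
qed

lemma band_inter_disjoint_complement: "y \<in> B \<Longrightarrow> y \<in> disjoint_complement B \<Longrightarrow> y = 0"
  by (force simp: disjoint_complement_def)

text \<open>\<open>z\<close> is the supremum of the elements of the band between 0 and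
  \<open>x\<close>. If \<open>w = inf (x - z) \<bar>b\<bar>\<close> were not 0 for some
  \<open>b\<close> in the band, \<open>z + w\<close> would be a larger such element.\<close>

lemma band_decomposition_pos:
  assumes B: "band B" and x: "0 \<le> x"
  obtains z where "0 \<le> z" "z \<le> x" "z \<in> B" "x - z \<in> disjoint_complement B"
proof -
  define A where "A = {z. 0 \<le> z \<and> z \<le> x \<and> z \<in> B}"
  have A0: "0 \<in> A" using x band_subspace[OF B] by (simp add: A_def subspace_0)
  have bd: "bdd_above A" by (rule bdd_aboveI[of _ x]) (simp add: A_def)
  define z where "z = Sup A"
  have up: "w \<le> z" if "w \<in> A" for w unfolding z_def by (rule cSup_upper[OF that bd])
  have zB: "z \<in> B" unfolding z_def by (rule band_Sup[OF B _ _ bd]) (use A0 in \<open>auto simp: A_def\<close>)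
  have zx: "z \<le> x" unfolding z_def by (rule cSup_least) (use A0 in \<open>auto simp: A_def\<close>)
  have z0: "0 \<le> z" using up[OF A0] .
  have "inf \<bar>x - z\<bar> \<bar>b\<bar> = 0" if b: "b \<in> B" for b
  proof -
    define w where "w = inf (x - z) \<bar>b\<bar>"
    have w0: "0 \<le> w" using zx by (simp add: w_def)
    have "w \<in> B" by (rule band_solid[OF B b]) (use w0 in \<open>simp add: w_def\<close>)
    then have "z + w \<in> B" using zB band_subspace[OF B] by (simp add: subspace_add)
    moreover have "w \<le> x - z" by (simp add: w_def)
    then have "z + w \<le> x" by (simp add: le_diff_eq add.commute)
    ultimately have "z + w \<in> A" using z0 w0 by (simp add: A_def)
    from up[OF this] have "w = 0" using w0 by simp
    then show ?thesis using zx by (simp add: w_def)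
  qed
  then have "x - z \<in> disjoint_complement B" by (simp add: disjoint_complement_def)
  then show ?thesis using that z0 zx zB by blast
qed

lemma band_decomposition_unique:
  assumes B: "band B"
    and "z \<in> B" "x - z \<in> disjoint_complement B" "z' \<in> B" "x - z' \<in> disjoint_complement B"
  shows "z = z'"
proof -
  have "z - z' \<in> B" using assms band_subspace[OF B] by (simp add: subspace_diff)
  moreover have "(x - z') - (x - z) \<in> disjoint_complement B"
    using assms subspace_disjoint_complement subspace_diff by blast
  ultimately show ?thesis using band_inter_disjoint_complement[of "z - z'" B] by simp
qed

text \<open>Riesz's projection theorem. Uniqueness of the decomposition gives linearity, and \<bar>p
  x\<bar> \<le> \<bar>x\<bar> makes \<open>p\<close> order bounded and band preserving.\<close>

lemma band_projection_ex:
  assumes B: "band B"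
  obtains \<pi> where "\<pi> \<in> band_projections"
    "\<And>x. \<pi> \<bullet> x \<in> B" "\<And>x. x - \<pi> \<bullet> x \<in> disjoint_complement B"
proof -
  let ?C = "disjoint_complement B"
  note sB = band_subspace[OF B] and sC = subspace_disjoint_complement[of B]
  define p where "p x = (THE z. z \<in> B \<and> x - z \<in> ?C)" for x
  have pI: "p x = z" if "z \<in> B" "x - z \<in> ?C" for x z
    unfolding p_def using that band_decomposition_unique[OF B] by blast
  have p: "p x \<in> B \<and> x - p x \<in> ?C" for x
  proof -
    obtain z1 where z1: "z1 \<in> B" "pprt x - z1 \<in> ?C"
      using band_decomposition_pos[OF B zero_le_pprt] by metis
    obtain z2 where z2: "z2 \<in> B" "pprt (- x) - z2 \<in> ?C"
      using band_decomposition_pos[OF B zero_le_pprt] by metis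
    have "x - (z1 - z2) = (pprt x - pprt (- x)) - (z1 - z2)" by (simp only: pprt_diff)
    also have "\<dots> = (pprt x - z1) - (pprt (- x) - z2)" by simp
    finally have "x - (z1 - z2) \<in> ?C" using subspace_diff[OF sC z1(2) z2(2)] by (simp only:)
    moreover have "z1 - z2 \<in> B" using subspace_diff[OF sB z1(1) z2(1)] .
    ultimately show ?thesis using pI[of "z1 - z2" x] by simp
  qed
  have lin: "linear p"
  proof (rule linearI)
    show "p (x + y) = p x + p y" for x y
      by (rule pI) (use p[of x] p[of y] subspace_add[OF sB] subspace_add[OF sC, of "x - p x" "y - p y"]
          in \<open>auto simp: algebra_simps\<close>)
    show "p (r *\<^sub>R x) = r *\<^sub>R p x" for r x
      by (rule pI) (use p[of x] subspace_scale[OF sB] subspace_scale[OF sC, of "x - p x"]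
          in \<open>auto simp: algebra_simps\<close>)
  qed
  have pos: "0 \<le> p x \<and> p x \<le> x" if x: "0 \<le> x" for x
  proof -
    obtain z where z: "0 \<le> z" "z \<le> x" "z \<in> B" "x - z \<in> ?C"
      by (rule band_decomposition_pos[OF B x])
    then show ?thesis using pI[of z x] by simp
  qed
  have pabs: "\<bar>p x\<bar> \<le> \<bar>x\<bar>" for x
  proof -
    have "p x = p (pprt x - - nprt x)" by (subst (1) prts) simp
    also have "\<dots> = p (pprt x) - p (- nprt x)" by (rule linear_diff[OF lin])
    finally have "\<bar>p x\<bar> \<le> \<bar>p (pprt x)\<bar> + \<bar>p (- nprt x)\<bar>" by (simp add: abs_triangle_ineq4)
    also have "\<dots> \<le> pprt x + - nprt x" by (intro add_mono) (use pos in auto)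
    finally show ?thesis by (simp add: abs_prts)
  qed
  have orth: "orthomorphism p"
  proof (rule orthomorphismI[OF lin])
    fix a b
    have "- (\<bar>a\<bar> + \<bar>b\<bar>) \<le> p x \<and> p x \<le> \<bar>a\<bar> + \<bar>b\<bar>" if x: "a \<le> x" "x \<le> b" for x
    proof -
      have "\<bar>x\<bar> \<le> \<bar>a\<bar> + \<bar>b\<bar>"
      proof (rule abs_leI)
        have "x \<le> \<bar>b\<bar>" using x(2) abs_ge_self order_trans by blast
        then show "x \<le> \<bar>a\<bar> + \<bar>b\<bar>" by (simp add: add_increasing)
        have "- x \<le> \<bar>a\<bar>" using x(1) abs_ge_minus_self[of a] by (meson neg_le_iff_le order_trans)
        then show "- x \<le> \<bar>a\<bar> + \<bar>b\<bar>" by (simp add: add_increasing2)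
      qed
      with pabs[of x] have "\<bar>p x\<bar> \<le> \<bar>a\<bar> + \<bar>b\<bar>" by (rule order_trans)
      then show ?thesis using abs_le_D1 abs_le_D2 minus_le_iff by blast
    qed
    then show "\<exists>c d. \<forall>x. a \<le> x \<and> x \<le> b \<longrightarrow> c \<le> p x \<and> p x \<le> d" by blast
  qed (use band_solid pabs in blast)
  have "Orth p \<bullet> x = p x" for x by (simp add: Orth_inverse orth)
  then show ?thesis using that[of "Orth p"] p B unfolding band_projections_def by auto
qed

text \<open>Turns the definition by bands into ring relations. For the converse the band is
  recovered as the set of fixed points of \<pi>.\<close>

lemma band_projections_iff: "\<pi> \<in> band_projections \<longleftrightarrow> 0 \<le> \<pi> \<and> \<pi> \<le> 1 \<and> \<pi> * \<pi> = \<pi>"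
proof
  assume "\<pi> \<in> band_projections"
  then obtain B where B: "band B"
    and p: "\<And>x. \<pi> \<bullet> x \<in> B" "\<And>x. x - \<pi> \<bullet> x \<in> disjoint_complement B"
    unfolding band_projections_def by blast
  have "0 \<le> \<pi> \<bullet> x \<and> \<pi> \<bullet> x \<le> x" if x: "0 \<le> x" for x
  proof -
    obtain z where "0 \<le> z" "z \<le> x" "z \<in> B" "x - z \<in> disjoint_complement B"
      by (rule band_decomposition_pos[OF B x])
    then show ?thesis using band_decomposition_unique[OF B p[of x]] by simp
  qed
  moreover have "\<pi> \<bullet> \<pi> \<bullet> x = \<pi> \<bullet> x" for x
    by (rule band_decomposition_unique[OF B p])
      (use p subspace_0[OF subspace_disjoint_complement] in auto)
  ultimately show "0 \<le> \<pi> \<and> \<pi> \<le> 1 \<and> \<pi> * \<pi> = \<pi>"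
    by (auto intro: orth_leI orth_eqI)
next
  assume p: "0 \<le> \<pi> \<and> \<pi> \<le> 1 \<and> \<pi> * \<pi> = \<pi>"
  then have p0: "0 \<le> \<pi>" and p1: "0 \<le> 1 - \<pi>" and pp: "\<And>x. \<pi> \<bullet> \<pi> \<bullet> x = \<pi> \<bullet> x"
    by (auto simp flip: orth_apply_simps(11))
  define B where "B = {x. \<pi> \<bullet> x = x}"
  have absB: "\<pi> \<bullet> \<bar>b\<bar> = \<bar>b\<bar>" if b: "b \<in> B" for b
  proof (rule order.antisym)
    show "\<pi> \<bullet> \<bar>b\<bar> \<le> \<bar>b\<bar>" using orth_pos[OF p1 abs_ge_zero, of b] by simp
    show "\<bar>b\<bar> \<le> \<pi> \<bullet> \<bar>b\<bar>"
      using orth_abs_apply_le[of \<pi> b] b p0 by (simp add: B_def)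
  qed
  have "band B" unfolding band_def
  proof (intro conjI ballI allI impI)
    show "subspace B" by (auto simp: B_def subspace_def)
  next
    fix x y assume x: "x \<in> B" and y: "\<bar>y\<bar> \<le> \<bar>x\<bar>"
    have "(1 - \<pi>) \<bullet> \<bar>y\<bar> \<le> (1 - \<pi>) \<bullet> \<bar>x\<bar>" by (rule orth_mono[OF p1 y])
    then have "(1 - \<pi>) \<bullet> \<bar>y\<bar> \<le> 0" using absB[OF x] by simp
    moreover have "\<bar>(1 - \<pi>) \<bullet> y\<bar> \<le> (1 - \<pi>) \<bullet> \<bar>y\<bar>" using orth_abs_apply_le[of "1 - \<pi>" y] p1 by simp
    ultimately have "\<bar>(1 - \<pi>) \<bullet> y\<bar> \<le> 0" by (rule order_trans[rotated])
    then show "y \<in> B" by (simp add: B_def)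
  next
    fix A assume A: "A \<noteq> {} \<and> A \<subseteq> B \<and> bdd_above A"
    have up: "a \<le> Sup A" if "a \<in> A" for a using A that by (intro cSup_upper) auto
    have "Sup A \<le> \<pi> \<bullet> Sup A"
    proof (rule cSup_least)
      fix a assume a: "a \<in> A"
      then have "a = \<pi> \<bullet> a" using A by (auto simp: B_def)
      also have "\<dots> \<le> \<pi> \<bullet> Sup A" by (rule orth_mono[OF p0 up[OF a]])
      finally show "a \<le> \<pi> \<bullet> Sup A" .
    qed (use A in blast)
    moreover obtain a where a: "a \<in> A" using A by blast
    then have "(1 - \<pi>) \<bullet> a = 0" using A by (auto simp: B_def)
    with orth_mono[OF p1 up[OF a]] have "\<pi> \<bullet> Sup A \<le> Sup A" by simp
    ultimately show "Sup A \<in> B" by (simp add: B_def)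
  qed
  moreover have "x - \<pi> \<bullet> x \<in> disjoint_complement B" for x
    unfolding disjoint_complement_def
  proof (intro CollectI ballI order.antisym)
    fix b assume b: "b \<in> B"
    \<comment> \<open>Both components of \<open>z\<close> are \<le> 0: \<open>1 - \<pi>\<close>
      kills \<open>\<bar>b\<bar>\<close>, and \<open>\<pi>\<close> kills
      \<open>(1 - \<pi>) \<bullet> \<bar>x\<bar>\<close>.\<close>
    define z where "z = inf \<bar>x - \<pi> \<bullet> x\<bar> \<bar>b\<bar>"
    have "(1 - \<pi>) \<bullet> z \<le> (1 - \<pi>) \<bullet> \<bar>b\<bar>" by (rule orth_mono[OF p1]) (simp add: z_def)
    then have "(1 - \<pi>) \<bullet> z \<le> 0" using absB[OF b] by simp
    moreover have "\<pi> \<bullet> z \<le> \<pi> \<bullet> (1 - \<pi>) \<bullet> \<bar>x\<bar>"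
    proof (rule orth_mono[OF p0])
      show "z \<le> (1 - \<pi>) \<bullet> \<bar>x\<bar>"
        using orth_abs_apply_le[of "1 - \<pi>" x] p1 unfolding z_def
        by (simp add: le_infI1)
    qed
    then have "\<pi> \<bullet> z \<le> 0" by (simp add: pp)
    ultimately have "(1 - \<pi>) \<bullet> z + \<pi> \<bullet> z \<le> 0" by (rule add_nonpos_nonpos)
    then show "inf \<bar>x - \<pi> \<bullet> x\<bar> \<bar>b\<bar> \<le> 0" by (simp add: z_def)
  qed simp
  ultimately show "\<pi> \<in> band_projections"
    unfolding band_projections_def using pp by (auto simp: B_def)
qed

lemma bp_nonneg: "\<pi> \<in> band_projections \<Longrightarrow> 0 \<le> \<pi>"
  and bp_le_one: "\<pi> \<in> band_projections \<Longrightarrow> \<pi> \<le> 1"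
  and bp_idem: "\<pi> \<in> band_projections \<Longrightarrow> \<pi> * \<pi> = \<pi>"
  by (simp_all add: band_projections_iff)

lemma bp_idem_apply: "\<pi> \<in> band_projections \<Longrightarrow> \<pi> \<bullet> \<pi> \<bullet> x = \<pi> \<bullet> x"
  using arg_cong[OF bp_idem[of \<pi>], of "\<lambda>R. R \<bullet> x"] by simp

lemma bp_zero [simp]: "0 \<in> band_projections"
  and bp_one [simp]: "1 \<in> band_projections"
  by (simp_all add: band_projections_iff)

lemma bp_compl: "\<pi> \<in> band_projections \<Longrightarrow> 1 - \<pi> \<in> band_projections"
  by (simp add: band_projections_iff algebra_simps)

lemma bp_pos: "\<pi> \<in> band_projections \<Longrightarrow> 0 \<le> x \<Longrightarrow> 0 \<le> \<pi> \<bullet> x"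
  by (rule orth_pos[OF bp_nonneg])

lemma bp_mono: "\<pi> \<in> band_projections \<Longrightarrow> x \<le> y \<Longrightarrow> \<pi> \<bullet> x \<le> \<pi> \<bullet> y"
  by (rule orth_mono[OF bp_nonneg])

lemma bp_apply_le: "\<pi> \<in> band_projections \<Longrightarrow> 0 \<le> x \<Longrightarrow> \<pi> \<bullet> x \<le> x"
  using orth_leD[OF bp_le_one, of \<pi> x] by simp

text \<open>An orthomorphism maps the band of \<rho> into itself, so \<rho> T \<rho> = T \<rho>.
  Applied to \<pi> and to 1 - \<pi> this gives T \<pi> = \<pi> T \<pi> = \<pi> T.\<close>

lemma bp_commute:
  assumes p: "\<pi> \<in> band_projections" shows "T * \<pi> = \<pi> * T"
proof (rule orth_eqI)
  have inv: "\<rho> \<bullet> T \<bullet> \<rho> \<bullet> x = T \<bullet> \<rho> \<bullet> x" if r: "\<rho> \<in> band_projections" for \<rho> x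
  proof -
    obtain B where B: "band B" "\<And>x. \<rho> \<bullet> x \<in> B" "\<And>x. x - \<rho> \<bullet> x \<in> disjoint_complement B"
      using r unfolding band_projections_def by blast
    have "T \<bullet> \<rho> \<bullet> x \<in> B"
      using orthomorphism_band[OF orthomorphism_orth_apply B(1)] B(2) by blast
    then show ?thesis
      by (intro band_decomposition_unique[OF B(1) B(2,3)])
        (simp_all add: subspace_0[OF subspace_disjoint_complement])
  qed
  fix x
  have "T \<bullet> \<pi> \<bullet> x = \<pi> \<bullet> T \<bullet> \<pi> \<bullet> x" using inv[OF p] by simp
  moreover have "\<pi> \<bullet> T \<bullet> (1 - \<pi>) \<bullet> x = 0" using inv[OF bp_compl[OF p], of x] by simp
  ultimately show "(T * \<pi>) \<bullet> x = (\<pi> * T) \<bullet> x" by simp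
qed

lemma bp_commute_apply: "\<pi> \<in> band_projections \<Longrightarrow> T \<bullet> \<pi> \<bullet> x = \<pi> \<bullet> T \<bullet> x"
  using arg_cong[OF bp_commute[of \<pi> T], of "\<lambda>R. R \<bullet> x"] by simp

lemma bp_mult: "\<pi> \<in> band_projections \<Longrightarrow> \<rho> \<in> band_projections \<Longrightarrow> \<pi> * \<rho> \<in> band_projections"
proof -
  assume p: "\<pi> \<in> band_projections" and r: "\<rho> \<in> band_projections"
  have "(\<pi> * \<rho>) * (\<pi> * \<rho>) = \<pi> * (\<rho> * \<pi>) * \<rho>" by (simp add: mult.assoc)
  also have "\<dots> = (\<pi> * \<pi>) * (\<rho> * \<rho>)" unfolding bp_commute[OF p, of \<rho>] by (simp add: mult.assoc)
  finally have "(\<pi> * \<rho>) * (\<pi> * \<rho>) = \<pi> * \<rho>" using p r by (simp add: bp_idem)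
  moreover have "\<pi> * \<rho> \<le> 1 * 1" using p r by (intro mult_mono bp_le_one bp_nonneg) auto
  ultimately show ?thesis using p r by (simp add: band_projections_iff)
qed

lemma bp_le_iff:
  assumes p: "\<pi> \<in> band_projections" and r: "\<rho> \<in> band_projections"
  shows "\<rho> \<le> \<pi> \<longleftrightarrow> \<rho> * \<pi> = \<rho>"
proof
  assume le: "\<rho> \<le> \<pi>"
  have "\<rho> * (1 - \<pi>) \<le> \<pi> * (1 - \<pi>)"
    by (rule mult_right_mono[OF le bp_nonneg[OF bp_compl[OF p]]])
  then have "\<rho> \<le> \<rho> * \<pi>" using bp_idem[OF p] by (simp add: algebra_simps)
  moreover have "\<rho> * \<pi> \<le> \<rho> * 1" by (intro mult_left_mono bp_le_one bp_nonneg p r)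
  ultimately show "\<rho> * \<pi> = \<rho>" by simp
next
  assume eq: "\<rho> * \<pi> = \<rho>"
  have "\<rho> * \<pi> \<le> 1 * \<pi>" by (intro mult_right_mono bp_le_one bp_nonneg p r)
  then show "\<rho> \<le> \<pi>" using eq by simp
qed

lemma bp_mult_le1: "\<pi> \<in> band_projections \<Longrightarrow> \<rho> \<in> band_projections \<Longrightarrow> \<pi> * \<rho> \<le> \<pi>"
  using mult_left_mono[OF bp_le_one bp_nonneg, of \<rho> \<pi>] by simp

lemma bp_mult_le2: "\<pi> \<in> band_projections \<Longrightarrow> \<rho> \<in> band_projections \<Longrightarrow> \<pi> * \<rho> \<le> \<rho>"
  using mult_right_mono[OF bp_le_one bp_nonneg, of \<pi> \<rho>] by simp

lemma bp_le_apply: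
  assumes "\<pi> \<in> band_projections" "\<rho> \<in> band_projections" "\<rho> \<le> \<pi>"
  shows "\<rho> \<bullet> \<pi> \<bullet> x = \<rho> \<bullet> x" "\<pi> \<bullet> \<rho> \<bullet> x = \<rho> \<bullet> x"
proof -
  have eq: "\<rho> * \<pi> = \<rho>" using assms bp_le_iff by blast
  show "\<rho> \<bullet> \<pi> \<bullet> x = \<rho> \<bullet> x" using arg_cong[OF eq, of "\<lambda>R. R \<bullet> x"] by simp
  then show "\<pi> \<bullet> \<rho> \<bullet> x = \<rho> \<bullet> x" using bp_commute_apply[OF assms(2), of \<pi> x] by simp
qed

section \<open>Suprema of band projections, principal projections and annihilators\<close>

text \<open>The supremum is taken among all orthomorphisms; it is idempotent because every
  \<open>\<pi> = \<pi> * \<pi>\<close> in \<open>A\<close> lies below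
  \<open>Sup A * Sup A\<close>.\<close>

lemma bp_Sup:
  assumes ne: "A \<noteq> {}" and A: "A \<subseteq> band_projections"
  shows "Sup A \<in> band_projections" "\<pi> \<in> A \<Longrightarrow> \<pi> \<le> Sup A"
    "(\<And>\<pi>. \<pi> \<in> A \<Longrightarrow> \<pi> \<le> T) \<Longrightarrow> Sup A \<le> T"
proof -
  have bd: "bdd_above A" by (rule bdd_aboveI[of _ 1]) (use A bp_le_one in blast)
  show up: "\<pi> \<le> Sup A" if "\<pi> \<in> A" for \<pi> by (rule cSup_upper[OF that bd])
  show least: "Sup A \<le> T" if "\<And>\<pi>. \<pi> \<in> A \<Longrightarrow> \<pi> \<le> T" for T by (rule cSup_least[OF ne that])
  have 1: "Sup A \<le> 1" by (rule least) (use A bp_le_one in blast)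
  obtain a where a: "a \<in> A" using ne by blast
  have 0: "0 \<le> Sup A" by (rule order_trans[OF bp_nonneg up]) (use a A in auto)
  have "Sup A \<le> Sup A * Sup A"
  proof (rule least)
    fix \<pi> assume p: "\<pi> \<in> A"
    then have "\<pi> = \<pi> * \<pi>" using A bp_idem[of \<pi>] by auto
    also have "\<dots> \<le> Sup A * Sup A" by (rule mult_mono[OF up[OF p] up[OF p] 0 bp_nonneg]) (use p A in auto)
    finally show "\<pi> \<le> Sup A * Sup A" .
  qed
  moreover have "Sup A * Sup A \<le> Sup A * 1" by (rule mult_left_mono[OF 1 0])
  ultimately show "Sup A \<in> band_projections" using 0 1 by (simp add: band_projections_iff)
qed

lemma bp_Sup_annihilates:
  assumes "A \<noteq> {}" "A \<subseteq> band_projections" "0 \<le> v" "\<And>\<pi>. \<pi> \<in> A \<Longrightarrow> \<pi> \<bullet> v = 0"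
  shows "Sup A \<bullet> v = 0"
proof -
  have "bdd_above ((\<lambda>T. T \<bullet> x) ` A)" if "0 \<le> x" for x
    by (rule bdd_aboveI[of _ x]) (use assms(2) that bp_apply_le in blast)
  then have "Sup A \<bullet> v = (SUP T\<in>A. T \<bullet> v)" by (intro orth_apply_Sup) (use assms in auto)
  also have "\<dots> = (SUP T\<in>A. 0)" by (rule SUP_cong) (use assms in auto)
  finally show ?thesis using assms by simp
qed

lemma pprt_unique:
  fixes a b :: "'e::lattice_ab_group_add"
  assumes "inf a b = 0" shows "pprt (a - b) = a"
proof -
  have "pprt (a - b) + b = sup (a - b + b) (0 + b)" unfolding pprt_def by (rule add_sup_distrib_right)
  also have "\<dots> = a + b" using add_eq_inf_sup[of a b] assms by simp
  finally show ?thesis by simp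
qed

lemma bp_pprt_apply:
  assumes p: "\<pi> \<in> band_projections" shows "\<pi> \<bullet> pprt x = pprt (\<pi> \<bullet> x)"
proof -
  have "inf (\<pi> \<bullet> pprt x) (\<pi> \<bullet> - nprt x) = 0"
    by (rule disjoint_mono[OF pprt_disjoint_nprt[of x]])
      (use p bp_pos[OF p, of "- nprt x"] bp_apply_le[OF p, of "- nprt x"] in \<open>auto simp: bp_pos bp_apply_le\<close>)
  from pprt_unique[OF this] have "pprt (\<pi> \<bullet> (pprt x + nprt x)) = \<pi> \<bullet> pprt x" by simp
  then show ?thesis by (simp flip: prts)
qed

lemma sup_eq_pprt: fixes x y :: "'e::lattice_ab_group_add" shows "sup x y = y + pprt (x - y)"
  by (simp add: pprt_def add_sup_distrib_left)

lemma bp_sup_apply: "\<pi> \<in> band_projections \<Longrightarrow> \<pi> \<bullet> sup x y = sup (\<pi> \<bullet> x) (\<pi> \<bullet> y)"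
  by (simp add: sup_eq_pprt bp_pprt_apply)

lemma bp_inf_apply: "\<pi> \<in> band_projections \<Longrightarrow> \<pi> \<bullet> inf x y = inf (\<pi> \<bullet> x) (\<pi> \<bullet> y)"
  by (simp add: inf_eq_neg_sup bp_sup_apply)

lemma bp_abs_apply: "\<pi> \<in> band_projections \<Longrightarrow> \<pi> \<bullet> \<bar>x\<bar> = \<bar>\<pi> \<bullet> x\<bar>"
  by (simp add: abs_lattice bp_sup_apply)

lemma bp_sup_mult: "\<pi> \<in> band_projections \<Longrightarrow> \<pi> * sup S T = sup (\<pi> * S) (\<pi> * T)"
  by (rule orth_eqI) (simp add: orth_sup_apply bp_sup_apply)

lemma bp_abs_mult: "\<pi> \<in> band_projections \<Longrightarrow> \<pi> * \<bar>T\<bar> = \<bar>\<pi> * T\<bar>"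
  by (simp add: abs_lattice bp_sup_mult)

lemma bp_pprt_mult: "\<pi> \<in> band_projections \<Longrightarrow> \<pi> * pprt T = pprt (\<pi> * T)"
  by (simp add: pprt_def bp_sup_mult)

text \<open>\<pi> is the complement of the projection onto the elements disjoint from
  \<open>pprt w\<close>; that projection fixes \<open>nprt w\<close> and kills
  \<open>pprt w\<close>.\<close>

lemma principal_projection:
  fixes w :: "'e::dedekind_complete_vector_lattice"
  obtains \<pi> where "\<pi> \<in> band_projections" "\<pi> \<bullet> w = pprt w"
proof -
  let ?B = "{x. inf \<bar>x\<bar> \<bar>pprt w\<bar> = 0}"
  obtain \<rho> where r: "\<rho> \<in> band_projections" "\<And>x. \<rho> \<bullet> x \<in> ?B" "\<And>x. x - \<rho> \<bullet> x \<in> disjoint_complement ?B"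
    using band_projection_ex[OF band_disjoint_complement[of "pprt w"]] by blast
  note u = band_decomposition_unique[OF band_disjoint_complement[of "pprt w"] r(2,3)]
  have "\<rho> \<bullet> nprt w = nprt w"
  proof (rule u)
    have "inf (pprt w) (- nprt w) = 0" by (rule pprt_disjoint_nprt)
    then show "nprt w \<in> ?B" by (simp add: inf_commute)
  qed (simp add: subspace_0[OF subspace_disjoint_complement])
  moreover have "\<rho> \<bullet> pprt w = 0"
    by (rule u) (auto simp: disjoint_complement_def inf_commute inf_absorb1)
  ultimately have "(1 - \<rho>) \<bullet> (pprt w + nprt w) = pprt w" by simp
  then show ?thesis using that[OF bp_compl[OF r(1)]] by (simp flip: prts)
qed

text \<open>Take the principal projection of \<open>w - d\<close>, whose positive part is
  \<open>w\<close> by disjointness.\<close>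

lemma bp_disjoint:
  fixes w d :: "'e::dedekind_complete_vector_lattice"
  assumes "inf w d = 0"
  obtains \<pi> where "\<pi> \<in> band_projections" "\<pi> \<bullet> w = w" "\<pi> \<bullet> d = 0"
proof -
  have 0: "0 \<le> w" "0 \<le> d" using assms inf_le1[of w d] inf_le2[of w d] by simp_all
  obtain \<pi> where p: "\<pi> \<in> band_projections" "\<pi> \<bullet> (w - d) = pprt (w - d)"
    by (rule principal_projection)
  then have eq: "\<pi> \<bullet> w - \<pi> \<bullet> d = w" using pprt_unique[OF assms] by simp
  have "\<pi> \<bullet> w \<le> w" "0 \<le> \<pi> \<bullet> d" using 0 p bp_apply_le bp_pos by blast+
  moreover have "\<pi> \<bullet> d = \<pi> \<bullet> w - w" using eq by (simp add: algebra_simps)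
  ultimately have "\<pi> \<bullet> d = 0" by (intro order.antisym) simp_all
  then show ?thesis using that p eq by simp
qed

text \<open>The largest band projection that kills \<open>v\<close>; its complement is the carrier
  of \<open>v\<close>. The absolute value is there because suprema of orthomorphisms are computed
  pointwise on positive elements only.\<close>

definition annihilator :: "'e::dedekind_complete_vector_lattice \<Rightarrow> 'e orth" where
  "annihilator v = Sup {\<pi> \<in> band_projections. \<pi> \<bullet> \<bar>v\<bar> = 0}"

lemma annihilator:
  shows annihilator_bp: "annihilator v \<in> band_projections"
    and annihilator_apply: "annihilator v \<bullet> v = 0"
    and annihilator_greatest: "\<pi> \<in> band_projections \<Longrightarrow> \<pi> \<bullet> v = 0 \<Longrightarrow> \<pi> \<le> annihilator v"
proof -
  let ?A = "{\<pi> \<in> band_projections. \<pi> \<bullet> \<bar>v\<bar> = 0}"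
  have "0 \<in> ?A" by simp
  then have ne: "?A \<noteq> {}" by blast
  have A: "?A \<subseteq> band_projections" by blast
  show n: "annihilator v \<in> band_projections" unfolding annihilator_def by (rule bp_Sup(1)[OF ne A])
  have "annihilator v \<bullet> \<bar>v\<bar> = 0"
    unfolding annihilator_def by (rule bp_Sup_annihilates[OF ne A]) auto
  then show "annihilator v \<bullet> v = 0" by (simp add: bp_abs_apply[OF n])
  show "\<pi> \<le> annihilator v" if "\<pi> \<in> band_projections" "\<pi> \<bullet> v = 0"
    unfolding annihilator_def by (rule bp_Sup(2)[OF ne A]) (use that in \<open>simp add: bp_abs_apply\<close>)
qed

text \<open>The principal projections of the single values \<open>T \<bullet> x\<close> depend on
  \<open>x\<close>, so the largest projection \<open>N\<close> that kills \<open>pprt T\<close> is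
  used instead. It fixes \<open>nprt T \<bullet> x\<close>: the carrier of that element kills
  \<open>pprt T \<bullet> y\<close> for every y \<ge> 0, because an orthomorphism has disjoint
  positive and negative parts even at different arguments.\<close>

lemma principal_projection_orth:
  fixes T :: "'e::dedekind_complete_vector_lattice orth"
  obtains \<pi> where "\<pi> \<in> band_projections" "\<pi> * T = pprt T"
proof -
  let ?A = "{\<pi> \<in> band_projections. \<pi> * pprt T = 0}"
  have "0 \<in> ?A" by simp
  then have ne: "?A \<noteq> {}" by blast
  have A: "?A \<subseteq> band_projections" by blast
  define N where "N = Sup ?A"
  have N: "N \<in> band_projections" unfolding N_def by (rule bp_Sup(1)[OF ne A])
  have 1: "N \<bullet> pprt T \<bullet> x = 0" if x: "0 \<le> x" for x
    unfolding N_def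
  proof (rule bp_Sup_annihilates[OF ne A])
    show "0 \<le> pprt T \<bullet> x" using x by (simp add: orth_pos)
    show "\<pi> \<bullet> pprt T \<bullet> x = 0" if "\<pi> \<in> ?A" for \<pi>
    proof -
      have "\<pi> \<bullet> pprt T \<bullet> x = (\<pi> * pprt T) \<bullet> x" by simp
      also have "\<dots> = 0" using that by (simp del: orth_apply_simps(11))
      finally show ?thesis .
    qed
  qed
  have 2: "N \<bullet> nprt T \<bullet> x = nprt T \<bullet> x" if x: "0 \<le> x" for x
  proof -
    have nT: "- (nprt T \<bullet> x) = - nprt (T \<bullet> x)"
      using orth_pprt_apply[OF x, of "- T"] by (simp add: pprt_neg)
    obtain w where w: "w = - nprt (T \<bullet> x)" by blast
    define \<rho> where "\<rho> = 1 - annihilator w"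
    have r: "\<rho> \<in> band_projections" unfolding \<rho>_def by (rule bp_compl[OF annihilator_bp])
    have rw: "\<rho> \<bullet> w = w" by (simp add: \<rho>_def annihilator_apply)
    have "\<rho> \<bullet> pprt T \<bullet> y = 0" if y: "0 \<le> y" for y
    proof -
      have "inf (pprt (T \<bullet> y)) w = 0"
        unfolding w by (rule orthomorphism_pprt_disjoint[OF orthomorphism_orth_apply y x])
      then obtain \<pi> where p: "\<pi> \<in> band_projections" "\<pi> \<bullet> pprt (T \<bullet> y) = pprt (T \<bullet> y)" "\<pi> \<bullet> w = 0"
        by (rule bp_disjoint)
      have "\<pi> \<le> annihilator w" by (rule annihilator_greatest[OF p(1,3)])
      then have "annihilator w \<bullet> \<pi> \<bullet> pprt (T \<bullet> y) = \<pi> \<bullet> pprt (T \<bullet> y)"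
        using bp_le_apply[OF annihilator_bp p(1)] by blast
      then show ?thesis using p y by (simp add: \<rho>_def orth_pprt_apply)
    qed
    then have "\<rho> \<in> ?A" using r by (auto intro!: orth_eqI)
    then have "\<rho> \<le> N" unfolding N_def by (rule bp_Sup(2)[OF ne A])
    then have "N \<bullet> \<rho> \<bullet> w = \<rho> \<bullet> w" using bp_le_apply[OF N r] by blast
    then have "N \<bullet> - (nprt T \<bullet> x) = - (nprt T \<bullet> x)" using rw w nT by simp
    then show ?thesis by simp
  qed
  have "(1 - N) * T = pprt T"
  proof (rule orth_eqI)
    fix x :: 'e assume x: "0 \<le> x"
    have "((1 - N) * T) \<bullet> x = (1 - N) \<bullet> (pprt T + nprt T) \<bullet> x" by (simp flip: prts)
    also have "\<dots> = pprt T \<bullet> x" using 1[OF x] 2[OF x] by simp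
    finally show "((1 - N) * T) \<bullet> x = pprt T \<bullet> x" .
  qed
  then show ?thesis using that bp_compl[OF N] by blast
qed

section \<open>Local arguments on nonzero band projections\<close>

lemma bp_le_disjoint_zero:
  assumes "\<pi> \<in> band_projections" "\<rho> \<in> band_projections" "\<rho> \<le> \<pi>" "\<rho> \<le> 1 - \<pi>"
  shows "\<rho> = 0"
  using bp_le_iff[of \<pi> \<rho>] bp_le_iff[OF bp_compl[OF assms(1)], of \<rho>] assms by (simp add: algebra_simps)

lemma bp_mult_zero_iff:
  assumes "\<pi> \<in> band_projections" "\<rho> \<in> band_projections"
  shows "\<rho> * \<pi> = 0 \<longleftrightarrow> \<rho> \<le> 1 - \<pi>"
  using bp_le_iff[OF bp_compl[OF assms(1)] assms(2)] by (auto simp: algebra_simps)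

lemma bp_mult_mono: "\<rho> \<in> band_projections \<Longrightarrow> S \<le> T \<Longrightarrow> \<rho> * S \<le> \<rho> * T"
  by (rule mult_left_mono[OF _ bp_nonneg])

lemma bp_le_mult:
  assumes "\<rho> \<in> band_projections" "\<rho>' \<in> band_projections" "\<rho>' \<le> \<rho>"
  shows "\<rho>' * \<rho> = \<rho>'" "\<rho> * \<rho>' = \<rho>'" "\<rho>' * (\<rho> * T) = \<rho>' * T"
  using assms bp_le_iff[of \<rho> \<rho>'] bp_commute[of \<rho> \<rho>'] by (simp_all flip: mult.assoc)

lemma bp_down_orth:
  assumes "\<rho> \<in> band_projections" "\<rho>' \<in> band_projections" "\<rho>' \<le> \<rho>" "\<rho> * S \<le> \<rho> * T"
  shows "\<rho>' * S \<le> \<rho>' * T"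
  using bp_mult_mono[OF assms(2,4)] bp_le_mult[OF assms(1-3)] by simp

text \<open>Substitute for arguing at a point. If the inequality failed, the carrier of the positive
  part of \<open>\<rho>0 \<bullet> (v - w)\<close> would be a nonzero projection below
  \<open>\<rho>0\<close>; the hypothesis gives a nonzero \<rho>' inside it that kills this positive
  part, which is impossible.\<close>

lemma local_le:
  assumes r0: "\<rho>0 \<in> band_projections"
    and loc: "\<And>\<rho>. \<rho> \<in> band_projections \<Longrightarrow> \<rho> \<noteq> 0 \<Longrightarrow> \<rho> \<le> \<rho>0 \<Longrightarrow>
      \<exists>\<rho>'\<in>band_projections. \<rho>' \<noteq> 0 \<and> \<rho>' \<le> \<rho> \<and> \<rho>' \<bullet> v \<le> \<rho>' \<bullet> w"
  shows "\<rho>0 \<bullet> v \<le> \<rho>0 \<bullet> w"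
proof -
  define u where "u = \<rho>0 \<bullet> (v - w)"
  define N where "N = annihilator (pprt u)"
  have N: "N \<in> band_projections" unfolding N_def by (rule annihilator_bp)
  have "(1 - \<rho>0) \<bullet> pprt u = 0"
    using bp_pprt_apply[OF bp_compl[OF r0], of u] bp_idem_apply[OF r0] by (simp add: u_def)
  then have "1 - \<rho>0 \<le> N" unfolding N_def by (rule annihilator_greatest[OF bp_compl[OF r0]])
  then have c: "1 - N \<le> \<rho>0" by (simp add: algebra_simps)
  have "1 - N = 0"
  proof (rule ccontr)
    assume "1 - N \<noteq> 0"
    then obtain \<rho>' where r': "\<rho>' \<in> band_projections" "\<rho>' \<noteq> 0" "\<rho>' \<le> 1 - N" "\<rho>' \<bullet> v \<le> \<rho>' \<bullet> w"
      using loc[OF bp_compl[OF N] _ c] by blast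
    have "\<rho>' \<bullet> u = \<rho>' \<bullet> (v - w)" unfolding u_def by (rule bp_le_apply[OF r0 r'(1) order_trans[OF r'(3) c]])
    then have "\<rho>' \<bullet> u \<le> 0" using r'(4) by simp
    then have "\<rho>' \<bullet> pprt u = 0" by (simp add: bp_pprt_apply[OF r'(1)])
    then have "\<rho>' \<le> N" unfolding N_def by (rule annihilator_greatest[OF r'(1)])
    then show False using bp_le_disjoint_zero[OF N r'(1)] r' by blast
  qed
  then have "pprt u = 0" using annihilator_apply[of "pprt u"] by (simp add: N_def)
  then have "u \<le> 0" using self_le_pprt[of u] by simp
  then show ?thesis by (simp add: u_def)
qed

lemma local_le_orth:
  assumes r0: "\<rho>0 \<in> band_projections"
    and loc: "\<And>\<rho>. \<rho> \<in> band_projections \<Longrightarrow> \<rho> \<noteq> 0 \<Longrightarrow> \<rho> \<le> \<rho>0 \<Longrightarrow>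
      \<exists>\<rho>'\<in>band_projections. \<rho>' \<noteq> 0 \<and> \<rho>' \<le> \<rho> \<and> \<rho>' * S \<le> \<rho>' * T"
  shows "\<rho>0 * S \<le> \<rho>0 * T"
proof (rule orth_leI)
  fix x :: 'a assume x: "0 \<le> x"
  have "\<rho>0 \<bullet> S \<bullet> x \<le> \<rho>0 \<bullet> T \<bullet> x"
  proof (rule local_le[OF r0])
    fix \<rho> assume "\<rho> \<in> band_projections" "\<rho> \<noteq> 0" "\<rho> \<le> \<rho>0"
    then obtain \<rho>' where r': "\<rho>' \<in> band_projections" "\<rho>' \<noteq> 0" "\<rho>' \<le> \<rho>" "\<rho>' * S \<le> \<rho>' * T"
      using loc by blast
    then have "\<rho>' \<bullet> S \<bullet> x \<le> \<rho>' \<bullet> T \<bullet> x" using orth_leD[OF r'(4) x] by simp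
    then show "\<exists>\<rho>'\<in>band_projections. \<rho>' \<noteq> 0 \<and> \<rho>' \<le> \<rho> \<and> \<rho>' \<bullet> S \<bullet> x \<le> \<rho>' \<bullet> T \<bullet> x" using r' by blast
  qed
  then show "(\<rho>0 * S) \<bullet> x \<le> (\<rho>0 * T) \<bullet> x" by simp
qed

text \<open>Substitute for a total order. Let \<pi> be the principal projection of
  \<open>T - S\<close>: if \<rho> meets \<pi>, then S \<le> T on the common part; otherwise T \<le>
  S on all of \<rho>.\<close>

lemma bp_cases_orth:
  fixes S T :: "'e::dedekind_complete_vector_lattice orth"
  assumes r: "\<rho> \<in> band_projections" "\<rho> \<noteq> 0"
  obtains \<rho>' where "\<rho>' \<in> band_projections" "\<rho>' \<noteq> 0" "\<rho>' \<le> \<rho>" "\<rho>' * S \<le> \<rho>' * T"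
  | \<rho>' where "\<rho>' \<in> band_projections" "\<rho>' \<noteq> 0" "\<rho>' \<le> \<rho>" "\<rho>' * T \<le> \<rho>' * S"
proof -
  obtain \<pi> where p: "\<pi> \<in> band_projections" "\<pi> * (T - S) = pprt (T - S)"
    by (rule principal_projection_orth)
  show ?thesis
  proof (cases "\<rho> * \<pi> = 0")
    case False
    have "0 \<le> \<rho> * (\<pi> * (T - S))" unfolding p(2) using r by (intro mult_nonneg_nonneg) (auto simp: bp_nonneg)
    then have "(\<rho> * \<pi>) * S \<le> (\<rho> * \<pi>) * T" by (simp add: algebra_simps)
    then show ?thesis by (rule that(1)[OF bp_mult[OF r(1) p(1)] False bp_mult_le1[OF r(1) p(1)]])
  next
    case True
    have "\<rho> * (T - S) = \<rho> * (pprt (T - S) + nprt (T - S))" by (simp flip: prts)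
    also have "\<dots> = (\<rho> * \<pi>) * (T - S) + \<rho> * nprt (T - S)" by (simp add: distrib_left mult.assoc p(2))
    also have "\<dots> \<le> 0" unfolding True using r by (simp add: mult_nonneg_nonpos bp_nonneg)
    finally have "\<rho> * T \<le> \<rho> * S" by (simp add: algebra_simps)
    then show ?thesis using that(2) r by blast
  qed
qed

lemma bp_scaleR_le:
  assumes "\<rho> \<in> band_projections" "\<rho> \<noteq> 0" "a *\<^sub>R \<rho> \<le> b *\<^sub>R \<rho>" shows "a \<le> b"
proof (rule ccontr)
  assume "\<not> a \<le> b"
  then have ab: "0 < a - b" by simp
  have "(a - b) *\<^sub>R \<rho> \<le> 0" using assms(3) by (simp add: algebra_simps)
  then have "(1 / (a - b)) *\<^sub>R ((a - b) *\<^sub>R \<rho>) \<le> 0"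
    by (rule scaleR_nonneg_nonpos[rotated]) (use ab in simp)
  then have "\<rho> \<le> 0" using ab by simp
  then show False using bp_nonneg[OF assms(1)] assms(2) by simp
qed

text \<open>A failing inequality fails by a real constant on a nonzero band. By the Archimedean
  property it still fails after adding some \<delta> to \<open>T\<close>; by localization there is a
  nonzero projection on no nonzero part of which the shifted inequality holds, so comparability
  gives the reverse one on a part.\<close>

lemma not_le_orthE:
  assumes r0: "\<rho>0 \<in> band_projections" and nle: "\<not> \<rho>0 * S \<le> \<rho>0 * T"
  obtains \<rho> \<delta> where "\<rho> \<in> band_projections" "\<rho> \<noteq> 0" "\<rho> \<le> \<rho>0" "(\<delta>::real) > 0" "\<rho> * T + \<delta> *\<^sub>R \<rho> \<le> \<rho> * S"
proof -
  obtain \<delta> :: real where d: "\<delta> > 0" "\<not> \<rho>0 * S \<le> \<rho>0 * (T + \<delta> *\<^sub>R 1)"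
  proof (rule ccontr)
    assume "\<not> thesis"
    then have "\<rho>0 * S \<le> \<rho>0 * (T + \<delta> *\<^sub>R 1)" if "\<delta> > 0" for \<delta> using that \<open>\<And>\<delta>. \<lbrakk>0 < \<delta>; \<not> \<rho>0 * S \<le> \<rho>0 * (T + \<delta> *\<^sub>R 1)\<rbrakk> \<Longrightarrow> thesis\<close> by blast
    then have "\<rho>0 * S - \<rho>0 * T \<le> \<delta> *\<^sub>R \<rho>0" if "\<delta> > 0" for \<delta>
      using that by (simp add: distrib_left diff_le_eq add.commute)
    then have "\<rho>0 * S - \<rho>0 * T \<le> 0" by (rule archimedean_eps)
    then show False using nle by simp
  qed
  have "\<exists>\<rho>\<in>band_projections. \<rho> \<noteq> 0 \<and> \<rho> \<le> \<rho>0 \<and> (\<forall>\<rho>'\<in>band_projections. \<rho>' \<noteq> 0 \<and> \<rho>' \<le> \<rho> \<longrightarrow> \<not> \<rho>' * S \<le> \<rho>' * (T + \<delta> *\<^sub>R 1))"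
    using local_le_orth[OF r0, of S "T + \<delta> *\<^sub>R 1"] d(2) by blast
  then obtain \<rho> where r: "\<rho> \<in> band_projections" "\<rho> \<noteq> 0" "\<rho> \<le> \<rho>0"
    "\<And>\<rho>'. \<rho>' \<in> band_projections \<Longrightarrow> \<rho>' \<noteq> 0 \<Longrightarrow> \<rho>' \<le> \<rho> \<Longrightarrow> \<not> \<rho>' * S \<le> \<rho>' * (T + \<delta> *\<^sub>R 1)" by blast
  show ?thesis
  proof (rule bp_cases_orth[OF r(1,2), of S "T + \<delta> *\<^sub>R 1"])
    fix \<rho>' assume "\<rho>' \<in> band_projections" "\<rho>' \<noteq> 0" "\<rho>' \<le> \<rho>" "\<rho>' * (T + \<delta> *\<^sub>R 1) \<le> \<rho>' * S"
    then show ?thesis using that[of \<rho>' \<delta>] d(1) r(3) by (auto simp: distrib_left)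
  qed (use r(4) in blast)
qed

text \<open>If no integer worked on any part of \<rho>, then n \<rho> would lie below
  \<open>\<rho> * \<bar>T\<bar>\<close> for all n, against the Archimedean property.\<close>

lemma orth_locally_bounded:
  assumes r: "\<rho> \<in> band_projections" "\<rho> \<noteq> 0"
  obtains \<rho>' M where "\<rho>' \<in> band_projections" "\<rho>' \<noteq> 0" "\<rho>' \<le> \<rho>" "(M::real) > 0" "\<rho>' * \<bar>T\<bar> \<le> M *\<^sub>R \<rho>'"
proof -
  have "\<exists>n::nat. n > 0 \<and> \<not> \<rho> * (real n *\<^sub>R 1) \<le> \<rho> * \<bar>T\<bar>"
  proof (rule ccontr)
    assume neg: "\<not> ?thesis"
    have *: "real n *\<^sub>R \<rho> \<le> \<rho> * \<bar>T\<bar>" if n: "n > 0" for n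
    proof -
      have "\<rho> * (real n *\<^sub>R 1) \<le> \<rho> * \<bar>T\<bar>" using n neg by blast
      then show ?thesis by simp
    qed
    have "\<rho> \<le> 0"
    proof (rule archimedean)
      fix n :: nat assume n: "n > 0"
      from scaleR_left_mono[OF *[OF n], of "1 / real n"] show "\<rho> \<le> (1 / real n) *\<^sub>R (\<rho> * \<bar>T\<bar>)" using n by simp
    qed
    then show False using r bp_nonneg[of \<rho>] by simp
  qed
  then obtain n :: nat where n: "n > 0" "\<not> \<rho> * (real n *\<^sub>R 1) \<le> \<rho> * \<bar>T\<bar>" by blast
  from not_le_orthE[OF r(1) n(2)] obtain \<rho>' \<delta> where
    r': "\<rho>' \<in> band_projections" "\<rho>' \<noteq> 0" "\<rho>' \<le> \<rho>" "(\<delta>::real) > 0" "\<rho>' * \<bar>T\<bar> + \<delta> *\<^sub>R \<rho>' \<le> \<rho>' * (real n *\<^sub>R 1)"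
    by blast
  have "\<rho>' * \<bar>T\<bar> \<le> \<rho>' * \<bar>T\<bar> + \<delta> *\<^sub>R \<rho>'" using r' by (simp add: scaleR_nonneg_nonneg bp_nonneg)
  also have "\<dots> \<le> real n *\<^sub>R \<rho>'" using r'(5) by simp
  finally have "\<rho>' * \<bar>T\<bar> \<le> real n *\<^sub>R \<rho>'" .
  then show ?thesis using that[of \<rho>' "real n"] r'(1-3) n by simp
qed

text \<open>A local form of Freudenthal's spectral theorem. On a band where \<open>T\<close> is
  bounded, \<open>t\<close> is the supremum of the reals that lie below \<open>T\<close> there.
  Since t + \<epsilon> is not among them, T \<le> t + \<epsilon> on a smaller band, while lower
  bounds above t - \<epsilon> persist on every smaller band.\<close>

lemma orth_real_approx:
  assumes r: "\<rho> \<in> band_projections" "\<rho> \<noteq> 0" and e: "(\<epsilon>::real) > 0"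
  obtains \<rho>' t where "\<rho>' \<in> band_projections" "\<rho>' \<noteq> 0" "\<rho>' \<le> \<rho>" "\<rho>' * \<bar>T - t *\<^sub>R 1\<bar> \<le> \<epsilon> *\<^sub>R \<rho>'"
proof -
  obtain \<rho>1 M where r1: "\<rho>1 \<in> band_projections" "\<rho>1 \<noteq> 0" "\<rho>1 \<le> \<rho>" "(M::real) > 0" "\<rho>1 * \<bar>T\<bar> \<le> M *\<^sub>R \<rho>1"
    by (rule orth_locally_bounded[OF r])
  have T1: "\<rho>1 * T \<le> M *\<^sub>R \<rho>1" using bp_mult_mono[OF r1(1) abs_ge_self[of T]] r1(5) by simp
  have T2: "(- M) *\<^sub>R \<rho>1 \<le> \<rho>1 * T"
  proof -
    have "- (\<rho>1 * T) \<le> \<rho>1 * \<bar>T\<bar>" using bp_mult_mono[OF r1(1) abs_ge_minus_self[of T]] by simp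
    then have "- (\<rho>1 * T) \<le> M *\<^sub>R \<rho>1" using r1(5) by simp
    then show ?thesis by (simp add: minus_le_iff)
  qed
  define R where "R = {t::real. t *\<^sub>R \<rho>1 \<le> \<rho>1 * T}"
  have "- M \<in> R" using T2 by (simp only: R_def mem_Collect_eq)
  then have ne: "R \<noteq> {}" by blast
  have bd: "bdd_above R"
    by (rule bdd_aboveI[of _ M])
      (use bp_scaleR_le[OF r1(1,2)] T1 order_trans in \<open>auto simp: R_def\<close>)
  define t where "t = Sup R"
  have "t + \<epsilon> \<notin> R" using cSup_upper[OF _ bd, of "t + \<epsilon>"] e unfolding t_def[symmetric] by auto
  then have "\<not> \<rho>1 * ((t + \<epsilon>) *\<^sub>R 1) \<le> \<rho>1 * T" by (simp add: R_def)
  from not_le_orthE[OF r1(1) this] obtain \<rho>' \<delta> where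
    r': "\<rho>' \<in> band_projections" "\<rho>' \<noteq> 0" "\<rho>' \<le> \<rho>1" "(\<delta>::real) > 0" "\<rho>' * T + \<delta> *\<^sub>R \<rho>' \<le> \<rho>' * ((t + \<epsilon>) *\<^sub>R 1)"
    by blast
  have "\<rho>' * T \<le> \<rho>' * T + \<delta> *\<^sub>R \<rho>'" using r' by (simp add: scaleR_nonneg_nonneg bp_nonneg)
  also have "\<dots> \<le> (t + \<epsilon>) *\<^sub>R \<rho>'" using r'(5) by simp
  finally have up: "\<rho>' * T \<le> (t + \<epsilon>) *\<^sub>R \<rho>'" .
  obtain s where s: "s \<in> R" "t - \<epsilon> < s" using less_cSupD[OF ne, of "t - \<epsilon>"] e unfolding t_def[symmetric] by auto
  have "\<rho>1 * (s *\<^sub>R 1) \<le> \<rho>1 * T" using s by (simp add: R_def)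
  from bp_down_orth[OF r1(1) r'(1,3) this] have "s *\<^sub>R \<rho>' \<le> \<rho>' * T" by simp
  moreover have "(t - \<epsilon>) *\<^sub>R \<rho>' \<le> s *\<^sub>R \<rho>'" using s bp_nonneg[OF r'(1)] by (intro scaleR_right_mono) auto
  ultimately have low: "(t - \<epsilon>) *\<^sub>R \<rho>' \<le> \<rho>' * T" by (rule order_trans[rotated])
  have "\<rho>' * \<bar>T - t *\<^sub>R 1\<bar> = \<bar>\<rho>' * T - t *\<^sub>R \<rho>'\<bar>"
    by (simp add: bp_abs_mult[OF r'(1)] right_diff_distrib)
  also have "\<dots> \<le> \<epsilon> *\<^sub>R \<rho>'" using up low by (intro abs_leI) (auto simp: algebra_simps)
  finally show ?thesis using that r' r1 by force
qed

text \<open>A maximal disjoint family of projections with the property \<open>P\<close>, from Zorn's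
  lemma. A nonzero projection disjoint from all of them would contain another one with
  \<open>P\<close> and contradict maximality.\<close>

lemma exhaustion:
  fixes P :: "'e::dedekind_complete_vector_lattice orth \<Rightarrow> bool"
  assumes dens: "\<And>\<rho>. \<rho> \<in> band_projections \<Longrightarrow> \<rho> \<noteq> 0 \<Longrightarrow>
    \<exists>\<rho>'\<in>band_projections. \<rho>' \<noteq> 0 \<and> \<rho>' \<le> \<rho> \<and> P \<rho>'"
  obtains A where "A \<subseteq> band_projections" "\<And>\<rho>. \<rho> \<in> A \<Longrightarrow> P \<rho>"
    "\<And>\<rho> \<tau>. \<rho> \<in> A \<Longrightarrow> \<tau> \<in> A \<Longrightarrow> \<rho> \<noteq> \<tau> \<Longrightarrow> \<rho> * \<tau> = 0"
    "\<And>\<tau>. \<tau> \<in> band_projections \<Longrightarrow> (\<And>\<rho>. \<rho> \<in> A \<Longrightarrow> \<rho> * \<tau> = 0) \<Longrightarrow> \<tau> = 0"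
proof -
  define \<A> where "\<A> = {A. A \<subseteq> {\<rho> \<in> band_projections. P \<rho>} \<and> (\<forall>\<rho>\<in>A. \<forall>\<tau>\<in>A. \<rho> \<noteq> \<tau> \<longrightarrow> \<rho> * \<tau> = 0)}"
  have "\<exists>M\<in>\<A>. \<forall>X\<in>\<A>. M \<subseteq> X \<longrightarrow> X = M"
  proof (rule subset_Zorn')
    fix C assume C: "subset.chain \<A> C"
    then have CA: "C \<subseteq> \<A>" by (simp add: subset_chain_def)
    have "\<rho> * \<tau> = 0" if rt: "\<rho> \<in> \<Union>C" "\<tau> \<in> \<Union>C" "\<rho> \<noteq> \<tau>" for \<rho> \<tau>
    proof -
      obtain A B where AB: "A \<in> C" "B \<in> C" "\<rho> \<in> A" "\<tau> \<in> B" using rt by blast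
      then have "A \<subseteq> B \<or> B \<subseteq> A" using C by (auto simp: subset_chain_def)
      then obtain D where "D \<in> C" "\<rho> \<in> D" "\<tau> \<in> D" using AB by blast
      then show ?thesis using CA rt(3) unfolding \<A>_def by blast
    qed
    then show "\<Union>C \<in> \<A>" using CA unfolding \<A>_def by blast
  qed
  then obtain M where M: "M \<in> \<A>" "\<And>X. X \<in> \<A> \<Longrightarrow> M \<subseteq> X \<Longrightarrow> X = M" by blast
  show ?thesis
  proof (rule that[of M])
    fix \<tau> assume t: "\<tau> \<in> band_projections" "\<And>\<rho>. \<rho> \<in> M \<Longrightarrow> \<rho> * \<tau> = 0"
    show "\<tau> = 0"
    proof (rule ccontr)
      assume "\<tau> \<noteq> 0"
      then obtain \<rho>' where r': "\<rho>' \<in> band_projections" "\<rho>' \<noteq> 0" "\<rho>' \<le> \<tau>" "P \<rho>'" using dens t(1) by blast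
      have z: "\<rho> * \<rho>' = 0" if "\<rho> \<in> M" for \<rho>
      proof -
        have "\<rho> * \<rho>' = \<rho> * \<tau> * \<rho>'" using bp_le_mult(2)[OF t(1) r'(1,3)] by (simp add: mult.assoc)
        then show ?thesis using t(2)[OF that] by simp
      qed
      then have z': "\<rho>' * \<rho> = 0" if "\<rho> \<in> M" for \<rho> using that bp_commute[OF r'(1), of \<rho>] by simp
      have "insert \<rho>' M \<in> \<A>" using M(1) r' z z' unfolding \<A>_def by blast
      then have "\<rho>' \<in> M" using M(2) by blast
      then have "\<rho>' * \<rho>' = 0" by (rule z)
      then show False using r' bp_idem by metis
    qed
  qed (use M(1) in \<open>auto simp: \<A>_def\<close>)
qed

section \<open>Partitions of unity\<close>

text \<open>A test by products. The infimum of \<open>\<pi> s\<close> and \<open>\<pi> t\<close> is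
  \<le> 0 both on \<open>\<pi> s\<close> and on its complement; and if \<rho> is an upper bound of
  the family, then 1 - \<rho> is disjoint from every member and hence 0.\<close>

lemma partition_of_unityI:
  assumes bp: "\<And>s. \<pi> s \<in> band_projections"
    and dis: "\<And>s t. s \<noteq> t \<Longrightarrow> \<pi> s * \<pi> t = 0"
    and full: "\<And>\<tau>. \<tau> \<in> band_projections \<Longrightarrow> (\<And>s. \<pi> s * \<tau> = 0) \<Longrightarrow> \<tau> = 0"
  shows "partition_of_unity \<pi>"
  unfolding partition_of_unity_def
proof (intro conjI allI impI ballI)
  show "range \<pi> \<subseteq> band_projections" using bp by blast
  fix s t :: 'a assume st: "s \<noteq> t"
  have "inf (\<pi> s) (\<pi> t) \<le> 0"
  proof (rule orth_leI)
    fix x :: 'b assume x: "0 \<le> x"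
    define w where "w = inf (\<pi> s \<bullet> x) (\<pi> t \<bullet> x)"
    have "\<pi> s \<bullet> w \<le> \<pi> s \<bullet> \<pi> t \<bullet> x" by (rule bp_mono[OF bp]) (simp add: w_def)
    also have "\<dots> = (\<pi> s * \<pi> t) \<bullet> x" by simp
    finally have 1: "\<pi> s \<bullet> w \<le> 0" using dis[OF st] by simp
    have "(1 - \<pi> s) \<bullet> w \<le> (1 - \<pi> s) \<bullet> \<pi> s \<bullet> x" by (rule bp_mono[OF bp_compl[OF bp]]) (simp add: w_def)
    then have "(1 - \<pi> s) \<bullet> w \<le> 0" using bp_idem_apply[OF bp] by simp
    with 1 have "\<pi> s \<bullet> w + (1 - \<pi> s) \<bullet> w \<le> 0" by (rule add_nonpos_nonpos)
    then show "inf (\<pi> s) (\<pi> t) \<bullet> x \<le> 0 \<bullet> x" using x by (simp add: orth_inf_apply w_def)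
  qed
  then show "inf (\<pi> s) (\<pi> t) = 0" by (intro order.antisym) (simp_all add: bp_nonneg[OF bp])
next
  fix \<rho> :: "'b orth" assume r: "\<rho> \<in> band_projections" "\<forall>s. \<pi> s \<le> \<rho>"
  have "1 - \<rho> = 0"
    by (rule full[OF bp_compl[OF r(1)]]) (use bp_le_mult(1)[OF r(1) bp] r(2) in \<open>simp add: algebra_simps\<close>)
  then show "1 \<le> \<rho>" by simp
qed

lemma partition_of_unity_bp: "partition_of_unity \<pi> \<Longrightarrow> \<pi> s \<in> band_projections"
  by (auto simp: partition_of_unity_def)

lemma partition_of_unity_disjoint:
  assumes p: "partition_of_unity \<pi>" and st: "s \<noteq> t" shows "\<pi> s * \<pi> t = 0"
proof (rule order.antisym)
  note b = partition_of_unity_bp[OF p]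
  have "\<pi> s * \<pi> t \<le> inf (\<pi> s) (\<pi> t)" using bp_mult_le1[OF b b] bp_mult_le2[OF b b] by simp
  also have "\<dots> = 0" using p st unfolding partition_of_unity_def by blast
  finally show "\<pi> s * \<pi> t \<le> 0" .
  show "0 \<le> \<pi> s * \<pi> t" by (rule bp_nonneg[OF bp_mult[OF b b]])
qed

lemma partition_of_unity_meets:
  assumes p: "partition_of_unity \<pi>" and r: "\<rho> \<in> band_projections" "\<rho> \<noteq> 0"
  obtains s where "\<rho> * \<pi> s \<noteq> 0"
proof -
  note b = partition_of_unity_bp[OF p]
  have "\<exists>s. \<rho> * \<pi> s \<noteq> 0"
  proof (rule ccontr)
    assume "\<not> ?thesis"
    then have "\<pi> s \<le> 1 - \<rho>" for s using bp_mult_zero_iff[OF r(1) b, of s] bp_commute[OF r(1), of "\<pi> s"] by simp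
    then have "1 \<le> 1 - \<rho>" using p bp_compl[OF r(1)] unfolding partition_of_unity_def by blast
    then show False using r bp_nonneg[of \<rho>] by simp
  qed
  then show ?thesis using that by blast
qed

lemma partition_of_unity_le:
  assumes p: "partition_of_unity \<pi>" and le: "\<And>s. \<pi> s \<bullet> v \<le> \<pi> s \<bullet> w"
  shows "v \<le> w"
proof -
  note b = partition_of_unity_bp[OF p]
  have "1 \<bullet> v \<le> 1 \<bullet> w"
  proof (rule local_le)
    fix \<rho> :: "'b orth" assume r: "\<rho> \<in> band_projections" "\<rho> \<noteq> 0"
    obtain s where s: "\<rho> * \<pi> s \<noteq> 0" by (rule partition_of_unity_meets[OF p r])
    have "(\<rho> * \<pi> s) \<bullet> v \<le> (\<rho> * \<pi> s) \<bullet> w" using bp_mono[OF r(1) le[of s]] by simp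
    then show "\<exists>\<rho>'\<in>band_projections. \<rho>' \<noteq> 0 \<and> \<rho>' \<le> \<rho> \<and> \<rho>' \<bullet> v \<le> \<rho>' \<bullet> w"
      using s bp_mult[OF r(1) b] bp_mult_le1[OF r(1) b] by blast
  qed simp
  then show ?thesis by simp
qed

lemma partition_of_unity_eq:
  assumes p: "partition_of_unity \<pi>" and "\<And>s. \<pi> s \<bullet> v = \<pi> s \<bullet> w"
  shows "v = w"
  by (rule order.antisym; rule partition_of_unity_le[OF p]) (simp_all add: assms)

lemma partition_of_unity_le_orth:
  assumes p: "partition_of_unity \<pi>" and le: "\<And>s. \<pi> s * S \<le> \<pi> s * T"
  shows "S \<le> T"
proof (rule orth_leI, rule partition_of_unity_le[OF p])
  fix x :: 'b and s assume "0 \<le> x"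
  then show "\<pi> s \<bullet> S \<bullet> x \<le> \<pi> s \<bullet> T \<bullet> x" using orth_leD[OF le[of s]] by simp
qed

text \<open>Measurable choice of an index. A maximal disjoint family of projections with a suitable
  index each is grouped by that index; the supremum of a group becomes \<open>\<pi> s\<close>, and
  the inequality passes to it by localization.\<close>

lemma partition_of_unity_choice:
  fixes S T :: "'s \<Rightarrow> 'e::dedekind_complete_vector_lattice orth"
  assumes dens: "\<And>\<rho>. \<rho> \<in> band_projections \<Longrightarrow> \<rho> \<noteq> 0 \<Longrightarrow>
    \<exists>\<rho>'\<in>band_projections. \<rho>' \<noteq> 0 \<and> \<rho>' \<le> \<rho> \<and> (\<exists>s. \<rho>' * S s \<le> \<rho>' * T s)"
  obtains \<pi> where "partition_of_unity \<pi>" "\<And>s. \<pi> s * S s \<le> \<pi> s * T s"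
proof -
  obtain A where A: "A \<subseteq> band_projections" "\<And>\<rho>. \<rho> \<in> A \<Longrightarrow> \<exists>s. \<rho> * S s \<le> \<rho> * T s"
    "\<And>\<rho> \<tau>. \<rho> \<in> A \<Longrightarrow> \<tau> \<in> A \<Longrightarrow> \<rho> \<noteq> \<tau> \<Longrightarrow> \<rho> * \<tau> = 0"
    "\<And>\<tau>. \<tau> \<in> band_projections \<Longrightarrow> (\<And>\<rho>. \<rho> \<in> A \<Longrightarrow> \<rho> * \<tau> = 0) \<Longrightarrow> \<tau> = 0"
    using exhaustion[of "\<lambda>\<rho>. \<exists>s. \<rho> * S s \<le> \<rho> * T s", OF dens] by blast
  obtain c where c: "\<And>\<rho>. \<rho> \<in> A \<Longrightarrow> \<rho> * S (c \<rho>) \<le> \<rho> * T (c \<rho>)" using A(2) by metis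
  \<comment> \<open>Indices that are never chosen get the supremum of {0}, so every
    \<open>B s\<close> is nonempty.\<close>
  define B where "B s = insert 0 {\<rho> \<in> A. c \<rho> = s}" for s
  have B: "B s \<noteq> {}" "B s \<subseteq> band_projections" for s using A(1) by (auto simp: B_def)
  define \<pi> where "\<pi> s = Sup (B s)" for s
  have bp: "\<pi> s \<in> band_projections" for s unfolding \<pi>_def by (rule bp_Sup(1)[OF B])
  have up: "\<rho> \<le> \<pi> s" if "\<rho> \<in> B s" for \<rho> s unfolding \<pi>_def by (rule bp_Sup(2)[OF B that])
  have zero: "\<pi> s * \<tau> = 0" if t: "\<tau> \<in> band_projections" "\<And>\<rho>. \<rho> \<in> B s \<Longrightarrow> \<rho> * \<tau> = 0" for s \<tau>
  proof -
    have "\<pi> s \<le> 1 - \<tau>" unfolding \<pi>_def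
      by (rule bp_Sup(3)[OF B]) (use t(2) bp_mult_zero_iff[OF t(1)] B(2) in blast)
    then show ?thesis using bp_mult_zero_iff[OF t(1) bp] by blast
  qed
  have meets: "\<exists>\<tau>\<in>B s. \<rho> * \<tau> \<noteq> 0" if r: "\<rho> \<in> band_projections" "\<rho> \<noteq> 0" "\<rho> \<le> \<pi> s" for \<rho> s
  proof (rule ccontr)
    assume n: "\<not> ?thesis"
    have "\<pi> s * \<rho> = 0" by (rule zero[OF r(1)]) (use n bp_commute[OF r(1)] in auto)
    then show False using bp_le_mult(2)[OF bp r(1,3)] r(2) by simp
  qed
  have part: "partition_of_unity \<pi>"
  proof (rule partition_of_unityI[OF bp])
    fix s t :: 's assume st: "s \<noteq> t"
    show "\<pi> s * \<pi> t = 0"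
    proof (rule zero[OF bp])
      fix \<rho> assume rho: "\<rho> \<in> B s"
      then have r: "\<rho> \<in> band_projections" using B(2) by blast
      have "\<pi> t * \<rho> = 0"
      proof (rule zero[OF r])
        fix \<tau> assume "\<tau> \<in> B t"
        then show "\<tau> * \<rho> = 0" using rho st A(3)[of \<tau> \<rho>] unfolding B_def by auto
      qed
      then show "\<rho> * \<pi> t = 0" using bp_commute[OF r] by metis
    qed
  next
    fix \<tau> assume t: "\<tau> \<in> band_projections" "\<And>s. \<pi> s * \<tau> = 0"
    show "\<tau> = 0"
    proof (rule A(4)[OF t(1)])
      fix \<rho> assume "\<rho> \<in> A"
      then have r: "\<rho> \<in> B (c \<rho>)" by (simp add: B_def)
      then have rb: "\<rho> \<in> band_projections" using B(2) by blast
      have "\<rho> * \<tau> \<le> \<pi> (c \<rho>) * \<tau>" by (rule mult_right_mono[OF up[OF r] bp_nonneg[OF t(1)]])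
      then show "\<rho> * \<tau> = 0" using t(2) bp_nonneg[OF bp_mult[OF rb t(1)]] by simp
    qed
  qed
  have "\<pi> s * S s \<le> \<pi> s * T s" for s
  proof (rule local_le_orth[OF bp])
    fix \<rho> assume r: "\<rho> \<in> band_projections" "\<rho> \<noteq> 0" "\<rho> \<le> \<pi> s"
    obtain \<tau> where t: "\<tau> \<in> B s" "\<rho> * \<tau> \<noteq> 0" using meets[OF r] by blast
    then have tb: "\<tau> \<in> band_projections" and "\<tau> * S s \<le> \<tau> * T s" using B(2) c by (auto simp: B_def)
    then have "(\<rho> * \<tau>) * S s \<le> (\<rho> * \<tau>) * T s"
      using bp_mult_mono[OF r(1), of "\<tau> * S s" "\<tau> * T s"] by (simp add: mult.assoc)
    then show "\<exists>\<rho>'\<in>band_projections. \<rho>' \<noteq> 0 \<and> \<rho>' \<le> \<rho> \<and> \<rho>' * S s \<le> \<rho>' * T s"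
      using t(2) bp_mult[OF r(1) tb] bp_mult_le1[OF r(1) tb] by blast
  qed
  then show ?thesis using that part by blast
qed

lemma scaleR_nonpos_cancel:
  fixes x :: "'e::ordered_real_vector"
  assumes "r *\<^sub>R x \<le> 0" "0 < r" shows "x \<le> 0"
  using scaleR_nonneg_nonpos[OF _ assms(1), of "1 / r"] assms(2) by simp

section \<open>Truncated ratios\<close>

text \<open>Think of \<open>trunc_ratio d v\<close> as \<open>min (v / d) 1\<close>, with value \<open>1\<close> where \<open>d\<close> vanishes. It turns
  \<open>E\<close>-valued norms into elements of the \<open>f\<close>-algebra of orthomorphisms.\<close>

definition trunc_ratio ::
  "'e::dedekind_complete_vector_lattice \<Rightarrow> 'e \<Rightarrow> 'e orth" where
  "trunc_ratio d v = Sup {T. 0 \<le> T \<and> T \<le> 1 \<and> T \<bullet> d \<le> v}"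

text \<open>Orthomorphisms are determined on the carrier of \<open>d\<close> by their value at
  \<open>d\<close>: if \<open>T\<close> exceeded some \<delta> > 0 on a nonzero band there,
  \<open>d\<close> would vanish on that band.\<close>

lemma le_annihilator_compl_kill:
  assumes d: "0 \<le> d" and T: "T \<bullet> d \<le> 0"
  shows "(1 - annihilator d) * T \<le> 0"
proof (rule ccontr)
  have c: "1 - annihilator d \<in> band_projections" by (rule bp_compl[OF annihilator_bp])
  assume "\<not> (1 - annihilator d) * T \<le> 0"
  then have "\<not> (1 - annihilator d) * T \<le> (1 - annihilator d) * 0" by simp
  then obtain \<rho> \<delta> where r: "\<rho> \<in> band_projections" "\<rho> \<noteq> 0" "\<rho> \<le> 1 - annihilator d"
    "(\<delta>::real) > 0" "\<rho> * 0 + \<delta> *\<^sub>R \<rho> \<le> \<rho> * T"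
    by (rule not_le_orthE[OF c])
  have "\<delta> *\<^sub>R (\<rho> \<bullet> d) \<le> \<rho> \<bullet> T \<bullet> d" using orth_leD[OF r(5) d] by simp
  also have "\<dots> \<le> 0" using bp_mono[OF r(1) T] by simp
  finally have "\<rho> \<bullet> d \<le> 0" using r(4) by (rule scaleR_nonpos_cancel)
  then have "\<rho> \<bullet> d = 0" using bp_pos[OF r(1) d] by simp
  then have "\<rho> \<le> annihilator d" by (rule annihilator_greatest[OF r(1)])
  then show False using bp_le_disjoint_zero[OF annihilator_bp r(1)] r by blast
qed

context
  fixes d v :: "'e::dedekind_complete_vector_lattice"
  assumes d0: "0 \<le> d" and v0: "0 \<le> v"
begin

lemma trunc_ratio_set: "0 \<in> {T. 0 \<le> T \<and> T \<le> 1 \<and> T \<bullet> d \<le> v}" "bdd_above {T. 0 \<le> T \<and> T \<le> 1 \<and> T \<bullet> d \<le> v}"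
  using v0 by (auto intro: bdd_aboveI[of _ 1])

lemma trunc_ratio_greatest: "0 \<le> T \<Longrightarrow> T \<le> 1 \<Longrightarrow> T \<bullet> d \<le> v \<Longrightarrow> T \<le> trunc_ratio d v"
  unfolding trunc_ratio_def by (rule cSup_upper[OF _ trunc_ratio_set(2)]) simp

lemma trunc_ratio_nonneg: "0 \<le> trunc_ratio d v"
  by (rule trunc_ratio_greatest) (simp_all add: v0)

lemma trunc_ratio_le_one: "trunc_ratio d v \<le> 1"
  unfolding trunc_ratio_def by (rule cSup_least) (use trunc_ratio_set(1) in blast, simp)

text \<open>Division with remainder 0: the supremum attains the truncated value. Otherwise the
  defect \<open>w\<close> would exceed \<epsilon> d somewhere, and adding \<epsilon> times the
  projection onto that place, cut off at 1, would give a larger candidate.\<close>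

lemma trunc_ratio_apply: "trunc_ratio d v \<bullet> d = inf v d"
proof (rule order.antisym)
  let ?A = "{T. 0 \<le> T \<and> T \<le> 1 \<and> T \<bullet> d \<le> v}"
  let ?L = "trunc_ratio d v"
  have ne: "?A \<noteq> {}" using trunc_ratio_set(1) by blast
  have Ld: "?L \<bullet> d \<le> d" using orth_leD[OF trunc_ratio_le_one d0] by simp
  have Ld0: "0 \<le> ?L \<bullet> d" by (rule orth_pos[OF trunc_ratio_nonneg d0])
  have "?L \<bullet> d = (SUP T\<in>?A. T \<bullet> d)" unfolding trunc_ratio_def
  proof (rule orth_apply_Sup[OF ne _ d0])
    fix x :: 'e assume x: "0 \<le> x"
    have "T \<bullet> x \<le> x" if "T \<le> 1" for T using orth_leD[OF that x] by simp
    then show "bdd_above ((\<lambda>T. T \<bullet> x) ` ?A)" by (intro bdd_aboveI[of _ x]) auto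
  qed
  also have "\<dots> \<le> v" by (rule cSUP_least[OF ne]) simp
  finally show upper: "?L \<bullet> d \<le> inf v d" using Ld by simp
  define w where "w = inf v d - ?L \<bullet> d"
  have w0: "0 \<le> w" using upper by (simp add: w_def)
  have "w \<le> inf v d" using Ld0 unfolding w_def by (subst diff_le_eq) (rule add_increasing2[OF _ order_refl])
  then have wd: "w \<le> d" by simp
  have "w \<le> 0"
  proof (rule archimedean_eps)
    fix \<epsilon> :: real assume e: "\<epsilon> > 0"
    \<comment> \<open>\<pi> projects onto the place where \<open>w\<close> exceeds \<epsilon> d. The
      candidate \<open>J\<close> shows that \<open>d\<close> vanishes there.\<close>
    obtain \<pi> where p: "\<pi> \<in> band_projections" "\<pi> \<bullet> (w - \<epsilon> *\<^sub>R d) = pprt (w - \<epsilon> *\<^sub>R d)"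
      by (rule principal_projection)
    define J where "J = ?L + \<epsilon> *\<^sub>R \<pi>"
    have J0: "0 \<le> J"
      unfolding J_def using e bp_nonneg[OF p(1)] trunc_ratio_nonneg
      by (intro add_nonneg_nonneg scaleR_nonneg_nonneg) auto
    have "0 \<le> \<pi> \<bullet> (w - \<epsilon> *\<^sub>R d)" unfolding p(2) by simp
    then have "\<epsilon> *\<^sub>R (\<pi> \<bullet> d) \<le> \<pi> \<bullet> w" by simp
    also have "\<dots> \<le> w" by (rule bp_apply_le[OF p(1) w0])
    finally have "?L \<bullet> d + \<epsilon> *\<^sub>R (\<pi> \<bullet> d) \<le> ?L \<bullet> d + w" by simp
    then have Jd: "J \<bullet> d \<le> inf v d" by (simp add: J_def w_def)
    then have "inf J 1 \<bullet> d = J \<bullet> d" using d0 by (simp add: orth_inf_apply inf_absorb1)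
    moreover have "inf J 1 \<le> ?L"
      by (rule trunc_ratio_greatest) (use J0 Jd calculation in auto)
    ultimately have "J \<bullet> d \<le> ?L \<bullet> d" using orth_leD[OF _ d0] by metis
    then have "\<epsilon> *\<^sub>R (\<pi> \<bullet> d) \<le> 0" by (simp add: J_def)
    then have "\<pi> \<bullet> d \<le> 0" using e by (rule scaleR_nonpos_cancel)
    then have pd: "\<pi> \<bullet> d = 0" using bp_pos[OF p(1) d0] by simp
    have "w - \<epsilon> *\<^sub>R d \<le> pprt (w - \<epsilon> *\<^sub>R d)" by (rule self_le_pprt)
    also have "\<dots> = \<pi> \<bullet> w" unfolding p(2)[symmetric] by (simp add: pd)
    also have "\<dots> \<le> 0" using bp_mono[OF p(1) wd] pd by simp
    finally show "w \<le> \<epsilon> *\<^sub>R d" by simp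
  qed
  then show "inf v d \<le> ?L \<bullet> d" by (simp add: w_def)
qed

lemma annihilator_le_trunc_ratio: "annihilator d \<le> trunc_ratio d v"
  by (rule trunc_ratio_greatest)
    (simp_all add: bp_nonneg bp_le_one annihilator_bp annihilator_apply v0)

lemma trunc_ratio_leI:
  assumes r: "\<rho> \<in> band_projections" "\<rho> \<le> 1 - annihilator d" and k: "\<rho> \<bullet> v \<le> \<kappa> *\<^sub>R (\<rho> \<bullet> d)"
  shows "\<rho> * trunc_ratio d v \<le> \<kappa> *\<^sub>R \<rho>"
proof -
  let ?T = "\<rho> * trunc_ratio d v - \<kappa> *\<^sub>R \<rho>"
  have "\<rho> \<bullet> inf v d \<le> \<rho> \<bullet> v" by (rule bp_mono[OF r(1)]) simp
  then have "?T \<bullet> d \<le> 0" using k by (auto simp: trunc_ratio_apply)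
  from le_annihilator_compl_kill[OF d0 this] have "\<rho> * ((1 - annihilator d) * ?T) \<le> 0"
    using mult_left_mono[OF _ bp_nonneg[OF r(1)]] by fastforce
  then have "\<rho> * ?T \<le> 0" by (simp add: bp_le_mult(3)[OF bp_compl[OF annihilator_bp] r])
  then show ?thesis using bp_idem[OF r(1)] by (simp add: right_diff_distrib flip: mult.assoc)
qed

text \<open>A ratio at most \<kappa> < 1 is not affected by the truncation. The excess
  \<open>a\<close> of \<open>v\<close> over \<kappa> d and the margin
  \<open>b = (1 - \<kappa>) d\<close> satisfy inf a b \<le> 0, so the positive part of
  \<open>a\<close> is carried by a projection that kills \<open>d\<close>, and such a projection
  does not meet the carrier of \<open>d\<close>.\<close>

lemma trunc_ratio_leD:
  assumes r: "\<rho> \<in> band_projections" "\<rho> \<le> 1 - annihilator d"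
    and k: "\<rho> * trunc_ratio d v \<le> \<kappa> *\<^sub>R \<rho>" "\<kappa> < 1"
  shows "\<rho> \<bullet> v \<le> \<kappa> *\<^sub>R (\<rho> \<bullet> d)"
proof -
  define a where "a = \<rho> \<bullet> v - \<kappa> *\<^sub>R (\<rho> \<bullet> d)"
  define b where "b = (1 - \<kappa>) *\<^sub>R (\<rho> \<bullet> d)"
  have b0: "0 \<le> b" using k(2) bp_pos[OF r(1) d0] by (simp add: b_def scaleR_nonneg_nonneg)
  have ab: "inf a b \<le> 0"
  proof -
    have "b = \<rho> \<bullet> d - \<kappa> *\<^sub>R (\<rho> \<bullet> d)" by (simp add: b_def algebra_simps)
    then have "inf a b = inf (\<rho> \<bullet> v) (\<rho> \<bullet> d) - \<kappa> *\<^sub>R (\<rho> \<bullet> d)"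
      using add_inf_distrib_right[of "\<rho> \<bullet> v" "\<rho> \<bullet> d" "- (\<kappa> *\<^sub>R (\<rho> \<bullet> d))"] by (simp add: a_def)
    also have "inf (\<rho> \<bullet> v) (\<rho> \<bullet> d) = (\<rho> * trunc_ratio d v) \<bullet> d"
      by (simp add: trunc_ratio_apply bp_inf_apply[OF r(1)])
    also have "\<dots> \<le> \<kappa> *\<^sub>R (\<rho> \<bullet> d)" using orth_leD[OF k(1) d0] by simp
    finally show ?thesis by simp
  qed
  have "inf (pprt a) b = 0"
  proof (rule order.antisym)
    define p where "p = inf (pprt a) b"
    obtain \<pi> where pi: "\<pi> \<in> band_projections" "\<pi> \<bullet> a = pprt a" by (rule principal_projection)
    have "\<pi> \<bullet> p \<le> \<pi> \<bullet> pprt a" by (rule bp_mono[OF pi(1)]) (simp add: p_def)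
    then have "\<pi> \<bullet> p \<le> \<pi> \<bullet> a" by (simp add: pi(2)[symmetric] bp_idem_apply[OF pi(1)])
    moreover have "\<pi> \<bullet> p \<le> \<pi> \<bullet> b" by (rule bp_mono[OF pi(1)]) (simp add: p_def)
    ultimately have "\<pi> \<bullet> p \<le> \<pi> \<bullet> inf a b" by (simp add: bp_inf_apply[OF pi(1)])
    then have 1: "\<pi> \<bullet> p \<le> 0" using bp_mono[OF pi(1) ab] by simp
    have "(1 - \<pi>) \<bullet> p \<le> (1 - \<pi>) \<bullet> pprt a" by (rule bp_mono[OF bp_compl[OF pi(1)]]) (simp add: p_def)
    then have "(1 - \<pi>) \<bullet> p \<le> 0" by (simp add: pi(2)[symmetric] bp_idem_apply[OF pi(1)])
    from add_nonpos_nonpos[OF 1 this] show "inf (pprt a) b \<le> 0" by (simp add: p_def)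
  qed (simp add: b0)
  then obtain \<tau> where t: "\<tau> \<in> band_projections" "\<tau> \<bullet> pprt a = pprt a" "\<tau> \<bullet> b = 0" by (rule bp_disjoint)
  have "(\<tau> * \<rho>) \<bullet> d = 0" using t(3) k(2) by (simp add: b_def)
  then have "\<tau> * \<rho> \<le> annihilator d" by (rule annihilator_greatest[OF bp_mult[OF t(1) r(1)]])
  moreover have "\<tau> * \<rho> \<le> 1 - annihilator d" using bp_mult_le2[OF t(1) r(1)] r(2) by (rule order_trans)
  ultimately have z: "\<tau> * \<rho> = 0" by (rule bp_le_disjoint_zero[OF annihilator_bp bp_mult[OF t(1) r(1)]])
  have "\<rho> \<bullet> pprt a = pprt a" by (simp add: bp_pprt_apply[OF r(1)] a_def bp_idem_apply[OF r(1)])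
  then have "pprt a = (\<tau> * \<rho>) \<bullet> pprt a" using t(2) by simp
  then have "pprt a = 0" unfolding z by simp
  then have "a \<le> 0" using self_le_pprt[of a] by simp
  then show ?thesis by (simp add: a_def)
qed

end

lemma abs_inf_diff_le:
  fixes a b c :: "'e::lattice_ab_group_add_abs"
  shows "\<bar>inf a c - inf b c\<bar> \<le> \<bar>a - b\<bar>"
proof -
  have *: "inf a c - inf b c \<le> \<bar>a - b\<bar>" for a b :: 'e
  proof -
    have "inf a c - \<bar>a - b\<bar> \<le> inf b c"
    proof (rule inf_greatest)
      have "inf a c \<le> b + \<bar>a - b\<bar>" using abs_ge_self[of "a - b"] by (simp add: diff_le_eq add.commute le_infI1)
      then show "inf a c - \<bar>a - b\<bar> \<le> b" by (simp add: diff_le_eq)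
      show "inf a c - \<bar>a - b\<bar> \<le> c" by (simp add: diff_le_eq add_increasing2)
    qed
    then show ?thesis using diff_le_eq add.commute by metis
  qed
  show ?thesis by (rule abs_leI) (use *[of a b] *[of b a] in \<open>simp_all add: abs_minus_commute\<close>)
qed

text \<open>The first estimate says nothing where \<open>d\<close> vanishes; the second one covers
  that part, since both ratios are 1 there.\<close>

lemma trunc_ratio_diff:
  assumes "0 \<le> d" "0 \<le> v" "0 \<le> v'"
  shows "\<bar>trunc_ratio d v - trunc_ratio d v'\<bar> \<bullet> d \<le> \<bar>v - v'\<bar>"
    "\<bar>trunc_ratio d v - trunc_ratio d v'\<bar> \<le> 1 - annihilator d"
proof -
  show "\<bar>trunc_ratio d v - trunc_ratio d v'\<bar> \<bullet> d \<le> \<bar>v - v'\<bar>"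
    using assms by (simp add: orth_abs_apply trunc_ratio_apply abs_inf_diff_le)
  have "trunc_ratio d u - trunc_ratio d u' \<le> 1 - annihilator d" if "0 \<le> u" "0 \<le> u'" for u u'
    by (intro diff_mono trunc_ratio_le_one annihilator_le_trunc_ratio) (use assms that in auto)
  then show "\<bar>trunc_ratio d v - trunc_ratio d v'\<bar> \<le> 1 - annihilator d"
    using assms by (intro abs_leI) simp_all
qed

text \<open>Carries order convergence from E to orthomorphisms: an eventual bound \<open>e\<close>
  of \<open>r\<close> yields the eventual bound \<open>trunc_ratio d e\<close> of \<open>R\<close>.
  A common lower bound \<open>L\<close> then satisfies \<open>L \<bullet> d \<le> 0\<close> and is
  \<le> 0 on the carrier of \<open>d\<close>; off the carrier the bound
  \<open>1 - annihilator d\<close> takes over.\<close>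

lemma order_null_lift:
  assumes d: "0 \<le> d" and R: "\<And>i. 0 \<le> R i" "\<And>i. R i \<le> 1 - annihilator d" "\<And>i. R i \<bullet> d \<le> r i"
    and r: "order_null r F"
  shows "order_null R F"
proof (rule order_nullI[of "1 - annihilator d"])
  note n = annihilator_bp[of d]
  show "0 \<le> 1 - annihilator d" by (rule bp_nonneg[OF bp_compl[OF n]])
  show "\<forall>\<^sub>F i in F. R i \<le> 1 - annihilator d" using R by simp
  fix L assume L: "\<And>D. 0 \<le> D \<Longrightarrow> \<forall>\<^sub>F i in F. R i \<le> D \<Longrightarrow> L \<le> D"
  have R1: "R i \<le> 1" for i using R(2) bp_le_one[OF bp_compl[OF n]] by (rule order_trans)
  have "L \<bullet> d \<le> 0"
  proof (rule order_nullD[OF r])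
    fix e assume e: "0 \<le> e" "\<forall>\<^sub>F i in F. r i \<le> e"
    have "\<forall>\<^sub>F i in F. R i \<le> trunc_ratio d e"
      using e(2) by eventually_elim (use R R1 order_trans in \<open>blast intro: trunc_ratio_greatest[OF d e(1)]\<close>)
    then have "L \<le> trunc_ratio d e" by (rule L[OF trunc_ratio_nonneg[OF d e(1)]])
    from orth_leD[OF this d] show "L \<bullet> d \<le> e" by (simp add: trunc_ratio_apply[OF d e(1)])
  qed
  from le_annihilator_compl_kill[OF d this] have 1: "(1 - annihilator d) * L \<le> 0" .
  have "L \<le> 1 - annihilator d" by (rule L) (use R(2) bp_nonneg[OF bp_compl[OF n]] in auto)
  from bp_mult_mono[OF n this] have "annihilator d * L \<le> 0" by (simp add: right_diff_distrib bp_idem[OF n])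
  from add_nonpos_nonpos[OF 1 this] show "L \<le> 0" by (simp add: algebra_simps)
qed

section \<open>Pure states\<close>

lemma bp_add:
  assumes "\<pi> \<in> band_projections" "\<rho> \<in> band_projections" "\<pi> * \<rho> = 0"
  shows "\<pi> + \<rho> \<in> band_projections"
proof -
  have "\<rho> * \<pi> = 0" using assms bp_commute[of \<pi> \<rho>] by simp
  moreover from this have "\<rho> \<le> 1 - \<pi>" using bp_mult_zero_iff assms by blast
  ultimately show ?thesis
    using assms by (simp add: band_projections_iff algebra_simps)
qed

lemma partition_of_unity_sum:
  assumes p: "partition_of_unity \<pi>" and K: "finite K"
  shows "sum \<pi> K \<in> band_projections" "s \<in> K \<Longrightarrow> sum \<pi> K * \<pi> s = \<pi> s" "s \<notin> K \<Longrightarrow> sum \<pi> K * \<pi> s = 0"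
proof -
  have s: "sum \<pi> K * \<pi> s = (if s \<in> K then \<pi> s else 0)" if "finite K" for K s
  proof -
    have "sum \<pi> K * \<pi> s = (\<Sum>t\<in>K. if t = s then \<pi> s else 0)"
      unfolding sum_distrib_right
      by (rule sum.cong) (use partition_of_unity_disjoint[OF p] bp_idem[OF partition_of_unity_bp[OF p]] in auto)
    then show ?thesis using that by simp
  qed
  then show "s \<in> K \<Longrightarrow> sum \<pi> K * \<pi> s = \<pi> s" "s \<notin> K \<Longrightarrow> sum \<pi> K * \<pi> s = 0" using K by simp_all
  show "sum \<pi> K \<in> band_projections" using K
  proof induction
    case (insert t K)
    then have "\<pi> t * sum \<pi> K = 0" using s[of K t] bp_commute[OF partition_of_unity_bp[OF p], of "sum \<pi> K" t] by simp
    then show ?case using insert bp_add[OF partition_of_unity_bp[OF p]] by simp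
  qed simp
qed

lemma partition_of_unity_le_sum:
  assumes p: "partition_of_unity \<pi>" and K: "finite K" "s \<in> K"
  shows "1 - sum \<pi> K \<le> 1 - \<pi> s"
  using partition_of_unity_sum[OF p K(1)] K bp_le_iff[OF _ partition_of_unity_bp[OF p]]
    bp_commute[OF partition_of_unity_bp[OF p]] by simp

lemma eventually_finite_subsets_at_top_mem:
  "\<forall>\<^sub>F K in finite_subsets_at_top UNIV. finite K \<and> s \<in> K"
  unfolding eventually_finite_subsets_at_top by (rule exI[of _ "{s}"]) auto

text \<open>A bounded net that is eventually \<le> 0 on each piece is eventually below
  \<open>(1 - \<pi> s) \<bullet> e\<close> for every single s; a lower bound of these elements is
  \<le> 0 on each piece.\<close>

lemma order_null_partition:
  assumes p: "partition_of_unity \<pi>" and e: "0 \<le> e" "\<forall>\<^sub>F i in F. r i \<le> e"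
    and z: "\<And>s. \<forall>\<^sub>F i in F. \<pi> s \<bullet> r i \<le> 0"
  shows "order_null r F"
proof -
  note b = partition_of_unity_bp[OF p]
  have ev: "\<forall>\<^sub>F i in F. r i \<le> (1 - \<pi> s) \<bullet> e" for s
    using z[of s] e(2)
  proof eventually_elim
    case (elim i)
    have "\<pi> s \<bullet> r i + (1 - \<pi> s) \<bullet> r i \<le> 0 + (1 - \<pi> s) \<bullet> e"
      by (intro add_mono elim(1) bp_mono[OF bp_compl[OF b] elim(2)])
    then show ?case by simp
  qed
  show ?thesis
  proof (rule order_nullI[OF e])
    fix L assume L: "\<And>d. 0 \<le> d \<Longrightarrow> \<forall>\<^sub>F i in F. r i \<le> d \<Longrightarrow> L \<le> d"
    show "L \<le> 0"
    proof (rule partition_of_unity_le[OF p])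
      fix s
      have "L \<le> (1 - \<pi> s) \<bullet> e" by (rule L[OF bp_pos[OF bp_compl[OF b] e(1)] ev])
      from bp_mono[OF b this, of s] show "\<pi> s \<bullet> L \<le> \<pi> s \<bullet> 0" by (simp add: bp_idem_apply[OF b])
    qed
  qed
qed

lemma partition_of_unity_null_orth:
  assumes p: "partition_of_unity \<pi>" and e: "0 \<le> T"
  shows "order_null (\<lambda>K. (1 - sum \<pi> K) * T) (finite_subsets_at_top UNIV)"
proof -
  note b = partition_of_unity_bp[OF p]
  have ev: "\<forall>\<^sub>F K in finite_subsets_at_top UNIV. (1 - sum \<pi> K) * T \<le> (1 - \<pi> s) * T" for s
    using eventually_finite_subsets_at_top_mem[of s]
    by eventually_elim (use mult_right_mono[OF partition_of_unity_le_sum[OF p] e] in blast)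
  have pos: "0 \<le> (1 - \<pi> s) * T" for s by (rule mult_nonneg_nonneg[OF bp_nonneg[OF bp_compl[OF b]] e])
  show ?thesis
  proof (rule order_nullI[OF pos[of undefined] ev])
    fix L assume L: "\<And>d. 0 \<le> d \<Longrightarrow> \<forall>\<^sub>F K in finite_subsets_at_top UNIV. (1 - sum \<pi> K) * T \<le> d \<Longrightarrow> L \<le> d"
    show "L \<le> 0"
    proof (rule partition_of_unity_le_orth[OF p])
      fix s
      have "L \<le> (1 - \<pi> s) * T" by (rule L[OF pos ev])
      from bp_mult_mono[OF b this, of s] show "\<pi> s * L \<le> \<pi> s * 0"
        by (simp add: algebra_simps bp_idem[OF b] flip: mult.assoc)
    qed
  qed
qed

text \<open>After a shift by \<open>c\<close> all pieces are nonnegative, and then the glued element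
  is the supremum of the pieces \<open>\<pi> s * \<psi> s\<close>.\<close>

lemma partition_of_unity_glue_orth:
  assumes p: "partition_of_unity \<pi>" and c: "\<And>s. \<bar>\<phi> s\<bar> \<le> c"
  obtains l where "\<And>s. \<pi> s * l = \<pi> s * \<phi> s"
proof -
  note b = partition_of_unity_bp[OF p]
  define \<psi> where "\<psi> s = \<phi> s + c" for s
  have psi: "0 \<le> \<psi> s \<and> \<psi> s \<le> c + c" for s
  proof
    have "- c \<le> \<phi> s" using abs_le_D2[OF c[of s]] by (simp only: minus_le_iff)
    then have "- c + c \<le> \<phi> s + c" by (rule add_right_mono)
    then show "0 \<le> \<psi> s" by (simp add: \<psi>_def)
    show "\<psi> s \<le> c + c" using abs_le_D1[OF c[of s]] by (simp add: \<psi>_def)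
  qed
  have up1: "\<pi> s * \<psi> s \<le> c + c" for s
    using mult_right_mono[OF bp_le_one[OF b], of "\<psi> s" s] psi[of s] by auto
  have bd: "bdd_above (range (\<lambda>s. \<pi> s * \<psi> s))" by (rule bdd_aboveI[of _ "c + c"]) (use up1 in auto)
  define u where "u = (SUP s. \<pi> s * \<psi> s)"
  have up: "\<pi> s * \<psi> s \<le> u" for s unfolding u_def by (rule cSUP_upper[OF _ bd]) simp
  have u0: "0 \<le> u" by (rule order_trans[OF _ up[of undefined]]) (use psi bp_nonneg[OF b] in simp)
  have eq: "\<pi> t * u = \<pi> t * \<psi> t" for t
  proof (rule order.antisym)
    have "u \<le> \<pi> t * \<psi> t + (1 - \<pi> t) * u" unfolding u_def
    proof (rule cSUP_least)
      fix s
      show "\<pi> s * \<psi> s \<le> \<pi> t * \<psi> t + (1 - \<pi> t) * (SUP s. \<pi> s * \<psi> s)"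
      proof (cases "s = t")
        case True
        then show ?thesis using u0 bp_nonneg[OF bp_compl[OF b]] by (simp add: u_def mult_nonneg_nonneg)
      next
        case False
        then have "\<pi> t * (\<pi> s * \<psi> s) = 0" using partition_of_unity_disjoint[OF p, of t s] by (simp flip: mult.assoc)
        then have "\<pi> s * \<psi> s = (1 - \<pi> t) * (\<pi> s * \<psi> s)" by (simp add: left_diff_distrib)
        also have "\<dots> \<le> (1 - \<pi> t) * u" by (rule bp_mult_mono[OF bp_compl[OF b] up])
        finally have "\<pi> s * \<psi> s \<le> (1 - \<pi> t) * u" .
        then show ?thesis using psi[of t] bp_nonneg[OF b] by (simp add: u_def add_increasing mult_nonneg_nonneg)
      qed
    qed simp
    from bp_mult_mono[OF b this, of t] show "\<pi> t * u \<le> \<pi> t * \<psi> t"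
      by (simp add: algebra_simps bp_idem[OF b] flip: mult.assoc)
    from bp_mult_mono[OF b up] show "\<pi> t * \<psi> t \<le> \<pi> t * u"
      by (metis bp_idem[OF b] mult.assoc)
  qed
  show ?thesis by (rule that[of "u - c"]) (simp add: right_diff_distrib eq \<psi>_def distrib_left)
qed

section \<open>Uniqueness of order limits, membership in \<open>Cuo\<close>, and components of pure
  states\<close>

lemma order_tendsto_unique:
  assumes "order_tendsto x l F" "order_tendsto x l' F" "F \<noteq> bot"
  shows "l = l'"
proof -
  have "order_null (\<lambda>i. \<bar>x i - l\<bar> + \<bar>x i - l'\<bar>) F"
    using assms(1,2) by (intro order_null_add) (simp_all add: order_tendsto_iff)
  then have "order_null (\<lambda>i. \<bar>l - l'\<bar>) F"
  proof (rule order_null_mono)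
    have "\<bar>l - l'\<bar> \<le> \<bar>x i - l\<bar> + \<bar>x i - l'\<bar>" for i
      using abs_triangle_ineq4[of "x i - l'" "x i - l"] by (simp add: add.commute)
    then show "\<forall>\<^sub>F i in F. \<bar>l - l'\<bar> \<le> \<bar>x i - l\<bar> + \<bar>x i - l'\<bar>" by simp
  qed
  from order_null_const_le[OF this assms(3)] show ?thesis by simp
qed

lemma Cuo_iff:
  fixes f :: "'s::uniform_space \<Rightarrow> 'x::ab_group_add"
  assumes nonneg: "\<And>s t. 0 \<le> nrm (f s - f t)" and tri: "\<And>s t. nrm (f s - f t) \<le> nrm (f s) + nrm (f t)"
  shows "f \<in> Cuo nrm X \<longleftrightarrow> range f \<subseteq> X \<and> (\<exists>e. \<forall>s. nrm (f s) \<le> e) \<and>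
    order_null (\<lambda>(s, t). nrm (f s - f t)) uniformity"
proof -
  have "(INF U\<in>{U. \<forall>\<^sub>F p in uniformity. p \<in> U}. SUP (s, t)\<in>U. nrm (f s - f t)) = 0 \<longleftrightarrow>
    order_null (\<lambda>(s, t). nrm (f s - f t)) uniformity" if e: "\<forall>s. nrm (f s) \<le> e" for e
    by (rule order_null_uniformity_iff[of _ "e + e"])
      (use nonneg order_trans[OF tri add_mono] e in auto)
  then show ?thesis unfolding Cuo_def by blast
qed

lemma Cuo_orth_iff:
  "\<phi> \<in> Cuo_orth \<longleftrightarrow> (\<exists>c. \<forall>s. \<bar>\<phi> s\<bar> \<le> c) \<and> order_null (\<lambda>(s, t). \<bar>\<phi> s - \<phi> t\<bar>) uniformity"
  by (subst Cuo_iff) (simp_all add: abs_triangle_ineq4)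

lemma Cuo_orth_bounded:
  assumes "\<phi> \<in> Cuo_orth" obtains c where "\<And>s. \<bar>\<phi> s\<bar> \<le> c" "0 \<le> c"
proof -
  obtain c where c: "\<And>s. \<bar>\<phi> s\<bar> \<le> c" using assms unfolding Cuo_orth_iff by blast
  moreover have "0 \<le> c" using abs_ge_zero c order_trans by blast
  ultimately show ?thesis by (rule that)
qed

text \<open>The partial sum over \<open>K\<close> equals \<open>sum \<pi> K * l\<close>, so its
  distance from \<open>l\<close> is \<open>(1 - sum \<pi> K) * \<bar>l\<bar>\<close>, which tends to
  0.\<close>

lemma pure_state_eq:
  assumes p: "partition_of_unity \<pi>" and phi: "\<phi> \<in> Cuo_orth" and l: "\<And>s. \<pi> s * l = \<pi> s * \<phi> s"
  shows "pure_state \<pi> \<phi> = l"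
proof -
  note b = partition_of_unity_bp[OF p]
  have "order_null (\<lambda>K. (1 - sum \<pi> K) * \<bar>l\<bar>) (finite_subsets_at_top UNIV)"
    by (rule partition_of_unity_null_orth[OF p abs_ge_zero])
  then have "order_null (\<lambda>K. \<bar>sum (\<lambda>s. \<pi> s * \<phi> s) K - l\<bar>) (finite_subsets_at_top UNIV)"
  proof (rule order_null_mono)
    have *: "\<bar>sum (\<lambda>s. \<pi> s * \<phi> s) K - l\<bar> = (1 - sum \<pi> K) * \<bar>l\<bar>" if K: "finite K" for K
    proof -
      have "sum (\<lambda>s. \<pi> s * \<phi> s) K = sum \<pi> K * l" by (simp add: sum_distrib_right l)
      then have "\<bar>sum (\<lambda>s. \<pi> s * \<phi> s) K - l\<bar> = \<bar>(1 - sum \<pi> K) * l\<bar>"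
        by (simp add: left_diff_distrib abs_minus_commute)
      then show ?thesis by (simp add: bp_abs_mult[OF bp_compl[OF partition_of_unity_sum(1)[OF p K]]])
    qed
    show "\<forall>\<^sub>F K in finite_subsets_at_top UNIV. \<bar>sum (\<lambda>s. \<pi> s * \<phi> s) K - l\<bar> \<le> (1 - sum \<pi> K) * \<bar>l\<bar>"
      using eventually_finite_subsets_at_top_mem[of undefined] by eventually_elim (simp add: *)
  qed
  then have "order_sums (\<lambda>s. \<pi> s * \<phi> s) l" by (simp add: order_sums_def order_tendsto_iff)
  then have "(THE l. order_sums (\<lambda>s. \<pi> s * \<phi> s) l) = l"
    by (intro the_equality) (auto simp: order_sums_def intro: order_tendsto_unique)
  then show ?thesis using phi by (simp add: pure_state_def)
qed

lemma pure_state_mult: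
  assumes p: "partition_of_unity \<pi>" and phi: "\<phi> \<in> Cuo_orth"
  shows "\<pi> s * pure_state \<pi> \<phi> = \<pi> s * \<phi> s"
proof -
  obtain c where c: "\<And>s. \<bar>\<phi> s\<bar> \<le> c" using Cuo_orth_bounded[OF phi] by blast
  obtain l where l: "\<And>s. \<pi> s * l = \<pi> s * \<phi> s" using partition_of_unity_glue_orth[where \<phi>=\<phi>, OF p c] by blast
  then show ?thesis using pure_state_eq[OF p phi l] by simp
qed

section \<open>Banach--Kantorovich spaces\<close>

locale banach_kantorovich =
  fixes scale :: "'k::real_normed_field \<Rightarrow> 'x::ab_group_add \<Rightarrow> 'x"
    and nrm :: "'x \<Rightarrow> 'e::dedekind_complete_vector_lattice"
    and Xt :: "'x set"
  assumes bk: "banach_kantorovich_space scale nrm Xt"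
begin

lemma lns: "lattice_normed_space scale nrm Xt"
  using bk by (simp add: banach_kantorovich_space_def)

sublocale vs: vector_space scale
  using lns by (simp add: lattice_normed_space_def)

lemma sub: "vs.subspace Xt"
  using lns by (simp add: lattice_normed_space_def)

lemmas Xt_zero [simp] = vs.subspace_0[OF sub]
  and Xt_add [simp] = vs.subspace_add[OF sub]
  and Xt_diff [simp] = vs.subspace_diff[OF sub]
  and Xt_neg [simp] = vs.subspace_neg[OF sub]
  and Xt_scale [simp] = vs.subspace_scale[OF sub]
  and Xt_sum = vs.subspace_sum[OF sub]

lemma nrm_ge_0 [simp]: "x \<in> Xt \<Longrightarrow> 0 \<le> nrm x"
  and nrm_zeroD: "x \<in> Xt \<Longrightarrow> nrm x = 0 \<Longrightarrow> x = 0"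
  and nrm_scale: "x \<in> Xt \<Longrightarrow> nrm (scale c x) = norm c *\<^sub>R nrm x"
  and nrm_triangle: "x \<in> Xt \<Longrightarrow> y \<in> Xt \<Longrightarrow> nrm (x + y) \<le> nrm x + nrm y"
  using lns by (simp_all add: lattice_normed_space_def)

lemma nrm_zero [simp]: "nrm 0 = 0"
  using nrm_scale[of 0 0] by simp

lemma nrm_minus: "x \<in> Xt \<Longrightarrow> nrm (- x) = nrm x"
  using nrm_scale[of x "- 1"] by simp

lemma nrm_diff_commute: "x \<in> Xt \<Longrightarrow> y \<in> Xt \<Longrightarrow> nrm (x - y) = nrm (y - x)"
  using nrm_minus[of "x - y"] by simp

lemma nrm_triangle_diff: "x \<in> Xt \<Longrightarrow> y \<in> Xt \<Longrightarrow> nrm (x - y) \<le> nrm x + nrm y"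
  using nrm_triangle[of x "- y"] by (simp add: nrm_minus)

lemma nrm_triangle3: "x \<in> Xt \<Longrightarrow> y \<in> Xt \<Longrightarrow> z \<in> Xt \<Longrightarrow> nrm (x - z) \<le> nrm (x - y) + nrm (y - z)"
  using nrm_triangle[of "x - y" "y - z"] by simp

lemma nrm_triangle3': "x \<in> Xt \<Longrightarrow> y \<in> Xt \<Longrightarrow> z \<in> Xt \<Longrightarrow> nrm (x - z) \<le> nrm (x - y) + nrm (z - y)"
  using nrm_triangle3[of x y z] nrm_diff_commute[of y z] by simp

lemma nrm_triangle_inv: "x \<in> Xt \<Longrightarrow> y \<in> Xt \<Longrightarrow> nrm x \<le> nrm y + nrm (x - y)"
  using nrm_triangle[of y "x - y"] by simp

lemma nrm_diff_abs_le:
  assumes "x \<in> Xt" "y \<in> Xt" shows "\<bar>nrm x - nrm y\<bar> \<le> nrm (x - y)"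
proof (rule abs_leI)
  show "nrm x - nrm y \<le> nrm (x - y)"
    using nrm_triangle_inv[OF assms] by (simp add: diff_le_eq add.commute)
  show "- (nrm x - nrm y) \<le> nrm (x - y)"
    using nrm_triangle_inv[OF assms(2,1)] nrm_diff_commute[OF assms] by (simp add: diff_le_eq add.commute)
qed

lemma nrm_le_zeroD: "x \<in> Xt \<Longrightarrow> y \<in> Xt \<Longrightarrow> nrm (x - y) \<le> 0 \<Longrightarrow> x = y"
  using nrm_zeroD[of "x - y"] order.antisym[OF _ nrm_ge_0, of "x - y"] by auto

lemma bp_nrm_eq_0: "\<pi> \<in> band_projections \<Longrightarrow> x \<in> Xt \<Longrightarrow> \<pi> \<bullet> nrm x \<le> 0 \<Longrightarrow> \<pi> \<bullet> nrm x = 0"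
  by (rule order.antisym[OF _ bp_pos[OF _ nrm_ge_0]])

text \<open>Completeness is defined for filters on the space itself; an indexed family is pushed
  forward with \<open>filtermap z\<close>.\<close>

lemma complete:
  assumes F: "F \<noteq> bot" "\<forall>\<^sub>F i in F. z i \<in> Xt"
    and cauchy: "order_null (\<lambda>(i, j). nrm (z i - z j)) (F \<times>\<^sub>F F)"
  obtains y where "y \<in> Xt" "order_null (\<lambda>i. nrm (y - z i)) F"
proof -
  let ?G = "filtermap z F"
  have GG: "?G \<times>\<^sub>F ?G = filtermap (map_prod z z) (F \<times>\<^sub>F F)"
    by (simp add: prod_filtermap1 prod_filtermap2 filtermap_filtermap apfst_def apsnd_def map_prod_def o_def case_prod_unfold)
  have "order_null (\<lambda>p. \<bar>(case map_prod z z p of (x, y) \<Rightarrow> nrm (x - y)) - 0\<bar>) (F \<times>\<^sub>F F)"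
  proof (rule order_null_mono[OF cauchy])
    show "\<forall>\<^sub>F p in F \<times>\<^sub>F F. \<bar>(case map_prod z z p of (x, y) \<Rightarrow> nrm (x - y)) - 0\<bar> \<le> (case p of (i, j) \<Rightarrow> nrm (z i - z j))"
      using eventually_prodI[OF F(2) F(2)] by eventually_elim auto
  qed
  then have "order_tendsto (\<lambda>(x, y). nrm (x - y)) 0 (?G \<times>\<^sub>F ?G)"
    unfolding order_tendsto_iff GG order_null_filtermap .
  moreover have "?G \<noteq> bot" "\<forall>\<^sub>F x in ?G. x \<in> Xt"
    using F by (simp_all add: filtermap_bot_iff eventually_filtermap)
  ultimately obtain y where y: "y \<in> Xt" "order_tendsto (\<lambda>x. nrm (y - x)) 0 ?G"
    using bk unfolding banach_kantorovich_space_def norm_order_complete_def by blast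
  have "order_null (\<lambda>i. \<bar>nrm (y - z i)\<bar>) F"
    using y(2) by (simp add: order_tendsto_iff order_null_filtermap)
  then have "order_null (\<lambda>i. nrm (y - z i)) F" by (rule order_null_mono) (intro always_eventually allI abs_ge_self)
  then show ?thesis using that y(1) by blast
qed

text \<open>Decomposability splits off a part \<open>y\<close> of norm
  \<open>\<pi> \<bullet> nrm x\<close>. It stands for \<pi> x as long as no action is
  available.\<close>

lemma projection_ex:
  assumes p: "\<pi> \<in> band_projections" and x: "x \<in> Xt"
  obtains y where "y \<in> Xt" "(1 - \<pi>) \<bullet> nrm y = 0" "\<pi> \<bullet> nrm (x - y) = 0"
proof -
  have "nrm x = \<pi> \<bullet> nrm x + (1 - \<pi>) \<bullet> nrm x" by simp
  then obtain y z where yz: "y \<in> Xt" "z \<in> Xt" "x = y + z" "nrm y = \<pi> \<bullet> nrm x" "nrm z = (1 - \<pi>) \<bullet> nrm x"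
    using bk bp_pos[OF p nrm_ge_0[OF x]] bp_pos[OF bp_compl[OF p] nrm_ge_0[OF x]] x
    unfolding banach_kantorovich_space_def decomposable_def by blast
  then show ?thesis using that[of y] by (simp add: bp_idem_apply[OF p])
qed

text \<open>\<open>g s\<close> is the part of \<open>f s\<close> in the band of
  \<open>\<pi> s\<close>. The finite sums of the \<open>g s\<close> are bounded by \<open>e\<close>
  and agree with \<open>f t\<close> on \<open>\<pi> t\<close> as soon as \<open>t\<close> is
  included, so they form a Cauchy net.\<close>

lemma partition_of_unity_glue:
  assumes p: "partition_of_unity \<pi>" and f: "\<And>s. f s \<in> Xt" and e: "0 \<le> e" "\<And>s. \<pi> s \<bullet> nrm (f s) \<le> e"
  obtains y where "y \<in> Xt" "\<And>s. \<pi> s \<bullet> nrm (y - f s) = 0"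
proof -
  note b = partition_of_unity_bp[OF p]
  have "\<exists>g. \<forall>s. g s \<in> Xt \<and> (1 - \<pi> s) \<bullet> nrm (g s) = 0 \<and> \<pi> s \<bullet> nrm (f s - g s) = 0"
  proof (intro choice allI)
    fix s
    obtain y where "y \<in> Xt" "(1 - \<pi> s) \<bullet> nrm y = 0" "\<pi> s \<bullet> nrm (f s - y) = 0"
      by (rule projection_ex[OF b f])
    then show "\<exists>y. y \<in> Xt \<and> (1 - \<pi> s) \<bullet> nrm y = 0 \<and> \<pi> s \<bullet> nrm (f s - y) = 0" by blast
  qed
  then obtain g where g: "\<And>s. g s \<in> Xt" "\<And>s. (1 - \<pi> s) \<bullet> nrm (g s) = 0" "\<And>s. \<pi> s \<bullet> nrm (f s - g s) = 0"
    by blast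
  define z where "z K = sum g K" for K
  have zX: "z K \<in> Xt" for K unfolding z_def by (rule Xt_sum) (use g(1) in simp)
  have off: "\<pi> t \<bullet> nrm (g s) = 0" if "s \<noteq> t" for s t
  proof -
    have "\<pi> t \<bullet> nrm (g s) = \<pi> t \<bullet> \<pi> s \<bullet> nrm (g s)" using g(2)[of s] by simp
    also have "\<dots> = (\<pi> t * \<pi> s) \<bullet> nrm (g s)" by simp
    also have "\<dots> = 0" using partition_of_unity_disjoint[OF p, of t s] that by (simp del: orth_apply_simps(11))
    finally show ?thesis .
  qed
  have z0: "\<pi> t \<bullet> nrm (z K) = 0" if "finite K" "t \<notin> K" for K t
    using that
  proof (induction K)
    case (insert s K)
    have "\<pi> t \<bullet> nrm (z (insert s K)) \<le> \<pi> t \<bullet> (nrm (g s) + nrm (z K))"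
      by (rule bp_mono[OF b]) (use insert g(1) zX in \<open>simp add: z_def nrm_triangle\<close>)
    also have "\<dots> = 0" using insert off[of s t] by auto
    finally show ?case by (rule bp_nrm_eq_0[OF b zX])
  qed (simp add: z_def)
  have zf: "\<pi> t \<bullet> nrm (z K - f t) = 0" if K: "finite K" "t \<in> K" for K t
  proof -
    have "z K = g t + z (K - {t})" using K by (simp add: z_def sum.remove)
    then have eq: "z K - f t = z (K - {t}) - (f t - g t)" by simp
    have "nrm (z K - f t) \<le> nrm (z (K - {t})) + nrm (f t - g t)"
      unfolding eq by (rule nrm_triangle_diff[OF zX]) (use f g(1) in simp)
    from bp_mono[OF b this, of t] have "\<pi> t \<bullet> nrm (z K - f t) \<le> 0" using z0[of "K - {t}" t] K g(3)[of t] by simp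
    then show ?thesis by (rule bp_nrm_eq_0[OF b Xt_diff[OF zX f]])
  qed
  have ze: "nrm (z K) \<le> e" if K: "finite K" for K
  proof (rule partition_of_unity_le[OF p])
    fix t
    show "\<pi> t \<bullet> nrm (z K) \<le> \<pi> t \<bullet> e"
    proof (cases "t \<in> K")
      case True
      have "nrm (z K) \<le> nrm (f t) + nrm (z K - f t)" by (rule nrm_triangle_inv[OF zX f])
      from bp_mono[OF b this, of t] have "\<pi> t \<bullet> nrm (z K) \<le> \<pi> t \<bullet> \<pi> t \<bullet> nrm (f t)"
        using zf[OF K True] bp_idem_apply[OF b] by simp
      also have "\<dots> \<le> \<pi> t \<bullet> e" by (rule bp_mono[OF b e(2)])
      finally show ?thesis .
    next
      case False
      then show ?thesis using z0[OF K] bp_pos[OF b e(1)] by simp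
    qed
  qed
  let ?F = "finite_subsets_at_top (UNIV :: 'a set)"
  have mem: "\<forall>\<^sub>F (K, L) in ?F \<times>\<^sub>F ?F. (finite K \<and> t \<in> K) \<and> (finite L \<and> t \<in> L)" for t
    using eventually_prodI[OF eventually_finite_subsets_at_top_mem[of t] eventually_finite_subsets_at_top_mem[of t]]
    by (simp add: case_prod_unfold)
  have null: "order_null (\<lambda>(K, L). nrm (z K - z L)) (?F \<times>\<^sub>F ?F)"
  proof (rule order_null_partition[OF p, of "e + e"])
    show "0 \<le> e + e" using e by simp
    show "\<forall>\<^sub>F i in ?F \<times>\<^sub>F ?F. (case i of (K, L) \<Rightarrow> nrm (z K - z L)) \<le> e + e"
      using mem[of undefined]
      by eventually_elim (use order_trans[OF nrm_triangle_diff[OF zX zX] add_mono[OF ze ze]] in auto)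
    fix t
    show "\<forall>\<^sub>F i in ?F \<times>\<^sub>F ?F. \<pi> t \<bullet> (case i of (K, L) \<Rightarrow> nrm (z K - z L)) \<le> 0"
      using mem[of t]
    proof eventually_elim
      case (elim i)
      obtain K L where i: "i = (K, L)" by force
      have "nrm (z K - z L) \<le> nrm (z K - f t) + nrm (z L - f t)" by (rule nrm_triangle3'[OF zX f zX])
      from bp_mono[OF b this, of t] show ?case using zf[of K t] zf[of L t] elim i by simp
    qed
  qed
  obtain y where y: "y \<in> Xt" "order_null (\<lambda>K. nrm (y - z K)) ?F"
    by (rule complete[OF finite_subsets_at_top_neq_bot always_eventually[OF allI[OF zX]] null])
  have "\<pi> t \<bullet> nrm (y - f t) \<le> 0" for t
  proof (rule order_null_const_le[OF order_null_mono[OF y(2)] finite_subsets_at_top_neq_bot])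
    show "\<forall>\<^sub>F K in ?F. \<pi> t \<bullet> nrm (y - f t) \<le> nrm (y - z K)"
      using eventually_finite_subsets_at_top_mem[of t]
    proof eventually_elim
      case (elim K)
      have "nrm (y - f t) \<le> nrm (y - z K) + nrm (z K - f t)" by (rule nrm_triangle3[OF y(1) zX f])
      from bp_mono[OF b this, of t] have "\<pi> t \<bullet> nrm (y - f t) \<le> \<pi> t \<bullet> nrm (y - z K)"
        using zf elim by simp
      also have "\<dots> \<le> nrm (y - z K)" by (rule bp_apply_le[OF b]) (use y zX in simp)
      finally show ?case .
    qed
  qed
  then have "\<pi> t \<bullet> nrm (y - f t) = 0" for t
    by (rule bp_nrm_eq_0[OF b Xt_diff[OF y(1) f]])
  then show ?thesis using that y by blast
qed

section \<open>The action of the orthomorphisms\<close>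

abbreviation rscale :: "real \<Rightarrow> 'x \<Rightarrow> 'x" where "rscale r \<equiv> scale (of_real r)"

lemma nrm_rscale_diff:
  assumes "x \<in> Xt" shows "nrm (rscale r x - rscale t x) = \<bar>r - t\<bar> *\<^sub>R nrm x"
proof -
  have "rscale r x - rscale t x = rscale (r - t) x" by (simp add: vs.scale_left_diff_distrib)
  then show ?thesis using assms by (simp only: nrm_scale norm_of_real)
qed

text \<open>\<open>y\<close> is an \<open>\<epsilon>\<close>-approximate value of \<open>a x\<close> if it is that close to \<open>r x\<close> wherever \<open>a\<close> is
  close to the real number \<open>r\<close>.\<close>

definition approx_value :: "real \<Rightarrow> 'e orth \<Rightarrow> 'x \<Rightarrow> 'x \<Rightarrow> bool" where
  "approx_value \<epsilon> a x y \<longleftrightarrow> y \<in> Xt \<and> (\<forall>\<rho>\<in>band_projections. \<forall>r \<delta>.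
     \<rho> * \<bar>a - r *\<^sub>R 1\<bar> \<le> \<delta> *\<^sub>R \<rho> \<longrightarrow> \<rho> \<bullet> nrm (y - rscale r x) \<le> (\<epsilon> + \<delta>) *\<^sub>R (\<rho> \<bullet> nrm x))"

lemma real_approx_dist:
  assumes r: "\<rho> \<in> band_projections" "\<rho> \<noteq> 0"
    and s: "\<rho> * \<bar>a - s *\<^sub>R 1\<bar> \<le> \<delta> *\<^sub>R \<rho>" and t: "\<rho> * \<bar>a - t *\<^sub>R 1\<bar> \<le> \<epsilon> *\<^sub>R \<rho>"
  shows "\<bar>s - t\<bar> \<le> \<delta> + \<epsilon>"
proof -
  have *: "s - t \<le> \<delta> + \<epsilon>" if s: "\<rho> * \<bar>a - s *\<^sub>R 1\<bar> \<le> \<delta> *\<^sub>R \<rho>" and t: "\<rho> * \<bar>a - t *\<^sub>R 1\<bar> \<le> \<epsilon> *\<^sub>R \<rho>"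
    for s t \<delta> \<epsilon>
  proof (rule bp_scaleR_le[OF r])
    have "\<rho> * - (a - s *\<^sub>R 1) \<le> \<rho> * \<bar>a - s *\<^sub>R 1\<bar>" by (rule bp_mult_mono[OF r(1) abs_ge_minus_self])
    moreover have "\<rho> * (a - t *\<^sub>R 1) \<le> \<rho> * \<bar>a - t *\<^sub>R 1\<bar>" by (rule bp_mult_mono[OF r(1) abs_ge_self])
    ultimately have "\<rho> * - (a - s *\<^sub>R 1) + \<rho> * (a - t *\<^sub>R 1) \<le> \<delta> *\<^sub>R \<rho> + \<epsilon> *\<^sub>R \<rho>"
      using s t by (meson add_mono order_trans)
    then show "(s - t) *\<^sub>R \<rho> \<le> (\<delta> + \<epsilon>) *\<^sub>R \<rho>" by (simp add: algebra_simps)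
  qed
  show ?thesis using *[OF s t] *[OF t s] by linarith
qed

text \<open>Locally both elements are compared with \<open>t x\<close> for a real \<open>t\<close>
  within (\<epsilon> + \<delta>) / 2 of \<open>a\<close>; the errors add up to 2 (\<epsilon> +
  \<delta>). The accuracy must be positive, hence the assumption on the sum.\<close>

lemma approx_value_dist:
  assumes x: "x \<in> Xt" and y: "approx_value \<epsilon> a x y" "approx_value \<delta> a x z" and e: "\<epsilon> + \<delta> > 0"
  shows "nrm (y - z) \<le> (2 * (\<epsilon> + \<delta>)) *\<^sub>R nrm x"
proof -
  have yz: "y \<in> Xt" "z \<in> Xt" using y by (auto simp: approx_value_def)
  have "1 \<bullet> nrm (y - z) \<le> 1 \<bullet> (2 * (\<epsilon> + \<delta>)) *\<^sub>R nrm x"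
  proof (rule local_le[OF bp_one])
    fix \<rho> :: "'e orth" assume "\<rho> \<in> band_projections" "\<rho> \<noteq> 0"
    then obtain \<rho>' t where r: "\<rho>' \<in> band_projections" "\<rho>' \<noteq> 0" "\<rho>' \<le> \<rho>" "\<rho>' * \<bar>a - t *\<^sub>R 1\<bar> \<le> ((\<epsilon> + \<delta>) / 2) *\<^sub>R \<rho>'"
      using e by (auto intro: orth_real_approx[of \<rho> "(\<epsilon> + \<delta>) / 2" a])
    have "nrm (y - z) \<le> nrm (y - rscale t x) + nrm (z - rscale t x)" by (rule nrm_triangle3') (use yz x in auto)
    from bp_mono[OF r(1) this]
    have "\<rho>' \<bullet> nrm (y - z) \<le> \<rho>' \<bullet> nrm (y - rscale t x) + \<rho>' \<bullet> nrm (z - rscale t x)" by simp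
    also have "\<dots> \<le> (\<epsilon> + (\<epsilon> + \<delta>) / 2) *\<^sub>R (\<rho>' \<bullet> nrm x) + (\<delta> + (\<epsilon> + \<delta>) / 2) *\<^sub>R (\<rho>' \<bullet> nrm x)"
      by (rule add_mono) (use y r in \<open>auto simp: approx_value_def\<close>)
    also have "\<dots> = \<rho>' \<bullet> (2 * (\<epsilon> + \<delta>)) *\<^sub>R nrm x" 
    proof -
      have "\<epsilon> + (\<epsilon> + \<delta>) / 2 + (\<delta> + (\<epsilon> + \<delta>) / 2) = 2 * (\<epsilon> + \<delta>)" by (simp add: field_simps)
      then show ?thesis by (simp only: orth_apply_simps flip: scaleR_add_left)
    qed
    finally show "\<exists>\<rho>'\<in>band_projections. \<rho>' \<noteq> 0 \<and> \<rho>' \<le> \<rho> \<and> \<rho>' \<bullet> nrm (y - z) \<le> \<rho>' \<bullet> (2 * (\<epsilon> + \<delta>)) *\<^sub>R nrm x"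
      using r by blast
  qed
  then show ?thesis by simp
qed

lemma approx_value_unique:
  assumes x: "x \<in> Xt" and y: "approx_value 0 a x y" "approx_value 0 a x z"
  shows "y = z"
proof (rule nrm_le_zeroD)
  show yz: "y \<in> Xt" "z \<in> Xt" using y by (auto simp: approx_value_def)
  have mono: "approx_value \<epsilon> a x w" if w: "approx_value 0 a x w" and e: "\<epsilon> > 0" for \<epsilon> w
    unfolding approx_value_def
  proof (intro conjI ballI allI impI)
    show "w \<in> Xt" using w by (simp add: approx_value_def)
    fix \<rho> :: "'e orth" and r \<delta> assume r: "\<rho> \<in> band_projections" "\<rho> * \<bar>a - r *\<^sub>R 1\<bar> \<le> \<delta> *\<^sub>R \<rho>"
    have "\<rho> \<bullet> nrm (w - rscale r x) \<le> (0 + \<delta>) *\<^sub>R (\<rho> \<bullet> nrm x)" using w r by (simp add: approx_value_def)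
    also have "\<dots> \<le> (\<epsilon> + \<delta>) *\<^sub>R (\<rho> \<bullet> nrm x)"
      using e x by (intro scaleR_right_mono bp_pos[OF r(1)]) auto
    finally show "\<rho> \<bullet> nrm (w - rscale r x) \<le> (\<epsilon> + \<delta>) *\<^sub>R (\<rho> \<bullet> nrm x)" .
  qed
  show "nrm (y - z) \<le> 0"
  proof (rule archimedean_eps)
    fix \<epsilon> :: real assume e: "\<epsilon> > 0"
    show "nrm (y - z) \<le> \<epsilon> *\<^sub>R nrm x"
      using approx_value_dist[OF x mono[OF y(1)] mono[OF y(2)], of "\<epsilon> / 4" "\<epsilon> / 4"] e by simp
  qed
qed

text \<open>The partition is indexed by the real numbers themselves: on \<open>\<pi> t\<close> the
  orthomorphism is within \<epsilon> of \<open>t\<close>, and the multiples \<open>t x\<close> are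
  glued.\<close>

lemma approx_value_ex:
  assumes x: "x \<in> Xt" and e: "\<epsilon> > 0"
  shows "\<exists>y. approx_value \<epsilon> a x y"
proof -
  obtain \<pi> :: "real \<Rightarrow> 'e orth" where p: "partition_of_unity \<pi>"
    and pt: "\<And>t. \<pi> t * \<bar>a - t *\<^sub>R 1\<bar> \<le> \<pi> t * (\<epsilon> *\<^sub>R 1)"
  proof (rule partition_of_unity_choice[of "\<lambda>t. \<bar>a - t *\<^sub>R 1\<bar>" "\<lambda>t. \<epsilon> *\<^sub>R 1"])
    fix \<rho> :: "'e orth" assume "\<rho> \<in> band_projections" "\<rho> \<noteq> 0"
    then obtain \<rho>' t where "\<rho>' \<in> band_projections" "\<rho>' \<noteq> 0" "\<rho>' \<le> \<rho>" "\<rho>' * \<bar>a - t *\<^sub>R 1\<bar> \<le> \<epsilon> *\<^sub>R \<rho>'"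
      by (rule orth_real_approx[OF _ _ e])
    then show "\<exists>\<rho>'\<in>band_projections. \<rho>' \<noteq> 0 \<and> \<rho>' \<le> \<rho> \<and> (\<exists>s. \<rho>' * \<bar>a - s *\<^sub>R 1\<bar> \<le> \<rho>' * (\<epsilon> *\<^sub>R 1))"
      by auto
  qed blast
  note b = partition_of_unity_bp[OF p]
  \<comment> \<open>Gluing needs a common bound for the pieces. It exists because \<bar>t\<bar> is
    at most \<bar>a\<bar> + \<epsilon> on \<open>\<pi> t\<close>, however large the index
    \<open>t\<close> is.\<close>
  have bound: "\<pi> t \<bullet> nrm (rscale t x) \<le> \<bar>a\<bar> \<bullet> nrm x + \<epsilon> *\<^sub>R nrm x" for t
  proof -
    have "\<bar>t *\<^sub>R 1\<bar> \<le> \<bar>a\<bar> + \<bar>a - t *\<^sub>R 1\<bar>"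
      using abs_triangle_ineq4[of a "a - t *\<^sub>R 1"] by simp
    moreover have "\<bar>t\<bar> *\<^sub>R (1 :: 'e orth) \<le> \<bar>t *\<^sub>R 1\<bar>"
      using abs_ge_self[of "t *\<^sub>R (1 :: 'e orth)"] abs_ge_minus_self[of "t *\<^sub>R (1 :: 'e orth)"]
      by (cases "t \<ge> 0") simp_all
    ultimately have "\<bar>t\<bar> *\<^sub>R 1 \<le> \<bar>a\<bar> + \<bar>a - t *\<^sub>R 1\<bar>" by (rule order_trans[rotated])
    from bp_mult_mono[OF b this, of t] have "\<bar>t\<bar> *\<^sub>R \<pi> t \<le> \<pi> t * \<bar>a\<bar> + \<pi> t * \<bar>a - t *\<^sub>R 1\<bar>"
      by (simp add: distrib_left)
    also have "\<dots> \<le> 1 * \<bar>a\<bar> + \<epsilon> *\<^sub>R 1"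
    proof (rule add_mono)
      show "\<pi> t * \<bar>a\<bar> \<le> 1 * \<bar>a\<bar>" by (rule mult_right_mono[OF bp_le_one[OF b] abs_ge_zero])
      have "\<pi> t * (\<epsilon> *\<^sub>R 1) \<le> \<epsilon> *\<^sub>R 1" using scaleR_left_mono[OF bp_le_one[OF b], of \<epsilon>] e by simp
      then show "\<pi> t * \<bar>a - t *\<^sub>R 1\<bar> \<le> \<epsilon> *\<^sub>R 1" using pt[of t] by (rule order_trans[rotated])
    qed
    finally have "(\<bar>t\<bar> *\<^sub>R \<pi> t) \<bullet> nrm x \<le> (1 * \<bar>a\<bar> + \<epsilon> *\<^sub>R 1) \<bullet> nrm x"
      by (rule orth_leD) (use x in simp)
    then show ?thesis using x by (simp add: nrm_scale)
  qed
  obtain y where y: "y \<in> Xt" "\<And>t. \<pi> t \<bullet> nrm (y - rscale t x) = 0"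
  proof (rule partition_of_unity_glue[OF p _ _ bound])
    show "0 \<le> \<bar>a\<bar> \<bullet> nrm x + \<epsilon> *\<^sub>R nrm x"
      using x e by (intro add_nonneg_nonneg orth_pos scaleR_nonneg_nonneg) auto
  qed (use x in auto)
  have "approx_value \<epsilon> a x y" unfolding approx_value_def
  proof (intro conjI ballI allI impI)
    fix \<rho> :: "'e orth" and r \<delta> assume r: "\<rho> \<in> band_projections" "\<rho> * \<bar>a - r *\<^sub>R 1\<bar> \<le> \<delta> *\<^sub>R \<rho>"
    show "\<rho> \<bullet> nrm (y - rscale r x) \<le> (\<epsilon> + \<delta>) *\<^sub>R (\<rho> \<bullet> nrm x)"
    proof (rule partition_of_unity_le[OF p])
      fix t
      define \<tau> where "\<tau> = \<pi> t * \<rho>"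
      have t: "\<tau> \<in> band_projections" unfolding \<tau>_def by (rule bp_mult[OF b r(1)])
      have tle: "\<tau> \<le> \<pi> t" "\<tau> \<le> \<rho>" unfolding \<tau>_def using bp_mult_le1[OF b r(1)] bp_mult_le2[OF b r(1)] by auto
      have 1: "\<tau> * \<bar>a - t *\<^sub>R 1\<bar> \<le> \<epsilon> *\<^sub>R \<tau>" using bp_down_orth[OF b t tle(1) pt] by simp
      have 2: "\<tau> * \<bar>a - r *\<^sub>R 1\<bar> \<le> \<delta> *\<^sub>R \<tau>"
        using bp_mult_mono[OF t r(2)] bp_le_mult[OF r(1) t tle(2)] by simp
      have "\<tau> \<bullet> nrm (y - rscale r x) \<le> (\<epsilon> + \<delta>) *\<^sub>R (\<tau> \<bullet> nrm x)"
      proof (cases "\<tau> = 0")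
        case False
        have z: "\<tau> \<bullet> nrm (y - rscale t x) = 0" using y(2)[of t] bp_le_apply(1)[OF b t tle(1), of "nrm (y - rscale t x)"] by simp
        have "nrm (y - rscale r x) \<le> nrm (y - rscale t x) + nrm (rscale t x - rscale r x)"
          by (rule nrm_triangle3) (use x y in auto)
        from bp_mono[OF t this] have "\<tau> \<bullet> nrm (y - rscale r x) \<le> \<bar>t - r\<bar> *\<^sub>R (\<tau> \<bullet> nrm x)"
          using z by (simp add: nrm_rscale_diff[OF x])
        also have "\<dots> \<le> (\<epsilon> + \<delta>) *\<^sub>R (\<tau> \<bullet> nrm x)"
          by (rule scaleR_right_mono[OF real_approx_dist[OF t False 1 2] bp_pos[OF t]]) (use x in simp)
        finally show ?thesis .
      qed simp
      then show "\<pi> t \<bullet> \<rho> \<bullet> nrm (y - rscale r x) \<le> \<pi> t \<bullet> (\<epsilon> + \<delta>) *\<^sub>R (\<rho> \<bullet> nrm x)" by (simp add: \<tau>_def)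
    qed
  qed (use y in simp)
  then show ?thesis by blast
qed

text \<open>By the distance estimate the \<epsilon>-approximate values are Cauchy as \<epsilon>
  decreases to 0, with regulator \<open>nrm x\<close>; their limit is the exact value.\<close>

lemma approx_value_zero_ex:
  assumes x: "x \<in> Xt"
  shows "\<exists>y. approx_value 0 a x y"
proof -
  obtain z where z: "\<And>\<epsilon>. \<epsilon> > 0 \<Longrightarrow> approx_value \<epsilon> a x (z \<epsilon>)"
    using approx_value_ex[OF x, of _ a] by metis
  let ?F = "at_right (0::real)"
  have small: "\<forall>\<^sub>F \<epsilon> in ?F. 0 < \<epsilon> \<and> \<epsilon> < \<eta>" if "\<eta> > 0" for \<eta>
    using eventually_at_right_real[OF that] by simp
  have zX: "\<forall>\<^sub>F \<epsilon> in ?F. z \<epsilon> \<in> Xt"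
    using small[of 1] by (simp add: eventually_mono[OF _ ] z[unfolded approx_value_def] eventually_at_right_less)
  have "order_null (\<lambda>(\<epsilon>, \<delta>). nrm (z \<epsilon> - z \<delta>)) (?F \<times>\<^sub>F ?F)"
  proof (rule order_null_uniform)
    fix \<eta> :: real assume h: "\<eta> > 0"
    then have h4: "\<eta> / 4 > 0" by simp
    show "\<forall>\<^sub>F p in ?F \<times>\<^sub>F ?F. (case p of (\<epsilon>, \<delta>) \<Rightarrow> nrm (z \<epsilon> - z \<delta>)) \<le> \<eta> *\<^sub>R nrm x"
      using eventually_prodI[OF small[OF h4] small[OF h4]]
    proof eventually_elim
      case (elim p)
      obtain \<epsilon> \<delta> where p: "p = (\<epsilon>, \<delta>)" by force
      have "nrm (z \<epsilon> - z \<delta>) \<le> (2 * (\<epsilon> + \<delta>)) *\<^sub>R nrm x"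
        by (rule approx_value_dist[OF x z z]) (use elim p in auto)
      also have "\<dots> \<le> \<eta> *\<^sub>R nrm x" by (rule scaleR_right_mono) (use elim p x in auto)
      finally show ?case by (simp add: p)
    qed
  qed (use x in simp)
  then obtain y where y: "y \<in> Xt" "order_null (\<lambda>\<epsilon>. nrm (y - z \<epsilon>)) ?F"
    by (rule complete[OF trivial_limit_at_right_real zX])
  have "approx_value 0 a x y" unfolding approx_value_def
  proof (intro conjI ballI allI impI)
    fix \<rho> :: "'e orth" and r \<delta> assume r: "\<rho> \<in> band_projections" "\<rho> * \<bar>a - r *\<^sub>R 1\<bar> \<le> \<delta> *\<^sub>R \<rho>"
    have null: "order_null (\<lambda>\<epsilon>. \<epsilon> *\<^sub>R nrm x) ?F"
    proof (rule order_null_uniform)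
      fix \<eta> :: real assume "\<eta> > 0"
      from small[OF this] show "\<forall>\<^sub>F \<epsilon> in ?F. \<epsilon> *\<^sub>R nrm x \<le> \<eta> *\<^sub>R nrm x"
        by eventually_elim (use x in \<open>auto intro: scaleR_right_mono\<close>)
    qed (use x in simp)
    have "\<rho> \<bullet> nrm (y - rscale r x) - \<delta> *\<^sub>R (\<rho> \<bullet> nrm x) \<le> 0"
    proof (rule order_null_const_le[OF order_null_mono[OF order_null_add[OF y(2) null]] trivial_limit_at_right_real])
      show "\<forall>\<^sub>F \<epsilon> in ?F. \<rho> \<bullet> nrm (y - rscale r x) - \<delta> *\<^sub>R (\<rho> \<bullet> nrm x) \<le> nrm (y - z \<epsilon>) + \<epsilon> *\<^sub>R nrm x"
        using small[of 1, simplified]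
      proof eventually_elim
        case (elim \<epsilon>)
        have zX: "z \<epsilon> \<in> Xt" using z elim by (simp add: approx_value_def)
        have "nrm (y - rscale r x) \<le> nrm (y - z \<epsilon>) + nrm (z \<epsilon> - rscale r x)"
          by (rule nrm_triangle3) (use x y zX in auto)
        from bp_mono[OF r(1) this]
        have "\<rho> \<bullet> nrm (y - rscale r x) \<le> \<rho> \<bullet> nrm (y - z \<epsilon>) + \<rho> \<bullet> nrm (z \<epsilon> - rscale r x)" by simp
        also have "\<dots> \<le> nrm (y - z \<epsilon>) + (\<epsilon> + \<delta>) *\<^sub>R (\<rho> \<bullet> nrm x)"
          by (rule add_mono) (use z[of \<epsilon>] elim r y zX in \<open>auto simp: approx_value_def bp_apply_le\<close>)
        also have "\<dots> = nrm (y - z \<epsilon>) + \<epsilon> *\<^sub>R (\<rho> \<bullet> nrm x) + \<delta> *\<^sub>R (\<rho> \<bullet> nrm x)"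
          by (simp add: scaleR_add_left)
        also have "\<dots> \<le> nrm (y - z \<epsilon>) + \<epsilon> *\<^sub>R nrm x + \<delta> *\<^sub>R (\<rho> \<bullet> nrm x)"
          using elim x by (intro add_mono scaleR_left_mono bp_apply_le r order_refl) auto
        finally show ?case by (simp add: diff_le_eq)
      qed
    qed
    then show "\<rho> \<bullet> nrm (y - rscale r x) \<le> (0 + \<delta>) *\<^sub>R (\<rho> \<bullet> nrm x)" by simp
  qed (use y in simp)
  then show ?thesis by blast
qed

text \<open>Extensional on \<open>Xt\<close>, as \<open>is_orth_action\<close> demands.\<close>

definition act :: "'e orth \<Rightarrow> 'x \<Rightarrow> 'x" where
  "act a = (\<lambda>x\<in>Xt. THE y. approx_value 0 a x y)"

lemma act_approx:
  assumes x: "x \<in> Xt" shows "approx_value 0 a x (act a x)"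
proof -
  have "\<exists>!y. approx_value 0 a x y" using approx_value_zero_ex[OF x] approx_value_unique[OF x] by blast
  from theI'[OF this] show ?thesis using x by (simp add: act_def)
qed

lemma act_eqI: "x \<in> Xt \<Longrightarrow> approx_value 0 a x y \<Longrightarrow> act a x = y"
  using approx_value_unique[OF _ act_approx] by blast

lemma act_in [simp]: "x \<in> Xt \<Longrightarrow> act a x \<in> Xt"
  using act_approx by (simp add: approx_value_def)

lemma act_near:
  assumes "x \<in> Xt" "\<rho> \<in> band_projections" "\<rho> * \<bar>a - r *\<^sub>R 1\<bar> \<le> \<epsilon> *\<^sub>R \<rho>"
  shows "\<rho> \<bullet> nrm (act a x - rscale r x) \<le> \<epsilon> *\<^sub>R (\<rho> \<bullet> nrm x)"
  using act_approx[OF assms(1), of a] assms(2,3) by (simp add: approx_value_def)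

end

section \<open>Algebraic laws, norm, faithfulness and uniqueness of the action\<close>

lemma abs_real_orth: "\<bar>t *\<^sub>R (1 :: 'e::dedekind_complete_vector_lattice orth)\<bar> = \<bar>t\<bar> *\<^sub>R 1"
proof -
  have *: "\<bar>t *\<^sub>R (1 :: 'e orth)\<bar> = t *\<^sub>R 1" if "t \<ge> 0" for t
    using that by (simp add: scaleR_nonneg_nonneg)
  show ?thesis using *[of t] *[of "- t"] by (cases "t \<ge> 0") auto
qed

context banach_kantorovich
begin

text \<open>The pattern for the algebraic laws: on a small band orthomorphisms are nearly real
  numbers, for which the laws are those of the vector space. One element \<open>u\<close> must
  control the error for every \<epsilon> and every band.\<close>

lemma eq_local:
  assumes y: "y \<in> Xt" and z: "z \<in> Xt"
    and loc: "\<And>\<epsilon> \<rho>. \<epsilon> > 0 \<Longrightarrow> \<rho> \<in> band_projections \<Longrightarrow> \<rho> \<noteq> 0 \<Longrightarrow>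
      \<exists>\<rho>'\<in>band_projections. \<rho>' \<noteq> 0 \<and> \<rho>' \<le> \<rho> \<and> \<rho>' \<bullet> nrm (y - z) \<le> \<rho>' \<bullet> \<epsilon> *\<^sub>R u"
  shows "y = z"
proof (rule nrm_le_zeroD[OF y z], rule archimedean_eps)
  fix \<epsilon> :: real assume "\<epsilon> > 0"
  have "1 \<bullet> nrm (y - z) \<le> 1 \<bullet> \<epsilon> *\<^sub>R u"
    by (rule local_le[OF bp_one]) (rule loc[OF \<open>\<epsilon> > 0\<close>])
  then show "nrm (y - z) \<le> \<epsilon> *\<^sub>R u" by simp
qed

lemma act_add_right:
  assumes x: "x \<in> Xt" and y: "y \<in> Xt"
  shows "act a (x + y) = act a x + act a y"
proof (rule eq_local[where u = "nrm (x + y) + (nrm x + nrm y)"])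
  fix \<epsilon> :: real and \<rho> :: "'e orth" assume e: "\<epsilon> > 0" and r: "\<rho> \<in> band_projections" "\<rho> \<noteq> 0"
  obtain \<rho>' t where t: "\<rho>' \<in> band_projections" "\<rho>' \<noteq> 0" "\<rho>' \<le> \<rho>" "\<rho>' * \<bar>a - t *\<^sub>R 1\<bar> \<le> \<epsilon> *\<^sub>R \<rho>'"
    by (rule orth_real_approx[OF r e])
  have "nrm (act a (x + y) - (act a x + act a y)) =
    nrm ((act a (x + y) - rscale t (x + y)) - ((act a x - rscale t x) + (act a y - rscale t y)))"
    by (simp add: algebra_simps)
  also have "\<dots> \<le> nrm (act a (x + y) - rscale t (x + y)) + nrm ((act a x - rscale t x) + (act a y - rscale t y))"
    by (rule nrm_triangle_diff) (use x y in auto)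
  also have "\<dots> \<le> nrm (act a (x + y) - rscale t (x + y)) + (nrm (act a x - rscale t x) + nrm (act a y - rscale t y))"
    by (rule add_left_mono, rule nrm_triangle) (use x y in auto)
  finally have le: "nrm (act a (x + y) - (act a x + act a y)) \<le> \<dots>" .
  from bp_mono[OF t(1) this]
  have "\<rho>' \<bullet> nrm (act a (x + y) - (act a x + act a y)) \<le> \<rho>' \<bullet> nrm (act a (x + y) - rscale t (x + y))
    + (\<rho>' \<bullet> nrm (act a x - rscale t x) + \<rho>' \<bullet> nrm (act a y - rscale t y))" by (simp only: orth_apply_simps)
  also have "\<dots> \<le> \<epsilon> *\<^sub>R (\<rho>' \<bullet> nrm (x + y)) + (\<epsilon> *\<^sub>R (\<rho>' \<bullet> nrm x) + \<epsilon> *\<^sub>R (\<rho>' \<bullet> nrm y))"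
    by (intro add_mono act_near t) (use x y in auto)
  also have "\<dots> = \<rho>' \<bullet> \<epsilon> *\<^sub>R (nrm (x + y) + (nrm x + nrm y))" by (simp add: scaleR_add_right)
  finally show "\<exists>\<rho>'\<in>band_projections. \<rho>' \<noteq> 0 \<and> \<rho>' \<le> \<rho> \<and>
      \<rho>' \<bullet> nrm (act a (x + y) - (act a x + act a y)) \<le> \<rho>' \<bullet> \<epsilon> *\<^sub>R (nrm (x + y) + (nrm x + nrm y))"
    using t by blast
qed (use x y in auto)

lemma act_add_left:
  assumes x: "x \<in> Xt"
  shows "act (a + b) x = act a x + act b x"
proof (rule eq_local[where u = "4 *\<^sub>R nrm x"])
  fix \<epsilon> :: real and \<rho> :: "'e orth" assume e: "\<epsilon> > 0" and r: "\<rho> \<in> band_projections" "\<rho> \<noteq> 0"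
  obtain \<rho>1 s where s: "\<rho>1 \<in> band_projections" "\<rho>1 \<noteq> 0" "\<rho>1 \<le> \<rho>" "\<rho>1 * \<bar>a - s *\<^sub>R 1\<bar> \<le> \<epsilon> *\<^sub>R \<rho>1"
    by (rule orth_real_approx[OF r e])
  obtain \<rho>' t where t: "\<rho>' \<in> band_projections" "\<rho>' \<noteq> 0" "\<rho>' \<le> \<rho>1" "\<rho>' * \<bar>b - t *\<^sub>R 1\<bar> \<le> \<epsilon> *\<^sub>R \<rho>'"
    by (rule orth_real_approx[OF s(1,2) e])
  have s': "\<rho>' * \<bar>a - s *\<^sub>R 1\<bar> \<le> \<epsilon> *\<^sub>R \<rho>'"
    using bp_mult_mono[OF t(1) s(4)] bp_le_mult[OF s(1) t(1,3)] by simp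
  have "(a + b) - (s + t) *\<^sub>R 1 = (a - s *\<^sub>R 1) + (b - t *\<^sub>R 1)" by (simp add: algebra_simps)
  then have "\<bar>(a + b) - (s + t) *\<^sub>R 1\<bar> \<le> \<bar>a - s *\<^sub>R 1\<bar> + \<bar>b - t *\<^sub>R 1\<bar>" by (metis abs_triangle_ineq)
  from bp_mult_mono[OF t(1) this]
  have "\<rho>' * \<bar>(a + b) - (s + t) *\<^sub>R 1\<bar> \<le> \<rho>' * \<bar>a - s *\<^sub>R 1\<bar> + \<rho>' * \<bar>b - t *\<^sub>R 1\<bar>" by (simp add: distrib_left)
  also have "\<dots> \<le> (2 * \<epsilon>) *\<^sub>R \<rho>'" using add_mono[OF s' t(4)] by (simp flip: scaleR_add_left)
  finally have st: "\<rho>' * \<bar>(a + b) - (s + t) *\<^sub>R 1\<bar> \<le> (2 * \<epsilon>) *\<^sub>R \<rho>'" .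
  have "nrm (act (a + b) x - (act a x + act b x)) =
    nrm ((act (a + b) x - rscale (s + t) x) - ((act a x - rscale s x) + (act b x - rscale t x)))"
    by (simp add: algebra_simps)
  also have "\<dots> \<le> nrm (act (a + b) x - rscale (s + t) x) + nrm ((act a x - rscale s x) + (act b x - rscale t x))"
    by (rule nrm_triangle_diff) (use x in auto)
  also have "\<dots> \<le> nrm (act (a + b) x - rscale (s + t) x) + (nrm (act a x - rscale s x) + nrm (act b x - rscale t x))"
    by (rule add_left_mono, rule nrm_triangle) (use x in auto)
  finally have le: "nrm (act (a + b) x - (act a x + act b x)) \<le> \<dots>" .
  from bp_mono[OF t(1) this]
  have "\<rho>' \<bullet> nrm (act (a + b) x - (act a x + act b x)) \<le> \<rho>' \<bullet> nrm (act (a + b) x - rscale (s + t) x)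
    + (\<rho>' \<bullet> nrm (act a x - rscale s x) + \<rho>' \<bullet> nrm (act b x - rscale t x))" by (simp only: orth_apply_simps)
  also have "\<dots> \<le> (2 * \<epsilon>) *\<^sub>R (\<rho>' \<bullet> nrm x) + (\<epsilon> *\<^sub>R (\<rho>' \<bullet> nrm x) + \<epsilon> *\<^sub>R (\<rho>' \<bullet> nrm x))"
    by (intro add_mono act_near[OF x t(1)] st s' t(4))
  also have "\<dots> = \<rho>' \<bullet> \<epsilon> *\<^sub>R 4 *\<^sub>R nrm x" by (simp flip: scaleR_add_left)
  finally show "\<exists>\<rho>'\<in>band_projections. \<rho>' \<noteq> 0 \<and> \<rho>' \<le> \<rho> \<and>
      \<rho>' \<bullet> nrm (act (a + b) x - (act a x + act b x)) \<le> \<rho>' \<bullet> \<epsilon> *\<^sub>R 4 *\<^sub>R nrm x"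
    using t s order_trans by blast
qed (use x in auto)

text \<open>The error of the product is (a - s) b + s (b - t). Its first term is controlled by a
  local bound \<open>M\<close> of \<open>b\<close>, its second by \<bar>s\<bar>; therefore
  \<open>M\<close> is fixed before \<open>s\<close>, and \<open>s\<close> before the accuracy
  \<open>\<epsilon>2\<close> of \<open>t\<close>.\<close>

lemma act_mult:
  assumes x: "x \<in> Xt"
  shows "act (a * b) x = act a (act b x)"
proof (rule eq_local[where u = "3 *\<^sub>R nrm x + nrm (act b x)"])
  fix \<epsilon> :: real and \<rho> :: "'e orth" assume e: "\<epsilon> > 0" and r: "\<rho> \<in> band_projections" "\<rho> \<noteq> 0"
  obtain \<rho>0 M where M: "\<rho>0 \<in> band_projections" "\<rho>0 \<noteq> 0" "\<rho>0 \<le> \<rho>" "(M::real) > 0" "\<rho>0 * \<bar>b\<bar> \<le> M *\<^sub>R \<rho>0"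
    by (rule orth_locally_bounded[OF r])
  define \<epsilon>1 where "\<epsilon>1 = \<epsilon> / (1 + M)"
  have e1: "\<epsilon>1 > 0" "\<epsilon>1 * M \<le> \<epsilon>" "\<epsilon>1 \<le> \<epsilon>" using e M(4) by (auto simp: \<epsilon>1_def field_simps)
  obtain \<rho>1 s where s: "\<rho>1 \<in> band_projections" "\<rho>1 \<noteq> 0" "\<rho>1 \<le> \<rho>0" "\<rho>1 * \<bar>a - s *\<^sub>R 1\<bar> \<le> \<epsilon>1 *\<^sub>R \<rho>1"
    by (rule orth_real_approx[OF M(1,2) e1(1)])
  define \<epsilon>2 where "\<epsilon>2 = \<epsilon> / (1 + \<bar>s\<bar>)"
  have e2: "\<epsilon>2 > 0" "\<bar>s\<bar> * \<epsilon>2 \<le> \<epsilon>" using e by (auto simp: \<epsilon>2_def field_simps)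
  obtain \<rho>' t where t: "\<rho>' \<in> band_projections" "\<rho>' \<noteq> 0" "\<rho>' \<le> \<rho>1" "\<rho>' * \<bar>b - t *\<^sub>R 1\<bar> \<le> \<epsilon>2 *\<^sub>R \<rho>'"
    by (rule orth_real_approx[OF s(1,2) e2(1)])
  have le0: "\<rho>' \<le> \<rho>0" using t(3) s(3) by (rule order_trans)
  have s': "\<rho>' * \<bar>a - s *\<^sub>R 1\<bar> \<le> \<epsilon>1 *\<^sub>R \<rho>'"
    using bp_mult_mono[OF t(1) s(4)] bp_le_mult[OF s(1) t(1,3)] by simp
  have M': "\<rho>' * \<bar>b\<bar> \<le> M *\<^sub>R \<rho>'"
    using bp_mult_mono[OF t(1) M(5)] bp_le_mult[OF M(1) t(1) le0] by simp
  have r0: "0 \<le> \<rho>'" by (rule bp_nonneg[OF t(1)])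
  have st: "\<rho>' * \<bar>a * b - (s * t) *\<^sub>R 1\<bar> \<le> (2 * \<epsilon>) *\<^sub>R \<rho>'"
  proof -
    have "a * b - (s * t) *\<^sub>R 1 = (a - s *\<^sub>R 1) * b + (s *\<^sub>R 1) * (b - t *\<^sub>R 1)"
      by (simp add: algebra_simps)
    then have "\<bar>a * b - (s * t) *\<^sub>R 1\<bar> \<le> \<bar>(a - s *\<^sub>R 1) * b\<bar> + \<bar>(s *\<^sub>R 1) * (b - t *\<^sub>R 1)\<bar>"
      by (metis abs_triangle_ineq)
    also have "\<dots> \<le> \<bar>a - s *\<^sub>R 1\<bar> * \<bar>b\<bar> + \<bar>s *\<^sub>R 1\<bar> * \<bar>b - t *\<^sub>R 1\<bar>"
      by (intro add_mono abs_le_mult)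
    finally have "\<bar>a * b - (s * t) *\<^sub>R 1\<bar> \<le> \<bar>a - s *\<^sub>R 1\<bar> * \<bar>b\<bar> + \<bar>s\<bar> *\<^sub>R \<bar>b - t *\<^sub>R 1\<bar>"
      by (simp add: abs_real_orth)
    from bp_mult_mono[OF t(1) this]
    have "\<rho>' * \<bar>a * b - (s * t) *\<^sub>R 1\<bar> \<le> (\<rho>' * \<bar>a - s *\<^sub>R 1\<bar>) * \<bar>b\<bar> + \<bar>s\<bar> *\<^sub>R (\<rho>' * \<bar>b - t *\<^sub>R 1\<bar>)"
      by (simp add: distrib_left mult.assoc)
    also have "\<dots> \<le> (\<epsilon>1 *\<^sub>R \<rho>') * \<bar>b\<bar> + \<bar>s\<bar> *\<^sub>R (\<epsilon>2 *\<^sub>R \<rho>')"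
      by (intro add_mono mult_right_mono scaleR_left_mono s' t(4)) auto
    also have "\<dots> = \<epsilon>1 *\<^sub>R (\<rho>' * \<bar>b\<bar>) + (\<bar>s\<bar> * \<epsilon>2) *\<^sub>R \<rho>'" by simp
    also have "\<dots> \<le> \<epsilon>1 *\<^sub>R (M *\<^sub>R \<rho>') + \<epsilon> *\<^sub>R \<rho>'"
      by (intro add_mono scaleR_left_mono scaleR_right_mono M' e2 r0) (use e1 in simp)
    also have "\<dots> \<le> \<epsilon> *\<^sub>R \<rho>' + \<epsilon> *\<^sub>R \<rho>'"
      using scaleR_right_mono[OF e1(2) r0] by simp
    finally show ?thesis by (simp flip: scaleR_add_left)
  qed
  let ?y = "act b x"
  have y: "?y \<in> Xt" using x by simp
  have "nrm (act (a * b) x - act a ?y) =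
    nrm ((act (a * b) x - rscale (s * t) x) - ((act a ?y - rscale s ?y) + rscale s (?y - rscale t x)))"
    by (simp add: algebra_simps)
  also have "\<dots> \<le> nrm (act (a * b) x - rscale (s * t) x) + nrm ((act a ?y - rscale s ?y) + rscale s (?y - rscale t x))"
    by (rule nrm_triangle_diff) (use x in auto)
  also have "\<dots> \<le> nrm (act (a * b) x - rscale (s * t) x) + (nrm (act a ?y - rscale s ?y) + nrm (rscale s (?y - rscale t x)))"
    by (rule add_left_mono, rule nrm_triangle) (use x in auto)
  also have "nrm (rscale s (?y - rscale t x)) = \<bar>s\<bar> *\<^sub>R nrm (?y - rscale t x)"
    using x by (simp add: nrm_scale)
  finally have le: "nrm (act (a * b) x - act a ?y) \<le> nrm (act (a * b) x - rscale (s * t) x)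
    + (nrm (act a ?y - rscale s ?y) + \<bar>s\<bar> *\<^sub>R nrm (?y - rscale t x))" .
  from bp_mono[OF t(1) this]
  have "\<rho>' \<bullet> nrm (act (a * b) x - act a ?y) \<le> \<rho>' \<bullet> nrm (act (a * b) x - rscale (s * t) x)
    + (\<rho>' \<bullet> nrm (act a ?y - rscale s ?y) + \<bar>s\<bar> *\<^sub>R (\<rho>' \<bullet> nrm (?y - rscale t x)))" by (simp only: orth_apply_simps)
  also have "\<dots> \<le> (2 * \<epsilon>) *\<^sub>R (\<rho>' \<bullet> nrm x) + (\<epsilon>1 *\<^sub>R (\<rho>' \<bullet> nrm ?y) + \<bar>s\<bar> *\<^sub>R (\<epsilon>2 *\<^sub>R (\<rho>' \<bullet> nrm x)))"
    by (intro add_mono scaleR_left_mono act_near x y t st s') simp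
  also have "\<dots> \<le> (2 * \<epsilon>) *\<^sub>R (\<rho>' \<bullet> nrm x) + (\<epsilon> *\<^sub>R (\<rho>' \<bullet> nrm ?y) + \<epsilon> *\<^sub>R (\<rho>' \<bullet> nrm x))"
    using scaleR_right_mono[OF e2(2) bp_pos[OF t(1) nrm_ge_0[OF x]]]
      scaleR_right_mono[OF e1(3) bp_pos[OF t(1) nrm_ge_0[OF y]]]
    by (intro add_left_mono add_mono) simp_all
  also have "\<dots> = \<rho>' \<bullet> \<epsilon> *\<^sub>R (3 *\<^sub>R nrm x + nrm ?y)"
  proof -
    have "(2 * \<epsilon>) *\<^sub>R v + (\<epsilon> *\<^sub>R w + \<epsilon> *\<^sub>R v) = \<epsilon> *\<^sub>R (3 *\<^sub>R v + w)" for v w :: 'e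
    proof -
      have "(2 * \<epsilon>) *\<^sub>R v + (\<epsilon> *\<^sub>R w + \<epsilon> *\<^sub>R v) = ((2 * \<epsilon>) *\<^sub>R v + \<epsilon> *\<^sub>R v) + \<epsilon> *\<^sub>R w" by simp
      also have "\<dots> = \<epsilon> *\<^sub>R (3 *\<^sub>R v + w)" by (simp add: scaleR_add_right flip: scaleR_add_left)
      finally show ?thesis .
    qed
    then show ?thesis by simp
  qed
  finally show "\<exists>\<rho>'\<in>band_projections. \<rho>' \<noteq> 0 \<and> \<rho>' \<le> \<rho> \<and>
      \<rho>' \<bullet> nrm (act (a * b) x - act a ?y) \<le> \<rho>' \<bullet> \<epsilon> *\<^sub>R (3 *\<^sub>R nrm x + nrm ?y)"
    using t le0 M(3) order_trans by blast
qed (use x in auto)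

lemma act_real:
  assumes x: "x \<in> Xt"
  shows "act (r *\<^sub>R 1) x = rscale r x"
proof (rule act_eqI[OF x])
  show "approx_value 0 (r *\<^sub>R 1) x (rscale r x)"
    unfolding approx_value_def
  proof (intro conjI ballI allI impI)
    fix \<rho> :: "'e orth" and t \<delta> assume p: "\<rho> \<in> band_projections" "\<rho> * \<bar>r *\<^sub>R 1 - t *\<^sub>R 1\<bar> \<le> \<delta> *\<^sub>R \<rho>"
    have "\<bar>r - t\<bar> *\<^sub>R \<rho> \<le> \<delta> *\<^sub>R \<rho>"
      using p(2) by (simp add: abs_real_orth flip: scaleR_diff_left)
    then have "(\<bar>r - t\<bar> *\<^sub>R \<rho>) \<bullet> nrm x \<le> (\<delta> *\<^sub>R \<rho>) \<bullet> nrm x" by (rule orth_leD) (use x in simp)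
    then show "\<rho> \<bullet> nrm (rscale r x - rscale t x) \<le> (0 + \<delta>) *\<^sub>R (\<rho> \<bullet> nrm x)"
      by (simp add: nrm_rscale_diff[OF x])
  qed (use x in simp)
qed

lemma act_one: "x \<in> Xt \<Longrightarrow> act 1 x = x"
  using act_real[of x 1] by simp

lemma act_scale:
  assumes x: "x \<in> Xt"
  shows "act a (scale c x) = scale c (act a x)"
proof (rule act_eqI)
  show "approx_value 0 a (scale c x) (scale c (act a x))"
    unfolding approx_value_def
  proof (intro conjI ballI allI impI)
    fix \<rho> :: "'e orth" and t \<delta> assume p: "\<rho> \<in> band_projections" "\<rho> * \<bar>a - t *\<^sub>R 1\<bar> \<le> \<delta> *\<^sub>R \<rho>"
    have "scale c (act a x) - rscale t (scale c x) = scale c (act a x - rscale t x)"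
      by (simp add: vs.scale_right_diff_distrib mult.commute)
    then have "nrm (scale c (act a x) - rscale t (scale c x)) = norm c *\<^sub>R nrm (act a x - rscale t x)"
      using x by (simp add: nrm_scale)
    then have "\<rho> \<bullet> nrm (scale c (act a x) - rscale t (scale c x)) = norm c *\<^sub>R (\<rho> \<bullet> nrm (act a x - rscale t x))"
      by simp
    also have "\<dots> \<le> norm c *\<^sub>R (\<delta> *\<^sub>R (\<rho> \<bullet> nrm x))"
      by (intro scaleR_left_mono act_near x p) simp
    also have "\<dots> = (0 + \<delta>) *\<^sub>R (\<rho> \<bullet> nrm (scale c x))" using x by (simp add: nrm_scale mult.commute)
    finally show "\<rho> \<bullet> nrm (scale c (act a x) - rscale t (scale c x)) \<le> (0 + \<delta>) *\<^sub>R (\<rho> \<bullet> nrm (scale c x))" .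
  qed (use x in simp)
qed (use x in simp)

text \<open>On a band where \<open>a\<close> is within \<epsilon> of a real \<open>t\<close>, both
  sides are within \<epsilon> \<open>nrm x\<close> of \<bar>t\<bar> \<open>nrm x\<close>.\<close>

lemma nrm_act:
  assumes x: "x \<in> Xt"
  shows "nrm (act a x) = \<bar>a\<bar> \<bullet> nrm x"
proof -
  define v where "v = nrm (act a x)"
  define w where "w = \<bar>a\<bar> \<bullet> nrm x"
  have near: "\<exists>\<rho>'\<in>band_projections. \<rho>' \<noteq> 0 \<and> \<rho>' \<le> \<rho> \<and> \<rho>' \<bullet> v \<le> \<rho>' \<bullet> (w + (2 * \<epsilon>) *\<^sub>R nrm x) \<and>
      \<rho>' \<bullet> w \<le> \<rho>' \<bullet> (v + (2 * \<epsilon>) *\<^sub>R nrm x)"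
    if e: "\<epsilon> > 0" and r: "\<rho> \<in> band_projections" "\<rho> \<noteq> 0" for \<epsilon> and \<rho> :: "'e orth"
  proof -
    obtain \<rho>' t where t: "\<rho>' \<in> band_projections" "\<rho>' \<noteq> 0" "\<rho>' \<le> \<rho>" "\<rho>' * \<bar>a - t *\<^sub>R 1\<bar> \<le> \<epsilon> *\<^sub>R \<rho>'"
      by (rule orth_real_approx[OF r e])
    have A: "\<rho>' \<bullet> nrm (act a x - rscale t x) \<le> \<epsilon> *\<^sub>R (\<rho>' \<bullet> nrm x)" by (rule act_near[OF x t(1,4)])
    have nt: "nrm (rscale t x) = \<bar>t\<bar> *\<^sub>R nrm x" using x by (simp add: nrm_scale)
    have B: "(\<rho>' * \<bar>a - t *\<^sub>R 1\<bar>) \<bullet> nrm x \<le> (\<epsilon> *\<^sub>R \<rho>') \<bullet> nrm x" by (rule orth_leD[OF t(4)]) (use x in simp)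
    have "nrm (act a x) \<le> nrm (rscale t x) + nrm (act a x - rscale t x)"
      by (rule nrm_triangle_inv) (use x in auto)
    from bp_mono[OF t(1) this] have 1: "\<rho>' \<bullet> v \<le> \<bar>t\<bar> *\<^sub>R (\<rho>' \<bullet> nrm x) + \<epsilon> *\<^sub>R (\<rho>' \<bullet> nrm x)"
      using A unfolding v_def nt by (simp add: order_trans[OF _ add_left_mono])
    have "nrm (rscale t x) \<le> nrm (act a x) + nrm (rscale t x - act a x)"
      by (rule nrm_triangle_inv) (use x in auto)
    also have "nrm (rscale t x - act a x) = nrm (act a x - rscale t x)" by (rule nrm_diff_commute) (use x in auto)
    finally have 2: "\<bar>t\<bar> *\<^sub>R (\<rho>' \<bullet> nrm x) \<le> \<rho>' \<bullet> v + \<epsilon> *\<^sub>R (\<rho>' \<bullet> nrm x)"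
      using bp_mono[OF t(1), of "nrm (rscale t x)" "nrm (act a x) + nrm (act a x - rscale t x)"] A
      unfolding v_def nt by (simp add: order_trans[OF _ add_left_mono])
    have "\<bar>a\<bar> \<le> \<bar>t\<bar> *\<^sub>R 1 + \<bar>a - t *\<^sub>R 1\<bar>"
      using abs_triangle_ineq[of "t *\<^sub>R 1" "a - t *\<^sub>R 1"] by (simp add: abs_real_orth)
    from bp_mono[OF t(1) orth_leD[OF this nrm_ge_0[OF x]]]
    have 3: "\<rho>' \<bullet> w \<le> \<bar>t\<bar> *\<^sub>R (\<rho>' \<bullet> nrm x) + \<epsilon> *\<^sub>R (\<rho>' \<bullet> nrm x)"
      using B unfolding w_def by (simp add: order_trans[OF _ add_left_mono])
    have "\<bar>t\<bar> *\<^sub>R 1 \<le> \<bar>a\<bar> + \<bar>a - t *\<^sub>R 1\<bar>"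
      using abs_triangle_ineq4[of a "a - t *\<^sub>R 1"] by (simp add: abs_real_orth)
    from bp_mono[OF t(1) orth_leD[OF this nrm_ge_0[OF x]]]
    have 4: "\<bar>t\<bar> *\<^sub>R (\<rho>' \<bullet> nrm x) \<le> \<rho>' \<bullet> w + \<epsilon> *\<^sub>R (\<rho>' \<bullet> nrm x)"
      using B unfolding w_def by (simp add: order_trans[OF _ add_left_mono])
    have "p + \<epsilon> *\<^sub>R q \<le> p' + (2 * \<epsilon>) *\<^sub>R q" if "p \<le> p' + \<epsilon> *\<^sub>R q" for p p' q :: 'e
    proof -
      have "p + \<epsilon> *\<^sub>R q \<le> (p' + \<epsilon> *\<^sub>R q) + \<epsilon> *\<^sub>R q" by (rule add_right_mono[OF that])
      then show ?thesis by (simp add: add.assoc flip: scaleR_add_left)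
    qed
    note this[OF 4] this[OF 2]
    with 1 3 show ?thesis using t(1-3) order_trans by (simp only: orth_apply_simps) blast
  qed
  have le: "p \<le> q"
    if "\<And>\<epsilon>. \<epsilon> > 0 \<Longrightarrow> 1 \<bullet> p \<le> 1 \<bullet> (q + (2 * \<epsilon>) *\<^sub>R nrm x)" for p q
  proof -
    have "p - q \<le> 0"
    proof (rule archimedean_eps)
      fix \<epsilon> :: real assume "\<epsilon> > 0"
      then show "p - q \<le> \<epsilon> *\<^sub>R 2 *\<^sub>R nrm x" using that[of \<epsilon>] by (simp add: diff_le_eq add.commute mult.commute)
    qed
    then show ?thesis by simp
  qed
  have "v \<le> w" by (rule le, rule local_le[OF bp_one]) (use near in blast)
  moreover have "w \<le> v" by (rule le, rule local_le[OF bp_one]) (use near in blast)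
  ultimately show ?thesis by (simp add: v_def w_def)
qed

lemma nrm_act_bp: "\<pi> \<in> band_projections \<Longrightarrow> x \<in> Xt \<Longrightarrow> nrm (act \<pi> x) = \<pi> \<bullet> nrm x"
  by (simp add: nrm_act bp_nonneg)

text \<open>If \<open>a\<close> acts as 0, then \<bar>a\<bar> vanishes on the carrier of every
  \<open>nrm x\<close>, so \<open>\<bar>a\<bar> \<bullet> w\<close> is disjoint from all norms.
  Since the norms have full double disjoint complement, this element is disjoint from
  itself.\<close>

lemma act_faithful:
  assumes z: "\<And>x. x \<in> Xt \<Longrightarrow> act a x = 0" shows "a = 0"
proof -
  have dc: "disjoint_complement (disjoint_complement (nrm ` Xt)) = UNIV"
    using lns by (simp add: lattice_normed_space_def)
  have "\<bar>a\<bar> \<bullet> w = 0" if w: "0 \<le> w" for w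
  proof -
    define v where "v = \<bar>a\<bar> \<bullet> w"
    have v0: "0 \<le> v" using w by (simp add: v_def orth_pos)
    have "inf \<bar>v\<bar> \<bar>nrm x\<bar> = 0" if x: "x \<in> Xt" for x
    proof -
      have "\<bar>a\<bar> \<bullet> nrm x = 0" using nrm_act[OF x, of a] z[OF x] by simp
      then have "(1 - annihilator (nrm x)) * \<bar>a\<bar> \<le> 0"
        by (intro le_annihilator_compl_kill) (use x in auto)
      from orth_leD[OF this w] have "v \<le> annihilator (nrm x) \<bullet> v" by (simp add: v_def)
      then have "inf v (nrm x) \<le> inf (annihilator (nrm x) \<bullet> v) (nrm x)" by (simp add: le_infI1)
      define p where "p = inf v (nrm x)"
      let ?n = "annihilator (nrm x)"
      note n = annihilator_bp[of "nrm x"]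
      have "?n \<bullet> p \<le> ?n \<bullet> nrm x" by (rule bp_mono[OF n]) (simp add: p_def)
      then have 1: "?n \<bullet> p \<le> 0" by (simp add: annihilator_apply)
      have "(1 - ?n) \<bullet> p \<le> (1 - ?n) \<bullet> v" by (rule bp_mono[OF bp_compl[OF n]]) (simp add: p_def)
      also have "\<dots> \<le> 0" using \<open>v \<le> ?n \<bullet> v\<close> by simp
      finally have "?n \<bullet> p + (1 - ?n) \<bullet> p \<le> 0" using 1 by (intro add_nonpos_nonpos)
      then have "p \<le> 0" by simp
      then show ?thesis using v0 x by (simp add: p_def order.antisym[OF _ inf_greatest])
    qed
    then have "v \<in> disjoint_complement (nrm ` Xt)" by (simp add: disjoint_complement_def)
    moreover have "v \<in> disjoint_complement (disjoint_complement (nrm ` Xt))" using dc by simp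
    ultimately have "inf \<bar>v\<bar> \<bar>v\<bar> = 0" unfolding disjoint_complement_def by blast
    then show ?thesis by (simp add: v_def)
  qed
  then have "\<bar>a\<bar> = 0" by (intro orth_eqI) simp
  then show ?thesis by simp
qed

lemma act_is_orth_action: "is_orth_action scale nrm Xt act"
  unfolding is_orth_action_def
proof (intro conjI allI ballI impI)
  fix \<pi> :: "'e orth" and x y assume p: "\<pi> \<in> band_projections" and x: "x \<in> Xt" and y: "y \<in> Xt"
  let ?z = "act \<pi> x + act (1 - \<pi>) y"
  have act0: "act 0 w = 0" if "w \<in> Xt" for w using act_real[OF that, of 0] by simp
  have "\<pi> \<bullet> nrm ?z = nrm (act \<pi> ?z)" using nrm_act_bp[OF p, of ?z] x y by simp
  also have "act \<pi> ?z = act (\<pi> * \<pi>) x + act (\<pi> * (1 - \<pi>)) y" using x y by (simp add: act_add_right act_mult)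
  also have "\<dots> = act \<pi> x" using bp_idem[OF p] y by (simp add: right_diff_distrib act0)
  finally have 1: "\<pi> \<bullet> nrm ?z = \<pi> \<bullet> nrm x" using nrm_act_bp[OF p x] by simp
  have "(1 - \<pi>) \<bullet> nrm ?z = nrm (act (1 - \<pi>) ?z)" using nrm_act_bp[OF bp_compl[OF p], of ?z] x y by simp
  also have "act (1 - \<pi>) ?z = act ((1 - \<pi>) * \<pi>) x + act ((1 - \<pi>) * (1 - \<pi>)) y" using x y by (simp add: act_add_right act_mult)
  also have "\<dots> = act (1 - \<pi>) y" unfolding bp_idem[OF bp_compl[OF p]] using bp_idem[OF p] x by (simp add: left_diff_distrib act0)
  finally have 2: "(1 - \<pi>) \<bullet> nrm ?z = (1 - \<pi>) \<bullet> nrm y" using nrm_act_bp[OF bp_compl[OF p] y] by simp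
  have "nrm ?z = \<pi> \<bullet> nrm ?z + (1 - \<pi>) \<bullet> nrm ?z" by simp
  then show "nrm ?z = \<pi> \<bullet> nrm x + (1 - \<pi>) \<bullet> nrm y" unfolding 1 2 .
next
  fix a show "act a \<in> Xt \<rightarrow>\<^sub>E Xt" using act_in by (auto simp: act_def)
next
  fix a :: "'e orth" and r x assume x: "x \<in> Xt"
  have "act (r *\<^sub>R a) x = act ((r *\<^sub>R 1) * a) x" by simp
  also have "\<dots> = rscale r (act a x)" using x by (simp only: act_mult act_real act_in)
  finally show "act (r *\<^sub>R a) x = rscale r (act a x)" .
qed (simp_all add: act_add_right act_add_left act_mult act_one act_scale nrm_act act_faithful)

text \<open>For any action the norm identity at \<open>a - r *\<^sub>R 1\<close> is exactly the
  estimate that defines an approximate value with error 0, and such values are unique.\<close>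

lemma is_orth_action_unique:
  assumes A: "is_orth_action scale nrm Xt A" shows "A = act"
proof (rule ext)
  fix a
  have "\<forall>a. A a \<in> Xt \<rightarrow>\<^sub>E Xt" using A unfolding is_orth_action_def by (rule conjunct1)
  then have E: "A a \<in> Xt \<rightarrow>\<^sub>E Xt" for a by (rule spec)
  have A_add: "\<forall>a b. \<forall>x\<in>Xt. A (a + b) x = A a x + A b x"
    and A_scaleR: "\<forall>a r. \<forall>x\<in>Xt. A (r *\<^sub>R a) x = rscale r (A a x)"
    and A_one: "\<forall>x\<in>Xt. A 1 x = x"
    and A_nrm: "\<forall>a. \<forall>x\<in>Xt. nrm (A a x) = \<bar>a\<bar> \<bullet> nrm x"
    using A unfolding is_orth_action_def by - (elim conjE, assumption)+
  show "A a = act a"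
  proof (rule extensionalityI[of _ Xt])
    show "A a \<in> extensional Xt" using E by (simp add: PiE_def)
    show "act a \<in> extensional Xt" by (simp add: act_def)
    fix x assume x: "x \<in> Xt"
    have "act a x = A a x"
    proof (rule act_eqI[OF x], unfold approx_value_def, intro conjI ballI allI impI)
      show "A a x \<in> Xt" using E[of a] x by auto
      fix \<rho> :: "'e orth" and r \<delta> assume p: "\<rho> \<in> band_projections" "\<rho> * \<bar>a - r *\<^sub>R 1\<bar> \<le> \<delta> *\<^sub>R \<rho>"
      have "A (a + (- r) *\<^sub>R 1) x = A a x + A ((- r) *\<^sub>R 1) x" using A_add x by (simp only:)
      also have "A ((- r) *\<^sub>R 1) x = rscale (- r) (A 1 x)" using A_scaleR x by (simp only:)
      also have "A 1 x = x" using A_one x by (simp only:)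
      finally have eq: "A (a - r *\<^sub>R 1) x = A a x - rscale r x" by (simp add: vs.scale_minus_left)
      have "nrm (A (a - r *\<^sub>R 1) x) = \<bar>a - r *\<^sub>R 1\<bar> \<bullet> nrm x" using A_nrm x by (simp only:)
      then show "\<rho> \<bullet> nrm (A a x - rscale r x) \<le> (0 + \<delta>) *\<^sub>R (\<rho> \<bullet> nrm x)"
        using orth_leD[OF p(2) nrm_ge_0[OF x]] by (simp add: eq)
    qed
    then show "A a x = act a x" by simp
  qed
qed

lemma orth_action_eq: "orth_action scale nrm Xt = act"
  unfolding orth_action_def
  by (rule the_equality[where P = "is_orth_action scale nrm Xt", OF act_is_orth_action is_orth_action_unique])

lemma act_bp_eq_iff:
  assumes p: "\<pi> \<in> band_projections" and x: "x \<in> Xt" and y: "y \<in> Xt"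
  shows "act \<pi> x = act \<pi> y \<longleftrightarrow> \<pi> \<bullet> nrm (x - y) = 0"
proof -
  have "act \<pi> (y + (x - y)) = act \<pi> y + act \<pi> (x - y)" using x y by (intro act_add_right) auto
  then have "act \<pi> x - act \<pi> y = act \<pi> (x - y)" by simp
  then have "\<pi> \<bullet> nrm (x - y) = nrm (act \<pi> x - act \<pi> y)" using nrm_act_bp[OF p, of "x - y"] x y by simp
  then show ?thesis using nrm_zeroD[of "act \<pi> x - act \<pi> y"] x y by auto
qed

lemma pure_value:
  assumes p: "partition_of_unity \<pi>" and f: "range f \<subseteq> Xt" "\<And>s. nrm (f s) \<le> e"
  shows pure_value_in: "pure_value scale nrm Xt f \<pi> \<in> Xt"
    and pure_value_bp: "\<pi> s \<bullet> nrm (pure_value scale nrm Xt f \<pi> - f s) = 0"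
proof -
  note b = partition_of_unity_bp[OF p]
  have fX: "f s \<in> Xt" for s using f by auto
  have e0: "0 \<le> e" using nrm_ge_0[OF fX] f(2) order_trans by blast
  obtain y where y: "y \<in> Xt" "\<And>s. \<pi> s \<bullet> nrm (y - f s) = 0"
  proof (rule partition_of_unity_glue[OF p fX e0])
    show "\<pi> s \<bullet> nrm (f s) \<le> e" for s by (rule order_trans[OF bp_apply_le[OF b nrm_ge_0[OF fX]] f(2)])
  qed blast
  have "pure_value scale nrm Xt f \<pi> = y"
    unfolding pure_value_def orth_action_eq
  proof (rule the_equality)
    show "y \<in> Xt \<and> (\<forall>s. act (\<pi> s) y = act (\<pi> s) (f s))"
      using y act_bp_eq_iff[OF b _ fX] by blast
    fix z assume z: "z \<in> Xt \<and> (\<forall>s. act (\<pi> s) z = act (\<pi> s) (f s))"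
    have "nrm (z - y) \<le> 0"
    proof (rule partition_of_unity_le[OF p])
      fix s
      have "nrm (z - y) \<le> nrm (z - f s) + nrm (y - f s)" by (rule nrm_triangle3') (use z y fX in auto)
      from bp_mono[OF b this, of s] show "\<pi> s \<bullet> nrm (z - y) \<le> \<pi> s \<bullet> 0"
        using y(2)[of s] z act_bp_eq_iff[OF b _ fX, of z s s] by simp
    qed
    then show "z = y" using nrm_le_zeroD z y by blast
  qed
  then show "pure_value scale nrm Xt f \<pi> \<in> Xt" "\<pi> s \<bullet> nrm (pure_value scale nrm Xt f \<pi> - f s) = 0"
    using y by auto
qed

end

section \<open>Order-valued uniformly continuous functions\<close>

lemma abs_scaleR_le:
  fixes x :: "'e::dedekind_complete_vector_lattice"
  shows "\<bar>r *\<^sub>R x\<bar> \<le> \<bar>r\<bar> *\<^sub>R \<bar>x\<bar>"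
proof -
  have *: "\<bar>r *\<^sub>R x\<bar> \<le> r *\<^sub>R \<bar>x\<bar>" if "0 \<le> r" for r and x :: 'e
  proof (rule abs_leI)
    show "r *\<^sub>R x \<le> r *\<^sub>R \<bar>x\<bar>" by (rule scaleR_left_mono[OF abs_ge_self that])
    show "- (r *\<^sub>R x) \<le> r *\<^sub>R \<bar>x\<bar>" using scaleR_left_mono[OF abs_ge_minus_self that, of x] by simp
  qed
  show ?thesis using *[of r x] *[of "- r" x] by (cases "0 \<le> r") auto
qed

text \<open>A pointwise operation with Lipschitz constant 1 in each argument preserves boundedness
  and uniform order continuity; sums, suprema, negation and multiplication by projections are
  instances.\<close>

lemma Cuo_orth_op:
  assumes phi: "\<phi> \<in> Cuo_orth" and psi: "\<psi> \<in> Cuo_orth"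
    and F: "\<And>a b a' b'. \<bar>F a b - F a' b'\<bar> \<le> \<bar>a - a'\<bar> + \<bar>b - b'\<bar>"
  shows "(\<lambda>s. F (\<phi> s) (\<psi> s)) \<in> Cuo_orth"
proof -
  obtain c where c: "\<And>s. \<bar>\<phi> s\<bar> \<le> c" using Cuo_orth_bounded[OF phi] by blast
  obtain d where d: "\<And>s. \<bar>\<psi> s\<bar> \<le> d" using Cuo_orth_bounded[OF psi] by blast
  have "\<bar>F (\<phi> s) (\<psi> s)\<bar> \<le> \<bar>F 0 0\<bar> + (c + d)" for s
  proof -
    have "\<bar>F (\<phi> s) (\<psi> s)\<bar> = \<bar>F 0 0 + (F (\<phi> s) (\<psi> s) - F 0 0)\<bar>" by simp
    also have "\<dots> \<le> \<bar>F 0 0\<bar> + \<bar>F (\<phi> s) (\<psi> s) - F 0 0\<bar>" by (rule abs_triangle_ineq)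
    also have "\<dots> \<le> \<bar>F 0 0\<bar> + (c + d)"
      using order_trans[OF F[of "\<phi> s" "\<psi> s" 0 0]] add_mono[OF c d, of s s] by simp
    finally show ?thesis .
  qed
  moreover have "order_null (\<lambda>(s, t). \<bar>F (\<phi> s) (\<psi> s) - F (\<phi> t) (\<psi> t)\<bar>) uniformity"
  proof (rule order_null_mono)
    show "order_null (\<lambda>p. (case p of (s, t) \<Rightarrow> \<bar>\<phi> s - \<phi> t\<bar>) + (case p of (s, t) \<Rightarrow> \<bar>\<psi> s - \<psi> t\<bar>)) uniformity"
      using phi psi by (intro order_null_add) (simp_all add: Cuo_orth_iff)
  qed (intro always_eventually, use F in auto)
  ultimately show ?thesis unfolding Cuo_orth_iff by blast
qed

lemma abs_add_diff_le:
  fixes a b :: "'e::lattice_ab_group_add_abs"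
  shows "\<bar>(a + b) - (a' + b')\<bar> \<le> \<bar>a - a'\<bar> + \<bar>b - b'\<bar>"
  using abs_triangle_ineq[of "a - a'" "b - b'"] by (simp add: algebra_simps)

lemma abs_sup_diff_le:
  fixes a b :: "'e::lattice_ab_group_add_abs"
  shows "\<bar>sup a b - sup a' b'\<bar> \<le> \<bar>a - a'\<bar> + \<bar>b - b'\<bar>"
proof -
  have *: "sup a b - sup a' b' \<le> \<bar>a - a'\<bar> + \<bar>b - b'\<bar>" for a b a' b' :: 'e
  proof -
    have "sup a b \<le> sup a' b' + (\<bar>a - a'\<bar> + \<bar>b - b'\<bar>)"
    proof (rule sup_least)
      have "a \<le> a' + \<bar>a - a'\<bar>" using abs_ge_self[of "a - a'"] by (simp add: diff_le_eq add.commute)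
      also have "\<dots> \<le> sup a' b' + (\<bar>a - a'\<bar> + \<bar>b - b'\<bar>)" by (intro add_mono) simp_all
      finally show "a \<le> \<dots>" .
      have "b \<le> b' + \<bar>b - b'\<bar>" using abs_ge_self[of "b - b'"] by (simp add: diff_le_eq add.commute)
      also have "\<dots> \<le> sup a' b' + (\<bar>a - a'\<bar> + \<bar>b - b'\<bar>)" by (intro add_mono) simp_all
      finally show "b \<le> \<dots>" .
    qed
    then show ?thesis by (simp add: diff_le_eq add.commute)
  qed
  show ?thesis
    using *[of a b a' b'] *[of a' b' a b] by (intro abs_leI) (simp_all add: abs_minus_commute)
qed

lemma Cuo_orth_const [simp]: "(\<lambda>s. c) \<in> Cuo_orth"
  unfolding Cuo_orth_iff by (auto simp: case_prod_unfold order_null_zero)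

lemma Cuo_orth_add [simp]: "\<phi> \<in> Cuo_orth \<Longrightarrow> \<psi> \<in> Cuo_orth \<Longrightarrow> (\<lambda>s. \<phi> s + \<psi> s) \<in> Cuo_orth"
  by (rule Cuo_orth_op[OF _ _ abs_add_diff_le])

lemma Cuo_orth_sup [simp]: "\<phi> \<in> Cuo_orth \<Longrightarrow> \<psi> \<in> Cuo_orth \<Longrightarrow> (\<lambda>s. sup (\<phi> s) (\<psi> s)) \<in> Cuo_orth"
  by (rule Cuo_orth_op[OF _ _ abs_sup_diff_le])

lemma Cuo_orth_neg [simp]: "\<phi> \<in> Cuo_orth \<Longrightarrow> (\<lambda>s. - \<phi> s) \<in> Cuo_orth"
  by (rule Cuo_orth_op[where F = "\<lambda>a b. - a", of \<phi> \<phi>]) (simp_all add: abs_minus_commute add_increasing2)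

lemma Cuo_orth_diff [simp]: "\<phi> \<in> Cuo_orth \<Longrightarrow> \<psi> \<in> Cuo_orth \<Longrightarrow> (\<lambda>s. \<phi> s - \<psi> s) \<in> Cuo_orth"
  using Cuo_orth_add[OF _ Cuo_orth_neg, of \<phi> \<psi>] by simp

lemma Cuo_orth_abs [simp]: "\<phi> \<in> Cuo_orth \<Longrightarrow> (\<lambda>s. \<bar>\<phi> s\<bar>) \<in> Cuo_orth"
  by (simp add: abs_lattice)

lemma Cuo_orth_pprt [simp]: "\<phi> \<in> Cuo_orth \<Longrightarrow> (\<lambda>s. pprt (\<phi> s)) \<in> Cuo_orth"
  by (simp add: pprt_def)

lemma Cuo_orth_sum: "finite A \<Longrightarrow> (\<And>i. i \<in> A \<Longrightarrow> \<phi> i \<in> Cuo_orth) \<Longrightarrow> (\<lambda>s. \<Sum>i\<in>A. \<phi> i s) \<in> Cuo_orth"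
  by (induction rule: finite_induct) simp_all

lemma Cuo_orth_bp_mult [simp]:
  fixes \<rho> :: "'e::dedekind_complete_vector_lattice orth"
  assumes "\<rho> \<in> band_projections" "\<phi> \<in> Cuo_orth" shows "(\<lambda>s. \<rho> * \<phi> s) \<in> Cuo_orth"
proof (rule Cuo_orth_op[where F = "\<lambda>a b. \<rho> * a", OF assms(2,2)])
  fix a b a' b' :: "'e orth"
  have "\<bar>\<rho> * a - \<rho> * a'\<bar> = \<rho> * \<bar>a - a'\<bar>"
    using assms by (simp add: bp_abs_mult flip: right_diff_distrib)
  also have "\<dots> \<le> 1 * \<bar>a - a'\<bar>" by (rule mult_right_mono[OF bp_le_one[OF assms(1)] abs_ge_zero])
  finally show "\<bar>\<rho> * a - \<rho> * a'\<bar> \<le> \<bar>a - a'\<bar> + \<bar>b - b'\<bar>" by (simp add: add_increasing2)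
qed

lemma Cuo_orth_scaleR [simp]:
  assumes "\<phi> \<in> Cuo_orth" shows "(\<lambda>s. r *\<^sub>R \<phi> s) \<in> Cuo_orth"
proof -
  have le: "\<bar>r *\<^sub>R x\<bar> \<le> (\<bar>r\<bar> + 1) *\<^sub>R \<bar>x\<bar>" for x :: "'b orth"
    by (rule order_trans[OF abs_scaleR_le scaleR_right_mono]) auto
  obtain c where c: "\<And>s. \<bar>\<phi> s\<bar> \<le> c" using Cuo_orth_bounded[OF assms] by blast
  have "\<bar>r *\<^sub>R \<phi> s\<bar> \<le> (\<bar>r\<bar> + 1) *\<^sub>R c" for s by (rule order_trans[OF le scaleR_left_mono[OF c]]) simp
  moreover have "order_null (\<lambda>(s, t). \<bar>r *\<^sub>R \<phi> s - r *\<^sub>R \<phi> t\<bar>) uniformity"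
  proof (rule order_null_mono)
    show "order_null (\<lambda>p. (\<bar>r\<bar> + 1) *\<^sub>R (case p of (s, t) \<Rightarrow> \<bar>\<phi> s - \<phi> t\<bar>)) uniformity"
      using assms by (intro order_null_scaleR) (simp_all add: Cuo_orth_iff)
    show "\<forall>\<^sub>F p in uniformity. (case p of (s, t) \<Rightarrow> \<bar>r *\<^sub>R \<phi> s - r *\<^sub>R \<phi> t\<bar>) \<le> (\<bar>r\<bar> + 1) *\<^sub>R (case p of (s, t) \<Rightarrow> \<bar>\<phi> s - \<phi> t\<bar>)"
      by (intro always_eventually allI) (use le in \<open>auto simp flip: scaleR_right_diff_distrib\<close>)
  qed
  ultimately show ?thesis unfolding Cuo_orth_iff by blast
qed

section \<open>Sup functionals\<close>

text \<open>A sup functional plays the role of the supremum over a closed set of points of \<open>\<Sigma>\<close>; smaller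
  functionals correspond to smaller sets, and single points to lattice homomorphisms.\<close>

definition sup_functional ::
  "(('s::uniform_space \<Rightarrow> 'e::dedekind_complete_vector_lattice orth) \<Rightarrow> 'e orth) \<Rightarrow> bool" where
  "sup_functional p \<longleftrightarrow>
     (\<forall>\<phi>\<in>Cuo_orth. \<forall>\<psi>\<in>Cuo_orth. p (\<lambda>s. \<phi> s + \<psi> s) \<le> p \<phi> + p \<psi>) \<and>
     (\<forall>\<phi>\<in>Cuo_orth. \<forall>\<psi>\<in>Cuo_orth. p (\<lambda>s. sup (\<phi> s) (\<psi> s)) = sup (p \<phi>) (p \<psi>)) \<and>
     (\<forall>c. p (\<lambda>s. c) = c) \<and>
     (\<forall>r\<ge>0. \<forall>\<phi>\<in>Cuo_orth. p (\<lambda>s. r *\<^sub>R \<phi> s) = r *\<^sub>R p \<phi>)"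

lemma sup_functional_restrict: "sup_functional (restrict p Cuo_orth) \<longleftrightarrow> sup_functional p"
  unfolding sup_functional_def by auto

context
  fixes p :: "('s::uniform_space \<Rightarrow> 'e::dedekind_complete_vector_lattice orth) \<Rightarrow> 'e orth"
  assumes p: "sup_functional p"
begin

lemma sf_add: "\<phi> \<in> Cuo_orth \<Longrightarrow> \<psi> \<in> Cuo_orth \<Longrightarrow> p (\<lambda>s. \<phi> s + \<psi> s) \<le> p \<phi> + p \<psi>"
  and sf_sup: "\<phi> \<in> Cuo_orth \<Longrightarrow> \<psi> \<in> Cuo_orth \<Longrightarrow> p (\<lambda>s. sup (\<phi> s) (\<psi> s)) = sup (p \<phi>) (p \<psi>)"
  and sf_const: "p (\<lambda>s. c) = c"
  and sf_scaleR: "0 \<le> r \<Longrightarrow> \<phi> \<in> Cuo_orth \<Longrightarrow> p (\<lambda>s. r *\<^sub>R \<phi> s) = r *\<^sub>R p \<phi>"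
  using p unfolding sup_functional_def by blast+

lemma sf_mono:
  assumes "\<phi> \<in> Cuo_orth" "\<psi> \<in> Cuo_orth" "\<And>s. \<phi> s \<le> \<psi> s" shows "p \<phi> \<le> p \<psi>"
proof -
  have "(\<lambda>s. sup (\<phi> s) (\<psi> s)) = \<psi>" using assms(3) by (simp add: sup_absorb2)
  then show ?thesis using sf_sup[OF assms(1,2)] by (simp add: le_iff_sup)
qed

lemma sf_add_const:
  assumes phi: "\<phi> \<in> Cuo_orth" shows "p (\<lambda>s. \<phi> s + c) = p \<phi> + c"
proof (rule order.antisym)
  show "p (\<lambda>s. \<phi> s + c) \<le> p \<phi> + c" using sf_add[OF phi Cuo_orth_const, of c] by (simp add: sf_const)
  have "p \<phi> \<le> p (\<lambda>s. \<phi> s + c) + - c"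
    using sf_add[OF Cuo_orth_add[OF phi Cuo_orth_const, of c] Cuo_orth_const, of "- c"] by (simp add: sf_const)
  then show "p \<phi> + c \<le> p (\<lambda>s. \<phi> s + c)" by (simp add: le_diff_eq)
qed

lemma sf_le_const: "\<phi> \<in> Cuo_orth \<Longrightarrow> (\<And>s. \<phi> s \<le> c) \<Longrightarrow> p \<phi> \<le> c"
  using sf_mono[OF _ Cuo_orth_const, of \<phi> c] by (simp add: sf_const)

lemma sf_ge_const: "\<phi> \<in> Cuo_orth \<Longrightarrow> (\<And>s. c \<le> \<phi> s) \<Longrightarrow> c \<le> p \<phi>"
  using sf_mono[OF Cuo_orth_const, of \<phi> c] by (simp add: sf_const)

lemma sf_zero: "p (\<lambda>s. 0) = 0"
  by (rule sf_const)

lemma sf_neg: "\<phi> \<in> Cuo_orth \<Longrightarrow> - p \<phi> \<le> p (\<lambda>s. - \<phi> s)"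
  using sf_add[of \<phi> "\<lambda>s. - \<phi> s"] by (simp add: sf_zero minus_le_iff[of "p \<phi>"] le_eq_neg add.commute)
    (metis add.commute add_le_cancel_left add.right_inverse)

text \<open>Multiplication by a projection is hidden in the lattice operations: for 0 \<le> a \<le>
  2c the supremum of \<open>a\<close> and (1 - \<rho>) 2c is \<rho> a + (1 - \<rho>) 2c. A shift by
  \<open>c\<close> brings \<phi> into that range.\<close>

lemma sf_bp_mult:
  assumes r: "\<rho> \<in> band_projections" and phi: "\<phi> \<in> Cuo_orth"
  shows "p (\<lambda>s. \<rho> * \<phi> s) = \<rho> * p \<phi>"
proof -
  obtain c where c: "\<And>s. \<bar>\<phi> s\<bar> \<le> c" using Cuo_orth_bounded[OF phi] by blast
  define \<psi> where "\<psi> s = \<phi> s + c" for s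
  have psi: "\<psi> \<in> Cuo_orth" unfolding \<psi>_def using phi by simp
  have bound: "0 \<le> \<psi> s" "\<psi> s \<le> c + c" for s
  proof -
    have "- c \<le> \<phi> s" using abs_le_D2[OF c[of s]] by (simp only: minus_le_iff)
    then have "- c + c \<le> \<phi> s + c" by (rule add_right_mono)
    then show "0 \<le> \<psi> s" by (simp add: \<psi>_def)
    show "\<psi> s \<le> c + c" using abs_le_D1[OF c[of s]] by (simp add: \<psi>_def)
  qed
  define d where "d = (1 - \<rho>) * (c + c)"
  have glue: "sup a d = \<rho> * a + d" if a: "0 \<le> a" "a \<le> c + c" for a
  proof -
    have dd: "\<rho> * d = 0" "(1 - \<rho>) * d = d" using bp_idem[OF r] bp_idem[OF bp_compl[OF r]]
      by (simp_all add: d_def right_diff_distrib flip: mult.assoc)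
    have ra: "0 \<le> \<rho> * a" using a r by (simp add: bp_nonneg mult_nonneg_nonneg)
    have "(1 - \<rho>) * a \<le> d" unfolding d_def by (rule bp_mult_mono[OF bp_compl[OF r] a(2)])
    then have "\<rho> * sup a d + (1 - \<rho>) * sup a d = \<rho> * a + d"
      using dd ra by (simp only: bp_sup_mult[OF r] bp_sup_mult[OF bp_compl[OF r]] sup_absorb1 sup_absorb2)
    then show ?thesis by (simp add: left_diff_distrib)
  qed
  have 0: "0 \<le> p \<psi>" "p \<psi> \<le> c + c" using sf_ge_const[OF psi] sf_le_const[OF psi] bound by blast+
  have "p (\<lambda>s. \<rho> * \<psi> s) + d = p (\<lambda>s. \<rho> * \<psi> s + d)" using sf_add_const[OF Cuo_orth_bp_mult[OF r psi]] by simp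
  also have "\<dots> = p (\<lambda>s. sup (\<psi> s) d)" using glue bound by simp
  also have "\<dots> = \<rho> * p \<psi> + d" using sf_sup[OF psi Cuo_orth_const] glue[OF 0] by (simp add: sf_const)
  finally have "p (\<lambda>s. \<rho> * \<psi> s) = \<rho> * p \<psi>" by simp
  moreover have "p \<psi> = p \<phi> + c" unfolding \<psi>_def by (rule sf_add_const[OF phi])
  moreover have "p (\<lambda>s. \<rho> * \<psi> s) = p (\<lambda>s. \<rho> * \<phi> s) + \<rho> * c"
    unfolding \<psi>_def distrib_left by (rule sf_add_const[OF Cuo_orth_bp_mult[OF r phi]])
  ultimately show ?thesis by (simp add: distrib_left)
qed

end

text \<open>The infinite distributive law in the form needed for infima:
  \<open>sup a b = a + pprt (b - a)\<close>, and the second summand grows when \<open>a\<close> is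
  replaced by the infimum.\<close>

lemma le_sup_Inf:
  fixes A :: "'e::dedekind_complete_vector_lattice set"
  assumes ne: "A \<noteq> {}" and bd: "bdd_below A" and z: "\<And>a. a \<in> A \<Longrightarrow> z \<le> sup a b"
  shows "z \<le> sup (Inf A) b"
proof -
  define k where "k = pprt (b - Inf A)"
  have "z - k \<le> Inf A"
  proof (rule cInf_greatest[OF ne])
    fix a assume a: "a \<in> A"
    have "z \<le> sup a b" by (rule z[OF a])
    also have "\<dots> = a + pprt (b - a)" by (subst sup_commute) (rule sup_eq_pprt)
    also have "\<dots> \<le> a + k"
      unfolding k_def by (intro add_left_mono pprt_mono diff_left_mono cInf_lower a bd)
    finally show "z - k \<le> a" by (simp add: diff_le_eq)
  qed
  then have "z \<le> Inf A + k" by (simp add: diff_le_eq)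
  also have "\<dots> = sup (Inf A) b" unfolding k_def by (subst sup_commute) (rule sup_eq_pprt[symmetric])
  finally show ?thesis .
qed

text \<open>The members need not be sup functionals themselves: for each pair one third member has
  to satisfy the estimates with \<open>p\<close> at \<phi> and \<open>q\<close> at \<psi>, and
  scaling may change the member. This weak directedness holds both for chains of sup functionals and
  for the penalized functionals whose infimum is a face.\<close>

lemma sup_functional_INF:
  fixes \<P> :: "(('s::uniform_space \<Rightarrow> 'e::dedekind_complete_vector_lattice orth) \<Rightarrow> 'e orth) set"
  assumes ne: "\<P> \<noteq> {}"
    and mono': "\<forall>p\<in>\<P>. \<forall>\<phi>\<in>Cuo_orth. \<forall>\<psi>\<in>Cuo_orth. (\<forall>s. \<phi> s \<le> \<psi> s) \<longrightarrow> p \<phi> \<le> p \<psi>"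
    and const': "\<forall>p\<in>\<P>. \<forall>c. p (\<lambda>s. c) = c"
    and dir': "\<forall>p\<in>\<P>. \<forall>q\<in>\<P>. \<exists>r\<in>\<P>. \<forall>\<phi>\<in>Cuo_orth. \<forall>\<psi>\<in>Cuo_orth.
      r (\<lambda>s. \<phi> s + \<psi> s) \<le> p \<phi> + q \<psi> \<and> r (\<lambda>s. sup (\<phi> s) (\<psi> s)) \<le> sup (p \<phi>) (q \<psi>)"
    and scale': "\<forall>p\<in>\<P>. \<forall>k::real. k > 0 \<longrightarrow> (\<exists>r\<in>\<P>. \<forall>\<phi>\<in>Cuo_orth. r (\<lambda>s. k *\<^sub>R \<phi> s) \<le> k *\<^sub>R p \<phi>)"
  shows "sup_functional (\<lambda>\<phi>. INF p\<in>\<P>. p \<phi>)"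
    and "\<forall>p\<in>\<P>. \<forall>\<phi>\<in>Cuo_orth. (INF p\<in>\<P>. p \<phi>) \<le> p \<phi>"
proof -
  note mono = mono'[rule_format] and const = const'[rule_format] and dir = dir'[rule_format]
    and scale = scale'[rule_format]
  define P where "P \<phi> = (INF p\<in>\<P>. p \<phi>)" for \<phi>
  have bd: "bdd_below ((\<lambda>p. p \<phi>) ` \<P>)" if phi: "\<phi> \<in> Cuo_orth" for \<phi>
  proof -
    obtain c where c: "\<And>s. \<bar>\<phi> s\<bar> \<le> c" using Cuo_orth_bounded[OF phi] by blast
    have "- c \<le> p \<phi>" if "p \<in> \<P>" for p
    proof -
      have "- c \<le> \<phi> s" for s using abs_le_D2[OF c[of s]] by (simp only: minus_le_iff)
      from mono[OF that Cuo_orth_const phi this] show ?thesis using const[OF that] by simp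
    qed
    then show ?thesis by (intro bdd_belowI[of _ "- c"]) auto
  qed
  have low: "P \<phi> \<le> p \<phi>" if "p \<in> \<P>" "\<phi> \<in> Cuo_orth" for p \<phi>
    unfolding P_def by (rule cINF_lower[OF bd[OF that(2)] that(1)])
  then show "\<forall>p\<in>\<P>. \<forall>\<phi>\<in>Cuo_orth. (INF p\<in>\<P>. p \<phi>) \<le> p \<phi>" unfolding P_def by blast
  have great: "u \<le> P \<phi>" if "\<And>p. p \<in> \<P> \<Longrightarrow> u \<le> p \<phi>" for u \<phi>
    unfolding P_def by (rule cINF_greatest[OF ne that])
  have Pmono: "P \<phi> \<le> P \<psi>" if "\<phi> \<in> Cuo_orth" "\<psi> \<in> Cuo_orth" "\<And>s. \<phi> s \<le> \<psi> s" for \<phi> \<psi>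
    by (rule great) (rule order_trans[OF low mono], use that in auto)
  have Pconst: "P (\<lambda>s. c) = c" for c
  proof -
    have "P (\<lambda>s. c) = (INF p\<in>\<P>. c)" unfolding P_def by (rule INF_cong) (simp_all add: const)
    then show ?thesis using ne by simp
  qed
  have Pscale: "P (\<lambda>s. k *\<^sub>R \<phi> s) \<le> k *\<^sub>R P \<phi>" if k: "k > 0" and phi: "\<phi> \<in> Cuo_orth" for k \<phi>
  proof -
    have "(1 / k) *\<^sub>R P (\<lambda>s. k *\<^sub>R \<phi> s) \<le> P \<phi>"
    proof (rule great)
      fix p assume p: "p \<in> \<P>"
      obtain r where r: "r \<in> \<P>" "\<forall>\<phi>\<in>Cuo_orth. r (\<lambda>s. k *\<^sub>R \<phi> s) \<le> k *\<^sub>R p \<phi>"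
        using scale[OF p k] by blast
      have "P (\<lambda>s. k *\<^sub>R \<phi> s) \<le> k *\<^sub>R p \<phi>" 
        by (rule order_trans[OF low[OF r(1) Cuo_orth_scaleR[OF phi]] r(2)[rule_format, OF phi]])
      from scaleR_left_mono[OF this, of "1 / k"] show "(1 / k) *\<^sub>R P (\<lambda>s. k *\<^sub>R \<phi> s) \<le> p \<phi>" using k by simp
    qed
    from scaleR_left_mono[OF this, of k] show ?thesis using k by simp
  qed
  have "sup_functional P"
    unfolding sup_functional_def
  proof (intro conjI ballI allI impI)
    fix \<phi> \<psi> :: "'s \<Rightarrow> 'e orth" assume phi: "\<phi> \<in> Cuo_orth" and psi: "\<psi> \<in> Cuo_orth"
    have "P (\<lambda>s. \<phi> s + \<psi> s) - P \<psi> \<le> P \<phi>"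
    proof (rule great)
      fix p assume p: "p \<in> \<P>"
      have "P (\<lambda>s. \<phi> s + \<psi> s) - p \<phi> \<le> P \<psi>"
      proof (rule great)
        fix q assume q: "q \<in> \<P>"
        obtain r where r: "r \<in> \<P>" "r (\<lambda>s. \<phi> s + \<psi> s) \<le> p \<phi> + q \<psi>" using dir[OF p q] phi psi by blast
        have "P (\<lambda>s. \<phi> s + \<psi> s) \<le> p \<phi> + q \<psi>"
          by (rule order_trans[OF low[OF r(1) Cuo_orth_add[OF phi psi]] r(2)])
        then show "P (\<lambda>s. \<phi> s + \<psi> s) - p \<phi> \<le> q \<psi>" by (simp add: diff_le_eq add.commute)
      qed
      then show "P (\<lambda>s. \<phi> s + \<psi> s) - P \<psi> \<le> p \<phi>" by (simp add: diff_le_eq add.commute)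
    qed
    then show "P (\<lambda>s. \<phi> s + \<psi> s) \<le> P \<phi> + P \<psi>" by (simp add: diff_le_eq)
    show "P (\<lambda>s. sup (\<phi> s) (\<psi> s)) = sup (P \<phi>) (P \<psi>)"
    proof (rule order.antisym)
      show "sup (P \<phi>) (P \<psi>) \<le> P (\<lambda>s. sup (\<phi> s) (\<psi> s))"
        by (intro sup_least Pmono) (use phi psi in auto)
      show "P (\<lambda>s. sup (\<phi> s) (\<psi> s)) \<le> sup (P \<phi>) (P \<psi>)"
        unfolding P_def[of \<phi>]
      proof (rule le_sup_Inf[OF _ bd[OF phi]])
        fix a assume "a \<in> (\<lambda>p. p \<phi>) ` \<P>"
        then obtain p where p: "p \<in> \<P>" "a = p \<phi>" by blast
        have "P (\<lambda>s. sup (\<phi> s) (\<psi> s)) \<le> sup (P \<psi>) a"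
          unfolding P_def[of \<psi>]
        proof (rule le_sup_Inf[OF _ bd[OF psi]])
          fix b assume "b \<in> (\<lambda>p. p \<psi>) ` \<P>"
          then obtain q where q: "q \<in> \<P>" "b = q \<psi>" by blast
          obtain r where r: "r \<in> \<P>" "r (\<lambda>s. sup (\<phi> s) (\<psi> s)) \<le> sup (p \<phi>) (q \<psi>)"
            using dir[OF p(1) q(1)] phi psi by blast
          show "P (\<lambda>s. sup (\<phi> s) (\<psi> s)) \<le> sup b a"
            using order_trans[OF low[OF r(1) Cuo_orth_sup[OF phi psi]] r(2)] p q by (simp add: sup_commute)
        qed (use ne in blast)
        then show "P (\<lambda>s. sup (\<phi> s) (\<psi> s)) \<le> sup a (P \<psi>)" by (simp add: sup_commute)
      qed (use ne in blast)
    qed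
  next
    fix r :: real and \<phi> :: "'s \<Rightarrow> 'e orth" assume r: "0 \<le> r" and phi: "\<phi> \<in> Cuo_orth"
    show "P (\<lambda>s. r *\<^sub>R \<phi> s) = r *\<^sub>R P \<phi>"
    proof (cases "r = 0")
      case False
      then have r: "r > 0" using r by simp
      have "P (\<lambda>s. (1 / r) *\<^sub>R r *\<^sub>R \<phi> s) \<le> (1 / r) *\<^sub>R P (\<lambda>s. r *\<^sub>R \<phi> s)"
        by (rule Pscale) (use r phi in auto)
      then have "P \<phi> \<le> (1 / r) *\<^sub>R P (\<lambda>s. r *\<^sub>R \<phi> s)" using r by simp
      from scaleR_left_mono[OF this, of r] have "r *\<^sub>R P \<phi> \<le> P (\<lambda>s. r *\<^sub>R \<phi> s)" using r by simp
      then show ?thesis using Pscale[OF r phi] by (rule order.antisym[rotated])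
    qed (simp add: Pconst)
  qed (simp add: Pconst)
  then show "sup_functional (\<lambda>\<phi>. INF p\<in>\<P>. p \<phi>)" unfolding P_def[abs_def] .
qed

text \<open>The largest sup functional, which stands for all of \<Sigma>; it is the start of the
  descent.\<close>

lemma sup_functional_SUP:
  "sup_functional (\<lambda>\<phi> :: 's::uniform_space \<Rightarrow> 'e::dedekind_complete_vector_lattice orth. SUP s. \<phi> s)"
proof -
  define P :: "('s \<Rightarrow> 'e orth) \<Rightarrow> 'e orth" where "P \<phi> = (SUP s. \<phi> s)" for \<phi>
  have up: "\<phi> s \<le> P \<phi>" if phi: "\<phi> \<in> Cuo_orth" for \<phi> :: "'s \<Rightarrow> 'e orth" and s
  proof -
    obtain c where c: "\<And>s. \<bar>\<phi> s\<bar> \<le> c" using Cuo_orth_bounded[OF phi] by blast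
    have "bdd_above (range \<phi>)" by (rule bdd_aboveI[of _ c]) (use abs_le_D1[OF c] in auto)
    then show ?thesis unfolding P_def by (intro cSUP_upper) simp_all
  qed
  have least: "P \<phi> \<le> u" if "\<And>s. \<phi> s \<le> u" for \<phi> :: "'s \<Rightarrow> 'e orth" and u
    unfolding P_def by (rule cSUP_least) (use that in auto)
  have scale: "P (\<lambda>s. r *\<^sub>R \<phi> s) \<le> r *\<^sub>R P \<phi>" if "0 \<le> r" "\<phi> \<in> Cuo_orth" for r \<phi>
    by (rule least) (rule scaleR_left_mono[OF up], use that in auto)
  have "sup_functional P"
    unfolding sup_functional_def
  proof (intro conjI ballI allI impI)
    fix \<phi> \<psi> :: "'s \<Rightarrow> 'e orth" assume phi: "\<phi> \<in> Cuo_orth" and psi: "\<psi> \<in> Cuo_orth"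
    show "P (\<lambda>s. \<phi> s + \<psi> s) \<le> P \<phi> + P \<psi>" by (rule least) (intro add_mono up phi psi)
    show "P (\<lambda>s. sup (\<phi> s) (\<psi> s)) = sup (P \<phi>) (P \<psi>)"
    proof (rule order.antisym)
      show "P (\<lambda>s. sup (\<phi> s) (\<psi> s)) \<le> sup (P \<phi>) (P \<psi>)" by (rule least) (intro sup_mono up phi psi)
      have "\<phi> s \<le> P (\<lambda>s. sup (\<phi> s) (\<psi> s))" "\<psi> s \<le> P (\<lambda>s. sup (\<phi> s) (\<psi> s))" for s
        using up[OF Cuo_orth_sup[OF phi psi], of s] by simp_all
      then show "sup (P \<phi>) (P \<psi>) \<le> P (\<lambda>s. sup (\<phi> s) (\<psi> s))" by (intro sup_least least)
    qed
  next
    fix r :: real and \<phi> :: "'s \<Rightarrow> 'e orth" assume r: "0 \<le> r" and phi: "\<phi> \<in> Cuo_orth"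
    show "P (\<lambda>s. r *\<^sub>R \<phi> s) = r *\<^sub>R P \<phi>"
    proof (cases "r = 0")
      case False
      then have r: "r > 0" using r by simp
      have "P (\<lambda>s. (1 / r) *\<^sub>R r *\<^sub>R \<phi> s) \<le> (1 / r) *\<^sub>R P (\<lambda>s. r *\<^sub>R \<phi> s)"
        by (rule scale) (use r phi in auto)
      then have "P \<phi> \<le> (1 / r) *\<^sub>R P (\<lambda>s. r *\<^sub>R \<phi> s)" using r by simp
      from scaleR_left_mono[OF this, of r] have "r *\<^sub>R P \<phi> \<le> P (\<lambda>s. r *\<^sub>R \<phi> s)" using r by simp
      then show ?thesis using scale[OF less_imp_le[OF r] phi] by (rule order.antisym[rotated])
    qed (simp add: P_def)
  qed (simp add: P_def)
  then show ?thesis unfolding P_def[abs_def] .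
qed

section \<open>Faces and minimal sup functionals\<close>

text \<open>If \<open>p\<close> is the supremum over \<open>T\<close> and \<open>\<theta>\<close> has maximum \<open>0\<close> on \<open>T\<close>, then \<open>face p \<theta>\<close> is the supremum over
  the set of points of \<open>T\<close> where this maximum is attained.\<close>

definition face ::
  "(('s \<Rightarrow> 'e::dedekind_complete_vector_lattice orth) \<Rightarrow> 'e orth) \<Rightarrow> ('s \<Rightarrow> 'e orth) \<Rightarrow> ('s \<Rightarrow> 'e orth) \<Rightarrow> 'e orth" where
  "face p \<theta> \<chi> = (INF c\<in>{0::real..}. p (\<lambda>s. \<chi> s + c *\<^sub>R \<theta> s))"

text \<open>\<theta> acts as a penalty. Since \<open>p \<theta> = 0\<close>, the functional with
  factor c + d lies below the one with factor c, so c + d is the common member required for factors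
  c and d. The choice c = 1 cancels -\<theta> and gives the last claim.\<close>

lemma face:
  fixes p :: "('s::uniform_space \<Rightarrow> 'e::dedekind_complete_vector_lattice orth) \<Rightarrow> 'e orth"
  assumes p: "sup_functional p" and th: "\<theta> \<in> Cuo_orth" "p \<theta> = 0"
  shows sup_functional_face: "sup_functional (face p \<theta>)"
    and face_le: "\<chi> \<in> Cuo_orth \<Longrightarrow> face p \<theta> \<chi> \<le> p \<chi>"
    and face_vertex: "face p \<theta> (\<lambda>s. - \<theta> s) \<le> 0"
proof -
  define \<P> where "\<P> = (\<lambda>c \<chi>. p (\<lambda>s. \<chi> s + c *\<^sub>R \<theta> s)) ` {0::real..}"
  have C: "(\<lambda>s. \<chi> s + c *\<^sub>R \<theta> s) \<in> Cuo_orth" if "\<chi> \<in> Cuo_orth" for \<chi> and c using that th by simp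
  have eq: "face p \<theta> = (\<lambda>\<chi>. INF q\<in>\<P>. q \<chi>)"
    by (simp add: face_def \<P>_def image_image fun_eq_iff)
  have more: "p (\<lambda>s. \<chi> s + (c + d) *\<^sub>R \<theta> s) \<le> p (\<lambda>s. \<chi> s + c *\<^sub>R \<theta> s)"
    if "\<chi> \<in> Cuo_orth" "0 \<le> d" for \<chi> c d
  proof -
    have "p (\<lambda>s. (\<chi> s + c *\<^sub>R \<theta> s) + d *\<^sub>R \<theta> s) \<le> p (\<lambda>s. \<chi> s + c *\<^sub>R \<theta> s) + p (\<lambda>s. d *\<^sub>R \<theta> s)"
      by (rule sf_add[OF p C[OF that(1)]]) (use th in simp)
    then show ?thesis using sf_scaleR[OF p that(2) th(1)] th(2) by (simp add: algebra_simps)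
  qed
  have ne: "\<P> \<noteq> {}" by (auto simp: \<P>_def)
  have mono: "\<And>q \<phi> \<psi>. q \<in> \<P> \<Longrightarrow> \<phi> \<in> Cuo_orth \<Longrightarrow> \<psi> \<in> Cuo_orth \<Longrightarrow> (\<And>s. \<phi> s \<le> \<psi> s) \<Longrightarrow> q \<phi> \<le> q \<psi>"
    unfolding \<P>_def by (auto intro!: sf_mono[OF p] simp: th)
  have const: "\<And>q c. q \<in> \<P> \<Longrightarrow> q (\<lambda>s. c) = c"
  proof -
    fix q k assume "q \<in> \<P>"
    then obtain c where c: "0 \<le> c" "q = (\<lambda>\<chi>. p (\<lambda>s. \<chi> s + c *\<^sub>R \<theta> s))" by (auto simp: \<P>_def)
    have "p (\<lambda>s. c *\<^sub>R \<theta> s + k) = k"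
      using sf_add_const[OF p, of "\<lambda>s. c *\<^sub>R \<theta> s" k] sf_scaleR[OF p c(1) th(1)] th by simp
    then show "q (\<lambda>s. k) = k" by (simp add: c(2) add.commute)
  qed
  have dir: "\<forall>q\<in>\<P>. \<forall>q'\<in>\<P>. \<exists>r\<in>\<P>. \<forall>\<phi>\<in>Cuo_orth. \<forall>\<psi>\<in>Cuo_orth.
    r (\<lambda>s. \<phi> s + \<psi> s) \<le> q \<phi> + q' \<psi> \<and> r (\<lambda>s. sup (\<phi> s) (\<psi> s)) \<le> sup (q \<phi>) (q' \<psi>)"
  proof (intro ballI)
    fix q q' assume "q \<in> \<P>" "q' \<in> \<P>"
    then obtain c d where c: "0 \<le> c" "q = (\<lambda>\<chi>. p (\<lambda>s. \<chi> s + c *\<^sub>R \<theta> s))"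
      and d: "0 \<le> d" "q' = (\<lambda>\<chi>. p (\<lambda>s. \<chi> s + d *\<^sub>R \<theta> s))" by (auto simp: \<P>_def)
    show "\<exists>r\<in>\<P>. \<forall>\<phi>\<in>Cuo_orth. \<forall>\<psi>\<in>Cuo_orth.
      r (\<lambda>s. \<phi> s + \<psi> s) \<le> q \<phi> + q' \<psi> \<and> r (\<lambda>s. sup (\<phi> s) (\<psi> s)) \<le> sup (q \<phi>) (q' \<psi>)"
    proof (intro bexI[of _ "\<lambda>\<chi>. p (\<lambda>s. \<chi> s + (c + d) *\<^sub>R \<theta> s)"] ballI conjI)
      fix \<phi> \<psi> :: "'s \<Rightarrow> 'e orth" assume phi: "\<phi> \<in> Cuo_orth" and psi: "\<psi> \<in> Cuo_orth"
      have "p (\<lambda>s. (\<phi> s + c *\<^sub>R \<theta> s) + (\<psi> s + d *\<^sub>R \<theta> s)) \<le> q \<phi> + q' \<psi>"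
        unfolding c(2) d(2) by (rule sf_add[OF p C[OF phi] C[OF psi]])
      then show "p (\<lambda>s. \<phi> s + \<psi> s + (c + d) *\<^sub>R \<theta> s) \<le> q \<phi> + q' \<psi>" by (simp add: algebra_simps)
      have "p (\<lambda>s. sup (\<phi> s) (\<psi> s) + (c + d) *\<^sub>R \<theta> s)
        = p (\<lambda>s. sup (\<phi> s + (c + d) *\<^sub>R \<theta> s) (\<psi> s + (d + c) *\<^sub>R \<theta> s))"
        by (simp add: add_sup_distrib_right add.commute)
      also have "\<dots> = sup (p (\<lambda>s. \<phi> s + (c + d) *\<^sub>R \<theta> s)) (p (\<lambda>s. \<psi> s + (d + c) *\<^sub>R \<theta> s))"
        by (rule sf_sup[OF p C[OF phi] C[OF psi]])
      also have "\<dots> \<le> sup (q \<phi>) (q' \<psi>)"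
        unfolding c(2) d(2) by (intro sup_mono more phi psi c d)
      finally show "p (\<lambda>s. sup (\<phi> s) (\<psi> s) + (c + d) *\<^sub>R \<theta> s) \<le> sup (q \<phi>) (q' \<psi>)" .
    qed (use c d in \<open>auto simp: \<P>_def\<close>)
  qed
  have scale: "\<forall>q\<in>\<P>. \<forall>k::real. k > 0 \<longrightarrow> (\<exists>r\<in>\<P>. \<forall>\<phi>\<in>Cuo_orth. r (\<lambda>s. k *\<^sub>R \<phi> s) \<le> k *\<^sub>R q \<phi>)"
  proof (intro ballI allI impI)
    fix q and k :: real assume "q \<in> \<P>" and k: "k > 0"
    then obtain c where c: "0 \<le> c" "q = (\<lambda>\<chi>. p (\<lambda>s. \<chi> s + c *\<^sub>R \<theta> s))" by (auto simp: \<P>_def)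
    show "\<exists>r\<in>\<P>. \<forall>\<phi>\<in>Cuo_orth. r (\<lambda>s. k *\<^sub>R \<phi> s) \<le> k *\<^sub>R q \<phi>"
    proof (intro bexI[of _ "\<lambda>\<chi>. p (\<lambda>s. \<chi> s + (k * c) *\<^sub>R \<theta> s)"] ballI)
      fix \<phi> :: "'s \<Rightarrow> 'e orth" assume phi: "\<phi> \<in> Cuo_orth"
      have "p (\<lambda>s. k *\<^sub>R (\<phi> s + c *\<^sub>R \<theta> s)) = k *\<^sub>R q \<phi>"
        unfolding c(2) by (rule sf_scaleR[OF p _ C[OF phi]]) (use k in simp)
      then show "p (\<lambda>s. k *\<^sub>R \<phi> s + (k * c) *\<^sub>R \<theta> s) \<le> k *\<^sub>R q \<phi>" by (simp add: scaleR_add_right)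
    qed (use c k in \<open>auto simp: \<P>_def\<close>)
  qed
  have "\<forall>p\<in>\<P>. \<forall>\<phi>\<in>Cuo_orth. \<forall>\<psi>\<in>Cuo_orth. (\<forall>s. \<phi> s \<le> \<psi> s) \<longrightarrow> p \<phi> \<le> p \<psi>"
    and "\<forall>p\<in>\<P>. \<forall>c. p (\<lambda>s. c) = c"
    using mono const by blast+
  note INF = sup_functional_INF[of \<P>, OF ne this dir scale]
  have *: "sup_functional (\<lambda>\<chi>. INF q\<in>\<P>. q \<chi>)" by (rule INF(1))
  have low: "(INF q\<in>\<P>. q \<chi>) \<le> q \<chi>" if "q \<in> \<P>" "\<chi> \<in> Cuo_orth" for q \<chi>
    using INF(2) that by blast
  show "sup_functional (face p \<theta>)" unfolding eq by (rule *)
  have low': "face p \<theta> \<chi> \<le> p (\<lambda>s. \<chi> s + c *\<^sub>R \<theta> s)" if "\<chi> \<in> Cuo_orth" "0 \<le> c" for \<chi> c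
    unfolding eq using low[of "\<lambda>\<chi>. p (\<lambda>s. \<chi> s + c *\<^sub>R \<theta> s)" \<chi>] that by (auto simp: \<P>_def)
  show "\<chi> \<in> Cuo_orth \<Longrightarrow> face p \<theta> \<chi> \<le> p \<chi>" using low'[of \<chi> 0] by simp
  show "face p \<theta> (\<lambda>s. - \<theta> s) \<le> 0" using low'[of "\<lambda>s. - \<theta> s" 1] th sf_zero[OF p] by simp
qed

text \<open>Zorn's lemma for the reversed pointwise order: \<open>R m p\<close> says that
  \<open>p\<close> lies below \<open>m\<close>. Extensionality makes the order antisymmetric. The
  closure assumption describes the infimum \<open>q\<close> by its order properties, which is all
  that the constraints on \<open>K\<close> have to survive.\<close>

lemma minimal_sup_functional:
  fixes K :: "(('s::uniform_space \<Rightarrow> 'e::dedekind_complete_vector_lattice orth) \<Rightarrow> 'e orth) set"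
  assumes ne: "K \<noteq> {}" and K: "\<And>p. p \<in> K \<Longrightarrow> sup_functional p" "K \<subseteq> extensional Cuo_orth"
    and Inf: "\<And>\<P> q. \<P> \<subseteq> K \<Longrightarrow> \<P> \<noteq> {} \<Longrightarrow> sup_functional q \<Longrightarrow> q \<in> extensional Cuo_orth \<Longrightarrow>
      (\<And>p \<phi>. p \<in> \<P> \<Longrightarrow> \<phi> \<in> Cuo_orth \<Longrightarrow> q \<phi> \<le> p \<phi>) \<Longrightarrow>
      (\<And>u \<phi>. \<phi> \<in> Cuo_orth \<Longrightarrow> (\<And>p. p \<in> \<P> \<Longrightarrow> u \<le> p \<phi>) \<Longrightarrow> u \<le> q \<phi>) \<Longrightarrow> q \<in> K"
  obtains m where "m \<in> K" "\<And>p. p \<in> K \<Longrightarrow> (\<And>\<phi>. \<phi> \<in> Cuo_orth \<Longrightarrow> p \<phi> \<le> m \<phi>) \<Longrightarrow> p = m"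
proof -
  define R where "R m p \<longleftrightarrow> (\<forall>\<phi>\<in>Cuo_orth. p \<phi> \<le> m \<phi>)"
    for m p :: "('s \<Rightarrow> 'e orth) \<Rightarrow> 'e orth"
  have "\<exists>m\<in>K. \<forall>p\<in>K. R m p \<longrightarrow> p = m"
  proof (rule predicate_Zorn)
    show "partial_order_on K (relation_of R K)"
    proof (rule partial_order_on_relation_ofI)
      fix p q assume pq: "p \<in> K" "q \<in> K" "R p q" "R q p"
      show "p = q"
      proof (rule extensionalityI[of _ Cuo_orth])
        show "p \<phi> = q \<phi>" if "\<phi> \<in> Cuo_orth" for \<phi>
          using pq(3,4) that unfolding R_def by (blast intro: order.antisym)
      qed (use pq K(2) in auto)
    qed (auto simp: R_def intro: order_trans)
  next
    fix \<P> assume "\<P> \<in> Chains (relation_of R K)"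
    then have PK: "\<P> \<subseteq> K" and chain: "\<And>p q. p \<in> \<P> \<Longrightarrow> q \<in> \<P> \<Longrightarrow> R p q \<or> R q p"
      by (auto simp: Chains_def relation_of_def)
    show "\<exists>u\<in>K. \<forall>a\<in>\<P>. R a u"
    proof (cases "\<P> = {}")
      case False
      have sf: "sup_functional p" if "p \<in> \<P>" for p using K(1) PK that by blast
      have dir: "\<forall>p\<in>\<P>. \<forall>q\<in>\<P>. \<exists>r\<in>\<P>. \<forall>\<phi>\<in>Cuo_orth. \<forall>\<psi>\<in>Cuo_orth.
        r (\<lambda>s. \<phi> s + \<psi> s) \<le> p \<phi> + q \<psi> \<and> r (\<lambda>s. sup (\<phi> s) (\<psi> s)) \<le> sup (p \<phi>) (q \<psi>)"
      proof (intro ballI)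
        fix p q assume pq: "p \<in> \<P>" "q \<in> \<P>"
        obtain r where r: "r \<in> \<P>" "R p r" "R q r"
          using chain[OF pq] pq by (auto simp: R_def)
        have "r (\<lambda>s. \<phi> s + \<psi> s) \<le> p \<phi> + q \<psi> \<and> r (\<lambda>s. sup (\<phi> s) (\<psi> s)) \<le> sup (p \<phi>) (q \<psi>)"
          if "\<phi> \<in> Cuo_orth" "\<psi> \<in> Cuo_orth" for \<phi> \<psi>
        proof
          have le: "r \<phi> \<le> p \<phi>" "r \<psi> \<le> q \<psi>" using r that by (auto simp: R_def)
          show "r (\<lambda>s. \<phi> s + \<psi> s) \<le> p \<phi> + q \<psi>"
            by (rule order_trans[OF sf_add[OF sf[OF r(1)] that] add_mono[OF le]])
          show "r (\<lambda>s. sup (\<phi> s) (\<psi> s)) \<le> sup (p \<phi>) (q \<psi>)"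
            unfolding sf_sup[OF sf[OF r(1)] that] by (rule sup_mono[OF le])
        qed
        then show "\<exists>r\<in>\<P>. \<forall>\<phi>\<in>Cuo_orth. \<forall>\<psi>\<in>Cuo_orth.
          r (\<lambda>s. \<phi> s + \<psi> s) \<le> p \<phi> + q \<psi> \<and> r (\<lambda>s. sup (\<phi> s) (\<psi> s)) \<le> sup (p \<phi>) (q \<psi>)"
          using r(1) by blast
      qed
      have scale: "\<forall>p\<in>\<P>. \<forall>k::real. k > 0 \<longrightarrow> (\<exists>r\<in>\<P>. \<forall>\<phi>\<in>Cuo_orth. r (\<lambda>s. k *\<^sub>R \<phi> s) \<le> k *\<^sub>R p \<phi>)"
      proof (intro ballI allI impI)
        fix p and k :: real assume "p \<in> \<P>" "k > 0"
        then show "\<exists>r\<in>\<P>. \<forall>\<phi>\<in>Cuo_orth. r (\<lambda>s. k *\<^sub>R \<phi> s) \<le> k *\<^sub>R p \<phi>"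
          using sf_scaleR[OF sf, of p k] by (intro bexI[of _ p]) auto
      qed
      have "\<forall>p\<in>\<P>. \<forall>\<phi>\<in>Cuo_orth. \<forall>\<psi>\<in>Cuo_orth. (\<forall>s. \<phi> s \<le> \<psi> s) \<longrightarrow> p \<phi> \<le> p \<psi>"
        and "\<forall>p\<in>\<P>. \<forall>c. p (\<lambda>s. c) = c"
        using sf_mono[OF sf] sf_const[OF sf] by blast+
      note INF = sup_functional_INF[OF False this dir scale]
      define q where "q = restrict (\<lambda>\<phi>. INF p\<in>\<P>. p \<phi>) Cuo_orth"
      have low: "q \<phi> \<le> p \<phi>" if "p \<in> \<P>" "\<phi> \<in> Cuo_orth" for p \<phi>
        using INF(2) that by (simp add: q_def)
      have "q \<in> K"
      proof (rule Inf[OF PK False])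
        show "sup_functional q" unfolding q_def sup_functional_restrict by (rule INF(1))
        show "u \<le> q \<phi>" if "\<phi> \<in> Cuo_orth" "\<And>p. p \<in> \<P> \<Longrightarrow> u \<le> p \<phi>" for u \<phi>
          unfolding q_def using that False by (auto intro: cINF_greatest)
      qed (use low in \<open>auto simp: q_def\<close>)
      then show ?thesis using low unfolding R_def by blast
    qed (use ne in auto)
  qed
  then show ?thesis using that unfolding R_def by blast
qed

text \<open>A sup functional with \<open>p (- \<phi>) = - p \<phi>\<close> is a unital lattice homomorphism.\<close>

definition odd_functional ::
  "(('s::uniform_space \<Rightarrow> 'e::dedekind_complete_vector_lattice orth) \<Rightarrow> 'e orth) \<Rightarrow> bool" where
  "odd_functional p \<longleftrightarrow> (\<forall>\<phi>\<in>Cuo_orth. p (\<lambda>s. - \<phi> s) = - p \<phi>)"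

text \<open>Analogue of the existence of extreme points in a face. Pass to the face where \<psi>
  attains \<open>p \<psi>\<close>, then to a minimal sup functional below it. For each \<phi> the
  face where \<phi> attains its maximum cannot be smaller, which forces oddness.\<close>

lemma dominated_homomorphism:
  fixes p :: "('s::uniform_space \<Rightarrow> 'e::dedekind_complete_vector_lattice orth) \<Rightarrow> 'e orth"
  assumes p: "sup_functional p" and psi: "\<psi> \<in> Cuo_orth"
  obtains \<sigma> where "sup_functional \<sigma>" "odd_functional \<sigma>" "\<sigma> \<in> extensional Cuo_orth"
    "\<And>\<phi>. \<phi> \<in> Cuo_orth \<Longrightarrow> \<sigma> \<phi> \<le> p \<phi>" "\<sigma> \<psi> = p \<psi>"
proof -
  have sf_at: "\<exists>q'. sup_functional q' \<and> q' \<in> extensional Cuo_orth \<and> (\<forall>\<phi>\<in>Cuo_orth. q' \<phi> \<le> q \<phi>) \<and>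
      q' (\<lambda>s. - \<phi> s) \<le> - q \<phi>" if q: "sup_functional q" and phi: "\<phi> \<in> Cuo_orth" for q :: "('s \<Rightarrow> 'e orth) \<Rightarrow> 'e orth" and \<phi>
  proof -
    \<comment> \<open>The constant \<open>q \<phi>\<close> is an element of \<Lambda>; subtracting
      it gives \<theta> the maximum 0 that a face requires.\<close>
    define \<theta> where "\<theta> s = \<phi> s - q \<phi>" for s
    have th: "\<theta> \<in> Cuo_orth" "q \<theta> = 0"
      using phi sf_add_const[OF q phi, of "- q \<phi>"] by (simp_all add: \<theta>_def[abs_def])
    define q' where "q' = restrict (face q \<theta>) Cuo_orth"
    have sf: "sup_functional q'" unfolding q'_def sup_functional_restrict by (rule sup_functional_face[OF q th])
    have "q' (\<lambda>s. - \<phi> s + q \<phi>) \<le> 0"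
      using face_vertex[OF q th] phi by (simp add: q'_def \<theta>_def[abs_def] algebra_simps)
    then have "q' (\<lambda>s. - \<phi> s) \<le> - q \<phi>"
      using sf_add_const[OF sf, of "\<lambda>s. - \<phi> s" "q \<phi>"] phi by (simp add: le_eq_neg)
    then show ?thesis using sf face_le[OF q th] by (auto simp: q'_def)
  qed
  obtain p1 where p1: "sup_functional p1" "p1 \<in> extensional Cuo_orth" "\<And>\<phi>. \<phi> \<in> Cuo_orth \<Longrightarrow> p1 \<phi> \<le> p \<phi>"
    "p1 (\<lambda>s. - \<psi> s) \<le> - p \<psi>" using sf_at[OF p psi] by blast
  define K where "K = {q. sup_functional q \<and> q \<in> extensional Cuo_orth \<and> (\<forall>\<phi>\<in>Cuo_orth. q \<phi> \<le> p1 \<phi>)}"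
  obtain \<sigma> where s: "\<sigma> \<in> K" "\<And>q. q \<in> K \<Longrightarrow> (\<And>\<phi>. \<phi> \<in> Cuo_orth \<Longrightarrow> q \<phi> \<le> \<sigma> \<phi>) \<Longrightarrow> q = \<sigma>"
  proof (rule minimal_sup_functional[of K])
    show "K \<noteq> {}" using p1 unfolding K_def by blast
    show "K \<subseteq> extensional Cuo_orth" unfolding K_def by blast
    show "sup_functional q" if "q \<in> K" for q using that unfolding K_def by blast
    fix \<P> q assume PK: "\<P> \<subseteq> K" "\<P> \<noteq> {}" and q: "sup_functional q" "q \<in> extensional Cuo_orth"
      and low: "\<And>p \<phi>. p \<in> \<P> \<Longrightarrow> \<phi> \<in> Cuo_orth \<Longrightarrow> q \<phi> \<le> p \<phi>"
    obtain r where r: "r \<in> \<P>" using PK by blast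
    then have "r \<in> K" using PK by blast
    then have "q \<phi> \<le> p1 \<phi>" if "\<phi> \<in> Cuo_orth" for \<phi>
      using low[OF r that] that unfolding K_def by (blast intro: order_trans)
    then show "q \<in> K" using q unfolding K_def by blast
  qed blast
  have sf: "sup_functional \<sigma>" and ext: "\<sigma> \<in> extensional Cuo_orth"
    and le1: "\<And>\<phi>. \<phi> \<in> Cuo_orth \<Longrightarrow> \<sigma> \<phi> \<le> p1 \<phi>" using s(1) unfolding K_def by blast+
  have "\<sigma> (\<lambda>s. - \<phi> s) = - \<sigma> \<phi>" if phi: "\<phi> \<in> Cuo_orth" for \<phi>
  proof (rule order.antisym)
    obtain q where q: "sup_functional q" "q \<in> extensional Cuo_orth" "\<forall>\<phi>\<in>Cuo_orth. q \<phi> \<le> \<sigma> \<phi>"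
      "q (\<lambda>s. - \<phi> s) \<le> - \<sigma> \<phi>" using sf_at[OF sf phi] by blast
    have "q \<in> K" using q le1 order_trans unfolding K_def by blast
    then have "q = \<sigma>" using s(2) q(3) by blast
    then show "\<sigma> (\<lambda>s. - \<phi> s) \<le> - \<sigma> \<phi>" using q(4) by simp
    show "- \<sigma> \<phi> \<le> \<sigma> (\<lambda>s. - \<phi> s)" by (rule sf_neg[OF sf phi])
  qed
  then have odd: "odd_functional \<sigma>" by (simp add: odd_functional_def)
  have le: "\<sigma> \<phi> \<le> p \<phi>" if "\<phi> \<in> Cuo_orth" for \<phi> using le1[OF that] p1(3)[OF that] by (rule order_trans)
  have "- \<sigma> \<psi> \<le> - p \<psi>"
    using odd psi le1[of "\<lambda>s. - \<psi> s"] p1(4) by (simp add: odd_functional_def) (metis minus_le_iff order_trans minus_minus)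
  then have "\<sigma> \<psi> = p \<psi>" using le[OF psi] by (intro order.antisym) simp_all
  then show ?thesis using that sf odd ext le by blast
qed

section \<open>Odd sup functionals as lattice homomorphisms and extreme points\<close>

context
  fixes \<sigma> :: "('s::uniform_space \<Rightarrow> 'e::dedekind_complete_vector_lattice orth) \<Rightarrow> 'e orth"
  assumes s: "sup_functional \<sigma>" "odd_functional \<sigma>"
begin

lemma hom_neg: "\<phi> \<in> Cuo_orth \<Longrightarrow> \<sigma> (\<lambda>s. - \<phi> s) = - \<sigma> \<phi>"
  using s(2) by (simp add: odd_functional_def)

lemma hom_add:
  assumes "\<phi> \<in> Cuo_orth" "\<psi> \<in> Cuo_orth" shows "\<sigma> (\<lambda>s. \<phi> s + \<psi> s) = \<sigma> \<phi> + \<sigma> \<psi>"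
proof (rule order.antisym[OF sf_add[OF s(1) assms]])
  have "- \<sigma> (\<lambda>s. \<phi> s + \<psi> s) \<le> - \<sigma> \<phi> + - \<sigma> \<psi>"
    using sf_add[OF s(1), of "\<lambda>s. - \<phi> s" "\<lambda>s. - \<psi> s"] hom_neg[of "\<lambda>s. \<phi> s + \<psi> s"] assms by (simp add: hom_neg)
  then have "- \<sigma> (\<lambda>s. \<phi> s + \<psi> s) \<le> - (\<sigma> \<phi> + \<sigma> \<psi>)" by simp
  then show "\<sigma> \<phi> + \<sigma> \<psi> \<le> \<sigma> (\<lambda>s. \<phi> s + \<psi> s)" by (simp only: neg_le_iff_le)
qed

lemma hom_diff: "\<phi> \<in> Cuo_orth \<Longrightarrow> \<psi> \<in> Cuo_orth \<Longrightarrow> \<sigma> (\<lambda>s. \<phi> s - \<psi> s) = \<sigma> \<phi> - \<sigma> \<psi>"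
  using hom_add[of \<phi> "\<lambda>s. - \<psi> s"] hom_neg[of \<psi>] by simp

lemma hom_scaleR:
  assumes "\<phi> \<in> Cuo_orth" shows "\<sigma> (\<lambda>s. r *\<^sub>R \<phi> s) = r *\<^sub>R \<sigma> \<phi>"
proof (cases "0 \<le> r")
  case False
  then show ?thesis
    using sf_scaleR[OF s(1) _ Cuo_orth_neg[OF assms], of "- r"] hom_neg[OF assms] by simp
qed (simp add: sf_scaleR[OF s(1) _ assms])

lemma hom_abs: "\<phi> \<in> Cuo_orth \<Longrightarrow> \<sigma> (\<lambda>s. \<bar>\<phi> s\<bar>) = \<bar>\<sigma> \<phi>\<bar>"
  using sf_sup[OF s(1), of \<phi> "\<lambda>s. - \<phi> s"] by (simp add: abs_lattice hom_neg)

lemma hom_subdiff: "\<sigma> \<in> extensional Cuo_orth \<Longrightarrow> \<sigma> \<in> subdiff_sup"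
  unfolding subdiff_sup_def
proof (intro CollectI conjI ballI allI)
  fix \<phi> :: "'s \<Rightarrow> 'e orth" assume phi: "\<phi> \<in> Cuo_orth"
  obtain c where c: "\<And>s. \<bar>\<phi> s\<bar> \<le> c" using Cuo_orth_bounded[OF phi] by blast
  have "bdd_above (range \<phi>)" by (rule bdd_aboveI[of _ c]) (use abs_le_D1[OF c] in auto)
  then show "\<sigma> \<phi> \<le> (SUP s. \<phi> s)" by (intro sf_le_const[OF s(1) phi] cSUP_upper) simp_all
qed (simp_all add: hom_add hom_scaleR)

text \<open>If \<open>\<sigma>\<close> is a proper convex combination involving \<open>T\<close>, then \<open>T\<close> vanishes at every \<open>\<bar>\<phi> - \<sigma> \<phi>\<bar>\<close>.\<close>

lemma hom_extreme_aux:
  assumes T: "T \<in> subdiff_sup" and T': "T' \<in> subdiff_sup" and u: "0 < (u::real)" "0 < u'"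
    and comb: "\<And>\<phi>. \<phi> \<in> Cuo_orth \<Longrightarrow> \<sigma> \<phi> = u *\<^sub>R T \<phi> + u' *\<^sub>R T' \<phi>" and phi: "\<phi> \<in> Cuo_orth"
  shows "T \<phi> = \<sigma> \<phi>"
proof -
  have SUP: "(SUP s. \<psi> s) \<le> c" if "\<And>s. \<psi> s \<le> c" for \<psi> :: "'s \<Rightarrow> 'e orth" and c
    by (rule cSUP_least) (use that in auto)
  have le: "R \<psi> \<le> c" if "R \<in> subdiff_sup" "\<psi> \<in> Cuo_orth" "\<And>s. \<psi> s \<le> c" for R and \<psi> :: "'s \<Rightarrow> 'e orth" and c
  proof -
    have "R \<psi> \<le> (SUP s. \<psi> s)" using that(1,2) unfolding subdiff_sup_def by blast
    also have "\<dots> \<le> c" by (rule SUP[OF that(3)])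
    finally show ?thesis .
  qed
  have add: "R (\<lambda>s. \<phi> s + \<psi> s) = R \<phi> + R \<psi>" if "R \<in> subdiff_sup" "\<phi> \<in> Cuo_orth" "\<psi> \<in> Cuo_orth"
    for R and \<phi> \<psi> :: "'s \<Rightarrow> 'e orth"
    using that unfolding subdiff_sup_def by blast
  have neg: "R (\<lambda>s. - \<psi> s) = - R \<psi>" if R: "R \<in> subdiff_sup" "\<psi> \<in> Cuo_orth" for R and \<psi> :: "'s \<Rightarrow> 'e orth"
  proof -
    have "\<forall>r. \<forall>\<phi>\<in>Cuo_orth. R (\<lambda>s. r *\<^sub>R \<phi> s) = r *\<^sub>R R \<phi>" using R(1) unfolding subdiff_sup_def by blast
    then have "R (\<lambda>s. (-1) *\<^sub>R \<psi> s) = (-1) *\<^sub>R R \<psi>" using R(2) by blast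
    then show ?thesis by simp
  qed
  have pos: "0 \<le> R \<psi>" if "R \<in> subdiff_sup" "\<psi> \<in> Cuo_orth" "\<And>s. 0 \<le> \<psi> s" for R and \<psi> :: "'s \<Rightarrow> 'e orth"
    using le[OF that(1), of "\<lambda>s. - \<psi> s" 0] neg[OF that(1,2)] that by simp
  \<comment> \<open>\<sigma> commutes with absolute values, so it vanishes at
    \<open>\<bar>\<chi>\<bar>\<close>. There \<open>T\<close> and \<open>T'\<close> are both
    nonnegative, hence each of them vanishes as well.\<close>
  define \<chi> where "\<chi> s = \<phi> s + - \<sigma> \<phi>" for s
  have chi: "\<chi> \<in> Cuo_orth" unfolding \<chi>_def using phi by simp
  have "\<sigma> \<chi> = 0" unfolding \<chi>_def using sf_add_const[OF s(1) phi, of "- \<sigma> \<phi>"] by simp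
  then have "\<sigma> (\<lambda>s. \<bar>\<chi> s\<bar>) = 0" using hom_abs[OF chi] by simp
  then have "u *\<^sub>R T (\<lambda>s. \<bar>\<chi> s\<bar>) + u' *\<^sub>R T' (\<lambda>s. \<bar>\<chi> s\<bar>) = 0" using comb[of "\<lambda>s. \<bar>\<chi> s\<bar>"] chi by simp
  moreover have "0 \<le> u' *\<^sub>R T' (\<lambda>s. \<bar>\<chi> s\<bar>)"
    using u pos[OF T', of "\<lambda>s. \<bar>\<chi> s\<bar>"] chi by (simp add: scaleR_nonneg_nonneg)
  ultimately have "u *\<^sub>R T (\<lambda>s. \<bar>\<chi> s\<bar>) \<le> 0" by (metis add_le_same_cancel1 add.commute)
  then have T0: "T (\<lambda>s. \<bar>\<chi> s\<bar>) \<le> 0" using u(1) by (rule scaleR_nonpos_cancel)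
  have mono: "T \<psi> \<le> T (\<lambda>s. \<bar>\<chi> s\<bar>)" if "\<psi> \<in> Cuo_orth" "\<And>s. \<psi> s \<le> \<bar>\<chi> s\<bar>" for \<psi>
  proof -
    have "0 \<le> T (\<lambda>s. \<bar>\<chi> s\<bar> + - \<psi> s)" by (rule pos[OF T]) (use that chi in auto)
    also have "\<dots> = T (\<lambda>s. \<bar>\<chi> s\<bar>) + - T \<psi>" using add[OF T, of "\<lambda>s. \<bar>\<chi> s\<bar>" "\<lambda>s. - \<psi> s"] neg[OF T, of \<psi>] that chi by simp
    finally show ?thesis by simp
  qed
  have "T \<chi> \<le> 0" using mono[OF chi] T0 by (meson abs_ge_self order_trans)
  moreover have "- T \<chi> \<le> 0" using mono[of "\<lambda>s. - \<chi> s"] T0 neg[OF T chi] chi by (metis Cuo_orth_neg abs_ge_minus_self order_trans)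
  ultimately have Tchi: "T \<chi> = 0" by (intro order.antisym) simp_all
  have "T (\<lambda>s. c) = c" for c
  proof (rule order.antisym)
    show "T (\<lambda>s. c) \<le> c" by (rule le[OF T]) simp_all
    have "T (\<lambda>s. - c) \<le> - c" by (rule le[OF T]) simp_all
    then show "c \<le> T (\<lambda>s. c)" using neg[OF T, of "\<lambda>s. c"] by simp
  qed
  then show ?thesis using add[OF T phi, of "\<lambda>s. - \<sigma> \<phi>"] Tchi by (simp add: \<chi>_def[abs_def])
qed

lemma hom_Sigma_extreme:
  assumes ext: "\<sigma> \<in> extensional Cuo_orth"
  shows "\<sigma> \<in> Sigma_extreme"
  unfolding Sigma_extreme_def
proof (intro CollectI conjI ballI allI impI hom_subdiff ext)
  fix T1 T2 :: "('s \<Rightarrow> 'e orth) \<Rightarrow> 'e orth" and u :: real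
  assume T: "T1 \<in> subdiff_sup" "T2 \<in> subdiff_sup"
    and u: "0 < u \<and> u < 1 \<and> (\<forall>\<phi>\<in>Cuo_orth. \<sigma> \<phi> = (1 - u) *\<^sub>R T1 \<phi> + u *\<^sub>R T2 \<phi>)"
  have "T1 \<phi> = \<sigma> \<phi>" if "\<phi> \<in> Cuo_orth" for \<phi>
    by (rule hom_extreme_aux[OF T, of "1 - u" u]) (use u that in auto)
  moreover have "T2 \<phi> = \<sigma> \<phi>" if "\<phi> \<in> Cuo_orth" for \<phi>
    by (rule hom_extreme_aux[OF T(2,1), of u "1 - u"]) (use u that in \<open>auto simp: add.commute\<close>)
  ultimately show "T1 = T2"
    by (intro extensionalityI[of _ Cuo_orth]) (use T in \<open>auto simp: subdiff_sup_def\<close>)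
qed

section \<open>Approximation by pure states\<close>

text \<open>The deviations of all functions in \<open>A\<close> are added into one function \<psi>
  with \<open>\<sigma> \<psi> = 0\<close>. Below every nonzero projection some
  \<open>\<psi> s\<close> is \<le> \<epsilon> on a nonzero part; otherwise \<psi> would be \<ge>
  \<epsilon> everywhere on a band, and so would \<open>\<sigma> \<psi>\<close>. The indices s chosen
  this way form the partition.\<close>

lemma hom_pure_state_approx:
  assumes A: "finite A" "A \<subseteq> Cuo_orth" and e: "(\<epsilon>::real) > 0"
  obtains \<pi> where "partition_of_unity \<pi>" "\<And>\<phi>. \<phi> \<in> A \<Longrightarrow> \<bar>pure_state \<pi> \<phi> - \<sigma> \<phi>\<bar> \<le> \<epsilon> *\<^sub>R 1"
proof -
  define \<psi> where "\<psi> s = (\<Sum>\<phi>\<in>A. \<bar>\<phi> s - \<sigma> \<phi>\<bar>)" for s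
  have C: "(\<lambda>s. \<bar>\<phi> s - \<sigma> \<phi>\<bar>) \<in> Cuo_orth" if "\<phi> \<in> A" for \<phi> using A that by (intro Cuo_orth_abs Cuo_orth_diff) auto
  have psi: "\<psi> \<in> Cuo_orth" unfolding \<psi>_def by (rule Cuo_orth_sum[OF A(1)]) (use C in auto)
  have z: "\<sigma> (\<lambda>s. \<bar>\<phi> s - \<sigma> \<phi>\<bar>) = 0" if "\<phi> \<in> A" for \<phi>
    using hom_abs[of "\<lambda>s. \<phi> s - \<sigma> \<phi>"] hom_diff[of \<phi> "\<lambda>s. \<sigma> \<phi>"] A that by (auto simp: sf_const[OF s(1)] subset_iff)
  have "\<sigma> (\<lambda>s. \<Sum>\<phi>\<in>B. \<bar>\<phi> s - \<sigma> \<phi>\<bar>) = 0" if "finite B" "B \<subseteq> A" for B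
    using that
  proof (induction rule: finite_induct)
    case (insert \<phi> B)
    have "(\<lambda>s. \<Sum>\<phi>\<in>B. \<bar>\<phi> s - \<sigma> \<phi>\<bar>) \<in> Cuo_orth" by (rule Cuo_orth_sum) (use insert C in auto)
    then show ?case using insert hom_add[OF C, of \<phi> "\<lambda>s. \<Sum>\<phi>\<in>B. \<bar>\<phi> s - \<sigma> \<phi>\<bar>"] z by simp
  qed (simp add: sf_const[OF s(1)])
  then have spsi: "\<sigma> \<psi> = 0" unfolding \<psi>_def[abs_def] using A(1) by blast
  obtain \<pi> where p: "partition_of_unity \<pi>" "\<And>s. \<pi> s * \<psi> s \<le> \<pi> s * (\<epsilon> *\<^sub>R 1)"
  proof (rule partition_of_unity_choice[of \<psi> "\<lambda>s. \<epsilon> *\<^sub>R 1"])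
    fix \<rho> :: "'e orth" assume r: "\<rho> \<in> band_projections" "\<rho> \<noteq> 0"
    show "\<exists>\<rho>'\<in>band_projections. \<rho>' \<noteq> 0 \<and> \<rho>' \<le> \<rho> \<and> (\<exists>s. \<rho>' * \<psi> s \<le> \<rho>' * (\<epsilon> *\<^sub>R 1))"
    proof (rule ccontr)
      assume n: "\<not> ?thesis"
      have "\<rho> * (\<epsilon> *\<^sub>R 1) \<le> \<rho> * \<psi> s" for s
      proof (rule local_le_orth[OF r(1)])
        fix \<tau> assume t: "\<tau> \<in> band_projections" "\<tau> \<noteq> 0" "\<tau> \<le> \<rho>"
        show "\<exists>\<rho>'\<in>band_projections. \<rho>' \<noteq> 0 \<and> \<rho>' \<le> \<tau> \<and> \<rho>' * (\<epsilon> *\<^sub>R 1) \<le> \<rho>' * \<psi> s"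
        proof (rule bp_cases_orth[OF t(1,2), of "\<epsilon> *\<^sub>R 1" "\<psi> s"])
          fix \<rho>' assume "\<rho>' \<in> band_projections" "\<rho>' \<noteq> 0" "\<rho>' \<le> \<tau>" "\<rho>' * \<psi> s \<le> \<rho>' * (\<epsilon> *\<^sub>R 1)"
          then show ?thesis using n t(3) order_trans by blast
        qed blast
      qed
      then have "\<rho> * (\<epsilon> *\<^sub>R 1) \<le> \<sigma> (\<lambda>s. \<rho> * \<psi> s)" by (intro sf_ge_const[OF s(1) Cuo_orth_bp_mult[OF r(1) psi]])
      also have "\<dots> = 0" using sf_bp_mult[OF s(1) r(1) psi] spsi by simp
      finally have "\<epsilon> *\<^sub>R \<rho> \<le> 0" by simp
      then have "\<rho> \<le> 0" using e by (rule scaleR_nonpos_cancel)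
      then show False using r bp_nonneg[OF r(1)] by simp
    qed
  qed blast
  note b = partition_of_unity_bp[OF p(1)]
  have "\<bar>pure_state \<pi> \<phi> - \<sigma> \<phi>\<bar> \<le> \<epsilon> *\<^sub>R 1" if phi: "\<phi> \<in> A" for \<phi>
  proof (rule partition_of_unity_le_orth[OF p(1)])
    fix s
    have C: "\<phi> \<in> Cuo_orth" using A phi by blast
    have "\<pi> s * \<bar>pure_state \<pi> \<phi> - \<sigma> \<phi>\<bar> = \<pi> s * \<bar>\<phi> s - \<sigma> \<phi>\<bar>"
      by (simp add: bp_abs_mult[OF b] right_diff_distrib pure_state_mult[OF p(1) C])
    also have "\<dots> \<le> \<pi> s * \<psi> s"
      unfolding \<psi>_def sum.remove[OF A(1) phi] by (rule bp_mult_mono[OF b]) (simp add: sum_nonneg)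
    also have "\<dots> \<le> \<pi> s * (\<epsilon> *\<^sub>R 1)" by (rule p(2))
    finally show "\<pi> s * \<bar>pure_state \<pi> \<phi> - \<sigma> \<phi>\<bar> \<le> \<pi> s * (\<epsilon> *\<^sub>R 1)" .
  qed
  then show ?thesis using that p(1) by blast
qed

text \<open>The filter base is indexed by finite sets of functions together with an accuracy; its
  sets are nonempty by the approximation lemma. The regulator is 1 for every function.\<close>

lemma hom_pure_state_filter:
  obtains F :: "('s \<Rightarrow> 'e orth) filter" where "F \<noteq> bot" "\<forall>\<^sub>F \<pi> in F. partition_of_unity \<pi>"
    "\<And>\<phi> \<epsilon>. \<phi> \<in> Cuo_orth \<Longrightarrow> (\<epsilon>::real) > 0 \<Longrightarrow> \<forall>\<^sub>F \<pi> in F. \<bar>pure_state \<pi> \<phi> - \<sigma> \<phi>\<bar> \<le> \<epsilon> *\<^sub>R 1"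
proof -
  define B where "B = {(A, \<epsilon>::real). finite A \<and> A \<subseteq> (Cuo_orth :: ('s \<Rightarrow> 'e orth) set) \<and> \<epsilon> > 0}"
  define G where "G b = {\<pi>. partition_of_unity \<pi> \<and> (\<forall>\<phi>\<in>fst b. \<bar>pure_state \<pi> \<phi> - \<sigma> \<phi>\<bar> \<le> snd b *\<^sub>R 1)}" for b
  define F where "F = (INF b\<in>B. principal (G b))"
  have B0: "({}, 1) \<in> B" by (simp add: B_def)
  have ev: "eventually P F \<longleftrightarrow> (\<exists>b\<in>B. eventually P (principal (G b)))" for P
    unfolding F_def
  proof (rule eventually_INF_base)
    fix a b assume ab: "a \<in> B" "b \<in> B"
    define x where "x = (fst a \<union> fst b, min (snd a) (snd b))"
    have "x \<in> B" using ab by (auto simp: x_def B_def)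
    moreover have "G x \<subseteq> G a \<inter> G b"
    proof -
      have m: "min (snd a) (snd b) *\<^sub>R (1::'e orth) \<le> snd a *\<^sub>R 1" "min (snd a) (snd b) *\<^sub>R (1::'e orth) \<le> snd b *\<^sub>R 1"
        by (rule scaleR_right_mono; simp)+
      show ?thesis unfolding G_def x_def using order_trans[OF _ m(1)] order_trans[OF _ m(2)] by auto
    qed
    ultimately show "\<exists>x\<in>B. principal (G x) \<le> inf (principal (G a)) (principal (G b))" by auto
  qed (use B0 in blast)
  show ?thesis
  proof (rule that[of F])
    show "F \<noteq> bot"
    proof
      assume "F = bot"
      then have "eventually (\<lambda>_. False) F" by simp
      then obtain b where b: "b \<in> B" "G b = {}" using ev by (auto simp: eventually_principal)
      obtain \<pi> where "partition_of_unity \<pi>" "\<And>\<phi>. \<phi> \<in> fst b \<Longrightarrow> \<bar>pure_state \<pi> \<phi> - \<sigma> \<phi>\<bar> \<le> snd b *\<^sub>R 1"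
        by (rule hom_pure_state_approx[of "fst b" "snd b"]) (use b in \<open>auto simp: B_def\<close>)
      then show False using b(2) unfolding G_def by blast
    qed
    show "\<forall>\<^sub>F \<pi> in F. partition_of_unity \<pi>"
      unfolding ev by (rule bexI[OF _ B0]) (simp add: eventually_principal G_def)
    fix \<phi> :: "'s \<Rightarrow> 'e orth" and \<epsilon> :: real assume "\<phi> \<in> Cuo_orth" "\<epsilon> > 0"
    then have "({\<phi>}, \<epsilon>) \<in> B" by (simp add: B_def)
    then show "\<forall>\<^sub>F \<pi> in F. \<bar>pure_state \<pi> \<phi> - \<sigma> \<phi>\<bar> \<le> \<epsilon> *\<^sub>R 1"
      unfolding ev by (rule bexI[rotated]) (simp add: eventually_principal G_def)
  qed
qed

end

section \<open>Values at points of \<open>\<Sigma>\<close>\<close>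

text \<open>The interiors of the slices of the entourage form an open cover.\<close>

lemma compact_UNIV_finite_net:
  fixes U :: "('s::uniform_space \<times> 's) \<Rightarrow> bool"
  assumes "compact (UNIV :: 's set)" "eventually U uniformity"
  obtains X where "finite X" "\<And>s. \<exists>x\<in>X. U (x, s)"
proof -
  define V where "V x = {y. \<forall>\<^sub>F z in nhds y. U (x, z)}" for x
  have "open (V x)" for x
    unfolding open_subopen[of "V x"]
  proof (intro ballI)
    fix y assume "y \<in> V x"
    then have "\<forall>\<^sub>F y' in nhds y. \<forall>\<^sub>F z in nhds y'. U (x, z)" by (simp add: V_def eventually_eventually)
    then show "\<exists>T. open T \<and> y \<in> T \<and> T \<subseteq> V x" unfolding eventually_nhds V_def by blast
  qed
  moreover have "x \<in> V x" for x
    using assms(2) by (auto simp: V_def eventually_nhds_uniformity elim!: eventually_mono)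
  ultimately obtain X where X: "finite X" "UNIV \<subseteq> (\<Union>x\<in>X. V x)"
    using compactE_image[OF assms(1), of UNIV V] by (metis UNIV_I UN_iff subsetI)
  have "\<exists>x\<in>X. U (x, s)" for s
    using X(2) eventually_nhds_x_imp_x unfolding V_def by blast
  then show ?thesis using that X(1) by blast
qed

locale norm_completion_bk = banach_kantorovich scale nrm Xt
  for scale :: "'k::real_normed_field \<Rightarrow> 'x::ab_group_add \<Rightarrow> 'x"
    and nrm :: "'x \<Rightarrow> 'e::dedekind_complete_vector_lattice"
    and Xt :: "'x set" +
  fixes X :: "'x set"
  assumes X: "X \<subseteq> Xt"
begin

lemma Cuo_in: "f \<in> Cuo nrm X \<Longrightarrow> f s \<in> Xt"
  using X by (auto simp: Cuo_def)

lemma Cuo_bounded: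
  assumes "f \<in> Cuo nrm X"
  obtains e where "0 \<le> e" "\<And>s. nrm (f s) \<le> e"
proof -
  obtain e where e: "\<forall>s. nrm (f s) \<le> e" using assms by (auto simp: Cuo_def)
  moreover have "0 \<le> e" using nrm_ge_0[OF Cuo_in[OF assms]] e order_trans by blast
  ultimately show ?thesis using that by blast
qed

lemma Cuo_order_null:
  fixes f :: "'s::uniform_space \<Rightarrow> 'x"
  assumes f: "f \<in> Cuo nrm X"
  shows "order_null (\<lambda>(s, t). nrm (f s - f t)) uniformity"
proof (rule Cuo_iff[THEN iffD1, THEN conjunct2, THEN conjunct2])
  show "f \<in> Cuo nrm X" by (rule f)
qed (use Cuo_in[OF f] nrm_triangle_diff in auto)

text \<open>Uniform order continuity of \<open>r\<close> in E is lifted to \<Lambda> through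
  \<open>order_null_lift\<close>, with the two estimates for differences of truncated
  ratios.\<close>

lemma trunc_ratio_Cuo:
  fixes r :: "'s::uniform_space \<Rightarrow> 'e"
  assumes d: "0 \<le> d" and r: "\<And>s. 0 \<le> r s"
    and null: "order_null (\<lambda>(s, t). \<bar>r s - r t\<bar>) uniformity"
  shows "(\<lambda>s. trunc_ratio d (r s)) \<in> Cuo_orth"
proof -
  have "\<bar>trunc_ratio d (r s)\<bar> \<le> 1" for s
    using trunc_ratio_nonneg[OF d r] trunc_ratio_le_one[OF d r] by simp
  moreover have "order_null (\<lambda>(s, t). \<bar>trunc_ratio d (r s) - trunc_ratio d (r t)\<bar>) uniformity"
    by (rule order_null_lift[OF d _ _ _ null]) (use trunc_ratio_diff[OF d r r] in auto)
  ultimately show ?thesis unfolding Cuo_orth_iff by blast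
qed

lemma nrm_trunc_ratio_Cuo:
  fixes f g :: "'s::uniform_space \<Rightarrow> 'x"
  assumes d: "0 \<le> d" and f: "f \<in> Cuo nrm X" and g: "g \<in> Cuo nrm X"
  shows "(\<lambda>s. trunc_ratio d (nrm (f s - g s))) \<in> Cuo_orth"
proof (rule trunc_ratio_Cuo[OF d])
  note fX = Cuo_in[OF f] and gX = Cuo_in[OF g]
  show "0 \<le> nrm (f s - g s)" for s using fX gX by simp
  show "order_null (\<lambda>(s, t). \<bar>nrm (f s - g s) - nrm (f t - g t)\<bar>) uniformity"
  proof (rule order_null_mono[OF order_null_add[OF Cuo_order_null[OF f] Cuo_order_null[OF g]]], intro always_eventually allI)
    fix p :: "'s \<times> 's"
    obtain s t where p: "p = (s, t)" by force
    have "\<bar>nrm (f s - g s) - nrm (f t - g t)\<bar> \<le> nrm ((f s - g s) - (f t - g t))"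
      by (rule nrm_diff_abs_le) (use fX gX in auto)
    also have "(f s - g s) - (f t - g t) = (f s - f t) - (g s - g t)" by simp
    also have "nrm \<dots> \<le> nrm (f s - f t) + nrm (g s - g t)"
      by (rule nrm_triangle_diff) (use fX gX in auto)
    finally show "(case p of (s, t) \<Rightarrow> \<bar>nrm (f s - g s) - nrm (f t - g t)\<bar>)
      \<le> (case p of (s, t) \<Rightarrow> nrm (f s - f t)) + (case p of (s, t) \<Rightarrow> nrm (g s - g t))" by (simp add: p)
  qed
qed

lemma nrm_trunc_ratio_Cuo_const:
  fixes f :: "'s::uniform_space \<Rightarrow> 'x"
  assumes d: "0 \<le> d" and f: "f \<in> Cuo nrm X" and x: "x \<in> Xt"
  shows "(\<lambda>s. trunc_ratio d (nrm (f s - x))) \<in> Cuo_orth"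
proof (rule trunc_ratio_Cuo[OF d])
  note fX = Cuo_in[OF f]
  show "0 \<le> nrm (f s - x)" for s using fX x by simp
  show "order_null (\<lambda>(s, t). \<bar>nrm (f s - x) - nrm (f t - x)\<bar>) uniformity"
  proof (rule order_null_mono[OF Cuo_order_null[OF f]], intro always_eventually allI)
    fix p :: "'s \<times> 's"
    obtain s t where p: "p = (s, t)" by force
    have "\<bar>nrm (f s - x) - nrm (f t - x)\<bar> \<le> nrm ((f s - x) - (f t - x))"
      by (rule nrm_diff_abs_le) (use fX x in auto)
    then show "(case p of (s, t) \<Rightarrow> \<bar>nrm (f s - x) - nrm (f t - x)\<bar>) \<le> (case p of (s, t) \<Rightarrow> nrm (f s - f t))"
      by (simp add: p)
  qed
qed

abbreviation pure_val :: "('s::uniform_space \<Rightarrow> 'x) \<Rightarrow> ('s \<Rightarrow> 'e orth) \<Rightarrow> 'x" where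
  "pure_val \<equiv> pure_value scale nrm Xt"

lemma pure_val:
  assumes p: "partition_of_unity \<pi>" and f: "f \<in> Cuo nrm X"
  shows pure_val_in: "pure_val f \<pi> \<in> Xt"
    and pure_val_bp: "\<pi> s \<bullet> nrm (pure_val f \<pi> - f s) = 0"
proof -
  have r: "range f \<subseteq> Xt" using Cuo_in[OF f] by blast
  obtain e where e: "\<And>s. nrm (f s) \<le> e" using Cuo_bounded[OF f] by blast
  show "pure_val f \<pi> \<in> Xt" by (rule pure_value_in[OF p r e])
  show "\<pi> s \<bullet> nrm (pure_val f \<pi> - f s) = 0" by (rule pure_value_bp[OF p r e])
qed

lemma pure_val_nrm_diff:
  assumes p: "partition_of_unity \<pi>" and f: "f \<in> Cuo nrm X" and x: "x \<in> Xt"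
  shows "\<pi> s \<bullet> nrm (pure_val f \<pi> - x) = \<pi> s \<bullet> nrm (f s - x)"
proof (rule order.antisym)
  note b = partition_of_unity_bp[OF p] and v = pure_val_in[OF p f] and fX = Cuo_in[OF f]
  have "nrm (pure_val f \<pi> - x) \<le> nrm (pure_val f \<pi> - f s) + nrm (f s - x)" by (rule nrm_triangle3[OF v fX x])
  from bp_mono[OF b this, of s] show "\<pi> s \<bullet> nrm (pure_val f \<pi> - x) \<le> \<pi> s \<bullet> nrm (f s - x)"
    using pure_val_bp[OF p f] by simp
  have "nrm (f s - x) \<le> nrm (f s - pure_val f \<pi>) + nrm (pure_val f \<pi> - x)" by (rule nrm_triangle3[OF fX v x])
  from bp_mono[OF b this, of s] show "\<pi> s \<bullet> nrm (f s - x) \<le> \<pi> s \<bullet> nrm (pure_val f \<pi> - x)"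
    using pure_val_bp[OF p f] nrm_diff_commute[OF fX v] by simp
qed

text \<open>Expresses distances of pure values through the action of pure states on \<Lambda>-valued
  functions, the only place where convergence of pure states gives information.\<close>

lemma pure_val_trunc_ratio:
  assumes p: "partition_of_unity \<pi>" and f: "f \<in> Cuo nrm X" and x: "x \<in> Xt" and d: "0 \<le> d"
  shows "pure_state \<pi> (\<lambda>s. trunc_ratio d (nrm (f s - x))) \<bullet> d = inf (nrm (pure_val f \<pi> - x)) d"
proof (rule partition_of_unity_eq[OF p])
  fix s
  note b = partition_of_unity_bp[OF p]
  let ?\<phi> = "\<lambda>s. trunc_ratio d (nrm (f s - x))"
  have "\<pi> s \<bullet> pure_state \<pi> ?\<phi> \<bullet> d = (\<pi> s * pure_state \<pi> ?\<phi>) \<bullet> d" by simp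
  also have "\<dots> = (\<pi> s * ?\<phi> s) \<bullet> d"
    using pure_state_mult[OF p nrm_trunc_ratio_Cuo_const[OF d f x]] by simp
  also have "\<dots> = \<pi> s \<bullet> inf (nrm (f s - x)) d"
    using trunc_ratio_apply[OF d, of "nrm (f s - x)"] Cuo_in[OF f] x by simp
  also have "\<dots> = \<pi> s \<bullet> inf (nrm (pure_val f \<pi> - x)) d"
    by (simp add: bp_inf_apply[OF b] pure_val_nrm_diff[OF p f x])
  finally show "\<pi> s \<bullet> pure_state \<pi> ?\<phi> \<bullet> d = \<pi> s \<bullet> inf (nrm (pure_val f \<pi> - x)) d" .
qed

end

section \<open>Values as limits along nets of pure states\<close>

context norm_completion_bk
begin

definition converges_to ::
  "(('s::uniform_space \<Rightarrow> 'e orth) \<Rightarrow> 'e orth) \<Rightarrow> ('s \<Rightarrow> 'e orth) filter \<Rightarrow> bool" where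
  "converges_to \<sigma> F \<longleftrightarrow> F \<noteq> bot \<and> (\<forall>\<^sub>F \<pi> in F. partition_of_unity \<pi>) \<and>
     (\<forall>\<phi>\<in>Cuo_orth. relatively_uniform_tendsto (\<lambda>\<pi>. pure_state \<pi> \<phi>) (\<sigma> \<phi>) F)"

text \<open>Convergence of pure states yields convergence of the distances to each fixed vector
  \<open>f t\<close>. The denominator is \<open>e + e\<close> because all differences of values of
  \<open>f\<close> have norm at most 2e: the truncation is never active and the ratio loses
  nothing.\<close>

lemma converges_to_nrm:
  assumes F: "converges_to \<sigma> F" and f: "f \<in> Cuo nrm X" and e: "\<And>s. nrm (f s) \<le> e"
  obtains v where "0 \<le> v" "\<And>\<delta>. (\<delta>::real) > 0 \<Longrightarrow> \<forall>\<^sub>F \<pi> in F. partition_of_unity \<pi> \<and>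
    \<bar>nrm (pure_val f \<pi> - f t) - \<sigma> (\<lambda>s. trunc_ratio (e + e) (nrm (f s - f t))) \<bullet> (e + e)\<bar> \<le> \<delta> *\<^sub>R v"
proof -
  let ?d = "e + e"
  let ?\<psi> = "\<lambda>s. trunc_ratio ?d (nrm (f s - f t))"
  note fX = Cuo_in[OF f]
  have e0: "0 \<le> e" using nrm_ge_0[OF fX] e order_trans by blast
  then have d0: "0 \<le> ?d" by simp
  have "?\<psi> \<in> Cuo_orth" by (rule nrm_trunc_ratio_Cuo_const[OF d0 f fX])
  then obtain u where u: "0 \<le> u" "\<And>\<epsilon>. \<epsilon> > 0 \<Longrightarrow> \<forall>\<^sub>F \<pi> in F. \<bar>pure_state \<pi> ?\<psi> - \<sigma> ?\<psi>\<bar> \<le> \<epsilon> *\<^sub>R u"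
    using F unfolding converges_to_def relatively_uniform_tendsto_def by blast
  show ?thesis
  proof (rule that[of "u \<bullet> ?d"])
    show "0 \<le> u \<bullet> ?d" by (rule orth_pos[OF u(1) d0])
    fix \<delta> :: real assume d: "\<delta> > 0"
    have "\<forall>\<^sub>F \<pi> in F. partition_of_unity \<pi>" using F by (simp add: converges_to_def)
    then show "\<forall>\<^sub>F \<pi> in F. partition_of_unity \<pi> \<and>
      \<bar>nrm (pure_val f \<pi> - f t) - \<sigma> ?\<psi> \<bullet> ?d\<bar> \<le> \<delta> *\<^sub>R (u \<bullet> ?d)"
      using u(2)[OF d]
    proof eventually_elim
      case (elim \<pi>)
      note p = elim(1)
      have le: "nrm (pure_val f \<pi> - f t) \<le> ?d"
      proof (rule partition_of_unity_le[OF p])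
        fix s
        have "\<pi> s \<bullet> nrm (pure_val f \<pi> - f t) = \<pi> s \<bullet> nrm (f s - f t)" by (rule pure_val_nrm_diff[OF p f fX])
        also have "\<dots> \<le> \<pi> s \<bullet> ?d"
          by (rule bp_mono[OF partition_of_unity_bp[OF p]], rule order_trans[OF nrm_triangle_diff[OF fX fX]], rule add_mono[OF e e])
        finally show "\<pi> s \<bullet> nrm (pure_val f \<pi> - f t) \<le> \<pi> s \<bullet> ?d" .
      qed
      have eq: "pure_state \<pi> ?\<psi> \<bullet> ?d = nrm (pure_val f \<pi> - f t)"
        unfolding pure_val_trunc_ratio[OF p f fX d0] by (rule inf_absorb1[OF le])
      have "\<bar>nrm (pure_val f \<pi> - f t) - \<sigma> ?\<psi> \<bullet> ?d\<bar> = \<bar>(pure_state \<pi> ?\<psi> - \<sigma> ?\<psi>) \<bullet> ?d\<bar>"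
        unfolding eq[symmetric] by (simp only: orth_apply_simps(9))
      also have "\<dots> = \<bar>pure_state \<pi> ?\<psi> - \<sigma> ?\<psi>\<bar> \<bullet> ?d" by (rule orth_abs_apply[OF d0, symmetric])
      also have "\<dots> \<le> (\<delta> *\<^sub>R u) \<bullet> ?d" by (rule orth_leD[OF elim(2) d0])
      finally show ?case using p by (simp only: orth_apply_simps(12) simp_thms)
    qed
  qed
qed

text \<open>Two filters are compared at once: with F' = F this is the Cauchy property, with
  different filters it shows that the limit does not depend on the net. A pure value is located by
  its distances to the finitely many vectors \<open>f t\<close>, t in a finite net of S.\<close>

lemma pure_val_cauchy:
  fixes f :: "'s::uniform_space \<Rightarrow> 'x"
  assumes cpt: "compact (UNIV :: 's set)" and f: "f \<in> Cuo nrm X"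
    and F: "converges_to \<sigma> F" and F': "converges_to \<sigma> F'"
  shows "order_null (\<lambda>(\<pi>, \<pi>'). nrm (pure_val f \<pi> - pure_val f \<pi>')) (F \<times>\<^sub>F F')"
proof -
  note fX = Cuo_in[OF f]
  obtain e where e0: "0 \<le> e" and e: "\<And>s. nrm (f s) \<le> e" using Cuo_bounded[OF f] by blast
  \<comment> \<open>The limit distance from \<open>f t\<close>. It depends on \<sigma> but not on
    the filter, which links \<open>F\<close> and \<open>F'\<close>.\<close>
  define m where "m t = \<sigma> (\<lambda>s. trunc_ratio (e + e) (nrm (f s - f t))) \<bullet> (e + e)" for t
  have "\<exists>v. \<forall>t. 0 \<le> v t \<and> (\<forall>\<delta>::real. \<delta> > 0 \<longrightarrow> (\<forall>\<^sub>F \<pi> in F. partition_of_unity \<pi> \<and> \<bar>nrm (pure_val f \<pi> - f t) - m t\<bar> \<le> \<delta> *\<^sub>R v t))"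
  proof (intro choice allI)
    fix t
    show "\<exists>v\<ge>0. \<forall>\<delta>::real. \<delta> > 0 \<longrightarrow> (\<forall>\<^sub>F \<pi> in F. partition_of_unity \<pi> \<and> \<bar>nrm (pure_val f \<pi> - f t) - m t\<bar> \<le> \<delta> *\<^sub>R v)"
      by (rule converges_to_nrm[OF F f e, of t]) (unfold m_def, blast)
  qed
  then obtain v where v: "\<And>t. 0 \<le> v t" "\<And>t \<delta>. (\<delta>::real) > 0 \<Longrightarrow> \<forall>\<^sub>F \<pi> in F. partition_of_unity \<pi> \<and> \<bar>nrm (pure_val f \<pi> - f t) - m t\<bar> \<le> \<delta> *\<^sub>R v t"
    by blast
  have "\<exists>v. \<forall>t. 0 \<le> v t \<and> (\<forall>\<delta>::real. \<delta> > 0 \<longrightarrow> (\<forall>\<^sub>F \<pi> in F'. partition_of_unity \<pi> \<and> \<bar>nrm (pure_val f \<pi> - f t) - m t\<bar> \<le> \<delta> *\<^sub>R v t))"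
  proof (intro choice allI)
    fix t
    show "\<exists>v\<ge>0. \<forall>\<delta>::real. \<delta> > 0 \<longrightarrow> (\<forall>\<^sub>F \<pi> in F'. partition_of_unity \<pi> \<and> \<bar>nrm (pure_val f \<pi> - f t) - m t\<bar> \<le> \<delta> *\<^sub>R v)"
      by (rule converges_to_nrm[OF F' f e, of t]) (unfold m_def, blast)
  qed
  then obtain v' where v': "\<And>t. 0 \<le> v' t" "\<And>t \<delta>. (\<delta>::real) > 0 \<Longrightarrow> \<forall>\<^sub>F \<pi> in F'. partition_of_unity \<pi> \<and> \<bar>nrm (pure_val f \<pi> - f t) - m t\<bar> \<le> \<delta> *\<^sub>R v' t"
    by blast
  have main: "\<exists>V\<ge>0. \<forall>\<delta>::real. \<delta> > 0 \<longrightarrow> (\<forall>\<^sub>F p in F \<times>\<^sub>F F'. (case p of (\<pi>, \<pi>') \<Rightarrow> nrm (pure_val f \<pi> - pure_val f \<pi>')) \<le> 2 *\<^sub>R w + \<delta> *\<^sub>R V)"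
    if w: "\<forall>\<^sub>F p in uniformity. (case p of (s, t) \<Rightarrow> nrm (f s - f t)) \<le> w" for w
  proof -
    obtain Y where Y: "finite Y" "\<And>s. \<exists>t\<in>Y. nrm (f t - f s) \<le> w"
      using compact_UNIV_finite_net[OF cpt w] by (metis case_prod_conv)
    \<comment> \<open>The regulators depend on \<open>t\<close>; since the net is finite, their sum
      serves all its points.\<close>
    define V where "V = (\<Sum>t\<in>Y. v t + v' t)"
    have vV: "v t + v' t \<le> V" if t: "t \<in> Y" for t
      unfolding V_def sum.remove[OF Y(1) t]
      by (rule add_increasing2[OF _ order_refl], rule sum_nonneg) (use v(1) v'(1) in simp)
    show ?thesis
    proof (intro exI[of _ V] conjI allI impI)
      show "0 \<le> V" unfolding V_def by (rule sum_nonneg) (use v(1) v'(1) in simp)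
      fix \<delta> :: real assume d: "\<delta> > 0"
      have 1: "\<forall>\<^sub>F \<pi> in F. \<forall>t\<in>Y. partition_of_unity \<pi> \<and> \<bar>nrm (pure_val f \<pi> - f t) - m t\<bar> \<le> \<delta> *\<^sub>R v t"
        by (rule eventually_ball_finite[OF Y(1)]) (use v(2)[OF d] in blast)
      have 2: "\<forall>\<^sub>F \<pi> in F'. \<forall>t\<in>Y. partition_of_unity \<pi> \<and> \<bar>nrm (pure_val f \<pi> - f t) - m t\<bar> \<le> \<delta> *\<^sub>R v' t"
        by (rule eventually_ball_finite[OF Y(1)]) (use v'(2)[OF d] in blast)
      show "\<forall>\<^sub>F p in F \<times>\<^sub>F F'. (case p of (\<pi>, \<pi>') \<Rightarrow> nrm (pure_val f \<pi> - pure_val f \<pi>')) \<le> 2 *\<^sub>R w + \<delta> *\<^sub>R V"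
        using eventually_prodI[OF 1 2]
      proof eventually_elim
        case (elim p)
        obtain \<pi> \<pi>' where p: "p = (\<pi>, \<pi>')" by force
        obtain t0 where t0: "t0 \<in> Y" using Y(2) by blast
        have pp: "partition_of_unity \<pi>" "partition_of_unity \<pi>'" using elim t0 by (auto simp: p)
        note fp = pure_val_in[OF pp(1) f] and fp' = pure_val_in[OF pp(2) f] and b = partition_of_unity_bp[OF pp(2)]
        have "nrm (pure_val f \<pi> - pure_val f \<pi>') \<le> 2 *\<^sub>R w + \<delta> *\<^sub>R V"
        proof (rule partition_of_unity_le[OF pp(2)])
          fix s
          \<comment> \<open>On \<open>\<pi>' s\<close> the second pure value equals
            \<open>f s\<close>, which is within \<open>w\<close> of \<open>f t\<close>. The first
            one is about as far from \<open>f t\<close> as the second, up to \<delta> V, so both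
            differ by at most 2w + \<delta> V there.\<close>
          obtain t where t: "t \<in> Y" "nrm (f t - f s) \<le> w" using Y(2) by blast
          have w': "nrm (f s - f t) \<le> w" using t(2) nrm_diff_commute[OF fX fX] by simp
          have close: "\<bar>nrm (pure_val f \<pi> - f t) - m t\<bar> \<le> \<delta> *\<^sub>R v t" "\<bar>nrm (pure_val f \<pi>' - f t) - m t\<bar> \<le> \<delta> *\<^sub>R v' t"
            using elim t(1) by (auto simp: p)
          have a1: "nrm (pure_val f \<pi> - f t) \<le> m t + \<delta> *\<^sub>R v t"
            using abs_le_D1[OF close(1)] by (simp add: diff_le_eq add.commute)
          have "- (nrm (pure_val f \<pi>' - f t) - m t) \<le> \<delta> *\<^sub>R v' t" by (rule abs_le_D2[OF close(2)])
          then have a2: "m t \<le> nrm (pure_val f \<pi>' - f t) + \<delta> *\<^sub>R v' t" by (simp add: diff_le_eq add.commute)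
          have "nrm (pure_val f \<pi> - f s) \<le> nrm (pure_val f \<pi> - f t) + nrm (f t - f s)" by (rule nrm_triangle3[OF fp fX fX])
          also have "\<dots> \<le> (m t + \<delta> *\<^sub>R v t) + w" by (rule add_mono[OF a1 t(2)])
          also have "\<dots> \<le> ((nrm (pure_val f \<pi>' - f t) + \<delta> *\<^sub>R v' t) + \<delta> *\<^sub>R v t) + w" by (intro add_right_mono a2)
          also have "\<dots> = nrm (pure_val f \<pi>' - f t) + w + \<delta> *\<^sub>R (v t + v' t)" by (simp add: algebra_simps)
          also have "\<dots> \<le> nrm (pure_val f \<pi>' - f t) + w + \<delta> *\<^sub>R V"
            by (intro add_left_mono scaleR_left_mono vV t(1)) (use d in simp)
          finally have a3: "nrm (pure_val f \<pi> - f s) \<le> nrm (pure_val f \<pi>' - f t) + w + \<delta> *\<^sub>R V" .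
          have "\<pi>' s \<bullet> nrm (pure_val f \<pi> - pure_val f \<pi>') = \<pi>' s \<bullet> nrm (pure_val f \<pi>' - pure_val f \<pi>)"
            using nrm_diff_commute[OF fp fp'] by simp
          also have "\<dots> = \<pi>' s \<bullet> nrm (f s - pure_val f \<pi>)" by (rule pure_val_nrm_diff[OF pp(2) f fp])
          also have "\<dots> = \<pi>' s \<bullet> nrm (pure_val f \<pi> - f s)" using nrm_diff_commute[OF fp fX] by simp
          also have "\<dots> \<le> \<pi>' s \<bullet> (nrm (pure_val f \<pi>' - f t) + w + \<delta> *\<^sub>R V)" by (rule bp_mono[OF b a3])
          also have "\<dots> = \<pi>' s \<bullet> (nrm (f s - f t) + w + \<delta> *\<^sub>R V)"
            using pure_val_nrm_diff[OF pp(2) f fX[of t], of s] by simp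
          also have "\<dots> \<le> \<pi>' s \<bullet> (w + w + \<delta> *\<^sub>R V)" by (intro bp_mono[OF b] add_right_mono w')
          finally show "\<pi>' s \<bullet> nrm (pure_val f \<pi> - pure_val f \<pi>') \<le> \<pi>' s \<bullet> (2 *\<^sub>R w + \<delta> *\<^sub>R V)"
            by (simp only: scaleR_2)
        qed
        then show ?case by (simp add: p)
      qed
    qed
  qed
  show ?thesis
  proof -
    note null = Cuo_order_null[OF f]
    obtain w where w: "0 \<le> w" "\<forall>\<^sub>F p in uniformity. (case p of (s, t) \<Rightarrow> nrm (f s - f t)) \<le> w"
      using order_null_bound[OF null] by blast
    obtain V where V: "0 \<le> V" "\<And>\<delta>::real. \<delta> > 0 \<Longrightarrow> (\<forall>\<^sub>F p in F \<times>\<^sub>F F'. (case p of (\<pi>, \<pi>') \<Rightarrow> nrm (pure_val f \<pi> - pure_val f \<pi>')) \<le> 2 *\<^sub>R w + \<delta> *\<^sub>R V)"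
      using main[OF w(2)] by blast
    show ?thesis
    proof (rule order_nullI[of "2 *\<^sub>R w + 1 *\<^sub>R V"])
      show "0 \<le> 2 *\<^sub>R w + 1 *\<^sub>R V" using w V by (simp add: scaleR_nonneg_nonneg)
      show "\<forall>\<^sub>F p in F \<times>\<^sub>F F'. (case p of (\<pi>, \<pi>') \<Rightarrow> nrm (pure_val f \<pi> - pure_val f \<pi>')) \<le> 2 *\<^sub>R w + 1 *\<^sub>R V"
        by (rule V(2)) simp
      fix L assume L: "\<And>d. 0 \<le> d \<Longrightarrow> \<forall>\<^sub>F p in F \<times>\<^sub>F F'. (case p of (\<pi>, \<pi>') \<Rightarrow> nrm (pure_val f \<pi> - pure_val f \<pi>')) \<le> d \<Longrightarrow> L \<le> d"
      have "(1 / 2) *\<^sub>R L \<le> 0"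
      proof (rule order_nullD[OF null])
        fix w assume w: "0 \<le> w" "\<forall>\<^sub>F p in uniformity. (case p of (s, t) \<Rightarrow> nrm (f s - f t)) \<le> w"
        obtain V where V: "0 \<le> V" "\<And>\<delta>::real. \<delta> > 0 \<Longrightarrow> (\<forall>\<^sub>F p in F \<times>\<^sub>F F'. (case p of (\<pi>, \<pi>') \<Rightarrow> nrm (pure_val f \<pi> - pure_val f \<pi>')) \<le> 2 *\<^sub>R w + \<delta> *\<^sub>R V)"
          using main[OF w(2)] by blast
        have "L - 2 *\<^sub>R w \<le> 0"
        proof (rule archimedean_eps)
          fix \<delta> :: real assume d: "\<delta> > 0"
          have "L \<le> 2 *\<^sub>R w + \<delta> *\<^sub>R V"
            by (rule L[OF _ V(2)[OF d]]) (use w V d in \<open>simp add: scaleR_nonneg_nonneg\<close>)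
          then show "L - 2 *\<^sub>R w \<le> \<delta> *\<^sub>R V" by (simp add: diff_le_eq add.commute)
        qed
        then have "(1 / 2) *\<^sub>R L \<le> (1 / 2) *\<^sub>R (2 *\<^sub>R w)" by (intro scaleR_left_mono) simp_all
        then show "(1 / 2) *\<^sub>R L \<le> w" by simp
      qed
      then show "L \<le> 0" by (rule scaleR_nonpos_cancel) simp
    qed
  qed
qed

lemma hom_converges_to:
  fixes \<sigma> :: "('s::uniform_space \<Rightarrow> 'e orth) \<Rightarrow> 'e orth"
  assumes "sup_functional \<sigma>" "odd_functional \<sigma>"
  obtains F where "converges_to \<sigma> F"
    "\<And>\<phi> \<epsilon>. \<phi> \<in> Cuo_orth \<Longrightarrow> (\<epsilon>::real) > 0 \<Longrightarrow> \<forall>\<^sub>F \<pi> in F. \<bar>pure_state \<pi> \<phi> - \<sigma> \<phi>\<bar> \<le> \<epsilon> *\<^sub>R 1"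
proof -
  obtain F :: "('s \<Rightarrow> 'e orth) filter" where F: "F \<noteq> bot" "\<forall>\<^sub>F \<pi> in F. partition_of_unity \<pi>"
    "\<And>\<phi> \<epsilon>. \<phi> \<in> Cuo_orth \<Longrightarrow> (\<epsilon>::real) > 0 \<Longrightarrow> \<forall>\<^sub>F \<pi> in F. \<bar>pure_state \<pi> \<phi> - \<sigma> \<phi>\<bar> \<le> \<epsilon> *\<^sub>R 1"
    using hom_pure_state_filter[OF assms] by blast
  have "relatively_uniform_tendsto (\<lambda>\<pi>. pure_state \<pi> \<phi>) (\<sigma> \<phi>) F" if "\<phi> \<in> Cuo_orth" for \<phi>
    unfolding relatively_uniform_tendsto_def using F(3)[OF that] orth_one_nonneg by blast
  then have "converges_to \<sigma> F" using F by (simp add: converges_to_def)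
  then show ?thesis using that F(3) by blast
qed

text \<open>A limit is built along one filter that converges to \<sigma>; the Cauchy estimate for
  this filter paired with any other shows that it is the limit along every such filter, as the
  definition of the value requires.\<close>

lemma value_at:
  fixes f :: "'s::uniform_space \<Rightarrow> 'x"
  assumes cpt: "compact (UNIV :: 's set)" and s: "sup_functional \<sigma>" "odd_functional \<sigma>"
    and f: "f \<in> Cuo nrm X"
  shows value_at_in: "value_at scale nrm Xt f \<sigma> \<in> Xt"
    and value_at_limit: "converges_to \<sigma> F \<Longrightarrow> order_null (\<lambda>\<pi>. nrm (value_at scale nrm Xt f \<sigma> - pure_val f \<pi>)) F"
proof -
  obtain F0 where F0: "converges_to \<sigma> F0" using hom_converges_to[OF s] by blast
  have part: "\<forall>\<^sub>F \<pi> in F. partition_of_unity \<pi>" and bot: "F \<noteq> bot" if "converges_to \<sigma> F" for F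
    using that by (auto simp: converges_to_def)
  have inX: "\<forall>\<^sub>F \<pi> in F. pure_val f \<pi> \<in> Xt" if "converges_to \<sigma> F" for F
    using part[OF that] by eventually_elim (rule pure_val_in[OF _ f])
  obtain y where y: "y \<in> Xt" "order_null (\<lambda>\<pi>. nrm (y - pure_val f \<pi>)) F0"
    by (rule complete[OF bot[OF F0] inX[OF F0] pure_val_cauchy[OF cpt f F0 F0]])
  have lim: "order_null (\<lambda>\<pi>. nrm (y - pure_val f \<pi>)) F" if F: "converges_to \<sigma> F" for F
  proof -
    have "order_null (\<lambda>p. nrm (y - pure_val f (fst p)) + (case p of (\<pi>, \<pi>') \<Rightarrow> nrm (pure_val f \<pi> - pure_val f \<pi>'))) (F0 \<times>\<^sub>F F)"
      by (rule order_null_add[OF order_null_compose[OF y(2) filtermap_fst_prod_filter[folded filterlim_def]] pure_val_cauchy[OF cpt f F0 F]])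
    then have n: "order_null (\<lambda>p. nrm (y - pure_val f (snd p))) (F0 \<times>\<^sub>F F)"
    proof (rule order_null_mono)
      show "\<forall>\<^sub>F p in F0 \<times>\<^sub>F F. nrm (y - pure_val f (snd p)) \<le>
        nrm (y - pure_val f (fst p)) + (case p of (\<pi>, \<pi>') \<Rightarrow> nrm (pure_val f \<pi> - pure_val f \<pi>'))"
        using eventually_prodI[OF inX[OF F0] inX[OF F]]
        by eventually_elim (use nrm_triangle3[OF y(1)] in \<open>auto simp: case_prod_unfold\<close>)
    qed
    have *: "(\<forall>\<^sub>F p in F0 \<times>\<^sub>F F. P (snd p)) \<longleftrightarrow> (\<forall>\<^sub>F \<pi> in F. P \<pi>)" for P
      using eventually_prod2[OF bot[OF F0], of P F] by (simp add: case_prod_unfold)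
    show ?thesis using n unfolding order_null_def *[of "\<lambda>\<pi>. nrm (y - pure_val f \<pi>) \<le> _"] .
  qed
  have tends: "order_tendsto (\<lambda>\<pi>. nrm (z - pure_val f \<pi>)) 0 F \<longleftrightarrow> order_null (\<lambda>\<pi>. nrm (z - pure_val f \<pi>)) F"
    if F: "converges_to \<sigma> F" and z: "z \<in> Xt" for F z
  proof -
    have 1: "\<forall>\<^sub>F \<pi> in F. \<bar>nrm (z - pure_val f \<pi>)\<bar> \<le> nrm (z - pure_val f \<pi>)"
      using inX[OF F] by eventually_elim (use z in simp)
    have 2: "\<forall>\<^sub>F \<pi> in F. nrm (z - pure_val f \<pi>) \<le> \<bar>nrm (z - pure_val f \<pi>)\<bar>"
      by (intro always_eventually allI abs_ge_self)
    show ?thesis unfolding order_tendsto_iff diff_0_right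
      by (rule iffI) (erule order_null_mono, rule 2, erule order_null_mono, rule 1)
  qed
  have "value_at scale nrm Xt f \<sigma> = y"
    unfolding value_at_def
  proof (rule the_equality)
    show "y \<in> Xt \<and> (\<forall>F. F \<noteq> bot \<and> (\<forall>\<^sub>F \<pi> in F. partition_of_unity \<pi>) \<and>
        (\<forall>\<phi>\<in>Cuo_orth. relatively_uniform_tendsto (\<lambda>\<pi>. pure_state \<pi> \<phi>) (\<sigma> \<phi>) F) \<longrightarrow>
      order_tendsto (\<lambda>\<pi>. nrm (y - pure_val f \<pi>)) 0 F)"
      using y lim tends[OF _ y(1)] unfolding converges_to_def[symmetric] by blast
    fix z assume "z \<in> Xt \<and> (\<forall>F. F \<noteq> bot \<and> (\<forall>\<^sub>F \<pi> in F. partition_of_unity \<pi>) \<and>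
        (\<forall>\<phi>\<in>Cuo_orth. relatively_uniform_tendsto (\<lambda>\<pi>. pure_state \<pi> \<phi>) (\<sigma> \<phi>) F) \<longrightarrow>
      order_tendsto (\<lambda>\<pi>. nrm (z - pure_val f \<pi>)) 0 F)"
    then have z: "z \<in> Xt" "order_null (\<lambda>\<pi>. nrm (z - pure_val f \<pi>)) F0"
      using tends[OF F0] F0 unfolding converges_to_def[symmetric] by blast+
    show "z = y"
    proof (rule nrm_le_zeroD[OF z(1) y(1)], rule order_null_const_le[OF order_null_mono[OF order_null_add[OF z(2) y(2)]] bot[OF F0]])
      show "\<forall>\<^sub>F \<pi> in F0. nrm (z - y) \<le> nrm (z - pure_val f \<pi>) + nrm (y - pure_val f \<pi>)"
        using inX[OF F0] by eventually_elim (rule nrm_triangle3'[OF z(1) _ y(1)])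
    qed
  qed
  then show "value_at scale nrm Xt f \<sigma> \<in> Xt"
    "converges_to \<sigma> F \<Longrightarrow> order_null (\<lambda>\<pi>. nrm (value_at scale nrm Xt f \<sigma> - pure_val f \<pi>)) F"
    using y lim by simp_all
qed

section \<open>Estimates for the distance between two values\<close>

lemma Cuo_norm_upper:
  assumes f: "f \<in> Cuo nrm X" and g: "g \<in> Cuo nrm X"
  shows "nrm (f s - g s) \<le> Cuo_norm nrm (\<lambda>s. f s - g s)"
proof -
  obtain e where e: "\<And>s. nrm (f s) \<le> e" using Cuo_bounded[OF f] by blast
  obtain e' where e': "\<And>s. nrm (g s) \<le> e'" using Cuo_bounded[OF g] by blast
  have "bdd_above (range (\<lambda>s. nrm (f s - g s)))"
    by (rule bdd_aboveI[of _ "e + e'"])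
      (use order_trans[OF nrm_triangle_diff add_mono[OF e e']] Cuo_in[OF f] Cuo_in[OF g] in auto)
  then show ?thesis unfolding Cuo_norm_def by (intro cSUP_upper) simp_all
qed

text \<open>The estimate holds for pure values componentwise and survives the limit.\<close>

lemma value_at_diff_le:
  fixes f g :: "'s::uniform_space \<Rightarrow> 'x"
  assumes cpt: "compact (UNIV :: 's set)" and s: "sup_functional \<sigma>" "odd_functional \<sigma>"
    and f: "f \<in> Cuo nrm X" and g: "g \<in> Cuo nrm X"
  shows "nrm (value_at scale nrm Xt f \<sigma> - value_at scale nrm Xt g \<sigma>) \<le> Cuo_norm nrm (\<lambda>s. f s - g s)"
proof -
  let ?f = "value_at scale nrm Xt f \<sigma>" and ?g = "value_at scale nrm Xt g \<sigma>" and ?N = "Cuo_norm nrm (\<lambda>s. f s - g s)"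
  note fX = value_at_in[OF cpt s f] and gX = value_at_in[OF cpt s g]
  obtain F where F: "converges_to \<sigma> F" using hom_converges_to[OF s] by blast
  have "nrm (?f - ?g) - ?N \<le> 0"
  proof (rule order_null_const_le[OF order_null_mono[OF order_null_add[OF value_at_limit[OF cpt s f F] value_at_limit[OF cpt s g F]]]])
    have "\<forall>\<^sub>F \<pi> in F. partition_of_unity \<pi>" using F by (simp add: converges_to_def)
    then show "\<forall>\<^sub>F \<pi> in F. nrm (?f - ?g) - ?N \<le> nrm (?f - pure_val f \<pi>) + nrm (?g - pure_val g \<pi>)"
    proof eventually_elim
      case (elim \<pi>)
      note pf = pure_val_in[OF elim f] and pg = pure_val_in[OF elim g]
      have le: "nrm (pure_val f \<pi> - pure_val g \<pi>) \<le> ?N"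
      proof (rule partition_of_unity_le[OF elim])
        fix s
        have "\<pi> s \<bullet> nrm (pure_val f \<pi> - pure_val g \<pi>) = \<pi> s \<bullet> nrm (f s - pure_val g \<pi>)"
          by (rule pure_val_nrm_diff[OF elim f pg])
        also have "\<dots> = \<pi> s \<bullet> nrm (pure_val g \<pi> - f s)" using nrm_diff_commute[OF Cuo_in[OF f] pg] by simp
        also have "\<dots> = \<pi> s \<bullet> nrm (g s - f s)" by (rule pure_val_nrm_diff[OF elim g Cuo_in[OF f]])
        also have "\<dots> = \<pi> s \<bullet> nrm (f s - g s)" using nrm_diff_commute[OF Cuo_in[OF f] Cuo_in[OF g]] by simp
        also have "\<dots> \<le> \<pi> s \<bullet> ?N" by (rule bp_mono[OF partition_of_unity_bp[OF elim] Cuo_norm_upper[OF f g]])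
        finally show "\<pi> s \<bullet> nrm (pure_val f \<pi> - pure_val g \<pi>) \<le> \<pi> s \<bullet> ?N" .
      qed
      have "nrm (?f - ?g) \<le> nrm (?f - pure_val f \<pi>) + nrm (pure_val f \<pi> - ?g)" by (rule nrm_triangle3[OF fX pf gX])
      also have "\<dots> \<le> nrm (?f - pure_val f \<pi>) + (nrm (pure_val f \<pi> - pure_val g \<pi>) + nrm (?g - pure_val g \<pi>))"
        by (rule add_left_mono[OF nrm_triangle3'[OF pf pg gX]])
      also have "\<dots> \<le> nrm (?f - pure_val f \<pi>) + (?N + nrm (?g - pure_val g \<pi>))"
        by (intro add_left_mono add_right_mono le)
      finally show ?case by (simp add: algebra_simps)
    qed
  qed (use F in \<open>simp add: converges_to_def\<close>)
  then show ?thesis by simp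
qed

text \<open>Eventually the pure state of the ratio is \<ge> 1 - \<epsilon>; multiplying by
  \<open>d\<close> bounds the distance of the pure values from below by (1 - \<epsilon>) d. Then the
  net and \<epsilon> pass to the limit.\<close>

lemma value_at_diff_ge:
  fixes f g :: "'s::uniform_space \<Rightarrow> 'x"
  assumes cpt: "compact (UNIV :: 's set)" and s: "sup_functional \<sigma>" "odd_functional \<sigma>"
    and f: "f \<in> Cuo nrm X" and g: "g \<in> Cuo nrm X" and d: "0 \<le> d"
    and one: "1 \<le> \<sigma> (\<lambda>s. trunc_ratio d (nrm (f s - g s)))"
  shows "d \<le> nrm (value_at scale nrm Xt f \<sigma> - value_at scale nrm Xt g \<sigma>)"
proof -
  let ?f = "value_at scale nrm Xt f \<sigma>" and ?g = "value_at scale nrm Xt g \<sigma>"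
  let ?\<phi> = "\<lambda>s. trunc_ratio d (nrm (f s - g s))"
  note fX = value_at_in[OF cpt s f] and gX = value_at_in[OF cpt s g]
  have C: "?\<phi> \<in> Cuo_orth" by (rule nrm_trunc_ratio_Cuo[OF d f g])
  obtain F where F: "converges_to \<sigma> F"
    "\<And>\<phi> \<epsilon>. \<phi> \<in> Cuo_orth \<Longrightarrow> (\<epsilon>::real) > 0 \<Longrightarrow> \<forall>\<^sub>F \<pi> in F. \<bar>pure_state \<pi> \<phi> - \<sigma> \<phi>\<bar> \<le> \<epsilon> *\<^sub>R 1"
    using hom_converges_to[OF s] by blast
  have "d - nrm (?f - ?g) \<le> \<epsilon> *\<^sub>R d" if e: "\<epsilon> > 0" for \<epsilon>
  proof -
    have "d - nrm (?f - ?g) - \<epsilon> *\<^sub>R d \<le> 0"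
    proof (rule order_null_const_le[OF order_null_mono[OF order_null_add[OF value_at_limit[OF cpt s f F(1)] value_at_limit[OF cpt s g F(1)]]]])
      have "\<forall>\<^sub>F \<pi> in F. partition_of_unity \<pi>" using F by (simp add: converges_to_def)
      then show "\<forall>\<^sub>F \<pi> in F. d - nrm (?f - ?g) - \<epsilon> *\<^sub>R d \<le> nrm (?f - pure_val f \<pi>) + nrm (?g - pure_val g \<pi>)"
        using F(2)[OF C e]
      proof eventually_elim
        case (elim \<pi>)
        note pf = pure_val_in[OF elim(1) f] and pg = pure_val_in[OF elim(1) g] and b = partition_of_unity_bp[OF elim(1)]
        have le: "pure_state \<pi> ?\<phi> \<bullet> d \<le> nrm (pure_val f \<pi> - pure_val g \<pi>)"
        proof (rule partition_of_unity_le[OF elim(1)])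
          fix s
          have "\<pi> s \<bullet> pure_state \<pi> ?\<phi> \<bullet> d = (\<pi> s * pure_state \<pi> ?\<phi>) \<bullet> d" by simp
          also have "\<dots> = (\<pi> s * ?\<phi> s) \<bullet> d" using pure_state_mult[OF elim(1) C] by simp
          also have "\<dots> = \<pi> s \<bullet> inf (nrm (f s - g s)) d"
            using trunc_ratio_apply[OF d, of "nrm (f s - g s)"] Cuo_in[OF f] Cuo_in[OF g] by simp
          also have "\<dots> \<le> \<pi> s \<bullet> nrm (f s - g s)" by (rule bp_mono[OF b]) simp
          also have "\<dots> = \<pi> s \<bullet> nrm (pure_val f \<pi> - g s)"
            by (rule pure_val_nrm_diff[OF elim(1) f Cuo_in[OF g], symmetric])
          also have "\<dots> = \<pi> s \<bullet> nrm (g s - pure_val f \<pi>)" using nrm_diff_commute[OF Cuo_in[OF g] pf] by simp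
          also have "\<dots> = \<pi> s \<bullet> nrm (pure_val g \<pi> - pure_val f \<pi>)"
            by (rule pure_val_nrm_diff[OF elim(1) g pf, symmetric])
          also have "\<dots> = \<pi> s \<bullet> nrm (pure_val f \<pi> - pure_val g \<pi>)" using nrm_diff_commute[OF pf pg] by simp
          finally show "\<pi> s \<bullet> pure_state \<pi> ?\<phi> \<bullet> d \<le> \<pi> s \<bullet> nrm (pure_val f \<pi> - pure_val g \<pi>)" .
        qed
        have "1 \<le> \<sigma> ?\<phi>" by (rule one)
        also have "\<dots> \<le> pure_state \<pi> ?\<phi> + \<epsilon> *\<^sub>R 1"
          using abs_le_D2[OF elim(2)] by (simp add: diff_le_eq add.commute)
        finally have "d \<le> pure_state \<pi> ?\<phi> \<bullet> d + \<epsilon> *\<^sub>R d" using orth_leD[OF _ d, of 1 "pure_state \<pi> ?\<phi> + \<epsilon> *\<^sub>R 1"] by simp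
        also have "\<dots> \<le> nrm (pure_val f \<pi> - pure_val g \<pi>) + \<epsilon> *\<^sub>R d" by (rule add_right_mono[OF le])
        also have "\<dots> \<le> (nrm (pure_val f \<pi> - ?f) + nrm (?f - pure_val g \<pi>)) + \<epsilon> *\<^sub>R d"
          by (rule add_right_mono[OF nrm_triangle3[OF pf fX pg]])
        also have "\<dots> \<le> (nrm (?f - pure_val f \<pi>) + (nrm (?f - ?g) + nrm (?g - pure_val g \<pi>))) + \<epsilon> *\<^sub>R d"
          using nrm_triangle3[OF fX gX pg] nrm_diff_commute[OF pf fX] by simp
        finally show ?case by (simp add: algebra_simps)
      qed
    qed (use F in \<open>simp add: converges_to_def\<close>)
    then show ?thesis by simp
  qed
  then have "d - nrm (?f - ?g) \<le> 0" by (rule archimedean_eps)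
  then show ?thesis by simp
qed

end

section \<open>Multipliers\<close>

lemma bp_cases:
  fixes v w :: "'e::dedekind_complete_vector_lattice"
  assumes r: "\<rho> \<in> band_projections" "\<rho> \<noteq> 0"
  obtains \<rho>' where "\<rho>' \<in> band_projections" "\<rho>' \<noteq> 0" "\<rho>' \<le> \<rho>" "\<rho>' \<bullet> v \<le> \<rho>' \<bullet> w"
  | \<rho>' where "\<rho>' \<in> band_projections" "\<rho>' \<noteq> 0" "\<rho>' \<le> \<rho>" "\<rho>' \<bullet> w \<le> \<rho>' \<bullet> v"
proof -
  obtain \<pi> where p: "\<pi> \<in> band_projections" "\<pi> \<bullet> (w - v) = pprt (w - v)" by (rule principal_projection)
  show ?thesis
  proof (cases "\<rho> * \<pi> = 0")
    case False
    have "0 \<le> \<rho> \<bullet> \<pi> \<bullet> (w - v)" unfolding p(2) by (rule bp_pos[OF r(1)]) simp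
    then have "(\<rho> * \<pi>) \<bullet> v \<le> (\<rho> * \<pi>) \<bullet> w" by simp
    then show ?thesis by (rule that(1)[OF bp_mult[OF r(1) p(1)] False bp_mult_le1[OF r(1) p(1)]])
  next
    case True
    have "\<rho> \<bullet> (w - v) = \<rho> \<bullet> (pprt (w - v) + nprt (w - v))" by (simp flip: prts)
    also have "\<dots> = (\<rho> * \<pi>) \<bullet> (w - v) + \<rho> \<bullet> nprt (w - v)" by (simp only: orth_apply_simps(2,11) p(2))
    also have "\<dots> \<le> 0" unfolding True using bp_mono[OF r(1) nprt_le_zero, of "w - v"] by simp
    finally have "\<rho> \<bullet> w \<le> \<rho> \<bullet> v" by simp
    then show ?thesis using that(2) r by blast
  qed
qed

text \<open>An arbitrary \<open>c\<close> need not be below a multiple of \<open>d\<close> even on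
  the carrier of \<open>d\<close>; but if d \<le> c / n held on all of \<rho> for every n,
  \<open>d\<close> would vanish there.\<close>

lemma locally_dominated:
  fixes d c :: "'e::dedekind_complete_vector_lattice"
  assumes r: "\<rho> \<in> band_projections" "\<rho> \<noteq> 0" "\<rho> \<le> 1 - annihilator d" and d: "0 \<le> d"
  obtains \<rho>' k where "\<rho>' \<in> band_projections" "\<rho>' \<noteq> 0" "\<rho>' \<le> \<rho>" "(k::real) > 0" "\<rho>' \<bullet> c \<le> k *\<^sub>R (\<rho>' \<bullet> d)"
proof -
  have "\<exists>n::nat. n > 0 \<and> \<not> \<rho> \<bullet> d \<le> \<rho> \<bullet> (1 / real n) *\<^sub>R c"
  proof (rule ccontr)
    assume neg: "\<not> ?thesis"
    have "\<rho> \<bullet> d \<le> 0"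
    proof (rule archimedean)
      fix n :: nat assume "n > 0"
      then have "\<rho> \<bullet> d \<le> \<rho> \<bullet> (1 / real n) *\<^sub>R c" using neg by blast
      then show "\<rho> \<bullet> d \<le> (1 / real n) *\<^sub>R (\<rho> \<bullet> c)" by simp
    qed
    then have "\<rho> \<bullet> d = 0" using bp_pos[OF r(1) d] by (rule order.antisym)
    then have "\<rho> \<le> annihilator d" by (rule annihilator_greatest[OF r(1)])
    then show False using bp_le_disjoint_zero[OF annihilator_bp r(1)] r by blast
  qed
  then obtain n :: nat where n: "n > 0" "\<not> \<rho> \<bullet> d \<le> \<rho> \<bullet> (1 / real n) *\<^sub>R c" by blast
  have "\<exists>\<tau>\<in>band_projections. \<tau> \<noteq> 0 \<and> \<tau> \<le> \<rho> \<and>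
      (\<forall>\<rho>'\<in>band_projections. \<rho>' \<noteq> 0 \<and> \<rho>' \<le> \<tau> \<longrightarrow> \<not> \<rho>' \<bullet> d \<le> \<rho>' \<bullet> (1 / real n) *\<^sub>R c)"
    using local_le[OF r(1), of d "(1 / real n) *\<^sub>R c"] n(2) by blast
  then obtain \<tau> where t: "\<tau> \<in> band_projections" "\<tau> \<noteq> 0" "\<tau> \<le> \<rho>"
    "\<And>\<rho>'. \<rho>' \<in> band_projections \<Longrightarrow> \<rho>' \<noteq> 0 \<Longrightarrow> \<rho>' \<le> \<tau> \<Longrightarrow> \<not> \<rho>' \<bullet> d \<le> \<rho>' \<bullet> (1 / real n) *\<^sub>R c" by blast
  show ?thesis
  proof (rule bp_cases[OF t(1,2), of d "(1 / real n) *\<^sub>R c"])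
    fix \<rho>' assume r': "\<rho>' \<in> band_projections" "\<rho>' \<noteq> 0" "\<rho>' \<le> \<tau>" "\<rho>' \<bullet> (1 / real n) *\<^sub>R c \<le> \<rho>' \<bullet> d"
    from scaleR_left_mono[OF r'(4), of "real n"] have "\<rho>' \<bullet> c \<le> real n *\<^sub>R (\<rho>' \<bullet> d)" using n(1) by simp
    then show ?thesis using that[of \<rho>' "real n"] r' t(3) n(1) order_trans by simp
  qed (use t(4) in blast)
qed

lemma orth_power_nonneg: "0 \<le> a \<Longrightarrow> 0 \<le> (a :: 'e::dedekind_complete_vector_lattice orth) ^ n"
  by (induction n) simp_all

lemma bp_power_le:
  fixes a :: "'e::dedekind_complete_vector_lattice orth"
  assumes r: "\<rho> \<in> band_projections" and a: "0 \<le> a" and t: "0 \<le> t" "\<rho> * a \<le> t *\<^sub>R \<rho>"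
  shows "\<rho> * a ^ n \<le> t ^ n *\<^sub>R \<rho>"
proof (induction n)
  case (Suc n)
  have "\<rho> * a ^ Suc n = (\<rho> * a) * a ^ n" by (simp add: mult.assoc)
  also have "\<dots> \<le> (t *\<^sub>R \<rho>) * a ^ n" by (rule mult_right_mono[OF t(2) orth_power_nonneg[OF a]])
  also have "\<dots> = t *\<^sub>R (\<rho> * a ^ n)" by simp
  also have "\<dots> \<le> t *\<^sub>R (t ^ n *\<^sub>R \<rho>)" by (rule scaleR_left_mono[OF Suc t(1)])
  finally show ?case by simp
qed simp

lemma bp_power_ge:
  fixes a :: "'e::dedekind_complete_vector_lattice orth"
  assumes r: "\<rho> \<in> band_projections" and a: "0 \<le> a" and t: "0 \<le> t" "t *\<^sub>R \<rho> \<le> \<rho> * a"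
  shows "t ^ n *\<^sub>R \<rho> \<le> \<rho> * a ^ n"
proof (induction n)
  case (Suc n)
  have "t *\<^sub>R (t ^ n *\<^sub>R \<rho>) \<le> t *\<^sub>R (\<rho> * a ^ n)" by (rule scaleR_left_mono[OF Suc t(1)])
  also have "\<dots> = (t *\<^sub>R \<rho>) * a ^ n" by simp
  also have "\<dots> \<le> (\<rho> * a) * a ^ n" by (rule mult_right_mono[OF t(2) orth_power_nonneg[OF a]])
  also have "\<dots> = \<rho> * a ^ Suc n" by (simp add: mult.assoc)
  finally show ?case by simp
qed simp

text \<open>Let s be the midpoint of r and t, and let m be about s^(-n). Then m r^n is small while m
  t^n is large, and Bernoulli's inequality gives the first bound. For the second, (1 - x)^m (1 +
  x)^m \<le> 1 and (1 + x)^m \<ge> m x with x = t^n.\<close>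

lemma jewett_polynomial:
  fixes r t \<eta> :: real
  assumes "0 < r" "r < t" "t < 1" "0 < \<eta>"
  obtains n m where "1 - \<eta> \<le> (1 - r ^ n) ^ m" "(1 - t ^ n) ^ m \<le> \<eta>" "n > 0"
proof -
  define s where "s = (r + t) / 2"
  have s: "r < s" "s < t" "0 < s" using assms by (auto simp: s_def)
  have "(\<lambda>n. (r / s) ^ n + r ^ n) \<longlonglongrightarrow> 0 + 0"
    by (intro tendsto_add LIMSEQ_realpow_zero) (use assms s in auto)
  then have 1: "\<forall>\<^sub>F n in sequentially. (r / s) ^ n + r ^ n < \<eta>"
    using order_tendstoD(2)[of _ "0 + 0" sequentially \<eta>] assms(4) by simp
  have "(\<lambda>n. (s / t) ^ n) \<longlonglongrightarrow> 0"
    by (rule LIMSEQ_realpow_zero) (use assms s in auto)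
  then have "\<forall>\<^sub>F n in sequentially. (s / t) ^ n < \<eta>" using order_tendstoD(2) assms(4) by blast
  then have 2: "\<forall>\<^sub>F n in sequentially. 1 / \<eta> < (t / s) ^ n"
    by eventually_elim (use assms s in \<open>simp add: power_divide field_simps\<close>)
  have "\<forall>\<^sub>F n in sequentially. (r / s) ^ n + r ^ n < \<eta> \<and> 1 / \<eta> < (t / s) ^ n \<and> n > 0"
    using 1 2 eventually_gt_at_top[of 0] by eventually_elim simp
  then obtain n where n: "(r / s) ^ n + r ^ n < \<eta>" "1 / \<eta> < (t / s) ^ n" "n > 0"
    by (auto simp: eventually_sequentially)
  \<comment> \<open>Rounding up costs at most 1, hence the extra term r^n in the choice of
    n.\<close>
  define m where "m = nat \<lceil>(1 / s) ^ n\<rceil>"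
  have m: "(1 / s) ^ n \<le> real m" "real m \<le> (1 / s) ^ n + 1"
    using s unfolding m_def by (auto simp: of_nat_nat intro: order_trans)
  show ?thesis
  proof (rule that[OF _ _ n(3)])
    have "real m * r ^ n \<le> ((1 / s) ^ n + 1) * r ^ n" by (rule mult_right_mono[OF m(2)]) (use assms in simp)
    also have "\<dots> = (r / s) ^ n + r ^ n" by (simp add: power_divide algebra_simps)
    finally have "real m * r ^ n \<le> \<eta>" using n(1) by simp
    moreover have "r ^ n \<le> 1" using assms by (intro power_le_one) auto
    then have "1 - real m * r ^ n \<le> (1 - r ^ n) ^ m" using Bernoulli_inequality[of "- (r ^ n)" m] by simp
    ultimately show "1 - \<eta> \<le> (1 - r ^ n) ^ m" by simp
    have tn: "0 \<le> t ^ n" "t ^ n \<le> 1" using assms by (auto intro: power_le_one)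
    have "1 / \<eta> < (t / s) ^ n" by (rule n(2))
    also have "\<dots> = (1 / s) ^ n * t ^ n" by (simp add: power_divide)
    also have "\<dots> \<le> real m * t ^ n" by (rule mult_right_mono[OF m(1) tn(1)])
    also have "\<dots> \<le> (1 + t ^ n) ^ m" using Bernoulli_inequality[of "t ^ n" m] tn by simp
    finally have big: "1 / \<eta> < (1 + t ^ n) ^ m" .
    have "(1 - t ^ n) ^ m * (1 + t ^ n) ^ m = (1 - t ^ n * t ^ n) ^ m"
    proof -
      have "(1 - t ^ n) * (1 + t ^ n) = 1 - t ^ n * t ^ n" by (simp add: algebra_simps)
      then show ?thesis by (simp only: flip: power_mult_distrib)
    qed
    also have "\<dots> \<le> 1" using tn by (intro power_le_one) (auto simp: mult_le_one)
    finally have "(1 - t ^ n) ^ m * (1 + t ^ n) ^ m \<le> 1" .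
    moreover have "(1 - t ^ n) ^ m * (1 / \<eta>) \<le> (1 - t ^ n) ^ m * (1 + t ^ n) ^ m"
      using big tn by (intro mult_left_mono) auto
    ultimately have "(1 - t ^ n) ^ m * (1 / \<eta>) \<le> 1" by simp
    then show "(1 - t ^ n) ^ m \<le> \<eta>" using assms(4) by (simp add: field_simps)
  qed
qed

context norm_completion_bk
begin

context
  fixes W :: "('s::uniform_space \<Rightarrow> 'x) set"
  assumes W: "W \<subseteq> Cuo nrm X"
begin

lemma multiplierD:
  assumes "\<phi> \<in> multipliers scale nrm Xt W"
  shows "\<phi> \<in> Cuo_orth" "0 \<le> \<phi> s" "\<phi> s \<le> 1"
    "f \<in> W \<Longrightarrow> g \<in> W \<Longrightarrow> (\<lambda>s. act (\<phi> s) (f s) + act (1 - \<phi> s) (g s)) \<in> W"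
  using assms by (auto simp: multipliers_def orth_action_eq)

lemma multiplierI:
  assumes "\<phi> \<in> Cuo_orth" "\<And>s. 0 \<le> \<phi> s" "\<And>s. \<phi> s \<le> 1"
    "\<And>f g. f \<in> W \<Longrightarrow> g \<in> W \<Longrightarrow> (\<lambda>s. act (\<phi> s) (f s) + act (1 - \<phi> s) (g s)) \<in> W"
  shows "\<phi> \<in> multipliers scale nrm Xt W"
  using assms by (auto simp: multipliers_def orth_action_eq)

lemma W_in: "f \<in> W \<Longrightarrow> f s \<in> Xt"
  using Cuo_in W by blast

lemma multiplier_compl:
  assumes "\<phi> \<in> multipliers scale nrm Xt W"
  shows "(\<lambda>s. 1 - \<phi> s) \<in> multipliers scale nrm Xt W"
proof (rule multiplierI)
  note m = multiplierD[OF assms]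
  show "(\<lambda>s. 1 - \<phi> s) \<in> Cuo_orth" using m(1) by simp
  show "(\<lambda>s. act (1 - \<phi> s) (f s) + act (1 - (1 - \<phi> s)) (g s)) \<in> W" if "f \<in> W" "g \<in> W" for f g
    using m(4)[OF that(2,1)] by (simp add: add.commute)
qed (use multiplierD[OF assms] in auto)

lemma multiplier_one: "(\<lambda>s. 1) \<in> multipliers scale nrm Xt W"
proof (rule multiplierI)
  have act0: "act 0 w = 0" if "w \<in> Xt" for w using act_real[OF that, of 0] by simp
  show "(\<lambda>s. act 1 (f s) + act (1 - 1) (g s)) \<in> W" if "f \<in> W" "g \<in> W" for f g
    using that W_in[OF that(1)] W_in[OF that(2)] by (simp add: act_one act0)
qed auto

text \<open>Using the same \<open>g\<close> twice, \<phi> (\<psi> f + (1 - \<psi>) g) + (1 - \<phi>)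
  g is the combination of f and g with weight \<phi> \<psi>.\<close>

lemma multiplier_mult:
  assumes phi: "\<phi> \<in> multipliers scale nrm Xt W" and psi: "\<psi> \<in> multipliers scale nrm Xt W"
  shows "(\<lambda>s. \<phi> s * \<psi> s) \<in> multipliers scale nrm Xt W"
proof (rule multiplierI)
  note m = multiplierD[OF phi] and n = multiplierD[OF psi]
  have absle: "\<bar>\<phi> s * \<psi> s - \<phi> t * \<psi> t\<bar> \<le> \<bar>\<phi> s - \<phi> t\<bar> + \<bar>\<psi> s - \<psi> t\<bar>" for s t
  proof -
    have "\<phi> s * \<psi> s - \<phi> t * \<psi> t = (\<phi> s - \<phi> t) * \<psi> s + \<phi> t * (\<psi> s - \<psi> t)" by (simp add: algebra_simps)
    then have "\<bar>\<phi> s * \<psi> s - \<phi> t * \<psi> t\<bar> \<le> \<bar>(\<phi> s - \<phi> t) * \<psi> s\<bar> + \<bar>\<phi> t * (\<psi> s - \<psi> t)\<bar>" by (metis abs_triangle_ineq)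
    also have "\<dots> \<le> \<bar>\<phi> s - \<phi> t\<bar> * \<bar>\<psi> s\<bar> + \<bar>\<phi> t\<bar> * \<bar>\<psi> s - \<psi> t\<bar>" by (intro add_mono abs_le_mult)
    also have "\<dots> \<le> \<bar>\<phi> s - \<phi> t\<bar> * 1 + 1 * \<bar>\<psi> s - \<psi> t\<bar>"
      by (intro add_mono mult_left_mono mult_right_mono) (use m(2,3) n(2,3) in auto)
    finally show ?thesis by simp
  qed
  have p01: "0 \<le> \<phi> s * \<psi> s" "\<phi> s * \<psi> s \<le> 1" for s
    using mult_nonneg_nonneg[OF m(2) n(2), of s s] mult_mono[OF m(3) n(3) orth_one_nonneg n(2), of s s] by simp_all
  show "(\<lambda>s. \<phi> s * \<psi> s) \<in> Cuo_orth"
    unfolding Cuo_orth_iff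
  proof
    show "\<exists>c. \<forall>s. \<bar>\<phi> s * \<psi> s\<bar> \<le> c" using p01 by (intro exI[of _ 1]) simp
    have "order_null (\<lambda>p. (case p of (s, t) \<Rightarrow> \<bar>\<phi> s - \<phi> t\<bar>) + (case p of (s, t) \<Rightarrow> \<bar>\<psi> s - \<psi> t\<bar>)) uniformity"
      using m(1) n(1) by (intro order_null_add) (simp_all add: Cuo_orth_iff)
    then show "order_null (\<lambda>(s, t). \<bar>\<phi> s * \<psi> s - \<phi> t * \<psi> t\<bar>) uniformity"
      by (rule order_null_mono) (intro always_eventually, use absle in auto)
  qed
  show "0 \<le> \<phi> s * \<psi> s" "\<phi> s * \<psi> s \<le> 1" for s using p01 .
  fix f g assume f: "f \<in> W" and g: "g \<in> W"
  have "(\<lambda>s. act (\<phi> s) (act (\<psi> s) (f s) + act (1 - \<psi> s) (g s)) + act (1 - \<phi> s) (g s)) \<in> W"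
    by (rule m(4)[OF n(4)[OF f g] g])
  also have "(\<lambda>s. act (\<phi> s) (act (\<psi> s) (f s) + act (1 - \<psi> s) (g s)) + act (1 - \<phi> s) (g s))
    = (\<lambda>s. act (\<phi> s * \<psi> s) (f s) + act (1 - \<phi> s * \<psi> s) (g s))"
  proof
    fix s
    have X: "f s \<in> Xt" "g s \<in> Xt" using W_in f g by auto
    have "act (\<phi> s) (act (\<psi> s) (f s) + act (1 - \<psi> s) (g s)) + act (1 - \<phi> s) (g s)
      = act (\<phi> s * \<psi> s) (f s) + (act (\<phi> s * (1 - \<psi> s)) (g s) + act (1 - \<phi> s) (g s))"
      using X by (simp add: act_add_right act_mult add.assoc)
    also have "act (\<phi> s * (1 - \<psi> s)) (g s) + act (1 - \<phi> s) (g s) = act (\<phi> s * (1 - \<psi> s) + (1 - \<phi> s)) (g s)"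
      using X by (simp add: act_add_left)
    also have "\<phi> s * (1 - \<psi> s) + (1 - \<phi> s) = 1 - \<phi> s * \<psi> s" by (simp add: algebra_simps)
    finally show "act (\<phi> s) (act (\<psi> s) (f s) + act (1 - \<psi> s) (g s)) + act (1 - \<phi> s) (g s)
      = act (\<phi> s * \<psi> s) (f s) + act (1 - \<phi> s * \<psi> s) (g s)" .
  qed
  finally show "(\<lambda>s. act (\<phi> s * \<psi> s) (f s) + act (1 - \<phi> s * \<psi> s) (g s)) \<in> W" .
qed

lemma multiplier_power:
  "\<phi> \<in> multipliers scale nrm Xt W \<Longrightarrow> (\<lambda>s. \<phi> s ^ n) \<in> multipliers scale nrm Xt W"
  by (induction n) (simp_all add: multiplier_one multiplier_mult)

end

lemma nrm_convex_combination:
  assumes X: "u \<in> Xt" "x \<in> Xt" "y \<in> Xt" and a: "0 \<le> a" "a \<le> 1"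
  shows "nrm (u - (act a x + act (1 - a) y)) \<le> a \<bullet> nrm (u - x) + (1 - a) \<bullet> nrm (u - y)"
proof -
  have act_diff: "act b (v - w) = act b v - act b w" if "v \<in> Xt" "w \<in> Xt" for b v w
    using act_add_right[of "v - w" w b] that by simp
  have "u = act (a + (1 - a)) u" using X by (simp add: act_one)
  also have "\<dots> = act a u + act (1 - a) u" by (rule act_add_left[OF X(1)])
  finally have "u - (act a x + act (1 - a) y) = act a (u - x) + act (1 - a) (u - y)"
    using X by (simp add: act_diff algebra_simps)
  then have "nrm (u - (act a x + act (1 - a) y)) \<le> nrm (act a (u - x)) + nrm (act (1 - a) (u - y))"
    using nrm_triangle[of "act a (u - x)" "act (1 - a) (u - y)"] X by simp
  also have "\<dots> = a \<bullet> nrm (u - x) + (1 - a) \<bullet> nrm (u - y)"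
    using X a nrm_act[of "u - x" a] nrm_act[of "u - y" "1 - a"] by simp
  finally show ?thesis .
qed

end

section \<open>The distance constraint and its minimal sup functionals\<close>

lemma trunc_ratio_annihilator:
  assumes d: "0 \<le> d" and v: "0 \<le> v"
  shows "annihilator d * trunc_ratio d v = annihilator d"
proof (rule order.antisym)
  note n = annihilator_bp[of d]
  show "annihilator d * trunc_ratio d v \<le> annihilator d"
    using bp_mult_mono[OF n trunc_ratio_le_one[OF d v]] by simp
  show "annihilator d \<le> annihilator d * trunc_ratio d v"
    using bp_mult_mono[OF n annihilator_le_trunc_ratio[OF d v]] bp_idem[OF n] by simp
qed

text \<open>On a common part of \<rho> and \<tau> the element \<open>T\<close> would be both \<ge> 1
  and \<le> 1 - \<delta>. This locates the band on which a constraint is violated.\<close>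

lemma bp_le_compl_of_bound:
  assumes r: "\<rho> \<in> band_projections" and n: "\<tau> \<in> band_projections"
    and le: "\<rho> * T \<le> (1 - \<delta>) *\<^sub>R \<rho>" and T: "\<tau> \<le> \<tau> * T" and d: "\<delta> > 0"
  shows "\<rho> \<le> 1 - \<tau>"
proof -
  define \<upsilon> where "\<upsilon> = \<rho> * \<tau>"
  have u: "\<upsilon> \<in> band_projections" unfolding \<upsilon>_def by (rule bp_mult[OF r n])
  have ur: "\<upsilon> \<le> \<rho>" "\<upsilon> \<le> \<tau>" unfolding \<upsilon>_def using bp_mult_le1[OF r n] bp_mult_le2[OF r n] by auto
  have "\<upsilon> * T \<le> (1 - \<delta>) *\<^sub>R \<upsilon>"
    using bp_mult_mono[OF u le] bp_le_mult[OF r u ur(1)] by simp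
  moreover have "\<upsilon> \<le> \<upsilon> * T"
    using bp_mult_mono[OF u T] bp_le_mult[OF n u ur(2)] by simp
  ultimately have "1 *\<^sub>R \<upsilon> \<le> (1 - \<delta>) *\<^sub>R \<upsilon>" by simp
  then have "\<upsilon> = 0" using bp_scaleR_le[OF u, of 1 "1 - \<delta>"] d by fastforce
  then show ?thesis unfolding \<upsilon>_def using bp_mult_zero_iff[OF n r] by blast
qed

context norm_completion_bk
begin

abbreviation rel_dist :: "'e \<Rightarrow> ('s::uniform_space \<Rightarrow> 'x) \<Rightarrow> ('s \<Rightarrow> 'x) \<Rightarrow> 's \<Rightarrow> 'e orth" where
  "rel_dist d f g \<equiv> \<lambda>s. trunc_ratio d (nrm (f s - g s))"

text \<open>Otherwise all \<open>f s - g s\<close> are bounded by (1 - \<delta>) d on a nonzero band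
  inside the carrier of \<open>d\<close>. Together with the trivial bound off the band this makes
  the norm of \<open>f - g\<close> smaller than \<open>d\<close> on the band.\<close>

lemma SUP_rel_dist:
  fixes f g :: "'s::uniform_space \<Rightarrow> 'x"
  assumes f: "f \<in> Cuo nrm X" and g: "g \<in> Cuo nrm X" and d: "0 \<le> d" "d \<le> Cuo_norm nrm (\<lambda>s. f s - g s)"
  shows "1 \<le> (SUP s. rel_dist d f g s)"
proof (rule ccontr)
  let ?T = "SUP s. rel_dist d f g s" and ?N = "Cuo_norm nrm (\<lambda>s. f s - g s)"
  have v0: "0 \<le> nrm (f s - g s)" for s using Cuo_in[OF f] Cuo_in[OF g] by simp
  have "bdd_above (range (rel_dist d f g))" by (rule bdd_aboveI[of _ 1]) (use trunc_ratio_le_one[OF d(1) v0] in auto)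
  then have up: "rel_dist d f g s \<le> ?T" for s by (intro cSUP_upper) simp_all
  assume "\<not> 1 \<le> ?T"
  then have "\<not> 1 * 1 \<le> 1 * ?T" by simp
  then obtain \<rho> \<delta> where r: "\<rho> \<in> band_projections" "\<rho> \<noteq> 0" "(\<delta>::real) > 0" "\<rho> * ?T + \<delta> *\<^sub>R \<rho> \<le> \<rho> * 1"
    by (rule not_le_orthE[OF bp_one])
  have le: "\<rho> * rel_dist d f g s \<le> (1 - \<delta>) *\<^sub>R \<rho>" for s
  proof -
    have "\<rho> * rel_dist d f g s \<le> \<rho> * ?T" by (rule bp_mult_mono[OF r(1) up])
    also have "\<dots> \<le> \<rho> - \<delta> *\<^sub>R \<rho>" using r(4) by (simp add: le_diff_eq)
    finally show ?thesis by (simp add: scaleR_diff_left)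
  qed
  have ra: "\<rho> \<le> 1 - annihilator d"
    by (rule bp_le_compl_of_bound[OF r(1) annihilator_bp le[of undefined] _ r(3)])
      (simp add: trunc_ratio_annihilator[OF d(1) v0])
  have "\<rho> \<bullet> nrm (f s - g s) \<le> (1 - \<delta>) *\<^sub>R (\<rho> \<bullet> d)" for s
    by (rule trunc_ratio_leD[OF d(1) v0 r(1) ra le]) (use r(3) in simp)
  moreover have "(1 - \<rho>) \<bullet> nrm (f s - g s) \<le> (1 - \<rho>) \<bullet> ?N" for s
    by (rule bp_mono[OF bp_compl[OF r(1)] Cuo_norm_upper[OF f g]])
  ultimately have "\<rho> \<bullet> nrm (f s - g s) + (1 - \<rho>) \<bullet> nrm (f s - g s) \<le> (1 - \<delta>) *\<^sub>R (\<rho> \<bullet> d) + (1 - \<rho>) \<bullet> ?N" for s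
    by (rule add_mono)
  then have "?N \<le> (1 - \<delta>) *\<^sub>R (\<rho> \<bullet> d) + (1 - \<rho>) \<bullet> ?N"
    unfolding Cuo_norm_def by (intro cSUP_least) simp_all
  then have "\<rho> \<bullet> ?N \<le> (1 - \<delta>) *\<^sub>R (\<rho> \<bullet> d)" by (simp add: algebra_simps)
  with bp_mono[OF r(1) d(2)] have "\<rho> \<bullet> d \<le> (1 - \<delta>) *\<^sub>R (\<rho> \<bullet> d)" by (rule order_trans)
  then have "\<delta> *\<^sub>R (\<rho> \<bullet> d) \<le> 0" by (simp add: algebra_simps)
  then have "\<rho> \<bullet> d \<le> 0" using r(3) by (rule scaleR_nonpos_cancel)
  then have "\<rho> \<bullet> d = 0" using bp_pos[OF r(1) d(1)] by (rule order.antisym)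
  then have "\<rho> \<le> annihilator d" by (rule annihilator_greatest[OF r(1)])
  then show False using bp_le_disjoint_zero[OF annihilator_bp r(1)] ra r(2) by blast
qed

context
  fixes W :: "('s::uniform_space \<Rightarrow> 'x) set" and f :: "'s \<Rightarrow> 'x" and d :: 'e
    and p :: "('s \<Rightarrow> 'e orth) \<Rightarrow> 'e orth"
  assumes W: "W \<subseteq> Cuo nrm X" and f: "f \<in> Cuo nrm X" and d: "0 \<le> d"
    and p: "sup_functional p" and p1: "\<forall>g\<in>W. 1 \<le> p (rel_dist d f g)"
    and min: "\<forall>q. sup_functional q \<and> (\<forall>\<phi>\<in>Cuo_orth. q \<phi> \<le> p \<phi>) \<and>
      (\<forall>g\<in>W. 1 \<le> q (rel_dist d f g)) \<longrightarrow> (\<forall>\<phi>\<in>Cuo_orth. q \<phi> = p \<phi>)"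
begin

lemma rel_dist_Cuo: "g \<in> W \<Longrightarrow> rel_dist d f g \<in> Cuo_orth"
  using nrm_trunc_ratio_Cuo[OF d f] W by blast

lemma nrm_fg: "g \<in> W \<Longrightarrow> 0 \<le> nrm (f s - g s)"
  using Cuo_in[OF f] Cuo_in W by (metis Xt_diff nrm_ge_0 subsetD)

text \<open>Restricting a minimal \<open>p\<close> to the part of \<open>\<pi>\<close> where \<open>\<theta> \<le> 0\<close> must violate the constraint for some \<open>g\<close>.\<close>

lemma minimal_cut:
  assumes pi: "\<pi> \<in> band_projections" and th: "\<theta> \<in> Cuo_orth"
    and low: "0 \<le> \<pi> * p (\<lambda>s. - \<theta> s)" and high: "\<not> \<pi> * p \<theta> \<le> 0"
  obtains g c \<rho> \<delta> where "g \<in> W" "0 \<le> (c::real)" "\<rho> \<in> band_projections" "\<rho> \<noteq> 0" "\<rho> \<le> \<pi>"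
    "\<rho> \<le> 1 - annihilator d" "0 < (\<delta>::real)"
    "\<rho> * p (\<lambda>s. rel_dist d f g s - c *\<^sub>R pprt (\<theta> s)) \<le> (1 - \<delta>) *\<^sub>R \<rho>"
proof -
  \<comment> \<open>A penalty that vanishes off \<pi> and where \<theta> \<le> 0. By
    \<open>low\<close> its maximum under \<open>p\<close> is 0, so \<open>face p \<eta>\<close>
    describes the points with \<theta> \<le> 0 on \<pi>.\<close>
  define \<eta> where "\<eta> s = - (\<pi> * pprt (\<theta> s))" for s
  have pt: "(\<lambda>s. pprt (\<theta> s)) \<in> Cuo_orth" using th by simp
  have eta: "\<eta> \<in> Cuo_orth" unfolding \<eta>_def using pi pt by simp
  have eta_eq: "\<eta> = (\<lambda>s. \<pi> * - pprt (\<theta> s))" by (simp add: \<eta>_def fun_eq_iff)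
  have p_eta: "p \<eta> = 0"
  proof (rule order.antisym)
    show "p \<eta> \<le> 0"
      by (rule sf_le_const[OF p eta]) (use pi in \<open>simp add: \<eta>_def bp_nonneg\<close>)
    define a where "a = p (\<lambda>s. - \<theta> s)"
    have "p (\<lambda>s. - pprt (\<theta> s) + pprt (- \<theta> s)) \<le> p (\<lambda>s. - pprt (\<theta> s)) + p (\<lambda>s. pprt (- \<theta> s))"
      by (rule sf_add[OF p]) (use th in simp_all)
    moreover have "(\<lambda>s. - pprt (\<theta> s) + pprt (- \<theta> s)) = (\<lambda>s. - \<theta> s)"
    proof
      fix s show "- pprt (\<theta> s) + pprt (- \<theta> s) = - \<theta> s" using pprt_diff[of "\<theta> s"] by (simp add: algebra_simps)
    qed
    moreover have "p (\<lambda>s. pprt (- \<theta> s)) = pprt a"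
      unfolding a_def pprt_def using sf_sup[OF p, of "\<lambda>s. - \<theta> s" "\<lambda>s. 0"] th by (simp add: sf_zero[OF p])
    ultimately have "a - pprt a \<le> p (\<lambda>s. - pprt (\<theta> s))" by (simp add: a_def diff_le_eq)
    from bp_mult_mono[OF pi this] have "\<pi> * a - \<pi> * pprt a \<le> \<pi> * p (\<lambda>s. - pprt (\<theta> s))" by (simp add: right_diff_distrib)
    moreover have "\<pi> * pprt a = \<pi> * a" using low by (simp add: bp_pprt_mult[OF pi] a_def)
    ultimately show "0 \<le> p \<eta>" unfolding eta_eq using sf_bp_mult[OF p pi, of "\<lambda>s. - pprt (\<theta> s)"] th by simp
  qed
  \<comment> \<open>If the face met every constraint, minimality would make it equal to
    \<open>p\<close>. Then \<open>p\<close> would vanish at the positive part of \<theta> on \<pi>,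
    against \<open>high\<close>.\<close>
  have notK: "\<not> (\<forall>g\<in>W. 1 \<le> face p \<eta> (rel_dist d f g))"
  proof
    assume "\<forall>g\<in>W. 1 \<le> face p \<eta> (rel_dist d f g)"
    then have "face p \<eta> (\<lambda>s. - \<eta> s) = p (\<lambda>s. - \<eta> s)"
      using min sup_functional_face[OF p eta p_eta] face_le[OF p eta p_eta] Cuo_orth_neg[OF eta] by blast
    with face_vertex[OF p eta p_eta] have "p (\<lambda>s. \<pi> * pprt (\<theta> s)) \<le> 0" by (simp add: \<eta>_def[abs_def])
    moreover have "p (\<lambda>s. \<pi> * \<theta> s) \<le> p (\<lambda>s. \<pi> * pprt (\<theta> s))"
      by (rule sf_mono[OF p]) (use pi th self_le_pprt in \<open>auto intro: bp_mult_mono\<close>)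
    ultimately have "p (\<lambda>s. \<pi> * \<theta> s) \<le> 0" by (rule order_trans[rotated])
    then show False using high sf_bp_mult[OF p pi th] by simp
  qed
  then obtain g where g: "g \<in> W" "\<not> 1 \<le> face p \<eta> (rel_dist d f g)" by blast
  note N = rel_dist_Cuo[OF g(1)]
  \<comment> \<open>The face is an infimum over the penalty factors, so a constraint that fails for
    it already fails for some factor.\<close>
  have "\<exists>c\<ge>0. \<not> 1 \<le> p (\<lambda>s. rel_dist d f g s + c *\<^sub>R \<eta> s)"
  proof (rule ccontr)
    assume "\<not> ?thesis"
    then have "1 \<le> face p \<eta> (rel_dist d f g)" unfolding face_def by (intro cINF_greatest) auto
    then show False using g(2) by blast
  qed
  then obtain c where c: "0 \<le> c" "\<not> 1 \<le> p (\<lambda>s. rel_dist d f g s + c *\<^sub>R \<eta> s)" by blast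
  define \<chi> where "\<chi> s = rel_dist d f g s + c *\<^sub>R \<eta> s" for s
  have chi: "\<chi> \<in> Cuo_orth" unfolding \<chi>_def using N eta by simp
  have "\<not> 1 * 1 \<le> 1 * p \<chi>" using c(2) by (simp add: \<chi>_def[abs_def])
  then obtain \<rho> \<delta> where r: "\<rho> \<in> band_projections" "\<rho> \<noteq> 0" "(\<delta>::real) > 0" "\<rho> * p \<chi> + \<delta> *\<^sub>R \<rho> \<le> \<rho> * 1"
    by (rule not_le_orthE[OF bp_one])
  have le: "\<rho> * p \<chi> \<le> (1 - \<delta>) *\<^sub>R \<rho>" using r(4) by (simp add: scaleR_diff_left le_diff_eq)
  \<comment> \<open>Off \<pi> nothing has changed and the constraint on \<open>p\<close> holds;
    hence the violation lies below \<pi>.\<close>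
  have 1: "1 - \<pi> \<le> (1 - \<pi>) * p \<chi>"
  proof -
    note q = bp_compl[OF pi]
    have "(1 - \<pi>) * \<eta> s = 0" for s using bp_idem[OF pi] by (simp add: \<eta>_def left_diff_distrib flip: mult.assoc)
    then have "(\<lambda>s. (1 - \<pi>) * \<chi> s) = (\<lambda>s. (1 - \<pi>) * rel_dist d f g s)" by (simp add: \<chi>_def distrib_left)
    then have "(1 - \<pi>) * p \<chi> = (1 - \<pi>) * p (rel_dist d f g)" using sf_bp_mult[OF p q chi] sf_bp_mult[OF p q N] by simp
    then show ?thesis using bp_mult_mono[OF q p1[rule_format, OF g(1)]] by simp
  qed
  have r_pi: "\<rho> \<le> \<pi>" using bp_le_compl_of_bound[OF r(1) bp_compl[OF pi] le 1 r(3)] by simp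
  \<comment> \<open>Where \<open>d\<close> vanishes the ratio is 1 and the penalty contributes 0
    under \<open>p\<close>; hence the violation lies in the carrier of \<open>d\<close>.\<close>
  have 2: "annihilator d \<le> annihilator d * p \<chi>"
  proof -
    let ?n = "annihilator d"
    note n = annihilator_bp[of d]
    have "(\<lambda>s. ?n * \<chi> s) = (\<lambda>s. c *\<^sub>R (?n * \<eta> s) + ?n)"
      by (simp add: \<chi>_def distrib_left trunc_ratio_annihilator[OF d nrm_fg[OF g(1)]] add.commute)
    then have "?n * p \<chi> = p (\<lambda>s. c *\<^sub>R (?n * \<eta> s) + ?n)" using sf_bp_mult[OF p n chi] by simp
    also have "\<dots> = c *\<^sub>R (?n * p \<eta>) + ?n"
      using sf_add_const[OF p, of "\<lambda>s. c *\<^sub>R (?n * \<eta> s)" ?n] sf_scaleR[OF p c(1), of "\<lambda>s. ?n * \<eta> s"] sf_bp_mult[OF p n eta] n eta by simp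
    finally show ?thesis using p_eta by simp
  qed
  have r_n: "\<rho> \<le> 1 - annihilator d" by (rule bp_le_compl_of_bound[OF r(1) annihilator_bp le 2 r(3)])
  have "(\<lambda>s. \<rho> * \<chi> s) = (\<lambda>s. \<rho> * (rel_dist d f g s - c *\<^sub>R pprt (\<theta> s)))"
    by (simp add: \<chi>_def \<eta>_def algebra_simps bp_le_mult[OF pi r(1) r_pi])
  then have "\<rho> * p \<chi> = \<rho> * p (\<lambda>s. rel_dist d f g s - c *\<^sub>R pprt (\<theta> s))"
    using sf_bp_mult[OF p r(1) chi] sf_bp_mult[OF p r(1), of "\<lambda>s. rel_dist d f g s - c *\<^sub>R pprt (\<theta> s)"] N pt by simp
  then show ?thesis using that[OF g(1) c(1) r(1,2) r_pi r_n r(3)] le by simp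
qed

text \<open>After Machado and Ransford: if a multiplier were not constant on the set described by a
  minimal \<open>p\<close>, a convex combination of two competitors would beat \<open>d\<close> on a nonzero band.\<close>

lemma minimal_multiplier:
  assumes phi: "\<phi> \<in> multipliers scale nrm Xt W"
  shows "p (\<lambda>s. - \<phi> s) = - p \<phi>"
proof (rule ccontr)
  note m = multiplierD[OF W phi]
  have C: "\<phi> \<in> Cuo_orth" "(\<lambda>s. - \<phi> s) \<in> Cuo_orth" using m(1) by simp_all
  \<comment> \<open>\<alpha> and \<beta> are the minimum and the maximum of \<phi> on the set
    described by \<open>p\<close>; they are to be shown equal.\<close>
  define \<alpha> where "\<alpha> = - p (\<lambda>s. - \<phi> s)"
  define \<beta> where "\<beta> = p \<phi>"
  have \<alpha>0: "0 \<le> \<alpha>" using sf_le_const[OF p C(2), of 0] m(2) by (simp add: \<alpha>_def)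
  have \<beta>1: "\<beta> \<le> 1" using sf_le_const[OF p C(1), of 1] m(3) by (simp add: \<beta>_def)
  assume "p (\<lambda>s. - \<phi> s) \<noteq> - p \<phi>"
  then have "\<not> \<beta> \<le> \<alpha>" using sf_neg[OF p C(1)] unfolding \<alpha>_def \<beta>_def by (metis le_minus_iff order.antisym)
  then have "\<not> 1 * \<beta> \<le> 1 * \<alpha>" by simp
  then obtain \<rho>0 \<delta>0 where r0: "\<rho>0 \<in> band_projections" "\<rho>0 \<noteq> 0" "(\<delta>0::real) > 0" "\<rho>0 * \<alpha> + \<delta>0 *\<^sub>R \<rho>0 \<le> \<rho>0 * \<beta>"
    by (rule not_le_orthE[OF bp_one])
  have "\<delta>0 / 4 > 0" using r0(3) by simp
  then obtain \<pi> a where pi: "\<pi> \<in> band_projections" "\<pi> \<noteq> 0" "\<pi> \<le> \<rho>0" "\<pi> * \<bar>\<alpha> - a *\<^sub>R 1\<bar> \<le> (\<delta>0 / 4) *\<^sub>R \<pi>"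
    using orth_real_approx[OF r0(1,2)] by blast
  \<comment> \<open>On \<pi> one has \<alpha> \<le> a + 2 \<delta>0 / 8 and \<beta> \<ge> \<alpha> +
    \<delta>0 \<ge> a + 6 \<delta>0 / 8; the levels with 3/8 and 5/8 lie strictly between.\<close>
  define r where "r = a + 3 * \<delta>0 / 8"
  define t where "t = a + 5 * \<delta>0 / 8"
  have al: "\<pi> * \<alpha> \<le> (a + \<delta>0 / 4) *\<^sub>R \<pi>"
  proof -
    have "\<pi> * (\<alpha> - a *\<^sub>R 1) \<le> (\<delta>0 / 4) *\<^sub>R \<pi>"
      by (rule order_trans[OF bp_mult_mono[OF pi(1) abs_ge_self] pi(4)])
    then show ?thesis by (simp add: right_diff_distrib scaleR_add_left diff_le_eq add.commute)
  qed
  have be: "(a + 3 * \<delta>0 / 4) *\<^sub>R \<pi> \<le> \<pi> * \<beta>"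
  proof -
    have "\<pi> * - (\<alpha> - a *\<^sub>R 1) \<le> (\<delta>0 / 4) *\<^sub>R \<pi>"
      by (rule order_trans[OF bp_mult_mono[OF pi(1) abs_ge_minus_self] pi(4)])
    then have "a *\<^sub>R \<pi> \<le> \<pi> * \<alpha> + (\<delta>0 / 4) *\<^sub>R \<pi>" by (simp add: right_diff_distrib diff_le_eq add.commute)
    then have "a *\<^sub>R \<pi> + (3 * \<delta>0 / 4) *\<^sub>R \<pi> \<le> (\<pi> * \<alpha> + (\<delta>0 / 4) *\<^sub>R \<pi>) + (3 * \<delta>0 / 4) *\<^sub>R \<pi>" by (rule add_right_mono)
    also have "\<dots> = \<pi> * \<alpha> + \<delta>0 *\<^sub>R \<pi>" by (simp add: add.assoc flip: scaleR_add_left)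
    also have "\<dots> = \<pi> * (\<rho>0 * \<alpha> + \<delta>0 *\<^sub>R \<rho>0)" by (simp add: distrib_left bp_le_mult[OF r0(1) pi(1,3)])
    also have "\<dots> \<le> \<pi> * (\<rho>0 * \<beta>)" by (rule bp_mult_mono[OF pi(1) r0(4)])
    also have "\<dots> = \<pi> * \<beta>" by (rule bp_le_mult(3)[OF r0(1) pi(1,3)])
    finally show ?thesis by (simp add: scaleR_add_left)
  qed
  have "0 *\<^sub>R \<pi> \<le> \<pi> * \<alpha>" using mult_nonneg_nonneg[OF bp_nonneg[OF pi(1)] \<alpha>0] by simp
  then have "0 *\<^sub>R \<pi> \<le> (a + \<delta>0 / 4) *\<^sub>R \<pi>" using al by (rule order_trans)
  then have a0: "0 \<le> a + \<delta>0 / 4" by (rule bp_scaleR_le[OF pi(1,2)])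
  have "\<pi> * \<beta> \<le> 1 *\<^sub>R \<pi>" using bp_mult_mono[OF pi(1) \<beta>1] by simp
  with be have "(a + 3 * \<delta>0 / 4) *\<^sub>R \<pi> \<le> 1 *\<^sub>R \<pi>" by (rule order_trans)
  then have a1: "a + 3 * \<delta>0 / 4 \<le> 1" by (rule bp_scaleR_le[OF pi(1,2)])
  have rt: "0 < r" "r < t" "t < 1" using a0 a1 r0(3) by (auto simp: r_def t_def)
  have gap: "a + \<delta>0 / 4 < r" "t < a + 3 * \<delta>0 / 4" using r0(3) by (auto simp: r_def t_def)

  \<comment> \<open>Cut at \<phi> \<le> t. This is a nonempty and proper part, since \<alpha> \<le>
    t and \<beta> exceeds t on \<pi>.\<close>
  obtain g1 c1 \<rho>1 \<delta>1 where g1: "g1 \<in> W" "0 \<le> (c1::real)" "\<rho>1 \<in> band_projections" "\<rho>1 \<noteq> 0" "\<rho>1 \<le> \<pi>"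
    "\<rho>1 \<le> 1 - annihilator d" "0 < (\<delta>1::real)"
    "\<rho>1 * p (\<lambda>s. rel_dist d f g1 s - c1 *\<^sub>R pprt (\<phi> s - t *\<^sub>R 1)) \<le> (1 - \<delta>1) *\<^sub>R \<rho>1"
  proof (rule minimal_cut[OF pi(1), of "\<lambda>s. \<phi> s - t *\<^sub>R 1"])
    show "(\<lambda>s. \<phi> s - t *\<^sub>R 1) \<in> Cuo_orth" using C by simp
    have "p (\<lambda>s. - (\<phi> s - t *\<^sub>R 1)) = t *\<^sub>R 1 - \<alpha>"
      using sf_add_const[OF p C(2), of "t *\<^sub>R 1"] by (simp add: \<alpha>_def algebra_simps)
    moreover have "\<pi> * \<alpha> \<le> t *\<^sub>R \<pi>"
      by (rule order_trans[OF al scaleR_right_mono]) (use gap rt pi bp_nonneg in auto)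
    ultimately show "0 \<le> \<pi> * p (\<lambda>s. - (\<phi> s - t *\<^sub>R 1))" by (simp add: right_diff_distrib)
    have "p (\<lambda>s. \<phi> s - t *\<^sub>R 1) = \<beta> - t *\<^sub>R 1"
      using sf_add_const[OF p C(1), of "- (t *\<^sub>R 1)"] by (simp add: \<beta>_def)
    moreover have "\<not> \<pi> * \<beta> \<le> t *\<^sub>R \<pi>"
      using bp_scaleR_le[OF pi(1,2), of "a + 3 * \<delta>0 / 4" t] be gap by (meson leD order_trans)
    ultimately show "\<not> \<pi> * p (\<lambda>s. \<phi> s - t *\<^sub>R 1) \<le> 0" by (simp add: right_diff_distrib)
  qed blast
  have al1: "\<rho>1 * \<alpha> \<le> (a + \<delta>0 / 4) *\<^sub>R \<rho>1" and be1: "(a + 3 * \<delta>0 / 4) *\<^sub>R \<rho>1 \<le> \<rho>1 * \<beta>"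
    using bp_mult_mono[OF g1(3) al] bp_mult_mono[OF g1(3) be] by (simp_all add: bp_le_mult[OF pi(1) g1(3,5)])
  \<comment> \<open>Cut at \<phi> \<ge> r, now inside \<open>\<rho>1\<close> instead of \<pi>, so
    that both competitors win on one common nonzero band.\<close>
  obtain g2 c2 \<rho>2 \<delta>2 where g2: "g2 \<in> W" "0 \<le> (c2::real)" "\<rho>2 \<in> band_projections" "\<rho>2 \<noteq> 0" "\<rho>2 \<le> \<rho>1"
    "\<rho>2 \<le> 1 - annihilator d" "0 < (\<delta>2::real)"
    "\<rho>2 * p (\<lambda>s. rel_dist d f g2 s - c2 *\<^sub>R pprt (- \<phi> s + r *\<^sub>R 1)) \<le> (1 - \<delta>2) *\<^sub>R \<rho>2"
  proof (rule minimal_cut[OF g1(3), of "\<lambda>s. - \<phi> s + r *\<^sub>R 1"])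
    show "(\<lambda>s. - \<phi> s + r *\<^sub>R 1) \<in> Cuo_orth" by (rule Cuo_orth_add[OF C(2) Cuo_orth_const])
    have "p (\<lambda>s. - (- \<phi> s + r *\<^sub>R 1)) = \<beta> - r *\<^sub>R 1"
      using sf_add_const[OF p C(1), of "- (r *\<^sub>R 1)"] by (simp add: \<beta>_def)
    moreover have "r *\<^sub>R \<rho>1 \<le> \<rho>1 * \<beta>"
      by (rule order_trans[OF scaleR_right_mono be1]) (use gap rt g1 bp_nonneg in auto)
    ultimately show "0 \<le> \<rho>1 * p (\<lambda>s. - (- \<phi> s + r *\<^sub>R 1))" by (simp add: right_diff_distrib)
    have "p (\<lambda>s. - \<phi> s + r *\<^sub>R 1) = r *\<^sub>R 1 - \<alpha>"
      using sf_add_const[OF p C(2), of "r *\<^sub>R 1"] by (simp add: \<alpha>_def)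
    moreover have "\<not> r *\<^sub>R \<rho>1 \<le> \<rho>1 * \<alpha>"
      using bp_scaleR_le[OF g1(3,4), of r "a + \<delta>0 / 4"] al1 gap by (meson leD order_trans)
    ultimately show "\<not> \<rho>1 * p (\<lambda>s. - \<phi> s + r *\<^sub>R 1) \<le> 0" by (simp add: right_diff_distrib)
  qed blast
  define \<delta> where "\<delta> = min (min \<delta>1 \<delta>2) 1"
  have del: "0 < \<delta>" "\<delta> \<le> \<delta>1" "\<delta> \<le> \<delta>2" "\<delta> \<le> 1" using g1(7) g2(7) by (auto simp: \<delta>_def)
  \<comment> \<open>Where \<phi> \<le> t the penalty in \<open>A\<close> vanishes and
    \<open>A\<close> is the relative distance to \<open>g1\<close>; the same holds for
    \<open>B\<close> and \<open>g2\<close> where \<phi> \<ge> r.\<close>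
  define A where "A s = rel_dist d f g1 s - c1 *\<^sub>R pprt (\<phi> s - t *\<^sub>R 1)" for s
  define B where "B s = rel_dist d f g2 s - c2 *\<^sub>R pprt (- \<phi> s + r *\<^sub>R 1)" for s
  have AC: "A \<in> Cuo_orth" unfolding A_def
    by (intro Cuo_orth_diff rel_dist_Cuo g1(1) Cuo_orth_scaleR Cuo_orth_pprt C(1) Cuo_orth_const)
  have BC: "B \<in> Cuo_orth" unfolding B_def
    by (intro Cuo_orth_diff rel_dist_Cuo g2(1) Cuo_orth_scaleR Cuo_orth_pprt Cuo_orth_add C(2) Cuo_orth_const)

  obtain e where e: "\<And>s. nrm (f s) \<le> e" using Cuo_bounded[OF f] by blast
  obtain e1 where e1: "\<And>s. nrm (g1 s) \<le> e1" "0 \<le> e1" using Cuo_bounded W g1(1) by blast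
  obtain e2 where e2: "\<And>s. nrm (g2 s) \<le> e2" "0 \<le> e2" using Cuo_bounded W g2(1) by blast
  define c where "c = e + (e1 + e2)"
  have g1X: "g1 s \<in> Xt" and g2X: "g2 s \<in> Xt" and fX: "f s \<in> Xt" for s
    using Cuo_in W g1(1) g2(1) f by blast+
  have c1: "nrm (f s - g1 s) \<le> c" for s
    unfolding c_def by (rule order_trans[OF nrm_triangle_diff[OF fX g1X] add_mono[OF e add_increasing2[OF e2(2) e1(1)]]])
  have c2: "nrm (f s - g2 s) \<le> c" for s
    unfolding c_def by (rule order_trans[OF nrm_triangle_diff[OF fX g2X] add_mono[OF e add_increasing[OF e1(2) e2(1)]]])
  \<comment> \<open>Beyond its own cut a competitor is only known to be within \<open>c\<close> of
    \<open>f\<close>. Shrinking the band turns this into a multiple of \<open>d\<close>.\<close>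
  obtain \<rho> k where r: "\<rho> \<in> band_projections" "\<rho> \<noteq> 0" "\<rho> \<le> \<rho>2" "(k::real) > 0" "\<rho> \<bullet> c \<le> k *\<^sub>R (\<rho> \<bullet> d)"
    by (rule locally_dominated[OF g2(3,4,6) d])
  have r_n: "\<rho> \<le> 1 - annihilator d" by (rule order_trans[OF r(3) g2(6)])
  have r_1: "\<rho> \<le> \<rho>1" by (rule order_trans[OF r(3) g2(5)])
  have pA: "\<rho> * p A \<le> (1 - \<delta>) *\<^sub>R \<rho>"
  proof -
    have "\<rho> * (\<rho>1 * p A) \<le> \<rho> * ((1 - \<delta>1) *\<^sub>R \<rho>1)" using bp_mult_mono[OF r(1) g1(8)] by (simp only: A_def[abs_def])
    then have "\<rho> * p A \<le> (1 - \<delta>1) *\<^sub>R \<rho>" by (simp add: bp_le_mult[OF g1(3) r(1) r_1])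
    also have "\<dots> \<le> (1 - \<delta>) *\<^sub>R \<rho>" by (rule scaleR_right_mono) (use del bp_nonneg[OF r(1)] in auto)
    finally show ?thesis .
  qed
  have pB: "\<rho> * p B \<le> (1 - \<delta>) *\<^sub>R \<rho>"
  proof -
    have "\<rho> * (\<rho>2 * p B) \<le> \<rho> * ((1 - \<delta>2) *\<^sub>R \<rho>2)" using bp_mult_mono[OF r(1) g2(8)] by (simp only: B_def[abs_def])
    then have "\<rho> * p B \<le> (1 - \<delta>2) *\<^sub>R \<rho>" by (simp add: bp_le_mult[OF g2(3) r(1,3)])
    also have "\<dots> \<le> (1 - \<delta>) *\<^sub>R \<rho>" by (rule scaleR_right_mono) (use del bp_nonneg[OF r(1)] in auto)
    finally show ?thesis .
  qed

  \<comment> \<open>The wrong competitor will have weight at most \<eta> and distance at most k d,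
    so it contributes at most \<eta> k d = (\<delta> / 4) d.\<close>
  define \<eta> where "\<eta> = \<delta> / (4 * k)"
  have eta: "0 < \<eta>" "\<eta> * k = \<delta> / 4" using del r(4) by (auto simp: \<eta>_def)
  obtain n l where nl: "1 - \<eta> \<le> (1 - r ^ n) ^ l" "(1 - t ^ n) ^ l \<le> \<eta>" "n > 0"
    by (rule jewett_polynomial[OF rt eta(1)])
  \<comment> \<open>\<psi> is at least 1 - \<eta> where \<phi> \<le> r and at most \<eta> where
    \<phi> \<ge> t, so it selects \<open>g1\<close> below and \<open>g2\<close> above.\<close>
  define \<psi> where "\<psi> s = (1 - \<phi> s ^ n) ^ l" for s
  have psiM: "\<psi> \<in> multipliers scale nrm Xt W" unfolding \<psi>_def
    by (intro multiplier_power multiplier_compl W phi)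
  note psi = multiplierD[OF W psiM]
  define h where "h s = act (\<psi> s) (g1 s) + act (1 - \<psi> s) (g2 s)" for s
  have hW: "h \<in> W" unfolding h_def by (rule psi(4)[OF g1(1) g2(1)])
  note N = rel_dist_Cuo[OF hW]
  \<comment> \<open>The amount by which \<open>A\<close> or \<open>B\<close> exceeds 1 - \<delta>.
    On \<rho> it is invisible to \<open>p\<close>, so pointwise estimates may contain it as an error
    term.\<close>
  define Z where "Z s = sup (sup (A s - (1 - \<delta>) *\<^sub>R 1) (B s - (1 - \<delta>) *\<^sub>R 1)) 0" for s
  have ZC: "Z \<in> Cuo_orth" unfolding Z_def using AC BC by simp
  have pZ: "\<rho> * p Z = 0"
  proof -
    have "p (\<lambda>s. A s + - ((1 - \<delta>) *\<^sub>R 1)) = p A - (1 - \<delta>) *\<^sub>R 1" "p (\<lambda>s. B s + - ((1 - \<delta>) *\<^sub>R 1)) = p B - (1 - \<delta>) *\<^sub>R 1"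
      using sf_add_const[OF p AC, of "- ((1 - \<delta>) *\<^sub>R 1)"] sf_add_const[OF p BC, of "- ((1 - \<delta>) *\<^sub>R 1)"] by simp_all
    moreover have "p Z = sup (p (\<lambda>s. sup (A s + - ((1 - \<delta>) *\<^sub>R 1)) (B s + - ((1 - \<delta>) *\<^sub>R 1)))) 0"
      using sf_sup[OF p, of "\<lambda>s. sup (A s - (1 - \<delta>) *\<^sub>R 1) (B s - (1 - \<delta>) *\<^sub>R 1)" "\<lambda>s. 0"] AC BC
      by (simp add: Z_def[abs_def] sf_zero[OF p])
    moreover have "p (\<lambda>s. sup (A s + - ((1 - \<delta>) *\<^sub>R 1)) (B s + - ((1 - \<delta>) *\<^sub>R 1)))
      = sup (p (\<lambda>s. A s + - ((1 - \<delta>) *\<^sub>R 1))) (p (\<lambda>s. B s + - ((1 - \<delta>) *\<^sub>R 1)))"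
      by (rule sf_sup[OF p]) (use AC BC in simp_all)
    ultimately have "p Z = sup (sup (p A - (1 - \<delta>) *\<^sub>R 1) (p B - (1 - \<delta>) *\<^sub>R 1)) 0" by simp
    then have "\<rho> * p Z = sup (sup (\<rho> * p A - (1 - \<delta>) *\<^sub>R \<rho>) (\<rho> * p B - (1 - \<delta>) *\<^sub>R \<rho>)) 0"
      by (simp only: bp_sup_mult[OF r(1)] right_diff_distrib mult_scaleR_right mult_1_right mult_zero_right)
    also have "\<dots> = 0" using pA pB by (intro sup_absorb2 sup_least) simp_all
    finally show ?thesis .
  qed

  have point: "\<rho> * rel_dist d f h s \<le> \<rho> * (Z s + (1 - \<delta> / 4) *\<^sub>R 1)" for s
  proof (rule local_le_orth[OF r(1)])
    fix \<tau>0 assume t0: "\<tau>0 \<in> band_projections" "\<tau>0 \<noteq> 0" "\<tau>0 \<le> \<rho>"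
    define goal where "goal \<tau> \<longleftrightarrow> \<tau> * rel_dist d f h s \<le> \<tau> * (Z s + (1 - \<delta> / 4) *\<^sub>R 1)" for \<tau>
    have Z0: "0 \<le> Z s" by (simp add: Z_def)
    have small: "goal \<tau>"
      if tau: "\<tau> \<in> band_projections" "\<tau> \<le> \<rho>" and le: "\<tau> \<bullet> nrm (f s - h s) \<le> (1 - \<delta> / 4) *\<^sub>R (\<tau> \<bullet> d)" for \<tau>
    proof -
      have "\<tau> * rel_dist d f h s \<le> (1 - \<delta> / 4) *\<^sub>R \<tau>"
        by (rule trunc_ratio_leI[OF d nrm_fg[OF hW] tau(1) order_trans[OF tau(2) r_n] le])
      also have "\<dots> \<le> \<tau> * Z s + (1 - \<delta> / 4) *\<^sub>R \<tau>"
        by (rule add_increasing[OF mult_nonneg_nonneg[OF bp_nonneg[OF tau(1)] Z0] order_refl])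
      finally show ?thesis by (simp add: goal_def distrib_left)
    qed
    have "\<exists>\<tau>\<in>band_projections. \<tau> \<noteq> 0 \<and> \<tau> \<le> \<tau>0 \<and> goal \<tau>"
    proof (rule bp_cases_orth[OF t0(1,2), of "(\<delta> / 2) *\<^sub>R 1" "Z s"])
      \<comment> \<open>Where the error term is at least \<delta> / 2, the trivial bound 1 for the
        ratio is enough: 1 \<le> \<delta> / 2 + 1 - \<delta> / 4.\<close>
      fix \<tau> assume t: "\<tau> \<in> band_projections" "\<tau> \<noteq> 0" "\<tau> \<le> \<tau>0" "\<tau> * (\<delta> / 2) *\<^sub>R 1 \<le> \<tau> * Z s"
      note tn = bp_nonneg[OF t(1)]
      have "\<tau> * rel_dist d f h s \<le> 1 *\<^sub>R \<tau>" using bp_mult_mono[OF t(1) trunc_ratio_le_one[OF d nrm_fg[OF hW, of s]]] by simp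
      also have "\<dots> \<le> (\<delta> / 2 + (1 - \<delta> / 4)) *\<^sub>R \<tau>" by (rule scaleR_right_mono[OF _ tn]) (use del in simp)
      also have "\<dots> = \<tau> * (\<delta> / 2) *\<^sub>R 1 + (1 - \<delta> / 4) *\<^sub>R \<tau>" by (simp only: scaleR_add_left mult_scaleR_right mult_1_right)
      also have "\<dots> \<le> \<tau> * Z s + (1 - \<delta> / 4) *\<^sub>R \<tau>" by (rule add_right_mono[OF t(4)])
      finally have "goal \<tau>" by (simp only: goal_def distrib_left mult_scaleR_right mult_1_right)
      then show ?thesis using t by blast
    next
      fix \<tau>1 assume t1: "\<tau>1 \<in> band_projections" "\<tau>1 \<noteq> 0" "\<tau>1 \<le> \<tau>0" "\<tau>1 * Z s \<le> \<tau>1 * (\<delta> / 2) *\<^sub>R 1"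
      \<comment> \<open>Where the error term is at most \<delta> / 2, a competitor without penalty
        has ratio at most \<delta> / 2 + (1 - \<delta>) = \<kappa>. The remaining gap up to 1 -
        \<delta> / 4 is what the wrong competitor may use.\<close>
      define \<kappa> where "\<kappa> = 1 - \<delta> / 2"
      have kap: "0 \<le> \<kappa>" "\<kappa> < 1" "\<kappa> + \<eta> * k = 1 - \<delta> / 4" "\<delta> / 2 + (1 - \<delta>) = \<kappa>" using del eta(2) by (auto simp: \<kappa>_def)
      let ?v1 = "nrm (f s - g1 s)" and ?v2 = "nrm (f s - g2 s)"
      have conv: "nrm (f s - h s) \<le> \<psi> s \<bullet> ?v1 + (1 - \<psi> s) \<bullet> ?v2"
        unfolding h_def by (rule nrm_convex_combination[OF fX g1X g2X psi(2,3)])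
      have psi01: "0 \<le> \<psi> s" "0 \<le> 1 - \<psi> s" "\<psi> s \<le> 1" "1 - \<psi> s \<le> 1" using psi(2,3) by auto
      have close1: "\<tau> \<bullet> ?v1 \<le> \<kappa> *\<^sub>R (\<tau> \<bullet> d)"
        if tau: "\<tau> \<in> band_projections" "\<tau> \<le> \<tau>1" and le: "\<tau> * \<phi> s \<le> \<tau> * (t *\<^sub>R 1)" for \<tau>
      proof -
        have "\<tau> * (\<phi> s - t *\<^sub>R 1) \<le> 0" using le by (simp add: right_diff_distrib)
        then have "\<tau> * pprt (\<phi> s - t *\<^sub>R 1) = 0" by (simp only: bp_pprt_mult[OF tau(1)] pprt_eq_0)
        then have "\<tau> * rel_dist d f g1 s = \<tau> * A s" by (simp add: A_def right_diff_distrib)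
        also have "\<dots> \<le> \<tau> * (Z s + (1 - \<delta>) *\<^sub>R 1)"
        proof (rule bp_mult_mono[OF tau(1)])
          have "A s - (1 - \<delta>) *\<^sub>R 1 \<le> Z s" unfolding Z_def by (simp add: le_supI1)
          then show "A s \<le> Z s + (1 - \<delta>) *\<^sub>R 1" by (simp only: diff_le_eq)
        qed
        also have "\<dots> = \<tau> * Z s + (1 - \<delta>) *\<^sub>R \<tau>" by (simp add: distrib_left)
        also have "\<dots> \<le> (\<delta> / 2) *\<^sub>R \<tau> + (1 - \<delta>) *\<^sub>R \<tau>"
          using bp_down_orth[OF t1(1) tau t1(4)] by (intro add_right_mono) simp
        also have "\<dots> = \<kappa> *\<^sub>R \<tau>" by (simp only: kap(4) flip: scaleR_add_left)
        finally have "\<tau> * rel_dist d f g1 s \<le> \<kappa> *\<^sub>R \<tau>" .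
        moreover have "\<tau> \<le> 1 - annihilator d" using tau(2) t1(3) t0(3) r_n by (meson order_trans)
        ultimately show ?thesis using kap by (intro trunc_ratio_leD[OF d nrm_fg[OF g1(1)] tau(1)])
      qed
      have close2: "\<tau> \<bullet> ?v2 \<le> \<kappa> *\<^sub>R (\<tau> \<bullet> d)"
        if tau: "\<tau> \<in> band_projections" "\<tau> \<le> \<tau>1" and le: "\<tau> * (r *\<^sub>R 1) \<le> \<tau> * \<phi> s" for \<tau>
      proof -
        have "\<tau> * (- \<phi> s + r *\<^sub>R 1) \<le> 0" using le by (simp add: algebra_simps)
        then have "\<tau> * pprt (- \<phi> s + r *\<^sub>R 1) = 0" by (simp only: bp_pprt_mult[OF tau(1)] pprt_eq_0)
        then have "\<tau> * rel_dist d f g2 s = \<tau> * B s" by (simp add: B_def right_diff_distrib)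
        also have "\<dots> \<le> \<tau> * (Z s + (1 - \<delta>) *\<^sub>R 1)"
        proof (rule bp_mult_mono[OF tau(1)])
          have "B s - (1 - \<delta>) *\<^sub>R 1 \<le> Z s" unfolding Z_def by (simp add: le_supI1)
          then show "B s \<le> Z s + (1 - \<delta>) *\<^sub>R 1" by (simp only: diff_le_eq)
        qed
        also have "\<dots> = \<tau> * Z s + (1 - \<delta>) *\<^sub>R \<tau>" by (simp add: distrib_left)
        also have "\<dots> \<le> (\<delta> / 2) *\<^sub>R \<tau> + (1 - \<delta>) *\<^sub>R \<tau>"
          using bp_down_orth[OF t1(1) tau t1(4)] by (intro add_right_mono) simp
        also have "\<dots> = \<kappa> *\<^sub>R \<tau>" by (simp only: kap(4) flip: scaleR_add_left)
        finally have "\<tau> * rel_dist d f g2 s \<le> \<kappa> *\<^sub>R \<tau>" .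
        moreover have "\<tau> \<le> 1 - annihilator d" using tau(2) t1(3) t0(3) r_n by (meson order_trans)
        ultimately show ?thesis using kap by (intro trunc_ratio_leD[OF d nrm_fg[OF g2(1)] tau(1)])
      qed
      \<comment> \<open>Contributions to the convex combination: a good competitor is controlled by
        \<kappa> times its weight (\<open>near\<close>), the other one by its small weight and the
        crude bound (\<open>far\<close>).\<close>
      have near: "\<tau> \<bullet> b \<bullet> v \<le> \<kappa> *\<^sub>R (b \<bullet> \<tau> \<bullet> d)"
        if tau: "\<tau> \<in> band_projections" and b: "0 \<le> b" and v: "\<tau> \<bullet> v \<le> \<kappa> *\<^sub>R (\<tau> \<bullet> d)" for \<tau> b v
        using orth_mono[OF b v] bp_commute_apply[OF tau, of b v] by simp
      have far: "\<tau> \<bullet> b \<bullet> v \<le> (\<eta> * k) *\<^sub>R (\<tau> \<bullet> d)"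
        if tau: "\<tau> \<in> band_projections" "\<tau> \<le> \<tau>1" and b: "\<tau> * b \<le> \<eta> *\<^sub>R \<tau>" and v: "0 \<le> v" "v \<le> c" for \<tau> b v
      proof -
        have tr: "\<tau> \<le> \<rho>" using tau(2) t1(3) t0(3) by (meson order_trans)
        have "\<tau> \<bullet> b \<bullet> v \<le> \<eta> *\<^sub>R (\<tau> \<bullet> v)" using orth_leD[OF b v(1)] by simp
        also have "\<dots> \<le> \<eta> *\<^sub>R (\<tau> \<bullet> c)" using eta(1) by (intro scaleR_left_mono bp_mono[OF tau(1) v(2)]) simp
        also have "\<tau> \<bullet> c \<le> k *\<^sub>R (\<tau> \<bullet> d)" using bp_mono[OF tau(1) r(5)] bp_le_apply[OF r(1) tau(1) tr] by simp
        then have "\<eta> *\<^sub>R (\<tau> \<bullet> c) \<le> \<eta> *\<^sub>R (k *\<^sub>R (\<tau> \<bullet> d))" using eta(1) by (intro scaleR_left_mono) auto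
        finally show ?thesis by simp
      qed
      have td: "0 \<le> \<tau> \<bullet> d" if "\<tau> \<in> band_projections" for \<tau> by (rule bp_pos[OF that d])
      have contract: "\<kappa> *\<^sub>R (b \<bullet> \<tau> \<bullet> d) \<le> \<kappa> *\<^sub>R (\<tau> \<bullet> d)"
        if "\<tau> \<in> band_projections" "b \<le> 1" for \<tau> b
        using orth_leD[OF that(2) td[OF that(1)]] kap(1) by (intro scaleR_left_mono) simp_all
      have concl: "\<exists>\<tau>\<in>band_projections. \<tau> \<noteq> 0 \<and> \<tau> \<le> \<tau>0 \<and> goal \<tau>"
        if tau: "\<tau> \<in> band_projections" "\<tau> \<noteq> 0" "\<tau> \<le> \<tau>1"
          and le: "\<tau> \<bullet> \<psi> s \<bullet> ?v1 + \<tau> \<bullet> (1 - \<psi> s) \<bullet> ?v2 \<le> (1 - \<delta> / 4) *\<^sub>R (\<tau> \<bullet> d)" for \<tau>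
      proof -
        have "\<tau> \<bullet> nrm (f s - h s) \<le> (1 - \<delta> / 4) *\<^sub>R (\<tau> \<bullet> d)"
          using bp_mono[OF tau(1) conv] le by (simp only: orth_apply_simps(2))
        then have "goal \<tau>" using tau t1(3) t0(3) by (intro small) (auto intro: order_trans)
        then show ?thesis using tau t1(3) order_trans by blast
      qed
      show ?thesis
      proof (rule bp_cases_orth[OF t1(1,2), of "t *\<^sub>R 1" "\<phi> s"])
        \<comment> \<open>\<phi> \<ge> t: \<open>g2\<close> is good, and \<psi> \<le> \<eta> limits
          the share of \<open>g1\<close>.\<close>
        fix \<tau> assume t: "\<tau> \<in> band_projections" "\<tau> \<noteq> 0" "\<tau> \<le> \<tau>1" "\<tau> * t *\<^sub>R 1 \<le> \<tau> * \<phi> s"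
        note tn = bp_nonneg[OF t(1)]
        have "\<tau> * (r *\<^sub>R 1) \<le> \<tau> * (t *\<^sub>R 1)" using scaleR_right_mono[OF less_imp_le[OF rt(2)] tn] by simp
        then have "\<tau> * (r *\<^sub>R 1) \<le> \<tau> * \<phi> s" using t(4) by (rule order_trans)
        then have v2: "\<tau> \<bullet> ?v2 \<le> \<kappa> *\<^sub>R (\<tau> \<bullet> d)" by (rule close2[OF t(1,3)])
        have "t ^ n *\<^sub>R \<tau> \<le> \<tau> * \<phi> s ^ n" by (rule bp_power_ge[OF t(1) m(2)]) (use t(4) rt in auto)
        then have "\<tau> * (1 - \<phi> s ^ n) \<le> (1 - t ^ n) *\<^sub>R \<tau>" by (simp add: algebra_simps)
        moreover have "0 \<le> 1 - \<phi> s ^ n"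
          using multiplierD(3)[OF W multiplier_power[OF W phi], of s n] by simp
        ultimately have "\<tau> * \<psi> s \<le> (1 - t ^ n) ^ l *\<^sub>R \<tau>"
          unfolding \<psi>_def by (intro bp_power_le[OF t(1)]) (use rt in \<open>auto intro: power_le_one\<close>)
        also have "\<dots> \<le> \<eta> *\<^sub>R \<tau>" by (rule scaleR_right_mono[OF nl(2) tn])
        finally have b: "\<tau> * \<psi> s \<le> \<eta> *\<^sub>R \<tau>" .
        have "\<tau> \<bullet> \<psi> s \<bullet> ?v1 + \<tau> \<bullet> (1 - \<psi> s) \<bullet> ?v2 \<le> (\<eta> * k) *\<^sub>R (\<tau> \<bullet> d) + \<kappa> *\<^sub>R (\<tau> \<bullet> d)"
          by (intro add_mono far[OF t(1,3) b nrm_fg[OF g1(1)] c1] order_trans[OF near[OF t(1) psi01(2) v2] contract[OF t(1) psi01(4)]])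
        also have "\<dots> = (1 - \<delta> / 4) *\<^sub>R (\<tau> \<bullet> d)" unfolding kap(3)[symmetric] by (simp add: scaleR_add_left add.commute)
        finally show ?thesis by (rule concl[OF t(1-3)])
      next
        fix \<tau>2 assume t2: "\<tau>2 \<in> band_projections" "\<tau>2 \<noteq> 0" "\<tau>2 \<le> \<tau>1" "\<tau>2 * \<phi> s \<le> \<tau>2 * t *\<^sub>R 1"
        show ?thesis
        proof (rule bp_cases_orth[OF t2(1,2), of "r *\<^sub>R 1" "\<phi> s"])
          \<comment> \<open>r \<le> \<phi> \<le> t: both competitors are good, so the weights do not
            matter.\<close>
          fix \<tau> assume t: "\<tau> \<in> band_projections" "\<tau> \<noteq> 0" "\<tau> \<le> \<tau>2" "\<tau> * r *\<^sub>R 1 \<le> \<tau> * \<phi> s"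
          have t_1: "\<tau> \<le> \<tau>1" using t(3) t2(3) by (rule order_trans)
          have v1: "\<tau> \<bullet> ?v1 \<le> \<kappa> *\<^sub>R (\<tau> \<bullet> d)" by (rule close1[OF t(1) t_1 bp_down_orth[OF t2(1) t(1,3) t2(4)]])
          have v2: "\<tau> \<bullet> ?v2 \<le> \<kappa> *\<^sub>R (\<tau> \<bullet> d)" by (rule close2[OF t(1) t_1 t(4)])
          have "\<tau> \<bullet> \<psi> s \<bullet> ?v1 + \<tau> \<bullet> (1 - \<psi> s) \<bullet> ?v2 \<le> \<kappa> *\<^sub>R (\<psi> s \<bullet> \<tau> \<bullet> d) + \<kappa> *\<^sub>R ((1 - \<psi> s) \<bullet> \<tau> \<bullet> d)"
            by (intro add_mono near t(1) psi01 v1 v2)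
          also have "\<dots> = \<kappa> *\<^sub>R (\<tau> \<bullet> d)" by (simp add: algebra_simps)
          also have "\<dots> \<le> (1 - \<delta> / 4) *\<^sub>R (\<tau> \<bullet> d)" by (rule scaleR_right_mono[OF _ td[OF t(1)]]) (use del in \<open>simp add: \<kappa>_def\<close>)
          finally show ?thesis by (rule concl[OF t(1,2) t_1])
        next
          \<comment> \<open>\<phi> \<le> r: \<open>g1\<close> is good, and 1 - \<psi> \<le> \<eta>
            limits the share of \<open>g2\<close>.\<close>
          fix \<tau> assume t: "\<tau> \<in> band_projections" "\<tau> \<noteq> 0" "\<tau> \<le> \<tau>2" "\<tau> * \<phi> s \<le> \<tau> * r *\<^sub>R 1"
          note tn = bp_nonneg[OF t(1)]
          have t_1: "\<tau> \<le> \<tau>1" using t(3) t2(3) by (rule order_trans)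
          have v1: "\<tau> \<bullet> ?v1 \<le> \<kappa> *\<^sub>R (\<tau> \<bullet> d)" by (rule close1[OF t(1) t_1 bp_down_orth[OF t2(1) t(1,3) t2(4)]])
          have "\<tau> * \<phi> s ^ n \<le> r ^ n *\<^sub>R \<tau>" by (rule bp_power_le[OF t(1) m(2)]) (use t(4) rt in auto)
          then have "(1 - r ^ n) *\<^sub>R \<tau> \<le> \<tau> * (1 - \<phi> s ^ n)" by (simp add: algebra_simps)
          moreover have "0 \<le> 1 - \<phi> s ^ n"
            using multiplierD(3)[OF W multiplier_power[OF W phi], of s n] by simp
          ultimately have "(1 - r ^ n) ^ l *\<^sub>R \<tau> \<le> \<tau> * \<psi> s"
            unfolding \<psi>_def by (intro bp_power_ge[OF t(1)]) (use rt in \<open>auto intro: power_le_one\<close>)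
          moreover have "(1 - \<eta>) *\<^sub>R \<tau> \<le> (1 - r ^ n) ^ l *\<^sub>R \<tau>" by (rule scaleR_right_mono[OF nl(1) tn])
          ultimately have "(1 - \<eta>) *\<^sub>R \<tau> \<le> \<tau> * \<psi> s" by (rule order_trans[rotated])
          then have b: "\<tau> * (1 - \<psi> s) \<le> \<eta> *\<^sub>R \<tau>" by (simp add: algebra_simps)
          have "\<tau> \<bullet> \<psi> s \<bullet> ?v1 + \<tau> \<bullet> (1 - \<psi> s) \<bullet> ?v2 \<le> \<kappa> *\<^sub>R (\<tau> \<bullet> d) + (\<eta> * k) *\<^sub>R (\<tau> \<bullet> d)"
            by (intro add_mono far[OF t(1) t_1 b nrm_fg[OF g2(1)] c2] order_trans[OF near[OF t(1) psi01(1) v1] contract[OF t(1) psi01(3)]])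
          also have "\<dots> = (1 - \<delta> / 4) *\<^sub>R (\<tau> \<bullet> d)" unfolding kap(3)[symmetric] by (simp add: scaleR_add_left)
          finally show ?thesis by (rule concl[OF t(1,2) t_1])
        qed
      qed
    qed
    then show "\<exists>\<rho>'\<in>band_projections. \<rho>' \<noteq> 0 \<and> \<rho>' \<le> \<tau>0 \<and>
        \<rho>' * rel_dist d f h s \<le> \<rho>' * (Z s + (1 - \<delta> / 4) *\<^sub>R 1)" unfolding goal_def .
  qed
  have "1 *\<^sub>R \<rho> \<le> \<rho> * p (rel_dist d f h)" using bp_mult_mono[OF r(1) p1[rule_format, OF hW]] by simp
  also have "\<dots> = p (\<lambda>s. \<rho> * rel_dist d f h s)" by (rule sf_bp_mult[OF p r(1) N, symmetric])
  also have "\<dots> \<le> p (\<lambda>s. \<rho> * (Z s + (1 - \<delta> / 4) *\<^sub>R 1))"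
    by (rule sf_mono[OF p _ _ point]) (use N ZC r(1) in auto)
  also have "\<dots> = \<rho> * (p Z + (1 - \<delta> / 4) *\<^sub>R 1)"
    using sf_bp_mult[OF p r(1), of "\<lambda>s. Z s + (1 - \<delta> / 4) *\<^sub>R 1"] sf_add_const[OF p ZC] ZC by simp
  also have "\<dots> = (1 - \<delta> / 4) *\<^sub>R \<rho>" by (simp add: distrib_left pZ)
  \<comment> \<open>The constraint at \<open>h\<close> and the pointwise estimate contradict each
    other on the nonzero \<rho>, because \<open>Z\<close> contributes 0.\<close>
  finally have "1 \<le> 1 - \<delta> / 4" by (rule bp_scaleR_le[OF r(1,2)])
  then show False using del by simp
qed

end

end

section \<open>The minimal functional as a point of \<Sigma>, and the distance formula\<close>

theorem theorem3p12:
  fixes scale :: "'k::real_normed_field \<Rightarrow> 'x::ab_group_add \<Rightarrow> 'x"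
    and nrm :: "'x \<Rightarrow> 'e::dedekind_complete_vector_lattice"
    and X Xt :: "'x set"
    and W :: "('s::{uniform_space, t2_space} \<Rightarrow> 'x) set"
    and f :: "'s \<Rightarrow> 'x"
  assumes "compact (UNIV :: 's set)"
    and "lattice_normed_space scale nrm X"
    and "norm_completion scale nrm X Xt"
    and "W \<subseteq> Cuo nrm X" and "W \<noteq> {}"
    and "separates_Sigma (multipliers scale nrm Xt W)"
    and "f \<in> Cuo nrm X"
  shows "\<exists>\<sigma>\<in>Sigma_extreme.
    (INF g\<in>W. Cuo_norm nrm (\<lambda>s. f s - g s)) =
    (INF x\<in>{value_at scale nrm Xt g \<sigma> | g. g \<in> W}. nrm (value_at scale nrm Xt f \<sigma> - x))"
proof -
  note cpt = assms(1) and W = assms(4) and ne = assms(5) and sep = assms(6) and f = assms(7)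
  interpret norm_completion_bk scale nrm Xt X
    using assms(3) by unfold_locales (auto simp: norm_completion_def)
  define d where "d = (INF g\<in>W. Cuo_norm nrm (\<lambda>s. f s - g s))"
  have nn: "0 \<le> Cuo_norm nrm (\<lambda>s. f s - g s)" if "g \<in> W" for g
  proof -
    have g: "g \<in> Cuo nrm X" using W that by blast
    have "0 \<le> nrm (f undefined - g undefined)" using Cuo_in[OF f] Cuo_in[OF g] by simp
    then show ?thesis using Cuo_norm_upper[OF f g] by (rule order_trans)
  qed
  have bd: "bdd_below ((\<lambda>g. Cuo_norm nrm (\<lambda>s. f s - g s)) ` W)" by (rule bdd_belowI[of _ 0]) (use nn in auto)
  have d0: "0 \<le> d" unfolding d_def by (rule cINF_greatest[OF ne nn])
  have dle: "d \<le> Cuo_norm nrm (\<lambda>s. f s - g s)" if "g \<in> W" for g unfolding d_def by (rule cINF_lower[OF bd that])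
  define K where "K = {p :: ('s \<Rightarrow> 'e orth) \<Rightarrow> 'e orth. sup_functional p \<and> p \<in> extensional Cuo_orth \<and>
    (\<forall>g\<in>W. 1 \<le> p (rel_dist d f g))}"
  have NC: "rel_dist d f g \<in> Cuo_orth" if "g \<in> W" for g using nrm_trunc_ratio_Cuo[OF d0 f] W that by blast
  obtain p where p: "p \<in> K" and min: "\<And>q. q \<in> K \<Longrightarrow> (\<And>\<phi>. \<phi> \<in> Cuo_orth \<Longrightarrow> q \<phi> \<le> p \<phi>) \<Longrightarrow> q = p"
  proof (rule minimal_sup_functional[of K])
    \<comment> \<open>The supremum over all of S satisfies every constraint because d is at most the
      norm of each f - g.\<close>
    have "restrict (\<lambda>\<phi>. SUP s. \<phi> s) Cuo_orth \<in> K"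
      unfolding K_def using SUP_rel_dist[OF f _ d0 dle] NC W
      by (auto simp: sup_functional_restrict sup_functional_SUP subset_iff)
    then show "K \<noteq> {}" by blast
    show "sup_functional q" if "q \<in> K" for q using that unfolding K_def by blast
    show "K \<subseteq> extensional Cuo_orth" unfolding K_def by blast
    fix \<P> q assume P: "\<P> \<subseteq> K" and q: "sup_functional q" "q \<in> extensional Cuo_orth"
      and great: "\<And>u \<phi>. \<phi> \<in> Cuo_orth \<Longrightarrow> (\<And>p. p \<in> \<P> \<Longrightarrow> u \<le> p \<phi>) \<Longrightarrow> u \<le> q \<phi>"
    have "1 \<le> q (rel_dist d f g)" if "g \<in> W" for g
      by (rule great[OF NC[OF that]]) (use P that in \<open>auto simp: K_def\<close>)
    then show "q \<in> K" using q unfolding K_def by blast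
  qed blast
  have sf: "sup_functional p" and ext: "p \<in> extensional Cuo_orth"
    and p1: "\<And>g. g \<in> W \<Longrightarrow> 1 \<le> p (rel_dist d f g)" using p unfolding K_def by blast+
  have min': "\<forall>q. sup_functional q \<and> (\<forall>\<phi>\<in>Cuo_orth. q \<phi> \<le> p \<phi>) \<and>
    (\<forall>g\<in>W. 1 \<le> q (rel_dist d f g)) \<longrightarrow> (\<forall>\<phi>\<in>Cuo_orth. q \<phi> = p \<phi>)"
  proof (intro allI impI ballI)
    fix q and \<phi> :: "'s \<Rightarrow> 'e orth" assume q: "sup_functional q \<and> (\<forall>\<phi>\<in>Cuo_orth. q \<phi> \<le> p \<phi>) \<and> (\<forall>g\<in>W. 1 \<le> q (rel_dist d f g))"
      and phi: "\<phi> \<in> Cuo_orth"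
    have "restrict q Cuo_orth \<in> K" using q NC by (auto simp: K_def sup_functional_restrict)
    then have "restrict q Cuo_orth = p" by (rule min) (use q in auto)
    then show "q \<phi> = p \<phi>" using phi by (metis restrict_apply')
  qed
  have "\<forall>g\<in>W. 1 \<le> p (rel_dist d f g)" using p1 by blast
  note mult = minimal_multiplier[OF W f d0 sf this min']
  \<comment> \<open>\<open>p \<psi>\<close> and \<open>p\<close> at -\<psi> are attained by
    homomorphisms \<sigma> and \<tau> below \<open>p\<close>. On multipliers \<open>p\<close> is
    odd, which leaves no room below it, so \<sigma> and \<tau> agree there; separation with b = 1
    makes them agree at \<psi>, and this is oddness of \<open>p\<close> at \<psi>.\<close>
  have odd: "odd_functional p"
    unfolding odd_functional_def
  proof
    fix \<psi> :: "'s \<Rightarrow> 'e orth" assume psi: "\<psi> \<in> Cuo_orth"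
    obtain \<sigma> where s: "sup_functional \<sigma>" "odd_functional \<sigma>" "\<sigma> \<in> extensional Cuo_orth"
      "\<And>\<phi>. \<phi> \<in> Cuo_orth \<Longrightarrow> \<sigma> \<phi> \<le> p \<phi>" "\<sigma> \<psi> = p \<psi>"
      by (rule dominated_homomorphism[OF sf psi]) blast
    obtain \<tau> where t: "sup_functional \<tau>" "odd_functional \<tau>" "\<tau> \<in> extensional Cuo_orth"
      "\<And>\<phi>. \<phi> \<in> Cuo_orth \<Longrightarrow> \<tau> \<phi> \<le> p \<phi>" "\<tau> (\<lambda>s. - \<psi> s) = p (\<lambda>s. - \<psi> s)"
      by (rule dominated_homomorphism[OF sf Cuo_orth_neg[OF psi]]) blast
    have agree: "\<upsilon> \<phi> = p \<phi>" if u: "sup_functional \<upsilon>" "odd_functional \<upsilon>" "\<And>\<phi>. \<phi> \<in> Cuo_orth \<Longrightarrow> \<upsilon> \<phi> \<le> p \<phi>"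
      and phi: "\<phi> \<in> multipliers scale nrm Xt W" for \<upsilon> \<phi>
    proof (rule order.antisym)
      have C: "\<phi> \<in> Cuo_orth" using multiplierD(1)[OF W phi] .
      show "\<upsilon> \<phi> \<le> p \<phi>" by (rule u(3)[OF C])
      have "- \<upsilon> \<phi> \<le> - p \<phi>" using u(3)[OF Cuo_orth_neg[OF C]] hom_neg[OF u(1,2) C] mult[OF phi] by simp
      then show "p \<phi> \<le> \<upsilon> \<phi>" by simp
    qed
    have "\<forall>\<phi>\<in>multipliers scale nrm Xt W. 1 * \<sigma> \<phi> = 1 * \<tau> \<phi>"
      using agree[OF s(1,2,4)] agree[OF t(1,2,4)] by simp
    then have "1 * \<sigma> \<psi> = 1 * \<tau> \<psi>"
      using sep hom_Sigma_extreme[OF s(1-3)] hom_Sigma_extreme[OF t(1-3)] bp_one psi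
      unfolding separates_Sigma_def by blast
    then have "\<sigma> \<psi> = \<tau> \<psi>" by simp
    then show "p (\<lambda>s. - \<psi> s) = - p \<psi>" using s(5) t(5) hom_neg[OF t(1,2) psi] by simp
  qed
  let ?v = "\<lambda>g. value_at scale nrm Xt g p"
  have "p \<in> Sigma_extreme" by (rule hom_Sigma_extreme[OF sf odd ext])
  moreover have "d = (INF x\<in>{?v g | g. g \<in> W}. nrm (?v f - x))"
  \<comment> \<open>The constraints give \<open>d\<close> as a lower bound at the point
    \<open>p\<close>; the opposite inequality holds at every point, since evaluation does not
    increase norms.\<close>
  proof -
    have ge: "d \<le> nrm (?v f - ?v g)" if "g \<in> W" for g
      by (rule value_at_diff_ge[OF cpt sf odd f _ d0 p1[OF that]]) (use W that in blast)
    have le: "nrm (?v f - ?v g) \<le> Cuo_norm nrm (\<lambda>s. f s - g s)" if "g \<in> W" for g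
      by (rule value_at_diff_le[OF cpt sf odd f]) (use W that in blast)
    have bd': "bdd_below ((\<lambda>g. nrm (?v f - ?v g)) ` W)" by (rule bdd_belowI[of _ d]) (use ge in auto)
    have "(INF g\<in>W. nrm (?v f - ?v g)) \<le> d"
      unfolding d_def by (rule cINF_mono[OF ne bd']) (use le in blast)
    moreover have "d \<le> (INF g\<in>W. nrm (?v f - ?v g))" by (rule cINF_greatest[OF ne ge])
    moreover have "(\<lambda>x. nrm (?v f - x)) ` {?v g | g. g \<in> W} = (\<lambda>g. nrm (?v f - ?v g)) ` W" by blast
    ultimately show ?thesis by (simp add: order.antisym)
  qed
  ultimately show ?thesis unfolding d_def by blast
qed

end
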